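(* Let $a\in L^1([0,1])$ be real-valued, $\rho\in\mathbb R$, $p,q\ge1$, $0\le k\le p-1$ and $0\le\ell\le q-1$ (with $p,q,k,\ell$ integers). Then, with the matrices $A_n(i,j)$, $S_n$ and the functions $\kappa_{[p,k]},\xi_{[p,k;q,\ell]},\mu_{[q,\ell]}$ defined in the context, $$\left\{\begin{bmatrix}n^{-1}A_n(1,1)&A_n(1,2)\\(A_n(1,2))^T&nA_n(2,2)\end{bmatrix}\right\}_n\sim_{\sigma,\lambda}\begin{bmatrix}a(x)\kappa_{[p,k]}(\theta)&\xi_{[p,k;q,\ell]}(\theta)\\(\xi_{[p,k;q,\ell]}(\theta))^*&-\rho\mu_{[q,\ell]}(\theta)\end{bmatrix}.$$ Moreover, if the matrices $A_n(1,1)$ are invertible and $a\ne0$ a.e., then $$\{nS_n\}_n\sim_{\sigma,\lambda}-\rho\mu_{[q,\ell]}(\theta)-\frac{(\xi_{[p,k;q,\ell]}(\theta))^*(\kappa_{[p,k]}(\theta))^{-1}\xi_{[p,k;q,\ell]}(\theta)}{a(x)}.$$ Here the right-hand sides are (a.e. defined) matrix-valued functions of $(x,\theta)\in[0,1]\times[-\pi,\pi]$.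
   Context: Distributions. Let $f:D\subset\mathbb R^h\to\mathbb C^{r\times s}$ be measurable with $0<\mu_h(D)<\infty$ ($\mu_h$ Lebesgue measure). For matrices $A_n$ of size $d_n\times e_n$ with $d_n,e_n\to\infty$, $\{A_n\}_n\sim_\sigma f$ means that for all $F\in C_c(\mathbb R)$ (continuous complex-valued with bounded support), $\lim_{n\to\infty}\frac1{\min(d_n,e_n)}\sum_{i=1}^{\min(d_n,e_n)}F(\sigma_i(A_n))=\frac1{\mu_h(D)}\int_D\frac{\sum_{i=1}^{\min(r,s)}F(\sigma_i(f(\mathbf x)))}{\min(r,s)}d\mathbf x$, with $\sigma_i$ the singular values. If $d_n=e_n$ and $r=s$, $\{A_n\}_n\sim_\lambda f$ means that for all $F\in C_c(\mathbb C)$, $\lim_{n\to\infty}\frac1{d_n}\sum_{i=1}^{d_n}F(\lambda_i(A_n))=\frac1{\mu_h(D)}\int_D\frac{\sum_{i=1}^sF(\lambda_i(f(\mathbf x)))}{s}d\mathbf x$, with $\lambda_i$ the eigenvalues. $\sim_{\sigma,\lambda}$ means both. B-splines. For $p,n\ge1$ and $0\le k\le p-1$, $B_{1,[p,k]},\dots,B_{n(p-k)+k+1,[p,k]}:\mathbb R\to\mathbb R$ are the (standard, partition-of-unity normalized) B-splines of degree $p$ on the knot sequence in $[0,1]$ in which $0$ and $1$ are each repeated $p+1$ times and each $i/n$, $i=1,\dots,n-1$, is repeated $p-k$ times (so they are of class $C^k$ at the interior knots). The reference B-splines $\beta_{1,[p,k]},\dots,\beta_{p-k,[p,k]}:\mathbb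 R\to\mathbb R$ are the first $p-k$ B-splines of degree $p$ on the knot sequence in which each of $0,1,\dots,\eta(p,k)$ is repeated $p-k$ times, $\eta(p,k)=\lceil (p+1)/(p-k)\rceil$. Matrices. $A_n(1,1)=\bigl[\int_0^1a(x)B'_{j+1,[p,k]}(x)B'_{i+1,[p,k]}(x)dx\bigr]_{i,j=1}^{n(p-k)+k-1}$; $A_n(1,2)=\bigl[\int_0^1B'_{j+1,[q,\ell]}(x)B_{i+1,[p,k]}(x)dx\bigr]$ with $i=1,\dots,n(p-k)+k-1$ and $j=1,\dots,n(q-\ell)+\ell-1$; $A_n(2,2)=\bigl[-\rho\int_0^1B_{j+1,[q,\ell]}(x)B_{i+1,[q,\ell]}(x)dx\bigr]_{i,j=1}^{n(q-\ell)+\ell-1}$; $S_n=A_n(2,2)-(A_n(1,2))^T(A_n(1,1))^{-1}A_n(1,2)$. Symbols. For $s\in\mathbb Z$ let $K^{[s]}_{[p,k]}=\bigl[\int_{\mathbb R}\beta'_{j,[p,k]}(y)\beta'_{i,[p,k]}(y-s)dy\bigr]_{i,j=1}^{p-k}$, $H^{[s]}_{[p,k;q,\ell]}=\bigl[\int_{\mathbb R}\beta'_{j,[q,\ell]}(y)\beta_{i,[p,k]}(y-s)dy\bigr]_{i=1,\dots,p-k}^{j=1,\dots,q-\ell}$, $M^{[s]}_{[q,\ell]}=\bigl[\int_{\mathbb R}\beta_{j,[q,\ell]}(y)\beta_{i,[q,\ell]}(y-s)dy\bigr]_{i,j=1}^{q-\ell}$, and define on $[-\pi,\pi]$ the functions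 $\kappa_{[p,k]}(\theta)=\sum_{s\in\mathbb Z}K^{[s]}_{[p,k]}e^{\mathrm is\theta}$, $\xi_{[p,k;q,\ell]}(\theta)=\sum_{s\in\mathbb Z}H^{[s]}_{[p,k;q,\ell]}e^{\mathrm is\theta}$, $\mu_{[q,\ell]}(\theta)=\sum_{s\in\mathbb Z}M^{[s]}_{[q,\ell]}e^{\mathrm is\theta}$ (finite sums, by compact support). *)

theory Defs
  imports
    "HOL-Analysis.Analysis"
    "Jordan_Normal_Form.Schur_Decomposition"
    "Jordan_Normal_Form.Gauss_Jordan_Elimination"
    "Jordan_Normal_Form.Char_Poly"
begin

section \<open>Singular value and spectral distributions\<close>

text \<open>Eigenvalues are counted with algebraic multiplicity.\<close>

definition eigenvalues_mset :: "complex mat \<Rightarrow> complex multiset" where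
  "eigenvalues_mset A = proots (char_poly A)"

text \<open>
  The \<open>min d e\<close> singular values of a \<open>d \<times> e\<close> matrix are the square roots of the
  eigenvalues of the smaller of the two Gram matrices. These eigenvalues are real and
  nonnegative, so \<open>Re\<close> only changes the type.
\<close>

definition singular_values_mset :: "complex mat \<Rightarrow> real multiset" where
  "singular_values_mset A =
     image_mset (\<lambda>z. sqrt (Re z))
       (eigenvalues_mset
         (if dim_col A \<le> dim_row A then mat_adjoint A * A else A * mat_adjoint A))"

text \<open>
  A measurable function from \<open>D\<close> to the \<open>r \<times> s\<close> matrices, where \<open>D\<close> is a Lebesgue
  measurable set with positive finite measure.
\<close>

definition symbol_on ::
  "'a::euclidean_space set \<Rightarrow> nat \<Rightarrow> nat \<Rightarrow> ('a \<Rightarrow> complex mat) \<Rightarrow> bool" where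
  "symbol_on D r s f \<longleftrightarrow>
     D \<in> lmeasurable \<and> 0 < measure lebesgue D \<and>
     (\<forall>x\<in>D. f x \<in> carrier_mat r s) \<and>
     (\<forall>i<r. \<forall>j<s. (\<lambda>x. f x $$ (i, j)) \<in> borel_measurable (lebesgue_on D))"

definition sv_distributed ::
  "(nat \<Rightarrow> complex mat) \<Rightarrow> 'a::euclidean_space set \<Rightarrow> nat \<Rightarrow> nat \<Rightarrow> ('a \<Rightarrow> complex mat) \<Rightarrow> bool" where
  "sv_distributed A D r s f \<longleftrightarrow>
     symbol_on D r s f \<and>
     filterlim (\<lambda>n. dim_row (A n)) at_top sequentially \<and>
     filterlim (\<lambda>n. dim_col (A n)) at_top sequentially \<and>
     (\<forall>F :: real \<Rightarrow> complex. continuous_on UNIV F \<and> bounded {t. F t \<noteq> 0} \<longrightarrow>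
       (\<lambda>n. (\<Sum>\<sigma>\<in>#singular_values_mset (A n). F \<sigma>) / of_nat (min (dim_row (A n)) (dim_col (A n))))
       \<longlonglongrightarrow>
       (LINT x:D|lebesgue. (\<Sum>\<sigma>\<in>#singular_values_mset (f x). F \<sigma>) / of_nat (min r s))
         / of_real (measure lebesgue D))"

definition eig_distributed ::
  "(nat \<Rightarrow> complex mat) \<Rightarrow> 'a::euclidean_space set \<Rightarrow> nat \<Rightarrow> ('a \<Rightarrow> complex mat) \<Rightarrow> bool" where
  "eig_distributed A D s f \<longleftrightarrow>
     symbol_on D s s f \<and>
     (\<forall>n. dim_col (A n) = dim_row (A n)) \<and>
     filterlim (\<lambda>n. dim_row (A n)) at_top sequentially \<and>
     (\<forall>F :: complex \<Rightarrow> complex. continuous_on UNIV F \<and> bounded {z. F z \<noteq> 0} \<longrightarrow>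
       (\<lambda>n. (\<Sum>z\<in>#eigenvalues_mset (A n). F z) / of_nat (dim_row (A n)))
       \<longlonglongrightarrow>
       (LINT x:D|lebesgue. (\<Sum>z\<in>#eigenvalues_mset (f x). F z) / of_nat s)
         / of_real (measure lebesgue D))"

definition sv_eig_distributed ::
  "(nat \<Rightarrow> complex mat) \<Rightarrow> 'a::euclidean_space set \<Rightarrow> nat \<Rightarrow> ('a \<Rightarrow> complex mat) \<Rightarrow> bool" where
  "sv_eig_distributed A D s f \<longleftrightarrow> sv_distributed A D s s f \<and> eig_distributed A D s f"

section \<open>B-splines\<close>

text \<open>
  Cox--de Boor recursion; \<open>bspline t p i\<close> has the knots \<open>t ! i, \<dots>, t ! (i + p + 1)\<close>
  (indices start at 0). A quotient with a vanishing knot difference is 0, as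
  division by zero yields 0.
\<close>

fun bspline :: "real list \<Rightarrow> nat \<Rightarrow> nat \<Rightarrow> real \<Rightarrow> real" where
  "bspline t 0 i x = (if t ! i \<le> x \<and> x < t ! (i + 1) then 1 else 0)"
| "bspline t (Suc p) i x =
     (x - t ! i) / (t ! (i + p + 1) - t ! i) * bspline t p i x
     + (t ! (i + p + 2) - x) / (t ! (i + p + 2) - t ! (i + 1)) * bspline t p (i + 1) x"

definition open_knots :: "nat \<Rightarrow> nat \<Rightarrow> nat \<Rightarrow> real list" where
  "open_knots p k n =
     replicate (p + 1) 0
     @ concat (map (\<lambda>i. replicate (p - k) (real i / real n)) [1..<n])
     @ replicate (p + 1) 1"

text \<open>\<open>spline_B p k n i\<close> is \<open>B_{i,[p,k]}\<close>, with \<open>i\<close> starting at 1.\<close>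

definition spline_B :: "nat \<Rightarrow> nat \<Rightarrow> nat \<Rightarrow> nat \<Rightarrow> real \<Rightarrow> real" where
  "spline_B p k n i = bspline (open_knots p k n) p (i - 1)"

definition spline_eta :: "nat \<Rightarrow> nat \<Rightarrow> nat" where
  "spline_eta p k = nat \<lceil>real (p + 1) / real (p - k)\<rceil>"

definition reference_knots :: "nat \<Rightarrow> nat \<Rightarrow> real list" where
  "reference_knots p k = concat (map (\<lambda>i. replicate (p - k) (real i)) [0..<spline_eta p k + 1])"

text \<open>\<open>spline_beta p k i\<close> is \<open>\<beta>_{i,[p,k]}\<close>, with \<open>i\<close> starting at 1.\<close>

definition spline_beta :: "nat \<Rightarrow> nat \<Rightarrow> nat \<Rightarrow> real \<Rightarrow> real" where
  "spline_beta p k i = bspline (reference_knots p k) p (i - 1)"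

section \<open>The matrices\<close>

text \<open>
  Matrix indices start at 0 in the library, so the entry \<open>(i, j)\<close> below is the one
  with 1-based indices \<open>(i + 1, j + 1)\<close>. The derivatives \<open>deriv\<close> are classical
  derivatives, which exist except at finitely many points (knots).
\<close>

definition spline_dim :: "nat \<Rightarrow> nat \<Rightarrow> nat \<Rightarrow> nat" where
  "spline_dim p k n = n * (p - k) + k - 1"

definition A11 :: "(real \<Rightarrow> real) \<Rightarrow> nat \<Rightarrow> nat \<Rightarrow> nat \<Rightarrow> real mat" where
  "A11 a p k n = Matrix.mat (spline_dim p k n) (spline_dim p k n)
     (\<lambda>(i, j). LINT x:{0..1}|lebesgue. a x * deriv (spline_B p k n (j + 2)) x * deriv (spline_B p k n (i + 2)) x)"

definition A12 :: "nat \<Rightarrow> nat \<Rightarrow> nat \<Rightarrow> nat \<Rightarrow> nat \<Rightarrow> real mat" where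
  "A12 p k q l n = Matrix.mat (spline_dim p k n) (spline_dim q l n)
     (\<lambda>(i, j). LINT x:{0..1}|lebesgue. deriv (spline_B q l n (j + 2)) x * spline_B p k n (i + 2) x)"

definition A22 :: "real \<Rightarrow> nat \<Rightarrow> nat \<Rightarrow> nat \<Rightarrow> real mat" where
  "A22 \<rho> q l n = Matrix.mat (spline_dim q l n) (spline_dim q l n)
     (\<lambda>(i, j). - \<rho> * (LINT x:{0..1}|lebesgue. spline_B q l n (j + 2) x * spline_B q l n (i + 2) x))"

text \<open>The inverse of a matrix; unspecified if the matrix is not invertible.\<close>

definition minv :: "'a::field mat \<Rightarrow> 'a mat" where
  "minv A = the (mat_inverse A)"

definition schur_compl :: "(real \<Rightarrow> real) \<Rightarrow> real \<Rightarrow> nat \<Rightarrow> nat \<Rightarrow> nat \<Rightarrow> nat \<Rightarrow> nat \<Rightarrow> real mat" where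
  "schur_compl a \<rho> p k q l n =
     A22 \<rho> q l n - (A12 p k q l n)\<^sup>T * minv (A11 a p k n) * A12 p k q l n"

abbreviation complex_mat :: "real mat \<Rightarrow> complex mat" where
  "complex_mat \<equiv> map_mat complex_of_real"

section \<open>The symbols\<close>

definition K_block :: "nat \<Rightarrow> nat \<Rightarrow> int \<Rightarrow> real mat" where
  "K_block p k s = Matrix.mat (p - k) (p - k)
     (\<lambda>(i, j). LINT y|lebesgue. deriv (spline_beta p k (j + 1)) y * deriv (spline_beta p k (i + 1)) (y - of_int s))"

definition H_block :: "nat \<Rightarrow> nat \<Rightarrow> nat \<Rightarrow> nat \<Rightarrow> int \<Rightarrow> real mat" where
  "H_block p k q l s = Matrix.mat (p - k) (q - l)
     (\<lambda>(i, j). LINT y|lebesgue. deriv (spline_beta q l (j + 1)) y * spline_beta p k (i + 1) (y - of_int s))"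

definition M_block :: "nat \<Rightarrow> nat \<Rightarrow> int \<Rightarrow> real mat" where
  "M_block q l s = Matrix.mat (q - l) (q - l)
     (\<lambda>(i, j). LINT y|lebesgue. spline_beta q l (j + 1) y * spline_beta q l (i + 1) (y - of_int s))"

text \<open>
  The entrywise Fourier sum of a family of \<open>r \<times> c\<close> coefficient matrices; for the
  families above only finitely many coefficients are nonzero.
\<close>

definition fourier_mat :: "nat \<Rightarrow> nat \<Rightarrow> (int \<Rightarrow> real mat) \<Rightarrow> real \<Rightarrow> complex mat" where
  "fourier_mat r c C \<theta> = Matrix.mat r c
     (\<lambda>(i, j). \<Sum>\<^sub>\<infinity>s. complex_of_real (C s $$ (i, j)) * cis (of_int s * \<theta>))"

definition kappa_symbol :: "nat \<Rightarrow> nat \<Rightarrow> real \<Rightarrow> complex mat" where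
  "kappa_symbol p k = fourier_mat (p - k) (p - k) (K_block p k)"

definition xi_symbol :: "nat \<Rightarrow> nat \<Rightarrow> nat \<Rightarrow> nat \<Rightarrow> real \<Rightarrow> complex mat" where
  "xi_symbol p k q l = fourier_mat (p - k) (q - l) (H_block p k q l)"

definition mu_symbol :: "nat \<Rightarrow> nat \<Rightarrow> real \<Rightarrow> complex mat" where
  "mu_symbol q l = fourier_mat (q - l) (q - l) (M_block q l)"

end

theory Submission
  imports Defs
begin

text \<open>
  All matrices are Hermitian, and the functions \<open>t \<mapsto> 1 / (t - z)\<close> with \<open>Im z > 0\<close> generate a dense
  algebra, so both distributions follow from the limits of the normalized traces of the resolvents.
  For a uniformly continuous coefficient the matrix is locally close to a banded block Toeplitz
  matrix whose symbol has the coefficient frozen at \<open>i / n\<close>; the Fourier coefficients of the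
  resolvents of these frozen symbols are the rows of an approximate resolvent, and the bound
  \<open>1 / Im z\<close> of the exact one controls the error. Integrable coefficients are reached by density.

  The resolvent of the Schur complement at \<open>z\<close> is the limit \<open>\<epsilon> \<rightarrow> 0\<close> of a diagonal block of the
  resolvent of the whole matrix with the shifts \<open>\<i>\<epsilon>\<close> and \<open>z\<close> on its two blocks. The error involves
  only the number of small eigenvalues of the stiffness matrix, which is negligible uniformly in \<open>n\<close>
  since the symbol \<open>a \<kappa>\<close> is invertible almost everywhere: if \<open>det \<kappa>\<close> vanished identically, a
  polynomial kernel vector of \<open>\<kappa>\<close> would give a kernel vector of every large stiffness matrix.
\<close>

text \<open>Resolvents off the real axis are bounded whatever the matrix is, and their traces react
  to the entrywise l1 norm of a perturbation, which is adapted to integrable coefficients. Shifts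
  \<open>Z\<close> that depend on the component and weights \<open>W\<close> on the diagonal are
  built in from the start. One limit theorem then gives the trace of the whole resolvent, the trace
  over one diagonal block and, with the coupling parameter \<open>\<tau>\<close> set to 0, the trace
  of the stiffness block by itself. The Schur complement is not covered directly because the inverse
  of the stiffness matrix need not be banded or uniformly bounded. Matrices are functions of two
  indices, read below the dimension only, so that a block is an index shift. A Borel representative
  \<open>b\<close> of the coefficient and the formal derivative \<open>dbspline\<close> stand in for
  \<open>a\<close> and \<open>deriv\<close>; this changes integrands on null sets only.\<close>

type_synonym mat_fun = "nat => nat => complex"

section \<open>Resolvents of dissipative matrices\<close>

definition inv_pair :: "nat => mat_fun => mat_fun => bool" where
 "inv_pair d T G \<longleftrightarrow> (\<forall>i<d. \<forall>j<d. (\<Sum>k<d. T i k * G k j) = (if i = j then 1 else 0)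
   \<and> (\<Sum>k<d. G i k * T k j) = (if i = j then 1 else 0))"

definition finv :: "nat => mat_fun => mat_fun" where
 "finv d T i j = minv (Matrix.mat d d (\<lambda>(i, j). T i j)) $$ (i, j)"

text \<open>A stable form of invertibility: it holds for a Hermitian matrix minus a diagonal of
  shifts, equal or not, with imaginary parts at least \<open>\<eta>\<close>, and it is kept when
  terms \<phi> c c^H with Im \<phi> >= 0 are subtracted.\<close>

definition dissipative :: "real => nat => mat_fun => bool" where
 "dissipative \<eta> d T \<longleftrightarrow>
   (\<forall>v. Im (\<Sum>i<d. \<Sum>j<d. cnj (v i) * T i j * v j) \<le> - \<eta> * (\<Sum>i<d. (cmod (v i))\<^sup>2))"

section \<open>Inverses of matrices given by entry functions\<close>

lemma mult_mat_index:
 assumes "A \<in> carrier_mat n m" "B \<in> carrier_mat m k" "i < n" "j < k"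
 shows "(A * B) $$ (i, j) = (\<Sum>l<m. A $$ (i, l) * B $$ (l, j))"
 using assms by (auto simp: scalar_prod_def atLeast0LessThan intro!: sum.cong)

lemma minv_inverse:
 fixes A :: "'a::field mat"
 assumes A: "A \<in> carrier_mat n n" and "Determinant.det A \<noteq> 0"
 shows "minv A \<in> carrier_mat n n" "A * minv A = 1\<^sub>m n" "minv A * A = 1\<^sub>m n"
proof -
 have "A \<in> Units (ring_mat TYPE('a) n ())"
  by (rule det_non_zero_imp_unit[OF assms])
 then obtain B where B: "mat_inverse A = Some B"
  using mat_inverse(1)[OF A, where b = "()"] by (cases "mat_inverse A") auto
 then show "minv A \<in> carrier_mat n n" "A * minv A = 1\<^sub>m n" "minv A * A = 1\<^sub>m n"
  using mat_inverse(2)[OF A B] by (auto simp: minv_def)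
qed

lemma minv_eqI:
 fixes A :: "'a::field mat"
 assumes A: "A \<in> carrier_mat n n" and B: "B \<in> carrier_mat n n" and AB: "A * B = 1\<^sub>m n"
 shows "minv A = B" "Determinant.det A \<noteq> 0"
proof -
 have "Determinant.det A * Determinant.det B = 1"
  using det_mult[OF A B] AB by simp
 then show d: "Determinant.det A \<noteq> 0" by auto
 note m = minv_inverse[OF A d]
 have "minv A = minv A * (A * B)" using m AB by simp
 also have "\<dots> = (minv A * A) * B" using A B m(1) by (simp add: assoc_mult_mat)
 also have "\<dots> = B" using m B by simp
 finally show "minv A = B" .
qed

lemma inv_pair_finv_det:
 assumes "Determinant.det (Matrix.mat d d (\<lambda>(i, j). T i j)) \<noteq> 0"
 shows "inv_pair d T (finv d T)"
proof -
 define A where "A = Matrix.mat d d (\<lambda>(i, j). T i j)"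
 have A: "A \<in> carrier_mat d d" by (simp add: A_def)
 note m = minv_inverse[OF A assms[folded A_def]]
 show ?thesis unfolding inv_pair_def
 proof (intro allI impI conjI)
  fix i j assume ij: "i < d" "j < d"
  have "(A * minv A) $$ (i, j) = (if i = j then 1 else 0)" using ij m(2) by simp
  then show "(\<Sum>k<d. T i k * finv d T k j) = (if i = j then 1 else 0)"
   unfolding mult_mat_index[OF A m(1) ij] using ij by (simp add: finv_def A_def)
  have "(minv A * A) $$ (i, j) = (if i = j then 1 else 0)" using ij m(3) by simp
  then show "(\<Sum>k<d. finv d T i k * T k j) = (if i = j then 1 else 0)"
   unfolding mult_mat_index[OF m(1) A ij] using ij by (simp add: finv_def A_def)
 qed
qed

text \<open>For square matrices a right inverse forces a nonzero determinant and is the inverse.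
  This is how \<open>finv\<close> is computed below.\<close>

lemma finv_eqI:
 assumes "\<And>i j. i < d ==> j < d ==> (\<Sum>k<d. T i k * G k j) = (if i = j then 1 else 0)"
 shows "inv_pair d T (finv d T)" "\<And>i j. i < d ==> j < d ==> finv d T i j = G i j"
proof -
 define A where "A = Matrix.mat d d (\<lambda>(i, j). T i j)"
 define B where "B = Matrix.mat d d (\<lambda>(i, j). G i j)"
 have A: "A \<in> carrier_mat d d" and B: "B \<in> carrier_mat d d" by (simp_all add: A_def B_def)
 have AB: "A * B = 1\<^sub>m d"
 proof (rule eq_matI)
  fix i j assume "i < dim_row (1\<^sub>m d :: complex mat)" "j < dim_col (1\<^sub>m d :: complex mat)"
  then have ij: "i < d" "j < d" by auto
  show "(A * B) $$ (i, j) = 1\<^sub>m d $$ (i, j)"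
   unfolding mult_mat_index[OF A B ij] using ij assms[OF ij] by (simp add: A_def B_def)
 qed (use A B in auto)
 show "inv_pair d T (finv d T)"
  by (rule inv_pair_finv_det) (use minv_eqI(2)[OF A B AB] in \<open>simp add: A_def\<close>)
 fix i j assume "i < d" "j < d"
 then show "finv d T i j = G i j"
  using minv_eqI(1)[OF A B AB] by (simp add: finv_def A_def B_def)
qed

lemma inv_pair_unique:
 assumes "inv_pair d T G" "i < d" "j < d"
 shows "finv d T i j = G i j"
 by (rule finv_eqI(2)) (use assms in \<open>auto simp: inv_pair_def\<close>)

lemma inv_pair_apply:
 assumes "inv_pair d T G" "i < d"
 shows "(\<Sum>j<d. T i j * (\<Sum>k<d. G j k * c k)) = c i"
proof -
 have "(\<Sum>j<d. T i j * (\<Sum>k<d. G j k * c k)) = (\<Sum>j<d. \<Sum>k<d. T i j * G j k * c k)"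
  by (simp add: sum_distrib_left mult.assoc)
 also have "\<dots> = (\<Sum>k<d. (\<Sum>j<d. T i j * G j k) * c k)"
  by (subst sum.swap) (simp add: sum_distrib_right)
 also have "\<dots> = (\<Sum>k<d. if i = k then c k else 0)"
  using assms by (intro sum.cong) (auto simp: inv_pair_def)
 also have "\<dots> = c i" using assms by simp
 finally show ?thesis .
qed

section \<open>Energy and norm bounds for inverses of dissipative matrices\<close>

lemma dissipative_det:
 assumes "dissipative \<eta> d T" "0 < \<eta>"
 shows "Determinant.det (Matrix.mat d d (\<lambda>(i, j). T i j)) \<noteq> 0"
proof
 define A where "A = Matrix.mat d d (\<lambda>(i, j). T i j)"
 have A: "A \<in> carrier_mat d d" by (simp add: A_def)
 assume "Determinant.det (Matrix.mat d d (\<lambda>(i, j). T i j)) = 0"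
 then obtain v where v: "v \<in> carrier_vec d" "v \<noteq> 0\<^sub>v d" "A *\<^sub>v v = 0\<^sub>v d"
  using det_0_iff_vec_prod_zero[OF A] by (auto simp: A_def)
 define w where "w i = vec_index v i" for i
 have "(\<Sum>j<d. T i j * w j) = 0" if "i < d" for i
 proof -
  have "vec_index (A *\<^sub>v v) i = 0" using v that by simp
  then show ?thesis using that v(1)
   by (simp add: A_def w_def scalar_prod_def atLeast0LessThan)
 qed
 then have z: "(\<Sum>i<d. \<Sum>j<d. cnj (w i) * T i j * w j) = 0"
  by (simp add: mult.assoc sum_distrib_left[symmetric])
 then have "0 \<le> - \<eta> * (\<Sum>i<d. (cmod (w i))\<^sup>2)"
  using assms(1)[unfolded dissipative_def, rule_format, of w] by simp
 then have "(\<Sum>i<d. (cmod (w i))\<^sup>2) \<le> 0"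
  using assms(2) by (simp add: mult_le_0_iff)
 then have "(\<Sum>i<d. (cmod (w i))\<^sup>2) = 0"
  by (simp add: sum_nonneg order_antisym)
 then have "\<forall>i<d. w i = 0" by (subst (asm) sum_nonneg_eq_0_iff) auto
 then have "v = 0\<^sub>v d" using v(1) by (intro eq_vecI) (auto simp: w_def)
 with v show False by simp
qed

lemma dissipative_inv:
 "dissipative \<eta> d T ==> 0 < \<eta> ==> inv_pair d T (finv d T)"
 by (intro inv_pair_finv_det dissipative_det)

text \<open>With v = G c one has T v = c, so the form of T at v is the conjugate of the form of G at
  c; dissipativity becomes this lower bound. It is sharper than a norm bound and is what controls
  rank-one updates of arbitrary size.\<close>

lemma dissipative_energy:
 assumes "dissipative \<eta> d T" "inv_pair d T G"
 shows "\<eta> * (\<Sum>i<d. (cmod (\<Sum>k<d. G i k * c k))\<^sup>2) \<le> Im (\<Sum>i<d. \<Sum>k<d. cnj (c i) * G i k * c k)"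
proof -
 define v where "v i = (\<Sum>k<d. G i k * c k)" for i
 have "(\<Sum>i<d. \<Sum>j<d. cnj (v i) * T i j * v j) = (\<Sum>i<d. cnj (v i) * c i)"
  using inv_pair_apply[OF assms(2), of _ c]
  by (intro sum.cong) (auto simp: mult.assoc sum_distrib_left[symmetric] v_def)
 also have "\<dots> = cnj (\<Sum>i<d. cnj (c i) * v i)"
  by (simp add: mult.commute)
 also have "(\<Sum>i<d. cnj (c i) * v i) = (\<Sum>i<d. \<Sum>k<d. cnj (c i) * G i k * c k)"
  by (simp add: v_def sum_distrib_left mult.assoc)
 finally have "Im (\<Sum>i<d. \<Sum>j<d. cnj (v i) * T i j * v j) = - Im (\<Sum>i<d. \<Sum>k<d. cnj (c i) * G i k * c k)"
  by (simp only: cnj.sel)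
 then show ?thesis
  using assms(1)[unfolded dissipative_def, rule_format, of v] unfolding v_def by linarith
qed

text \<open>The matrix -T^H is dissipative with the same constant and has inverse -G^H; the energy
  inequality for this pair bounds G^H c by the same imaginary part.\<close>

lemma dissipative_energy_adj:
 assumes "dissipative \<eta> d T" "inv_pair d T G"
 shows "\<eta> * (\<Sum>k<d. (cmod (\<Sum>i<d. cnj (G i k) * c i))\<^sup>2) \<le> Im (\<Sum>i<d. \<Sum>k<d. cnj (c i) * G i k * c k)"
proof -
 define T' where "T' i j = - cnj (T j i)" for i j
 define G' where "G' i j = - cnj (G j i)" for i j
 have d: "dissipative \<eta> d T'" unfolding dissipative_def
 proof
  fix v
  have "(\<Sum>i<d. \<Sum>j<d. cnj (v i) * T' i j * v j) = - cnj (\<Sum>j<d. \<Sum>i<d. cnj (v j) * T j i * v i)"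
   by (subst sum.swap) (simp add: T'_def sum_negf mult_ac)
  then have "Im (\<Sum>i<d. \<Sum>j<d. cnj (v i) * T' i j * v j) = Im (\<Sum>j<d. \<Sum>i<d. cnj (v j) * T j i * v i)"
   by (simp only: cnj.sel uminus_complex.sel minus_minus)
  then show "Im (\<Sum>i<d. \<Sum>j<d. cnj (v i) * T' i j * v j) \<le> - \<eta> * (\<Sum>i<d. (cmod (v i))\<^sup>2)"
   using assms(1)[unfolded dissipative_def, rule_format, of v] by linarith
 qed
 have i: "inv_pair d T' G'" unfolding inv_pair_def
 proof (intro allI impI conjI)
  fix i j assume ij: "i < d" "j < d"
  have "(\<Sum>k<d. T' i k * G' k j) = cnj (\<Sum>k<d. G j k * T k i)"
   by (simp add: T'_def G'_def mult.commute)
  also have "(\<Sum>k<d. G j k * T k i) = (if j = i then 1 else 0)"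
   using assms(2) ij unfolding inv_pair_def by blast
  finally show "(\<Sum>k<d. T' i k * G' k j) = (if i = j then 1 else 0)" by simp
  have "(\<Sum>k<d. G' i k * T' k j) = cnj (\<Sum>k<d. T j k * G k i)"
   by (simp add: T'_def G'_def mult.commute)
  also have "(\<Sum>k<d. T j k * G k i) = (if j = i then 1 else 0)"
   using assms(2) ij unfolding inv_pair_def by blast
  finally show "(\<Sum>k<d. G' i k * T' k j) = (if i = j then 1 else 0)" by simp
 qed
 have "(\<Sum>i<d. \<Sum>k<d. cnj (c i) * G' i k * c k) = - cnj (\<Sum>i<d. \<Sum>k<d. cnj (c i) * G i k * c k)"
  by (subst sum.swap) (simp add: G'_def sum_negf mult_ac)
 then have "Im (\<Sum>i<d. \<Sum>k<d. cnj (c i) * G' i k * c k) = Im (\<Sum>i<d. \<Sum>k<d. cnj (c i) * G i k * c k)"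
  by (simp only: cnj.sel uminus_complex.sel minus_minus)
 moreover have "cmod (\<Sum>k<d. G' i k * c k) = cmod (\<Sum>k<d. cnj (G k i) * c k)" for i
  by (simp add: G'_def sum_negf)
 ultimately show ?thesis
  using dissipative_energy[OF d i, of c] by simp
qed

lemma L2_set_sq: "(L2_set f A)\<^sup>2 = (\<Sum>i\<in>A. (f i)\<^sup>2)"
 by (simp add: L2_set_def sum_nonneg)

lemma norm_sum_mult_le_L2:
 fixes x y :: "nat => complex"
 shows "cmod (\<Sum>i\<in>A. x i * y i) \<le> L2_set (\<lambda>i. cmod (x i)) A * L2_set (\<lambda>i. cmod (y i)) A"
proof -
 have "cmod (\<Sum>i\<in>A. x i * y i) \<le> (\<Sum>i\<in>A. \<bar>cmod (x i)\<bar> * \<bar>cmod (y i)\<bar>)"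
  by (rule order_trans[OF norm_sum]) (simp add: norm_mult)
 also have "\<dots> \<le> L2_set (\<lambda>i. cmod (x i)) A * L2_set (\<lambda>i. cmod (y i)) A"
  by (rule L2_set_mult_ineq)
 finally show ?thesis .
qed

lemma le_of_sq_le_mult:
 assumes "(\<eta>::real) * x\<^sup>2 \<le> c * x" "0 < \<eta>" "0 \<le> x" "0 \<le> c" shows "x \<le> c / \<eta>"
proof (cases "x = 0")
 case False
 then have "\<eta> * x \<le> c" using assms by (simp add: power2_eq_square mult.assoc[symmetric])
 then show ?thesis using assms by (simp add: field_simps)
qed (use assms in auto)

text \<open>Cauchy-Schwarz bounds the right-hand side of the energy inequality by the product of the
  norms of c and G c, and one factor cancels.\<close>

lemma dissipative_norm:
 assumes "dissipative \<eta> d T" "inv_pair d T G" "0 < \<eta>"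
 shows "L2_set (\<lambda>i. cmod (\<Sum>k<d. G i k * c k)) {..<d} \<le> L2_set (\<lambda>i. cmod (c i)) {..<d} / \<eta>"
  and "L2_set (\<lambda>k. cmod (\<Sum>i<d. cnj (G i k) * c i)) {..<d} \<le> L2_set (\<lambda>i. cmod (c i)) {..<d} / \<eta>"
proof -
 let ?c = "L2_set (\<lambda>i. cmod (c i)) {..<d}"
 have "(\<Sum>i<d. \<Sum>k<d. cnj (c i) * G i k * c k) = (\<Sum>i<d. cnj (c i) * (\<Sum>k<d. G i k * c k))"
  by (simp add: sum_distrib_left mult.assoc)
 then have "Im (\<Sum>i<d. \<Sum>k<d. cnj (c i) * G i k * c k) \<le> ?c * L2_set (\<lambda>i. cmod (\<Sum>k<d. G i k * c k)) {..<d}"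
  using norm_sum_mult_le_L2[of "\<lambda>i. cnj (c i)" "\<lambda>i. \<Sum>k<d. G i k * c k" "{..<d}"]
  by (metis (no_types, lifting) L2_set_cong abs_Im_le_cmod abs_le_D1 complex_mod_cnj order_trans)
 then have "\<eta> * (L2_set (\<lambda>i. cmod (\<Sum>k<d. G i k * c k)) {..<d})\<^sup>2 \<le> ?c * L2_set (\<lambda>i. cmod (\<Sum>k<d. G i k * c k)) {..<d}"
  using dissipative_energy[OF assms(1,2), of c] by (simp add: L2_set_sq)
 then show "L2_set (\<lambda>i. cmod (\<Sum>k<d. G i k * c k)) {..<d} \<le> ?c / \<eta>"
  by (rule le_of_sq_le_mult) (use assms in \<open>auto simp: L2_set_nonneg\<close>)
 have "(\<Sum>i<d. \<Sum>k<d. cnj (c i) * G i k * c k) = (\<Sum>k<d. c k * (\<Sum>i<d. cnj (c i) * G i k))"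
  by (subst sum.swap) (simp add: sum_distrib_left mult_ac)
 then have "Im (\<Sum>i<d. \<Sum>k<d. cnj (c i) * G i k * c k) \<le> ?c * L2_set (\<lambda>k. cmod (\<Sum>i<d. cnj (c i) * G i k)) {..<d}"
  using norm_sum_mult_le_L2[of c "\<lambda>k. \<Sum>i<d. cnj (c i) * G i k" "{..<d}"]
  by (metis (no_types, lifting) abs_Im_le_cmod abs_le_D1 order_trans)
 moreover have "cmod (\<Sum>i<d. cnj (c i) * G i k) = cmod (\<Sum>i<d. cnj (G i k) * c i)" for k
  by (subst complex_mod_cnj[symmetric]) (simp add: mult.commute)
 ultimately have "\<eta> * (L2_set (\<lambda>k. cmod (\<Sum>i<d. cnj (G i k) * c i)) {..<d})\<^sup>2 \<le> ?c * L2_set (\<lambda>k. cmod (\<Sum>i<d. cnj (G i k) * c i)) {..<d}"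
  using dissipative_energy_adj[OF assms(1,2), of c] by (simp add: L2_set_sq)
 then show "L2_set (\<lambda>k. cmod (\<Sum>i<d. cnj (G i k) * c i)) {..<d} \<le> ?c / \<eta>"
  by (rule le_of_sq_le_mult) (use assms in \<open>auto simp: L2_set_nonneg\<close>)
qed

lemma dissipative_col_row:
 assumes "dissipative \<eta> d T" "inv_pair d T G" "0 < \<eta>" "j < d"
 shows "L2_set (\<lambda>i. cmod (G i j)) {..<d} \<le> 1 / \<eta>"
  and "L2_set (\<lambda>i. cmod (G j i)) {..<d} \<le> 1 / \<eta>"
proof -
 define e :: "nat => complex" where "e i = (if i = j then 1 else 0)" for i
 have "(\<Sum>i<d. (cmod (e i))\<^sup>2) = (\<Sum>i<d. if i = j then 1 else 0)"
  by (intro sum.cong) (auto simp: e_def)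
 then have "L2_set (\<lambda>i. cmod (e i)) {..<d} = 1"
  using assms(4) by (simp add: L2_set_def)
 moreover have "(\<Sum>k<d. G i k * e k) = G i j" for i
  using assms(4) by (simp add: e_def if_distrib[of "\<lambda>x. _ * x"] cong: if_cong)
 moreover have "(\<Sum>i<d. cnj (G i k) * e i) = cnj (G j k)" for k
  using assms(4) by (simp add: e_def if_distrib[of "\<lambda>x. _ * x"] cong: if_cong)
 ultimately show "L2_set (\<lambda>i. cmod (G i j)) {..<d} \<le> 1 / \<eta>" "L2_set (\<lambda>i. cmod (G j i)) {..<d} \<le> 1 / \<eta>"
  using dissipative_norm[OF assms(1-3), of e] by simp_all
qed

lemma dissipative_entry:
 assumes "dissipative \<eta> d T" "inv_pair d T G" "0 < \<eta>" "i < d" "j < d"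
 shows "cmod (G i j) \<le> 1 / \<eta>"
 using dissipative_col_row(1)[OF assms(1-3,5)] member_le_L2_set[of "{..<d}" i "\<lambda>i. cmod (G i j)"] assms(4)
 by auto

section \<open>The resolvent identity and perturbation bounds\<close>

lemma resolvent_identity:
 assumes "inv_pair d T G" "inv_pair d T' G'" "i < d" "j < d"
 shows "G i j - G' i j = (\<Sum>k<d. \<Sum>l<d. G i k * (T' k l - T k l) * G' l j)"
proof -
 have "(\<Sum>k<d. \<Sum>l<d. G i k * (T' k l - T k l) * G' l j)
   = (\<Sum>k<d. G i k * (\<Sum>l<d. T' k l * G' l j)) - (\<Sum>k<d. \<Sum>l<d. G i k * T k l * G' l j)"
  by (simp add: algebra_simps sum_subtractf sum_distrib_left)
 also have "(\<Sum>k<d. G i k * (\<Sum>l<d. T' k l * G' l j)) = (\<Sum>k<d. if k = j then G i k else 0)"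
  using assms by (intro sum.cong) (auto simp: inv_pair_def)
 also have "(\<Sum>k<d. \<Sum>l<d. G i k * T k l * G' l j) = (\<Sum>l<d. (\<Sum>k<d. G i k * T k l) * G' l j)"
  by (subst sum.swap) (simp add: sum_distrib_right)
 also have "\<dots> = (\<Sum>l<d. if i = l then G' l j else 0)"
  using assms by (intro sum.cong) (auto simp: inv_pair_def)
 finally show ?thesis using assms by simp
qed

text \<open>In G - G' = G (T' - T) G' the entry (k, l) of T' - T enters the weighted trace with the
  coefficient sum over i of W i G i k G' l i. Cauchy-Schwarz on column k of G and row l of G' bounds
  it by B / \<eta>^2. No factor \<open>d\<close> is lost, so an entrywise error of order o(n) is
  negligible after division by n.\<close>

lemma resolvent_trace_perturb:
 assumes "dissipative \<eta> d T" "inv_pair d T G" "dissipative \<eta> d T'" "inv_pair d T' G'" "0 < \<eta>"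
  and W: "\<And>i. i < d ==> cmod (W i) \<le> B"
 shows "cmod (\<Sum>i<d. W i * (G i i - G' i i)) \<le> B / \<eta>\<^sup>2 * (\<Sum>i<d. \<Sum>j<d. cmod (T i j - T' i j))"
proof -
 have "(\<Sum>i<d. W i * (G i i - G' i i)) = (\<Sum>i<d. \<Sum>k<d. \<Sum>l<d. W i * (G i k * (T' k l - T k l) * G' l i))"
  by (intro sum.cong) (simp_all add: resolvent_identity[OF assms(2,4)] sum_distrib_left)
 also have "\<dots> = (\<Sum>k<d. \<Sum>i<d. \<Sum>l<d. W i * (G i k * (T' k l - T k l) * G' l i))"
  by (rule sum.swap)
 also have "\<dots> = (\<Sum>k<d. \<Sum>l<d. \<Sum>i<d. W i * (G i k * (T' k l - T k l) * G' l i))"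
  by (intro sum.cong refl sum.swap)
 also have "\<dots> = (\<Sum>k<d. \<Sum>l<d. (T' k l - T k l) * (\<Sum>i<d. (W i * G i k) * G' l i))"
  by (simp add: sum_distrib_left mult_ac)
 also have "cmod \<dots> \<le> (\<Sum>k<d. \<Sum>l<d. cmod (T k l - T' k l) * (B / \<eta>\<^sup>2))"
 proof (intro order_trans[OF norm_sum] sum_mono)
  fix k l assume kl: "k \<in> {..<d}" "l \<in> {..<d}"
  have B: "0 \<le> B" using W[of k] kl norm_ge_zero order_trans by blast
  have "L2_set (\<lambda>i. cmod (W i * G i k)) {..<d} \<le> L2_set (\<lambda>i. B * cmod (G i k)) {..<d}"
   using W by (intro L2_set_mono) (auto simp: norm_mult intro!: mult_right_mono)
  also have "\<dots> = B * L2_set (\<lambda>i. cmod (G i k)) {..<d}"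
   using B by (simp add: L2_set_right_distrib)
  also have "\<dots> \<le> B * (1 / \<eta>)"
   using dissipative_col_row(1)[OF assms(1,2,5)] kl B by (intro mult_left_mono) auto
  finally have "L2_set (\<lambda>i. cmod (W i * G i k)) {..<d} * L2_set (\<lambda>i. cmod (G' l i)) {..<d} \<le> B * (1/\<eta>) * (1 / \<eta>)"
   using dissipative_col_row(2)[OF assms(3,4,5)] kl B assms(5)
   by (intro mult_mono) (auto simp: L2_set_nonneg)
  then have "cmod (\<Sum>i<d. (W i * G i k) * G' l i) \<le> B / \<eta>\<^sup>2"
   using norm_sum_mult_le_L2[of "\<lambda>i. W i * G i k" "\<lambda>i. G' l i" "{..<d}"]
   by (simp add: power2_eq_square)
  then show "cmod ((T' k l - T k l) * (\<Sum>i<d. (W i * G i k) * G' l i)) \<le> cmod (T k l - T' k l) * (B / \<eta>\<^sup>2)"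
   unfolding norm_mult by (subst norm_minus_commute) (intro mult_left_mono, auto)
 qed
 also have "\<dots> = B / \<eta>\<^sup>2 * (\<Sum>i<d. \<Sum>j<d. cmod (T i j - T' i j))"
  by (simp add: sum_distrib_left sum_distrib_right mult_ac)
 finally show ?thesis .
qed

text \<open>Meant for the fixed size of a symbol, where it gives continuity of the resolvent in the
  parameters.\<close>

lemma resolvent_entry_perturb:
 assumes "dissipative \<eta> d T" "inv_pair d T G" "dissipative \<eta> d T'" "inv_pair d T' G'" "0 < \<eta>" "i < d" "j < d"
 shows "cmod (G i j - G' i j) \<le> 1 / \<eta>\<^sup>2 * (\<Sum>i<d. \<Sum>j<d. cmod (T i j - T' i j))"
proof -
 have "cmod (G i j - G' i j) \<le> (\<Sum>k<d. \<Sum>l<d. cmod (T k l - T' k l) * (1 / \<eta>\<^sup>2))"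
  unfolding resolvent_identity[OF assms(2,4,6,7)]
 proof (intro order_trans[OF norm_sum] sum_mono)
  fix k l assume kl: "k \<in> {..<d}" "l \<in> {..<d}"
  have "cmod (G i k) * cmod (G' l j) \<le> (1 / \<eta>) * (1 / \<eta>)"
   using dissipative_entry[OF assms(1,2,5,6)] dissipative_entry[OF assms(3,4,5) _ assms(7)] kl assms(5)
   by (intro mult_mono) auto
  then have "cmod (T k l - T' k l) * (cmod (G i k) * cmod (G' l j)) \<le> cmod (T k l - T' k l) * (1 / \<eta>\<^sup>2)"
   by (intro mult_left_mono) (auto simp: power2_eq_square)
  then show "cmod (G i k * (T' k l - T k l) * G' l j) \<le> cmod (T k l - T' k l) * (1 / \<eta>\<^sup>2)"
   by (simp add: norm_mult norm_minus_commute mult_ac)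
 qed
 then show ?thesis by (simp add: sum_distrib_left mult_ac)
qed

section \<open>Hermitian matrices and diagonal shifts\<close>

definition herm :: "nat => mat_fun => bool" where
 "herm d X \<longleftrightarrow> (\<forall>i<d. \<forall>j<d. X i j = cnj (X j i))"

definition shiftd :: "mat_fun => (nat => complex) => mat_fun" where
 "shiftd X Z i j = X i j - (if i = j then Z i else 0)"

lemma cnj_fixed_Im_0: "cnj z = z ==> Im z = 0"
 by (simp add: complex_eq_iff)

lemma herm_quadratic_real:
 assumes "herm d X" shows "Im (\<Sum>i<d. \<Sum>j<d. cnj (v i) * X i j * v j) = 0"
proof -
 have "cnj (\<Sum>i<d. \<Sum>j<d. cnj (v i) * X i j * v j) = (\<Sum>j<d. \<Sum>i<d. cnj (v j) * cnj (X i j) * v i)"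
  by (subst sum.swap) (simp add: mult_ac)
 also have "\<dots> = (\<Sum>i<d. \<Sum>j<d. cnj (v i) * X i j * v j)"
  using assms unfolding herm_def by (intro sum.cong refl) (metis lessThan_iff)
 finally show ?thesis by (rule cnj_fixed_Im_0)
qed

lemma dissipative_shiftd:
 assumes "herm d X" "\<And>i. i < d ==> \<eta> \<le> Im (Z i)"
 shows "dissipative \<eta> d (shiftd X Z)"
 unfolding dissipative_def
proof
 fix v
 have "(\<Sum>i<d. \<Sum>j<d. cnj (v i) * shiftd X Z i j * v j) = (\<Sum>i<d. \<Sum>j<d. cnj (v i) * X i j * v j)
   - (\<Sum>i<d. \<Sum>j<d. if i = j then Z i * (cnj (v i) * v j) else 0)"
  unfolding sum_subtractf[symmetric] by (intro sum.cong refl) (simp add: shiftd_def algebra_simps)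
 also have "(\<Sum>i<d. \<Sum>j<d. if i = j then Z i * (cnj (v i) * v j) else 0) = (\<Sum>i<d. Z i * (cnj (v i) * v i))"
  by simp
 also have "(\<Sum>i<d. Z i * (cnj (v i) * v i)) = (\<Sum>i<d. Z i * of_real ((cmod (v i))\<^sup>2))"
  by (intro sum.cong refl) (simp only: complex_norm_square, simp only: mult.commute)
 finally have "Im (\<Sum>i<d. \<Sum>j<d. cnj (v i) * shiftd X Z i j * v j) = - (\<Sum>i<d. Im (Z i) * (cmod (v i))\<^sup>2)"
  using herm_quadratic_real[OF assms(1)] by simp
 also have "\<dots> \<le> - (\<Sum>i<d. \<eta> * (cmod (v i))\<^sup>2)"
  using assms(2) by (intro le_imp_neg_le sum_mono mult_right_mono) auto
 finally show "Im (\<Sum>i<d. \<Sum>j<d. cnj (v i) * shiftd X Z i j * v j) \<le> - \<eta> * (\<Sum>i<d. (cmod (v i))\<^sup>2)"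
  by (simp add: sum_distrib_left sum_negf)
qed

section \<open>The spectral theorem\<close>

definition unitary_fun :: "nat => mat_fun => bool" where
 "unitary_fun d U \<longleftrightarrow> (\<forall>i<d. \<forall>j<d. (\<Sum>k<d. cnj (U k i) * U k j) = (if i = j then 1 else 0)
   \<and> (\<Sum>k<d. U i k * cnj (U j k)) = (if i = j then 1 else 0))"

text \<open>U diag(f) U^H, the functional calculus of a Hermitian matrix whose eigenvectors are the
  columns of U.\<close>

definition udiag :: "nat => mat_fun => (nat => complex) => mat_fun" where
 "udiag d U f i j = (\<Sum>k<d. U i k * f k * cnj (U j k))"

lemma udiag_mult:
 assumes "unitary_fun d U"
 shows "(\<Sum>j<d. udiag d U f i j * udiag d U g j l) = udiag d U (\<lambda>k. f k * g k) i l"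
proof -
 have "(\<Sum>j<d. udiag d U f i j * udiag d U g j l)
   = (\<Sum>j<d. \<Sum>k<d. \<Sum>m<d. U i k * f k * (cnj (U j k) * U j m) * g m * cnj (U l m))"
  by (simp add: udiag_def sum_product mult.assoc)
 also have "\<dots> = (\<Sum>k<d. \<Sum>j<d. \<Sum>m<d. U i k * f k * (cnj (U j k) * U j m) * g m * cnj (U l m))"
  by (rule sum.swap)
 also have "\<dots> = (\<Sum>k<d. \<Sum>m<d. \<Sum>j<d. U i k * f k * (cnj (U j k) * U j m) * g m * cnj (U l m))"
  by (intro sum.cong refl sum.swap)
 also have "\<dots> = (\<Sum>k<d. \<Sum>m<d. U i k * f k * (\<Sum>j<d. cnj (U j k) * U j m) * g m * cnj (U l m))"
  by (simp add: sum_distrib_left sum_distrib_right)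
 also have "\<dots> = (\<Sum>k<d. \<Sum>m<d. if k = m then U i k * f k * g m * cnj (U l m) else 0)"
  using assms by (intro sum.cong refl) (simp add: unitary_fun_def)
 finally show ?thesis by (simp add: udiag_def mult.assoc)
qed

lemma udiag_const:
 assumes "unitary_fun d U" "i < d" "j < d"
 shows "udiag d U (\<lambda>_. c) i j = (if i = j then c else 0)"
proof -
 have "udiag d U (\<lambda>_. c) i j = c * (\<Sum>k<d. U i k * cnj (U j k))"
  by (simp add: udiag_def sum_distrib_left mult_ac)
 then show ?thesis using assms by (simp add: unitary_fun_def)
qed

lemma udiag_trace:
 assumes "unitary_fun d U" shows "(\<Sum>i<d. udiag d U f i i) = (\<Sum>k<d. f k)"
proof -
 have "(\<Sum>i<d. udiag d U f i i) = (\<Sum>k<d. f k * (\<Sum>i<d. cnj (U i k) * U i k))"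
  unfolding udiag_def by (subst sum.swap) (simp add: sum_distrib_left mult_ac)
 then show ?thesis using assms by (simp add: unitary_fun_def)
qed

lemma udiag_diff: "udiag d U f i j - udiag d U g i j = udiag d U (\<lambda>k. f k - g k) i j"
 by (simp add: udiag_def sum_subtractf[symmetric] algebra_simps)

lemma udiag_inv_pair:
 assumes "unitary_fun d U" "\<And>k. k < d ==> f k \<noteq> 0"
  and "\<And>i j. i < d ==> j < d ==> T i j = udiag d U f i j"
 shows "inv_pair d T (udiag d U (\<lambda>k. 1 / f k))"
proof -
 have 1: "udiag d U (\<lambda>k. f k * (1 / f k)) i j = udiag d U (\<lambda>_. 1) i j"
  "udiag d U (\<lambda>k. (1 / f k) * f k) i j = udiag d U (\<lambda>_. 1) i j" for i j
  using assms(2) by (auto simp: udiag_def intro!: sum.cong)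
 show ?thesis unfolding inv_pair_def
 proof (intro allI impI conjI)
  fix i j assume ij: "i < d" "j < d"
  have "(\<Sum>k<d. T i k * udiag d U (\<lambda>k. 1 / f k) k j) = (\<Sum>k<d. udiag d U f i k * udiag d U (\<lambda>k. 1 / f k) k j)"
   using assms(3) ij by (intro sum.cong) auto
  then show "(\<Sum>k<d. T i k * udiag d U (\<lambda>k. 1 / f k) k j) = (if i = j then 1 else 0)"
   unfolding udiag_mult[OF assms(1)] 1 udiag_const[OF assms(1) ij] .
  have "(\<Sum>k<d. udiag d U (\<lambda>k. 1 / f k) i k * T k j) = (\<Sum>k<d. udiag d U (\<lambda>k. 1 / f k) i k * udiag d U f k j)"
   using assms(3) ij by (intro sum.cong) auto
  then show "(\<Sum>k<d. udiag d U (\<lambda>k. 1 / f k) i k * T k j) = (if i = j then 1 else 0)"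
   unfolding udiag_mult[OF assms(1)] 1 udiag_const[OF assms(1) ij] .
 qed
qed

section \<open>Eigenvalue multisets, traces and orthonormal eigenvectors\<close>

lemma proots_linear_factors: "proots (\<Prod>a\<leftarrow>as. [:- a, 1:]) = mset (as :: complex list)"
proof (induction as)
 case (Cons a as)
 have "(\<Prod>a\<leftarrow>as. [:- a, 1:]) \<noteq> (0 :: complex poly)" by (auto simp: prod_list_zero_iff)
 then show ?case using Cons by (simp add: proots_mult del: mult_pCons_left)
qed simp

lemma unitary_conjugate_mat:
 assumes "unitary_fun d U"
 defines "P \<equiv> Matrix.mat d d (\<lambda>(i, j). U i j)" and "Q \<equiv> Matrix.mat d d (\<lambda>(i, j). cnj (U j i))"
 shows "P * Q = 1\<^sub>m d" "Q * P = 1\<^sub>m d"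
 using assms(1) by (auto intro!: eq_matI simp: P_def Q_def unitary_fun_def scalar_prod_def atLeast0LessThan)

text \<open>The matrix is similar to a diagonal one, whose characteristic polynomial is already
  factored; multiplicities are therefore the algebraic ones.\<close>

lemma eigenvalues_udiag:
 assumes U: "unitary_fun d U" and A: "A \<in> carrier_mat d d"
  and eq: "\<And>i j. i < d ==> j < d ==> A $$ (i, j) = udiag d U f i j"
 shows "eigenvalues_mset A = image_mset f (mset_set {..<d})"
proof -
 define P where "P = Matrix.mat d d (\<lambda>(i, j). U i j)"
 define Q where "Q = Matrix.mat d d (\<lambda>(i, j). cnj (U j i))"
 define B where "B = Matrix.mat d d (\<lambda>(i, j). if i = j then f i else 0)"
 have c: "P \<in> carrier_mat d d" "Q \<in> carrier_mat d d" "B \<in> carrier_mat d d" by (simp_all add: P_def Q_def B_def)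
 have PB: "P * B \<in> carrier_mat d d" using c by simp
 have "A = P * B * Q"
 proof (rule eq_matI)
  fix i j assume "i < dim_row (P * B * Q)" "j < dim_col (P * B * Q)"
  then have ij: "i < d" "j < d" using c by auto
  have "(P * B) $$ (i, k) = U i k * f k" if "k < d" for k
   unfolding mult_mat_index[OF c(1,3) ij(1) that] using ij that by (simp add: P_def B_def if_distrib[of "\<lambda>x. _ * x"] cong: if_cong)
  then show "A $$ (i, j) = (P * B * Q) $$ (i, j)"
   unfolding mult_mat_index[OF PB c(2) ij] eq[OF ij] udiag_def using ij by (intro sum.cong) (auto simp: Q_def)
 qed (use A c in auto)
 then have "similar_mat_wit A B P Q"
  using unitary_conjugate_mat[OF U] A c by (intro similar_mat_witI[of _ _ d]) (auto simp: P_def Q_def)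
 then have "char_poly A = char_poly B"
  by (intro char_poly_similar) (auto simp: similar_mat_def)
 also have "\<dots> = (\<Prod>a\<leftarrow>diag_mat B. [:- a, 1:])"
  by (rule char_poly_upper_triangular[OF c(3)]) (auto simp: B_def)
 finally have "eigenvalues_mset A = mset (diag_mat B)"
  by (simp add: eigenvalues_mset_def proots_linear_factors)
 also have "diag_mat B = map f [0..<d]" by (auto simp: diag_mat_def B_def)
 finally show ?thesis by (simp add: atLeast0LessThan mset_map mset_upt)
qed

lemma similar_trace:
 assumes "similar_mat A B" "A \<in> carrier_mat d d"
 shows "(\<Sum>i<d. A $$ (i, i)) = (\<Sum>i<d. (B :: complex mat) $$ (i, i))"
proof -
 obtain P Q where w: "similar_mat_wit A B P Q" using assms by (auto simp: similar_mat_def)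
 note W = similar_mat_witD[OF carrier_matD(1)[OF assms(2), symmetric] w]
 have c: "B \<in> carrier_mat d d" "P \<in> carrier_mat d d" "Q \<in> carrier_mat d d" "P * B \<in> carrier_mat d d" "Q * P = 1\<^sub>m d" "A = P * B * Q"
  using W by auto
 have "Q * (P * B) = (Q * P) * B" by (rule assoc_mult_mat[symmetric]) (use c in auto)
 then have QPB: "Q * (P * B) = B" using c(1,5) by simp
 have "(\<Sum>i<d. A $$ (i, i)) = (\<Sum>i<d. \<Sum>k<d. (P * B) $$ (i, k) * Q $$ (k, i))"
  unfolding c(6) by (intro sum.cong refl mult_mat_index[OF c(4,3)]) auto
 also have "\<dots> = (\<Sum>k<d. \<Sum>i<d. Q $$ (k, i) * (P * B) $$ (i, k))"
  by (subst sum.swap) (simp add: mult.commute)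
 also have "\<dots> = (\<Sum>k<d. (Q * (P * B)) $$ (k, k))"
  by (intro sum.cong refl mult_mat_index[OF c(3,4), symmetric]) auto
 finally show ?thesis unfolding QPB .
qed

text \<open>The trace is the sum of the diagonal of a Schur form, so if it differs from d t then not
  every eigenvalue is t. This supplies the new eigenvector in the induction for the spectral
  theorem.\<close>

lemma eigenvalue_off_mean:
 assumes A: "(A :: complex mat) \<in> carrier_mat d d" and "(\<Sum>i<d. A $$ (i, i)) \<noteq> of_nat d * t"
 shows "\<exists>e v. e \<noteq> t \<and> (\<exists>i<d. v i \<noteq> 0) \<and> (\<forall>i<d. (\<Sum>j<d. A $$ (i, j) * v j) = e * v i)"
proof -
 obtain es where es: "char_poly A = (\<Prod>a\<leftarrow>es. [:- a, 1:])" "length es = d"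
  using char_poly_factorized[OF A] by blast
 obtain B P Q where sd: "schur_decomposition A es = (B, P, Q)" by (metis prod_cases3)
 have S: "similar_mat_wit A B P Q" "diag_mat B = es"
  using schur_decomposition[OF A es(1) sd] by auto
 have "\<exists>e\<in>set es. e \<noteq> t"
 proof (rule ccontr)
  assume "\<not> ?thesis"
  then have all: "\<And>i. i < d ==> es ! i = t" using es(2) by auto
  have "dim_row B = d" using similar_mat_witD[OF carrier_matD(1)[OF A, symmetric] S(1)] by auto
  then have "(\<Sum>i<d. B $$ (i, i)) = (\<Sum>i<d. es ! i)"
   by (intro sum.cong refl) (simp add: S(2)[symmetric] diag_mat_def)
  also have "\<dots> = of_nat d * t" using all by simp
  finally show False using similar_trace[of A B d] S(1) A assms(2) by (auto simp: similar_mat_def)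
 qed
 then obtain e where e: "e \<in> set es" "e \<noteq> t" by blast
 have "poly (char_poly A) e = 0"
  unfolding es(1) poly_prod_list using e(1) by (auto simp: prod_list_zero_iff)
 then obtain v where v: "eigenvector A v e"
  using eigenvalue_root_char_poly[OF A] by (auto simp: eigenvalue_def)
 then have vc: "v \<in> carrier_vec d" "v \<noteq> 0\<^sub>v d" "A *\<^sub>v v = e \<cdot>\<^sub>v v" using A by (auto simp: eigenvector_def)
 have "\<exists>i<d. vec_index v i \<noteq> 0"
 proof (rule ccontr)
  assume "\<not> ?thesis"
  then have "v = 0\<^sub>v d" using vc(1) by (intro eq_vecI) auto
  with vc show False by simp
 qed
 moreover have "(\<Sum>j<d. A $$ (i, j) * vec_index v j) = e * vec_index v i" if "i < d" for i
 proof -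
  have "vec_index (A *\<^sub>v v) i = e * vec_index v i" unfolding vc(3) using vc(1) that by simp
  then show ?thesis using that vc(1) A by (simp add: scalar_prod_def atLeast0LessThan)
 qed
 ultimately show ?thesis using e(2) by blast
qed

lemma sum_delta_mult_left: "finite A ==> i \<in> A ==> (\<Sum>k\<in>A. f k * (if k = i then 1 else 0)) = (f i :: complex)"
 by (simp add: if_distrib[of "\<lambda>x. _ * x"] cong: if_cong)

lemma herm_inner_swap:
 assumes "herm d X"
 shows "(\<Sum>i<d. cnj (u i) * (\<Sum>j<d. X i j * v j)) = cnj (\<Sum>j<d. cnj (v j) * (\<Sum>i<d. X j i * u i))"
proof -
 have "(\<Sum>i<d. cnj (u i) * (\<Sum>j<d. X i j * v j)) = (\<Sum>j<d. \<Sum>i<d. cnj (u i) * (X i j * v j))"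
  unfolding sum_distrib_left by (rule sum.swap)
 also have "\<dots> = (\<Sum>j<d. \<Sum>i<d. v j * (cnj (X j i) * cnj (u i)))"
  using assms unfolding herm_def by (intro sum.cong refl) (metis lessThan_iff mult.commute mult.assoc)
 finally show ?thesis by (simp add: sum_distrib_left)
qed

text \<open>Deflation without restricting to a subspace: rank-one terms move the m known
  eigenvectors to one common eigenvalue t, chosen so that the modified matrix Y must have an
  eigenvalue e different from t. Eigenvectors of the Hermitian Y for e and t are orthogonal, and on
  vectors orthogonal to the known ones Y agrees with X.\<close>

lemma herm_orthonormal_eigenvectors:
 assumes X: "herm d X" and "m \<le> d"
 shows "\<exists>u lam. (\<forall>k<m. \<forall>l<m. (\<Sum>i<d. cnj (u k i) * u l i) = (if k = l then 1 else 0))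
   \<and> (\<forall>k<m. \<forall>i<d. (\<Sum>j<d. X i j * u k j) = of_real (lam k) * u k i)"
 using assms(2)
proof (induction m)
 case (Suc m)
 then have "m \<le> d" by simp
 from Suc.IH[OF this] obtain u lam where ul: "\<forall>k<m. \<forall>l<m. (\<Sum>i<d. cnj (u k i) * u l i) = (if k = l then 1 else 0)"
  "\<forall>k<m. \<forall>i<d. (\<Sum>j<d. X i j * u k j) = of_real (lam k) * u k i" by blast
 have on: "(\<Sum>i<d. cnj (u k i) * u l i) = (if k = l then 1 else 0)" if "k < m" "l < m" for k l
  using ul(1) that by blast
 have ev: "(\<Sum>j<d. X i j * u k j) = of_real (lam k) * u k i" if "k < m" "i < d" for k i
  using ul(2) that by blast
 have md: "m < d" using Suc by simp
 \<comment> \<open>The trace of Y is tr X plus the sum of the t - lam k, and it equals d t exactly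
   when t = c. The real number Re c + 1 is never c.\<close>
 define c where "c = ((\<Sum>i<d. X i i) - (\<Sum>k<m. of_real (lam k))) / (of_nat d - of_nat m)"
 define t where "t = Re c + 1"
 define Y where "Y i j = X i j + (\<Sum>k<m. of_real (t - lam k) * u k i * cnj (u k j))" for i j
 have hY: "herm d Y"
  unfolding herm_def
 proof (intro allI impI)
  fix i j assume "i < d" "j < d"
  then have "X i j = cnj (X j i)" using X unfolding herm_def by blast
  then have "Y i j = cnj (X j i) + (\<Sum>k<m. of_real (t - lam k) * u k i * cnj (u k j))"
   unfolding Y_def by (simp only:)
  also have "\<dots> = cnj (Y j i)" unfolding Y_def by (simp add: mult_ac)
  finally show "Y i j = cnj (Y j i)" .
 qed
 have Yu: "(\<Sum>j<d. Y i j * v j) = (\<Sum>j<d. X i j * v j)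
   + (\<Sum>k<m. of_real (t - lam k) * u k i * (\<Sum>j<d. cnj (u k j) * v j))" for i v
 proof -
  have "(\<Sum>j<d. Y i j * v j) = (\<Sum>j<d. X i j * v j) + (\<Sum>j<d. \<Sum>k<m. of_real (t - lam k) * u k i * (cnj (u k j) * v j))"
   unfolding Y_def by (simp add: distrib_right sum.distrib sum_distrib_right mult.assoc)
  then show ?thesis by (subst (asm) sum.swap) (simp add: sum_distrib_left)
 qed
 have Yev: "(\<Sum>j<d. Y i j * u k j) = of_real t * u k i" if "k < m" "i < d" for k i
 proof -
  have "(\<Sum>l<m. of_real (t - lam l) * u l i * (\<Sum>j<d. cnj (u l j) * u k j))
   = (\<Sum>l<m. (of_real (t - lam l) * u l i) * (if l = k then 1 else 0))"
   using on that by (intro sum.cong) auto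
  also have "\<dots> = of_real (t - lam k) * u k i" by (rule sum_delta_mult_left) (use that in auto)
  finally show ?thesis unfolding Yu ev[OF that] by (simp add: algebra_simps)
 qed
 have "(\<Sum>i<d. Y i i) = (\<Sum>i<d. X i i) + (\<Sum>k<m. of_real (t - lam k) * (\<Sum>i<d. cnj (u k i) * u k i))"
  unfolding Y_def sum.distrib by (subst sum.swap) (simp add: sum_distrib_left mult_ac)
 also have "\<dots> = (\<Sum>i<d. X i i) + (\<Sum>k<m. of_real (t - lam k))"
  using on by simp
 also have "\<dots> \<noteq> of_nat d * of_real t"
 proof
  assume "(\<Sum>i<d. X i i) + (\<Sum>k<m. of_real (t - lam k)) = of_nat d * of_real t"
  then have "of_real t * (of_nat d - of_nat m) = (\<Sum>i<d. X i i) - (\<Sum>k<m. of_real (lam k))"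
   by (simp add: sum_subtractf algebra_simps)
  moreover have "(of_nat d - of_nat m :: complex) \<noteq> 0" using md by simp
  ultimately have "of_real t = c" unfolding c_def by (simp add: field_simps)
  then have "Re c = t" by (metis Re_complex_of_real)
  then show False by (simp add: t_def)
 qed
 finally obtain e v where e: "e \<noteq> of_real t" and v0: "\<exists>i<d. v i \<noteq> 0"
  and Yv: "\<And>i. i < d ==> (\<Sum>j<d. Y i j * v j) = e * v i"
  using eigenvalue_off_mean[of "Matrix.mat d d (\<lambda>(i, j). Y i j)" d "of_real t"] by auto
 have orth: "(\<Sum>i<d. cnj (u k i) * v i) = 0" if k: "k < m" for k
 proof -
  have "e * (\<Sum>i<d. cnj (u k i) * v i) = (\<Sum>i<d. cnj (u k i) * (\<Sum>j<d. Y i j * v j))"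
   using Yv by (simp add: sum_distrib_left mult_ac)
  also have "\<dots> = cnj (\<Sum>j<d. cnj (v j) * (\<Sum>i<d. Y j i * u k i))"
   by (rule herm_inner_swap[OF hY])
  also have "\<dots> = of_real t * (\<Sum>i<d. cnj (u k i) * v i)"
   using Yev[OF k] by (simp add: sum_distrib_left mult_ac)
  finally show ?thesis using e by simp
 qed
 have Xv: "(\<Sum>j<d. X i j * v j) = e * v i" if "i < d" for i
  using Yv[OF that] unfolding Yu using orth by simp
 define N where "N = (\<Sum>i<d. (cmod (v i))\<^sup>2)"
 have vv: "(\<Sum>i<d. cnj (v i) * v i) = of_real N"
  unfolding N_def of_real_sum by (intro sum.cong refl) (simp only: complex_norm_square, simp only: mult.commute)
 have N0: "N \<noteq> 0" using v0 unfolding N_def by (subst sum_nonneg_eq_0_iff) auto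
 then have Np: "0 < N" unfolding N_def using sum_nonneg[of "{..<d}" "\<lambda>i. (cmod (v i))\<^sup>2"] by force
 have "(\<Sum>i<d. \<Sum>j<d. cnj (v i) * X i j * v j) = (\<Sum>i<d. cnj (v i) * (\<Sum>j<d. X i j * v j))"
  by (simp add: sum_distrib_left mult.assoc)
 also have "\<dots> = e * of_real N"
  unfolding vv[symmetric] using Xv by (simp add: sum_distrib_left mult_ac)
 finally have "Im (e * of_real N) = 0" using herm_quadratic_real[OF X, of v] by metis
 then have "Im e = 0" using N0 by simp
 then have er: "e = of_real (Re e)" by (simp add: complex_eq_iff)
 define w where "w i = v i / of_real (sqrt N)" for i
 have ww: "(\<Sum>i<d. cnj (w i) * w i) = 1"
 proof -
  have sq: "of_real (sqrt N) * of_real (sqrt N) = of_real N"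
   using Np by (simp add: of_real_mult[symmetric] del: of_real_mult)
  have "(\<Sum>i<d. cnj (w i) * w i) = (\<Sum>i<d. cnj (v i) * v i) / of_real N"
   unfolding sum_divide_distrib by (intro sum.cong refl) (simp add: w_def sq)
  then show ?thesis using vv Np by simp
 qed
 have uw: "(\<Sum>i<d. cnj (u k i) * w i) = 0" if "k < m" for k
  using orth[OF that] by (simp add: w_def sum_divide_distrib[symmetric])
 have wu: "(\<Sum>i<d. cnj (w i) * u k i) = 0" if "k < m" for k
 proof -
  have "(\<Sum>i<d. cnj (w i) * u k i) = cnj (\<Sum>i<d. cnj (u k i) * w i)" by (simp add: mult.commute)
  then show ?thesis using uw[OF that] by simp
 qed
 have Xw: "(\<Sum>j<d. X i j * w j) = of_real (Re e) * w i" if "i < d" for i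
  using Xv[OF that] er by (simp add: w_def sum_divide_distrib[symmetric])
 show ?case
 proof (intro exI[of _ "u(m := w)"] exI[of _ "lam(m := Re e)"] conjI allI impI)
  fix k l assume "k < Suc m" "l < Suc m"
  then show "(\<Sum>i<d. cnj ((u(m := w)) k i) * (u(m := w)) l i) = (if k = l then 1 else 0)"
   using on uw wu ww by (cases "k = m"; cases "l = m") (auto simp: less_Suc_eq)
 next
  fix k i assume "k < Suc m" "i < d"
  then show "(\<Sum>j<d. X i j * (u(m := w)) k j) = of_real ((lam(m := Re e)) k) * (u(m := w)) k i"
   using ev Xw by (cases "k = m") (auto simp: less_Suc_eq)
 qed
qed simp

theorem spectral_theorem:
 assumes X: "herm d X"
 obtains U lam where "unitary_fun d U"
  "\<And>i j. i < d ==> j < d ==> X i j = udiag d U (\<lambda>k. of_real (lam k)) i j"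
proof -
 obtain u lam where ul: "\<forall>k<d. \<forall>l<d. (\<Sum>i<d. cnj (u k i) * u l i) = (if k = l then 1 else 0)"
  "\<forall>k<d. \<forall>i<d. (\<Sum>j<d. X i j * u k j) = of_real (lam k) * u k i"
  using herm_orthonormal_eigenvectors[OF X order_refl] by blast
 have on: "(\<Sum>i<d. cnj (u k i) * u l i) = (if k = l then 1 else 0)" if "k < d" "l < d" for k l
  using ul(1) that by blast
 have ev: "(\<Sum>j<d. X i j * u k j) = of_real (lam k) * u k i" if "k < d" "i < d" for k i
  using ul(2) that by blast
 define U where "U i k = u k i" for i k
 define P where "P = Matrix.mat d d (\<lambda>(i, j). U i j)"
 define Q where "Q = Matrix.mat d d (\<lambda>(i, j). cnj (U j i))"
 have c: "P \<in> carrier_mat d d" "Q \<in> carrier_mat d d" by (simp_all add: P_def Q_def)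
 have "Q * P = 1\<^sub>m d"
  using on by (auto intro!: eq_matI simp: P_def Q_def U_def scalar_prod_def atLeast0LessThan)
 then have PQ: "P * Q = 1\<^sub>m d" using mat_mult_left_right_inverse[OF c(2,1)] by simp
 have "(\<Sum>k<d. U i k * cnj (U j k)) = (if i = j then 1 else 0)" if ij: "i < d" "j < d" for i j
 proof -
  have "(P * Q) $$ (i, j) = (if i = j then 1 else 0)" using PQ ij by simp
  then show ?thesis unfolding mult_mat_index[OF c ij] using ij by (simp add: P_def Q_def)
 qed
 then have un: "unitary_fun d U" using on by (auto simp: unitary_fun_def U_def)
 show thesis
 proof (rule that[OF un])
  fix i j assume ij: "i < d" "j < d"
  have "X i j = (\<Sum>l<d. X i l * (if l = j then 1 else 0))"
   by (rule sum_delta_mult_left[symmetric]) (use ij in auto)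
  also have "\<dots> = (\<Sum>l<d. X i l * (\<Sum>k<d. U l k * cnj (U j k)))"
   using un ij by (intro sum.cong) (auto simp: unitary_fun_def)
  also have "\<dots> = (\<Sum>k<d. (\<Sum>l<d. X i l * U l k) * cnj (U j k))"
   unfolding sum_distrib_left sum_distrib_right by (subst sum.swap) (simp add: mult.assoc)
  also have "\<dots> = udiag d U (\<lambda>k. of_real (lam k)) i j"
   unfolding udiag_def using ev ij by (intro sum.cong) (auto simp: U_def)
  finally show "X i j = udiag d U (\<lambda>k. of_real (lam k)) i j" .
 qed
qed

lemma udiag_shiftd:
 assumes "unitary_fun d U" "\<And>i j. i < d ==> j < d ==> X i j = udiag d U f i j" "i < d" "j < d"
 shows "shiftd X (\<lambda>_. z) i j = udiag d U (\<lambda>k. f k - z) i j"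
 using assms udiag_const[OF assms(1,3,4), of z] by (simp add: shiftd_def udiag_diff[symmetric])

definition herm_eigs :: "nat => mat_fun => real multiset" where
 "herm_eigs d X = image_mset Re (eigenvalues_mset (Matrix.mat d d (\<lambda>(i, j). X i j)))"

text \<open>All four facts are read off from A = U diag(lam) U^H with real lam. As A is its own
  adjoint, its Gram matrix is A A = U diag(lam^2) U^H, so the singular values are the |lam k|; and
  the trace of a function of A is the sum of its values at the lam k.\<close>

lemma herm_eigs:
 assumes X: "herm d X" and A: "A \<in> carrier_mat d d" "\<And>i j. i < d ==> j < d ==> A $$ (i, j) = X i j"
 shows "eigenvalues_mset A = image_mset of_real (herm_eigs d X)"
  and "singular_values_mset A = image_mset abs (herm_eigs d X)"
  and "size (herm_eigs d X) = d"
  and "Im z \<noteq> 0 ==> (\<Sum>x\<in>#herm_eigs d X. 1 / (of_real x - z)) = (\<Sum>i<d. finv d (shiftd X (\<lambda>_. z)) i i)"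
proof -
 obtain U lam where U: "unitary_fun d U"
  and XU: "\<And>i j. i < d ==> j < d ==> X i j = udiag d U (\<lambda>k. of_real (lam k)) i j"
  using spectral_theorem[OF X] by blast
 have AX: "A = Matrix.mat d d (\<lambda>(i, j). X i j)" using A by (intro eq_matI) auto
 have e: "eigenvalues_mset A = image_mset (\<lambda>k. of_real (lam k)) (mset_set {..<d})"
  by (rule eigenvalues_udiag[OF U A(1)]) (simp add: A(2) XU)
 then have h: "herm_eigs d X = image_mset lam (mset_set {..<d})"
  unfolding herm_eigs_def AX by (simp add: image_mset.compositionality o_def)
 show "eigenvalues_mset A = image_mset of_real (herm_eigs d X)"
  by (simp add: e h image_mset.compositionality o_def)
 show "size (herm_eigs d X) = d" by (simp add: h)
 have ca: "mat_adjoint A \<in> carrier_mat d d" using A(1) by (auto simp: mat_adjoint_def)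
 have "mat_adjoint A $$ (i, j) = A $$ (i, j)" if ij: "i < d" "j < d" for i j
 proof -
  have "mat_adjoint A $$ (i, j) = cnj (A $$ (j, i))"
   using ij A(1) unfolding mat_adjoint_def by (simp add: mat_of_rows_def carrier_matD)
  also have "\<dots> = cnj (X j i)" by (simp only: A(2)[OF ij(2,1)])
  also have "\<dots> = X i j" using X ij unfolding herm_def by metis
  also have "\<dots> = A $$ (i, j)" by (simp only: A(2)[OF ij])
  finally show ?thesis .
 qed
 then have "mat_adjoint A = A"
  by (rule eq_matI) (use carrier_matD[OF ca] carrier_matD[OF A(1)] in simp_all)
 then have "singular_values_mset A = image_mset (\<lambda>z. sqrt (Re z)) (eigenvalues_mset (A * A))"
  unfolding singular_values_mset_def by simp
 also have "eigenvalues_mset (A * A) = image_mset (\<lambda>k. of_real (lam k) * of_real (lam k)) (mset_set {..<d})"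
 proof (rule eigenvalues_udiag[OF U])
  fix i j assume ij: "i < d" "j < d"
  show "(A * A) $$ (i, j) = udiag d U (\<lambda>k. of_real (lam k) * of_real (lam k)) i j"
   unfolding mult_mat_index[OF A(1) A(1) ij] udiag_mult[OF U, symmetric] using ij A(2) XU
   by (intro sum.cong) auto
 qed (use A in auto)
 finally show "singular_values_mset A = image_mset abs (herm_eigs d X)"
  by (simp add: h image_mset.compositionality o_def)
 assume z: "Im z \<noteq> 0"
 then have nz: "of_real (lam k) - z \<noteq> 0" for k by (auto simp: complex_eq_iff)
 have "inv_pair d (shiftd X (\<lambda>_. z)) (udiag d U (\<lambda>k. 1 / (of_real (lam k) - z)))"
  by (rule udiag_inv_pair[OF U nz]) (simp add: udiag_shiftd[OF U XU])
 then have "(\<Sum>i<d. finv d (shiftd X (\<lambda>_. z)) i i) = (\<Sum>i<d. udiag d U (\<lambda>k. 1 / (of_real (lam k) - z)) i i)"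
  by (intro sum.cong refl inv_pair_unique) auto
 also have "\<dots> = (\<Sum>k<d. 1 / (of_real (lam k) - z))" by (rule udiag_trace[OF U])
 also have "\<dots> = (\<Sum>x\<in>#herm_eigs d X. 1 / (of_real x - z))"
  unfolding h by (simp add: image_mset.compositionality o_def sum_unfold_sum_mset)
 finally show "(\<Sum>x\<in>#herm_eigs d X. 1 / (of_real x - z)) = (\<Sum>i<d. finv d (shiftd X (\<lambda>_. z)) i i)" ..
qed

section \<open>Schur complements\<close>

lemma sum_lessThan_add: "(\<Sum>k<m + n. f k) = (\<Sum>k<m. f k) + (\<Sum>k<n. f (m + k) :: 'a::comm_monoid_add)" for m n :: nat
 by (induction n) (auto simp: add.assoc)

lemma sum_of_bool_mult: "i < d ==> (\<Sum>k<d. (if i = k then 1 else 0) * f k) = (f i :: complex)" for d :: nat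
 by (simp add: if_distrib[of "\<lambda>x. x * _"] cong: if_cong)


text \<open>Column d + j of M G = 1, split into blocks, is a linear system for an upper part h and a
  lower part g. Solving the upper equations for h with \<open>Ai\<close> and inserting into the
  lower ones shows that S maps g to a unit vector.\<close>

lemma block_inverse:
 assumes G: "inv_pair (d + e) M G" and Ai: "inv_pair d (\<lambda>i j. M i j) Ai" and ij: "i < e" "j < e"
  and S: "\<And>i j. S i j = M (d + i) (d + j) - (\<Sum>a<d. \<Sum>b<d. M (d + i) a * Ai a b * M b (d + j))"
 shows "finv e S i j = G (d + i) (d + j)"
proof (rule finv_eqI(2)[OF _ ij])
 fix i j assume ij: "i < e" "j < e"
 define h where "h a = G a (d + j)" for a
 define g where "g l = G (d + l) (d + j)" for l
 have top: "(\<Sum>b<d. M a b * h b) = - (\<Sum>l<e. M a (d + l) * g l)" if "a < d" for a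
 proof -
  have "(\<Sum>k<d + e. M a k * G k (d + j)) = 0"
   using G that ij by (simp add: inv_pair_def)
  then show ?thesis unfolding sum_lessThan_add h_def g_def by (simp add: add_eq_0_iff)
 qed
 have bot: "(\<Sum>b<d. M (d + i) b * h b) + (\<Sum>l<e. M (d + i) (d + l) * g l) = (if i = j then 1 else 0)"
 proof -
  have "(\<Sum>k<d + e. M (d + i) k * G k (d + j)) = (if i = j then 1 else 0)"
   using G ij by (simp add: inv_pair_def)
  then show ?thesis unfolding sum_lessThan_add h_def g_def .
 qed
 have hb: "h a = - (\<Sum>b<d. \<Sum>l<e. Ai a b * M b (d + l) * g l)" if a: "a < d" for a
 proof -
  have "h a = (\<Sum>c<d. (if a = c then 1 else 0) * h c)" using sum_of_bool_mult[OF a] by simp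
  also have "\<dots> = (\<Sum>c<d. (\<Sum>b<d. Ai a b * M b c) * h c)"
   using Ai a by (intro sum.cong) (auto simp: inv_pair_def)
  also have "\<dots> = (\<Sum>b<d. Ai a b * (\<Sum>c<d. M b c * h c))"
   unfolding sum_distrib_left sum_distrib_right by (subst sum.swap) (simp add: mult.assoc)
  also have "\<dots> = (\<Sum>b<d. Ai a b * - (\<Sum>l<e. M b (d + l) * g l))"
   using top by (intro sum.cong) auto
  finally show ?thesis by (simp add: sum_negf sum_distrib_left mult.assoc)
 qed
 have "(\<Sum>l<e. S i l * g l) = (\<Sum>l<e. M (d + i) (d + l) * g l)
   - (\<Sum>l<e. \<Sum>a<d. \<Sum>b<d. M (d + i) a * Ai a b * M b (d + l) * g l)"
  by (simp add: S left_diff_distrib sum_subtractf sum_distrib_right)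
 also have "(\<Sum>l<e. \<Sum>a<d. \<Sum>b<d. M (d + i) a * Ai a b * M b (d + l) * g l)
   = (\<Sum>a<d. \<Sum>l<e. \<Sum>b<d. M (d + i) a * Ai a b * M b (d + l) * g l)" by (rule sum.swap)
 also have "\<dots> = (\<Sum>a<d. \<Sum>b<d. \<Sum>l<e. M (d + i) a * Ai a b * M b (d + l) * g l)"
  by (intro sum.cong refl sum.swap)
 also have "\<dots> = - (\<Sum>a<d. M (d + i) a * h a)"
  unfolding sum_negf[symmetric]
  by (intro sum.cong refl) (simp add: hb sum_distrib_left mult.assoc)
 finally show "(\<Sum>l<e. S i l * G (d + l) (d + j)) = (if i = j then 1 else 0)"
  using bot by (simp add: g_def add.commute)
qed

lemma inv_pair_cong:
 assumes "inv_pair d T G" "\<And>i j. i < d ==> j < d ==> T' i j = T i j"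
 shows "inv_pair d T' G"
 unfolding inv_pair_def
proof (intro allI impI)
 fix i j assume ij: "i < d" "j < d"
 have "(\<Sum>k<d. T' i k * G k j) = (\<Sum>k<d. T i k * G k j)" "(\<Sum>k<d. G i k * T' k j) = (\<Sum>k<d. G i k * T k j)"
  using assms(2) ij by (auto intro!: sum.cong)
 then show "(\<Sum>k<d. T' i k * G k j) = (if i = j then 1 else 0) \<and> (\<Sum>k<d. G i k * T' k j) = (if i = j then 1 else 0)"
  using assms(1) ij by (simp add: inv_pair_def)
qed

text \<open>The first bound is the resolvent identity and is good for small \<tau>. The second sees
  neither \<tau> nor c: by Sherman-Morrison the traces differ by \<tau> (v, w) / (1 - \<tau> s) with
  s = c^H G c, the energy inequalities give |(v, w)| <= Im s / \<eta>, and |1 - \<tau> s| >=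
  |\<tau>| Im s when Im \<tau> >= 0.\<close>

lemma rank_one_trace:
 assumes T: "dissipative \<eta> d T" and T': "dissipative \<eta> d T'" and \<eta>: "0 < \<eta>"
  and eq: "\<And>i j. i < d ==> j < d ==> T' i j = T i j - \<tau> * c i * cnj (c j)"
 shows "cmod ((\<Sum>i<d. finv d T' i i) - (\<Sum>i<d. finv d T i i)) \<le> cmod \<tau> * (\<Sum>i<d. (cmod (c i))\<^sup>2) / \<eta>\<^sup>2"
  and "0 \<le> Im \<tau> ==> cmod ((\<Sum>i<d. finv d T' i i) - (\<Sum>i<d. finv d T i i)) \<le> 1 / \<eta>"
proof -
 define G where "G = finv d T"
 define H where "H = finv d T'"
 have G: "inv_pair d T G" and H: "inv_pair d T' H"
  using dissipative_inv[OF T \<eta>] dissipative_inv[OF T' \<eta>] by (simp_all add: G_def H_def)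
 define u where "u i = (\<Sum>k<d. H i k * c k)" for i
 define v where "v i = (\<Sum>k<d. G i k * c k)" for i
 define w where "w j = (\<Sum>l<d. cnj (G l j) * c l)" for j
 have diff: "H i j - G i j = \<tau> * u i * cnj (w j)" if ij: "i < d" "j < d" for i j
 proof -
  have "H i j - G i j = (\<Sum>k<d. \<Sum>l<d. H i k * (T k l - T' k l) * G l j)"
   by (rule resolvent_identity[OF H G ij])
  also have "\<dots> = (\<Sum>k<d. \<Sum>l<d. \<tau> * (H i k * c k) * (cnj (c l) * G l j))"
   by (intro sum.cong refl) (simp add: eq)
  also have "\<dots> = \<tau> * u i * (\<Sum>l<d. cnj (c l) * G l j)"
   by (simp add: u_def sum_distrib_left sum_distrib_right mult.assoc) (subst sum.swap, simp)
  finally show ?thesis by (simp add: w_def mult.commute)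
 qed
 define D where "D = (\<Sum>i<d. H i i) - (\<Sum>i<d. G i i)"
 have D: "D = \<tau> * (\<Sum>i<d. u i * cnj (w i))"
  by (simp add: D_def sum_subtractf[symmetric] diff sum_distrib_left mult.assoc)
 let ?n = "\<lambda>f. L2_set (\<lambda>i. cmod (f i)) {..<d}"
 have "cmod D \<le> cmod \<tau> * (?n u * ?n w)"
  using norm_sum_mult_le_L2[of u "\<lambda>i. cnj (w i)" "{..<d}"] unfolding D by (simp add: norm_mult mult_left_mono)
 also have "\<dots> \<le> cmod \<tau> * (?n c / \<eta> * (?n c / \<eta>))"
  using dissipative_norm(1)[OF T' H \<eta>, of c] dissipative_norm(2)[OF T G \<eta>, of c] \<eta>
  unfolding u_def w_def by (intro mult_left_mono mult_mono) (auto intro!: L2_set_nonneg divide_nonneg_pos)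
 also have "\<dots> = cmod \<tau> * (?n c)\<^sup>2 / \<eta>\<^sup>2" by (simp add: power2_eq_square)
 finally show "cmod ((\<Sum>i<d. finv d T' i i) - (\<Sum>i<d. finv d T i i)) \<le> cmod \<tau> * (\<Sum>i<d. (cmod (c i))\<^sup>2) / \<eta>\<^sup>2"
  unfolding D_def G_def H_def L2_set_sq .
 assume \<tau>: "0 \<le> Im \<tau>"
 define s where "s = (\<Sum>i<d. \<Sum>k<d. cnj (c i) * G i k * c k)"
 have sw: "s = (\<Sum>j<d. cnj (w j) * c j)"
  unfolding s_def by (subst sum.swap) (simp add: w_def sum_distrib_left sum_distrib_right mult_ac)
 \<comment> \<open>Sherman-Morrison, kept multiplied out because 1 - \<tau> s is not yet known to be
   nonzero.\<close>
 have uv: "u i * (1 - \<tau> * s) = v i" if "i < d" for i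
 proof -
  have "u i - v i = (\<Sum>j<d. (H i j - G i j) * c j)" by (simp add: u_def v_def left_diff_distrib sum_subtractf)
  also have "\<dots> = \<tau> * u i * s" using that by (simp add: diff sw sum_distrib_left mult.assoc)
  finally show ?thesis by (simp add: algebra_simps)
 qed
 have D2: "D * (1 - \<tau> * s) = \<tau> * (\<Sum>i<d. v i * cnj (w i))"
  unfolding D sum_distrib_left sum_distrib_right
  by (intro sum.cong refl) (simp add: uv[symmetric] mult_ac)
 have e1: "\<eta> * (?n v)\<^sup>2 \<le> Im s" unfolding L2_set_sq v_def s_def by (rule dissipative_energy[OF T G])
 have e2: "\<eta> * (?n w)\<^sup>2 \<le> Im s" unfolding L2_set_sq w_def s_def by (rule dissipative_energy_adj[OF T G])
 have s0: "0 \<le> Im s" using e1 \<eta> by (meson mult_nonneg_nonneg order_less_imp_le order_trans zero_le_power2)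
 have "2 * (?n v * ?n w) \<le> (?n v)\<^sup>2 + (?n w)\<^sup>2" using sum_squares_bound[of "?n v" "?n w"] by simp
 \<comment> \<open>Both \<eta> |v|^2 and \<eta> |w|^2 are at most Im s, and the product of the norms
   is at most the mean of the squares.\<close>
 then have vw: "\<eta> * (?n v * ?n w) \<le> Im s" using e1 e2 \<eta> by (smt (verit) distrib_left mult_left_mono mult.left_commute)
 have "cmod (\<Sum>i<d. v i * cnj (w i)) \<le> ?n v * ?n w"
  using norm_sum_mult_le_L2[of v "\<lambda>i. cnj (w i)" "{..<d}"] by simp
 also have "\<dots> \<le> Im s / \<eta>" using vw \<eta> by (simp add: pos_le_divide_eq mult.commute)
 finally have vw2: "cmod (\<Sum>i<d. v i * cnj (w i)) \<le> Im s / \<eta>" .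
 have "cmod D \<le> 1 / \<eta>"
 proof (cases "\<tau> = 0 \<or> Im s = 0")
  case True
  then have "D * (1 - \<tau> * s) = 0" "\<tau> * s = 0 \<or> True" using D2 vw2 by auto
  show ?thesis
  proof (cases "\<tau> = 0")
   case True then show ?thesis using D \<eta> by simp
  next
   case False
   then have i0: "Im s = 0" using True by simp
   have "(?n w)\<^sup>2 \<le> 0" using e2 \<eta> i0 by (simp add: mult_le_0_iff)
   then have "?n w = 0" by simp
   then have "\<forall>i<d. w i = 0" by (subst (asm) L2_set_eq_0_iff) auto
   then have "D = 0" unfolding D by simp
   then show ?thesis using \<eta> by simp
  qed
 next
  case False
  then have t: "\<tau> \<noteq> 0" and sp: "0 < Im s" using s0 by auto
  \<comment> \<open>The point 1 / \<tau> lies in the closed lower half-plane and s in the open upper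
    one, so their distance is at least Im s.\<close>
  have "Im (1 / \<tau>) \<le> 0" using \<tau> by (simp add: Im_divide divide_nonpos_nonneg)
  then have "Im s \<le> \<bar>Im (1 / \<tau> - s)\<bar>" using sp by simp
  also have "\<dots> \<le> cmod (1 / \<tau> - s)" by (rule abs_Im_le_cmod)
  finally have "cmod \<tau> * Im s \<le> cmod \<tau> * cmod (1 / \<tau> - s)" by (intro mult_left_mono) auto
  also have "\<dots> = cmod (1 - \<tau> * s)" unfolding norm_mult[symmetric] using t by (simp add: algebra_simps)
  finally have lo: "cmod \<tau> * Im s \<le> cmod (1 - \<tau> * s)" .
  have "cmod D * (cmod \<tau> * Im s) \<le> cmod D * cmod (1 - \<tau> * s)" using lo by (intro mult_left_mono) auto
  also have "\<dots> = cmod \<tau> * cmod (\<Sum>i<d. v i * cnj (w i))" using D2 by (metis norm_mult)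
  also have "\<dots> \<le> cmod \<tau> * (Im s / \<eta>)" using vw2 by (intro mult_left_mono) auto
  finally have "cmod D * (cmod \<tau> * Im s) \<le> (1 / \<eta>) * (cmod \<tau> * Im s)" by (simp add: mult_ac)
  moreover have "0 < cmod \<tau> * Im s" using t sp by simp
  ultimately show ?thesis by (rule mult_right_le_imp_le)
 qed
 then show "cmod ((\<Sum>i<d. finv d T' i i) - (\<Sum>i<d. finv d T i i)) \<le> 1 / \<eta>"
  by (simp add: D_def G_def H_def)
qed

definition rank_update :: "nat => mat_fun => mat_fun => (nat => complex) => mat_fun" where
 "rank_update m T c \<phi> i j = T i j - (\<Sum>k<m. \<phi> k * c k i * cnj (c k j))"

lemma dissipative_rank_update:
 assumes T: "dissipative \<eta> d T" and "\<And>k. k < m ==> 0 \<le> Im (\<phi> k)"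
 shows "dissipative \<eta> d (rank_update m T c \<phi>)"
 unfolding dissipative_def
proof
 fix v
 have "(\<Sum>i<d. \<Sum>j<d. cnj (v i) * (\<Sum>k<m. \<phi> k * c k i * cnj (c k j)) * v j)
   = (\<Sum>i<d. \<Sum>j<d. \<Sum>k<m. \<phi> k * ((cnj (v i) * c k i) * (cnj (c k j) * v j)))"
  by (simp add: sum_distrib_left sum_distrib_right mult_ac)
 also have "\<dots> = (\<Sum>i<d. \<Sum>k<m. \<Sum>j<d. \<phi> k * ((cnj (v i) * c k i) * (cnj (c k j) * v j)))"
  by (intro sum.cong refl sum.swap)
 also have "\<dots> = (\<Sum>k<m. \<Sum>i<d. \<Sum>j<d. \<phi> k * ((cnj (v i) * c k i) * (cnj (c k j) * v j)))"
  by (rule sum.swap)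
 also have "\<dots> = (\<Sum>k<m. \<phi> k * ((\<Sum>i<d. cnj (v i) * c k i) * cnj (\<Sum>i<d. cnj (v i) * c k i)))"
  by (simp add: sum_product sum_distrib_left mult_ac)
 also have "\<dots> = (\<Sum>k<m. \<phi> k * of_real ((cmod (\<Sum>i<d. cnj (v i) * c k i))\<^sup>2))"
  by (simp only: complex_norm_square)
 finally have e: "(\<Sum>i<d. \<Sum>j<d. cnj (v i) * (\<Sum>k<m. \<phi> k * c k i * cnj (c k j)) * v j)
   = (\<Sum>k<m. \<phi> k * of_real ((cmod (\<Sum>i<d. cnj (v i) * c k i))\<^sup>2))" .
 have "Im (\<Sum>k<m. \<phi> k * of_real ((cmod (\<Sum>i<d. cnj (v i) * c k i))\<^sup>2)) = (\<Sum>k<m. Im (\<phi> k) * (cmod (\<Sum>i<d. cnj (v i) * c k i))\<^sup>2)"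
  unfolding Im_sum by (intro sum.cong refl) (simp del: of_real_power)
 also have "\<dots> \<ge> 0" using assms(2) by (intro sum_nonneg) auto
 finally have p: "0 \<le> Im (\<Sum>i<d. \<Sum>j<d. cnj (v i) * (\<Sum>k<m. \<phi> k * c k i * cnj (c k j)) * v j)"
  unfolding e .
 have "(\<Sum>i<d. \<Sum>j<d. cnj (v i) * rank_update m T c \<phi> i j * v j) = (\<Sum>i<d. \<Sum>j<d. cnj (v i) * T i j * v j)
   - (\<Sum>i<d. \<Sum>j<d. cnj (v i) * (\<Sum>k<m. \<phi> k * c k i * cnj (c k j)) * v j)"
  unfolding rank_update_def by (simp only: right_diff_distrib left_diff_distrib sum_subtractf)
 then have "Im (\<Sum>i<d. \<Sum>j<d. cnj (v i) * rank_update m T c \<phi> i j * v j) = Im (\<Sum>i<d. \<Sum>j<d. cnj (v i) * T i j * v j)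
   - Im (\<Sum>i<d. \<Sum>j<d. cnj (v i) * (\<Sum>k<m. \<phi> k * c k i * cnj (c k j)) * v j)"
  by (simp only: minus_complex.sel)
 then show "Im (\<Sum>i<d. \<Sum>j<d. cnj (v i) * rank_update m T c \<phi> i j * v j) \<le> - \<eta> * (\<Sum>i<d. (cmod (v i))\<^sup>2)"
  using p T[unfolded dissipative_def, rule_format, of v] by linarith
qed

lemma rank_update_upd:
 assumes "k < m"
 shows "rank_update m T c (\<phi>(k := x)) i j = rank_update m T c \<phi> i j - (x - \<phi> k) * c k i * cnj (c k j)"
proof -
 have "(\<Sum>l<m. (\<phi>(k := x)) l * c l i * cnj (c l j)) - (\<Sum>l<m. \<phi> l * c l i * cnj (c l j))
   = (\<Sum>l<m. if l = k then (x - \<phi> k) * c k i * cnj (c k j) else 0)"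
  unfolding sum_subtractf[symmetric] by (intro sum.cong refl) (auto simp: algebra_simps)
 also have "\<dots> = (x - \<phi> k) * c k i * cnj (c k j)" using assms by simp
 finally show ?thesis unfolding rank_update_def by (simp add: algebra_simps)
qed

text \<open>The coefficients are exchanged one at a time, each exchange being a rank-one update.
  Where the change is small the perturbation bound applies, elsewhere the bound that ignores the
  size of the coefficients; \<open>b\<close> records which.\<close>

lemma rank_update_trace:
 assumes T: "dissipative \<eta> d T" and \<eta>: "0 < \<eta>"
  and \<phi>: "\<And>k. 0 \<le> Im (\<phi> k)" and \<psi>: "\<And>k. 0 \<le> Im (\<psi> k)"
  and b: "\<And>k. k < m ==> b k = 2 / \<eta> \<or> cmod (\<psi> k - \<phi> k) * (\<Sum>i<d. (cmod (c k i))\<^sup>2) / \<eta>\<^sup>2 \<le> b k"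
 shows "cmod ((\<Sum>i<d. finv d (rank_update m T c \<psi>) i i) - (\<Sum>i<d. finv d (rank_update m T c \<phi>) i i)) \<le> (\<Sum>k<m. b k)"
proof -
 let ?tr = "\<lambda>\<phi>. \<Sum>i<d. finv d (rank_update m T c \<phi>) i i"
 define \<zeta> where "\<zeta> l k = (if k < l then \<psi> k else \<phi> k)" for l k
 have \<zeta>: "0 \<le> Im (\<zeta> l k)" for l k using \<phi> \<psi> by (simp add: \<zeta>_def)
 have dis: "dissipative \<eta> d (rank_update m T c f)" if "\<And>k. 0 \<le> Im (f k)" for f
  by (rule dissipative_rank_update[OF T]) (use that in auto)
 have step: "cmod (?tr (\<zeta> (Suc l)) - ?tr (\<zeta> l)) \<le> b l" if l: "l < m" for l
 proof -
  have S: "\<zeta> (Suc l) = (\<zeta> l)(l := \<psi> l)" and S0: "\<zeta> l l = \<phi> l" by (auto simp: \<zeta>_def fun_eq_iff)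
  show ?thesis
  proof (cases "b l = 2 / \<eta>")
   case False
   then have "cmod (\<psi> l - \<phi> l) * (\<Sum>i<d. (cmod (c l i))\<^sup>2) / \<eta>\<^sup>2 \<le> b l" using b[OF l] by blast
   moreover have "cmod (?tr (\<zeta> (Suc l)) - ?tr (\<zeta> l)) \<le> cmod (\<psi> l - \<phi> l) * (\<Sum>i<d. (cmod (c l i))\<^sup>2) / \<eta>\<^sup>2"
    by (rule rank_one_trace(1)[OF dis[OF \<zeta>] dis[OF \<zeta>] \<eta>]) (simp only: S S0 rank_update_upd[OF l])
   ultimately show ?thesis by linarith
  next
   case True
   \<comment> \<open>The difference \<open>\<psi> l - \<phi> l\<close> may have negative imaginary
     part. So the size-free bound is applied twice, from the coefficient 0 to each of the two
     values; hence 2 / \<eta>.\<close>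
   define o0 where "o0 = (\<zeta> l)(l := 0)"
   have o0: "0 \<le> Im (o0 k)" for k using \<zeta> by (simp add: o0_def)
   have o0l: "o0 l = 0" by (simp add: o0_def)
   have z1: "\<zeta> (Suc l) = o0(l := \<psi> l)" by (simp add: S o0_def)
   have z2: "\<zeta> l = o0(l := \<phi> l)" unfolding o0_def S0[symmetric] by (simp only: fun_upd_upd fun_upd_triv)
   have 1: "cmod (?tr (\<zeta> (Suc l)) - ?tr o0) \<le> 1 / \<eta>" unfolding z1
    by (rule rank_one_trace(2)[where \<tau> = "\<psi> l" and c = "c l", OF dis[OF o0] dis \<eta> _ \<psi>])
      (simp_all only: rank_update_upd[OF l] o0l diff_zero, simp add: o0 \<psi>)
   have 2: "cmod (?tr (\<zeta> l) - ?tr o0) \<le> 1 / \<eta>" unfolding z2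
    by (rule rank_one_trace(2)[where \<tau> = "\<phi> l" and c = "c l", OF dis[OF o0] dis \<eta> _ \<phi>])
      (simp_all only: rank_update_upd[OF l] o0l diff_zero, simp add: o0 \<phi>)
   have e: "?tr (\<zeta> (Suc l)) - ?tr (\<zeta> l) = (?tr (\<zeta> (Suc l)) - ?tr o0) - (?tr (\<zeta> l) - ?tr o0)" by simp
   have "cmod (?tr (\<zeta> (Suc l)) - ?tr (\<zeta> l)) \<le> cmod (?tr (\<zeta> (Suc l)) - ?tr o0) + cmod (?tr (\<zeta> l) - ?tr o0)"
    by (subst e) (rule norm_triangle_ineq4)
   also have "\<dots> \<le> 1 / \<eta> + 1 / \<eta>" by (intro add_mono 1 2)
   finally have "cmod (?tr (\<zeta> (Suc l)) - ?tr (\<zeta> l)) \<le> 1 / \<eta> + 1 / \<eta>" .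
   then show ?thesis using True by simp
  qed
 qed
 have "cmod (?tr (\<zeta> l) - ?tr (\<zeta> 0)) \<le> (\<Sum>k<l. b k)" if "l \<le> m" for l
  using that
 proof (induction l)
  case (Suc l)
  have e: "?tr (\<zeta> (Suc l)) - ?tr (\<zeta> 0) = (?tr (\<zeta> (Suc l)) - ?tr (\<zeta> l)) + (?tr (\<zeta> l) - ?tr (\<zeta> 0))" by simp
  have "cmod (?tr (\<zeta> (Suc l)) - ?tr (\<zeta> 0)) \<le> cmod (?tr (\<zeta> (Suc l)) - ?tr (\<zeta> l)) + cmod (?tr (\<zeta> l) - ?tr (\<zeta> 0))"
   by (subst e) (rule norm_triangle_ineq)
  then show ?case using Suc step[of l] by simp
 qed simp
 from this[of m] have "cmod (?tr (\<zeta> m) - ?tr (\<zeta> 0)) \<le> (\<Sum>k<m. b k)" by simp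
 moreover have "\<zeta> 0 = \<phi>" by (simp add: \<zeta>_def fun_eq_iff)
 moreover have "rank_update m T c (\<zeta> m) = rank_update m T c \<psi>"
  by (simp add: rank_update_def \<zeta>_def fun_eq_iff)
 ultimately show ?thesis by simp
qed

definition block_fun :: "nat => mat_fun => mat_fun => mat_fun => mat_fun" where
 "block_fun d A B C i j = (if i < d then if j < d then A i j else B i (j - d)
   else if j < d then cnj (B j (i - d)) else C (i - d) (j - d))"

definition schur_fun :: "nat => mat_fun => mat_fun => mat_fun => mat_fun" where
 "schur_fun d A B C i j = C i j - (\<Sum>a<d. \<Sum>b<d. cnj (B a i) * finv d A a b * B b j)"

lemma herm_block_fun:
 assumes "herm d A" "herm e C" shows "herm (d + e) (block_fun d A B C)"
 unfolding herm_def
proof (intro allI impI)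
 fix i j assume ij: "i < d + e" "j < d + e"
 show "block_fun d A B C i j = cnj (block_fun d A B C j i)"
 proof (cases "i < d"; cases "j < d")
  assume "i < d" "j < d"
  moreover from this have "A i j = cnj (A j i)" using assms(1) unfolding herm_def by blast
  ultimately show ?thesis by (simp add: block_fun_def)
 next
  assume a: "\<not> i < d" "\<not> j < d"
  then have "i - d < e" "j - d < e" using ij by auto
  then have "C (i - d) (j - d) = cnj (C (j - d) (i - d))" using assms(2) unfolding herm_def by blast
  then show ?thesis using a by (simp add: block_fun_def)
 qed (auto simp: block_fun_def)
qed

text \<open>If f k were 0, column k of U would lie in the kernel of A.\<close>

lemma inv_pair_spectrum_nz:
 assumes "inv_pair d A Ai" "unitary_fun d U" "\<And>i j. i < d ==> j < d ==> A i j = udiag d U f i j" "k < d"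
 shows "f k \<noteq> 0"
proof
 assume f0: "f k = 0"
 have AU: "(\<Sum>j<d. A i j * U j k) = 0" if i: "i < d" for i
 proof -
  have "(\<Sum>j<d. A i j * U j k) = (\<Sum>j<d. \<Sum>l<d. U i l * f l * (cnj (U j l) * U j k))"
   using assms(3) i by (intro sum.cong refl) (simp add: udiag_def sum_distrib_right mult.assoc)
  also have "\<dots> = (\<Sum>l<d. U i l * f l * (\<Sum>j<d. cnj (U j l) * U j k))"
   by (subst sum.swap) (simp add: sum_distrib_left)
  also have "\<dots> = (\<Sum>l<d. if l = k then U i l * f l else 0)"
   using assms(2,4) by (intro sum.cong) (auto simp: unitary_fun_def)
  also have "\<dots> = 0" using f0 by (intro sum.neutral) auto
  finally show ?thesis .
 qed
 have "U i k = 0" if i: "i < d" for i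
 proof -
  have "U i k = (\<Sum>l<d. (if i = l then 1 else 0) * U l k)" using sum_of_bool_mult[OF i] by simp
  also have "\<dots> = (\<Sum>l<d. (\<Sum>j<d. Ai i j * A j l) * U l k)"
   using assms(1) i by (intro sum.cong) (auto simp: inv_pair_def)
  also have "\<dots> = (\<Sum>j<d. Ai i j * (\<Sum>l<d. A j l * U l k))"
   unfolding sum_distrib_left sum_distrib_right by (subst sum.swap) (simp add: mult.assoc)
  also have "\<dots> = 0" using AU by simp
  finally show ?thesis .
 qed
 then have "(\<Sum>i<d. cnj (U i k) * U i k) = 0" by simp
 then show False using assms(2,4) by (simp add: unitary_fun_def)
qed

text \<open>In an eigenbasis of A the Schur complements of A and of A - \<i>\<epsilon> are both C
  minus a sum of terms \<phi> k c_k c_k^H, where c_k = B^H u_k and \<phi> k is 1 / lam k or 1 / (lam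
  k - \<i>\<epsilon>). For |lam k| > \<delta> the coefficients differ by at most \<epsilon> /
  \<delta>^2. Every other k costs at most 2 / Im z by the size-free bound, and such k are counted by
  the imaginary part of the trace of the resolvent of A at \<i>\<delta>. The norm of the inverse of
  A does not enter.\<close>

lemma schur_trace_compare:
 assumes A: "herm d A" and C: "herm e C" and Ai: "inv_pair d A (finv d A)"
  and z: "0 < Im z" and \<epsilon>: "0 < \<epsilon>" and \<delta>: "0 < \<delta>"
 shows "herm e (schur_fun d A B C)"
  and "cmod ((\<Sum>i<e. finv e (shiftd (schur_fun d A B C) (\<lambda>_. z)) i i)
    - (\<Sum>i<e. finv (d + e) (shiftd (block_fun d A B C) (\<lambda>i. if i < d then \<i> * of_real \<epsilon> else z)) (d + i) (d + i)))
   \<le> 4 * \<delta> * Im (\<Sum>i<d. finv d (shiftd A (\<lambda>_. \<i> * of_real \<delta>)) i i) / Im z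
    + \<epsilon> / \<delta>\<^sup>2 * (\<Sum>a<d. \<Sum>i<e. (cmod (B a i))\<^sup>2) / (Im z)\<^sup>2" (is "cmod (?s - ?g) \<le> ?b")
proof -
 obtain U lam where U: "unitary_fun d U"
  and AU: "\<And>i j. i < d ==> j < d ==> A i j = udiag d U (\<lambda>k. complex_of_real (lam k)) i j"
  using spectral_theorem[OF A] by blast
 have lam0: "lam k \<noteq> 0" if "k < d" for k
  using inv_pair_spectrum_nz[OF Ai U AU that] by auto
 define c where "c k i = (\<Sum>a<d. cnj (B a i) * U a k)" for k i
 have sum_c: "(\<Sum>a<d. \<Sum>b<d. cnj (B a i) * udiag d U \<phi> a b * B b j) = (\<Sum>k<d. \<phi> k * c k i * cnj (c k j))" for \<phi> i j
 proof -
  have "(\<Sum>a<d. \<Sum>b<d. cnj (B a i) * udiag d U \<phi> a b * B b j)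
    = (\<Sum>a<d. \<Sum>b<d. \<Sum>k<d. \<phi> k * (cnj (B a i) * U a k) * (cnj (U b k) * B b j))"
   by (simp add: udiag_def sum_distrib_left sum_distrib_right mult_ac)
  also have "\<dots> = (\<Sum>a<d. \<Sum>k<d. \<Sum>b<d. \<phi> k * (cnj (B a i) * U a k) * (cnj (U b k) * B b j))"
   by (intro sum.cong refl sum.swap)
  also have "\<dots> = (\<Sum>k<d. \<Sum>a<d. \<Sum>b<d. \<phi> k * (cnj (B a i) * U a k) * (cnj (U b k) * B b j))"
   by (rule sum.swap)
  also have "\<dots> = (\<Sum>k<d. \<phi> k * (\<Sum>a<d. cnj (B a i) * U a k) * (\<Sum>b<d. cnj (U b k) * B b j))"
   by (intro sum.cong refl) ((simp only: mult.assoc sum_product)?, simp only: sum_distrib_left mult.assoc)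
  finally show ?thesis by (simp add: c_def mult.commute)
 qed
 define w where "w = \<i> * complex_of_real \<epsilon>"
 have nz: "complex_of_real (lam k) - w \<noteq> 0" for k using \<epsilon> by (auto simp: w_def complex_eq_iff)
 have invA: "finv d A a b = udiag d U (\<lambda>k. 1 / complex_of_real (lam k)) a b" if "a < d" "b < d" for a b
  by (rule inv_pair_unique[OF udiag_inv_pair[OF U _ AU] that]) (use lam0 in auto)
 have Aw: "inv_pair d (shiftd A (\<lambda>_. w)) (udiag d U (\<lambda>k. 1 / (complex_of_real (lam k) - w)))"
  by (rule udiag_inv_pair[OF U nz]) (simp add: udiag_shiftd[OF U AU])
 define \<phi> where "\<phi> k = (if k < d then 1 / complex_of_real (lam k) else 0)" for k
 define \<psi> where "\<psi> k = (if k < d then 1 / (complex_of_real (lam k) - w) else 0)" for k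
 have S0: "schur_fun d A B C i j = C i j - (\<Sum>k<d. \<phi> k * c k i * cnj (c k j))" for i j
  unfolding schur_fun_def sum_c[symmetric]
  by (intro arg_cong2[of _ _ _ _ minus] refl sum.cong) (auto simp: invA udiag_def \<phi>_def intro!: sum.cong)
 show hS: "herm e (schur_fun d A B C)"
  unfolding herm_def
 proof (intro allI impI)
  fix i j assume "i < e" "j < e"
  then have "C i j = cnj (C j i)" using C unfolding herm_def by blast
  then have "schur_fun d A B C i j = cnj (C j i) - (\<Sum>k<d. \<phi> k * c k i * cnj (c k j))" unfolding S0 by (simp only:)
  also have "\<dots> = cnj (schur_fun d A B C j i)" unfolding S0 by (simp add: \<phi>_def mult_ac)
  finally show "schur_fun d A B C i j = cnj (schur_fun d A B C j i)" .
 qed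
 define T where "T = shiftd C (\<lambda>_. z)"
 have dT: "dissipative (Im z) e T" unfolding T_def by (rule dissipative_shiftd[OF C]) simp
 have 1: "shiftd (schur_fun d A B C) (\<lambda>_. z) = rank_update d T c \<phi>"
  by (auto simp: fun_eq_iff shiftd_def S0 rank_update_def T_def)
 define Z where "Z i = (if i < d then w else z)" for i
 have Zeq: "Z = (\<lambda>i. if i < d then \<i> * of_real \<epsilon> else z)" by (simp add: Z_def w_def fun_eq_iff)
 define M where "M = shiftd (block_fun d A B C) Z"
 have dM: "dissipative (min \<epsilon> (Im z)) (d + e) M" unfolding M_def
  by (rule dissipative_shiftd[OF herm_block_fun[OF A C]]) (auto simp: Z_def w_def)
 have M: "inv_pair (d + e) M (finv (d + e) M)"
  by (rule dissipative_inv[OF dM]) (use \<epsilon> z in simp)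
 have Aw': "inv_pair d M (udiag d U (\<lambda>k. 1 / (complex_of_real (lam k) - w)))"
  by (rule inv_pair_cong[OF Aw]) (simp add: M_def shiftd_def block_fun_def Z_def)
 \<comment> \<open>\<open>M\<close> carries the shift \<i>\<epsilon> on its first \<open>d\<close>
   indices and z on the others, so by the block inverse formula its lower right block inverts the
   Schur complement with the coefficients \<psi>.\<close>
 have 2: "finv e (rank_update d T c \<psi>) i j = finv (d + e) M (d + i) (d + j)" if "i < e" "j < e" for i j
 proof (rule block_inverse[OF M Aw' that])
  fix i j
  have "(\<Sum>a<d. \<Sum>b<d. M (d + i) a * udiag d U (\<lambda>k. 1 / (complex_of_real (lam k) - w)) a b * M b (d + j))
    = (\<Sum>a<d. \<Sum>b<d. cnj (B a i) * udiag d U \<psi> a b * B b j)"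
   by (intro sum.cong refl) (auto simp: M_def shiftd_def block_fun_def udiag_def \<psi>_def intro!: sum.cong)
  moreover have "M (d + i) (d + j) = T i j" by (simp add: M_def T_def shiftd_def block_fun_def Z_def)
  ultimately show "rank_update d T c \<psi> i j = M (d + i) (d + j)
    - (\<Sum>a<d. \<Sum>b<d. M (d + i) a * udiag d U (\<lambda>k. 1 / (complex_of_real (lam k) - w)) a b * M b (d + j))"
   by (simp add: sum_c rank_update_def)
 qed
 define N where "N k = (\<Sum>i<e. (cmod (c k i))\<^sup>2)" for k
 define b where "b k = (if \<bar>lam k\<bar> \<le> \<delta> then 2 / Im z else \<epsilon> / \<delta>\<^sup>2 * N k / (Im z)\<^sup>2)" for k
 have N0: "0 \<le> N k" for k by (simp add: N_def sum_nonneg)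
 have small: "cmod (\<psi> k - \<phi> k) \<le> \<epsilon> / \<delta>\<^sup>2" if k: "k < d" "\<not> \<bar>lam k\<bar> \<le> \<delta>" for k
 proof -
  have "\<psi> k - \<phi> k = w / ((complex_of_real (lam k) - w) * complex_of_real (lam k))"
   using k nz[of k] lam0[OF k(1)] by (simp add: \<psi>_def \<phi>_def field_simps)
  also have "cmod \<dots> = \<epsilon> / (cmod (complex_of_real (lam k) - w) * \<bar>lam k\<bar>)"
   using \<epsilon> by (simp add: norm_divide norm_mult w_def)
  also have "\<dots> \<le> \<epsilon> / (\<delta> * \<delta>)"
  proof (rule divide_left_mono)
   have "\<bar>lam k\<bar> \<le> cmod (complex_of_real (lam k) - w)"
    using abs_Re_le_cmod[of "complex_of_real (lam k) - w"] by (simp add: w_def)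
   then show "\<delta> * \<delta> \<le> cmod (complex_of_real (lam k) - w) * \<bar>lam k\<bar>"
    using k \<delta> by (intro mult_mono) auto
   then show "0 < cmod (complex_of_real (lam k) - w) * \<bar>lam k\<bar> * (\<delta> * \<delta>)"
    using \<delta> by (smt (verit) mult_pos_pos)
  qed (use \<epsilon> in auto)
  finally show ?thesis by (simp add: power2_eq_square)
 qed
 have "cmod ((\<Sum>i<e. finv e (rank_update d T c \<psi>) i i) - (\<Sum>i<e. finv e (rank_update d T c \<phi>) i i)) \<le> (\<Sum>k<d. b k)"
 proof (rule rank_update_trace[OF dT z])
  show "0 \<le> Im (\<phi> k)" for k by (simp add: \<phi>_def Im_divide)
  show "0 \<le> Im (\<psi> k)" for k using \<epsilon> by (simp add: \<psi>_def Im_divide w_def)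
  show "b k = 2 / Im z \<or> cmod (\<psi> k - \<phi> k) * (\<Sum>i<e. (cmod (c k i))\<^sup>2) / (Im z)\<^sup>2 \<le> b k" if "k < d" for k
  proof (cases "\<bar>lam k\<bar> \<le> \<delta>")
   case False
   have "cmod (\<psi> k - \<phi> k) * N k / (Im z)\<^sup>2 \<le> \<epsilon> / \<delta>\<^sup>2 * N k / (Im z)\<^sup>2"
    using small[OF that False] N0[of k] by (intro divide_right_mono mult_right_mono) auto
   then show ?thesis using False unfolding b_def N_def[symmetric] by simp
  qed (simp add: b_def)
 qed
 also have "(\<Sum>k<d. b k) \<le> (\<Sum>k<d. 4 * \<delta> * Im (1 / (complex_of_real (lam k) - \<i> * of_real \<delta>)) / Im z + \<epsilon> / \<delta>\<^sup>2 * N k / (Im z)\<^sup>2)"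
 proof (rule sum_mono)
  fix k
  \<comment> \<open>This is at least 1 / (2 \<delta>) when |lam k| <= \<delta>, so 4 \<delta> times
    it dominates the 2 in the cost 2 / Im z of an exceptional index.\<close>
  have im: "Im (1 / (complex_of_real (lam k) - \<i> * of_real \<delta>)) = \<delta> / ((lam k)\<^sup>2 + \<delta>\<^sup>2)"
   by (simp add: Im_divide)
  have p: "0 \<le> \<epsilon> / \<delta>\<^sup>2 * N k / (Im z)\<^sup>2" using \<epsilon> N0[of k] by simp
  show "b k \<le> 4 * \<delta> * Im (1 / (complex_of_real (lam k) - \<i> * of_real \<delta>)) / Im z + \<epsilon> / \<delta>\<^sup>2 * N k / (Im z)\<^sup>2"
  proof (cases "\<bar>lam k\<bar> \<le> \<delta>")
   case True
   then have "(lam k)\<^sup>2 \<le> \<delta>\<^sup>2" using \<delta> by (metis abs_le_square_iff abs_of_pos)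
   then have "2 * ((lam k)\<^sup>2 + \<delta>\<^sup>2) \<le> 4 * \<delta> * \<delta>" by (simp add: power2_eq_square)
   moreover have "0 < (lam k)\<^sup>2 + \<delta>\<^sup>2" using \<delta> by (simp add: add_nonneg_pos)
   ultimately have "2 \<le> 4 * \<delta> * (\<delta> / ((lam k)\<^sup>2 + \<delta>\<^sup>2))" by (simp add: pos_le_divide_eq)
   then have "2 / Im z \<le> 4 * \<delta> * (\<delta> / ((lam k)\<^sup>2 + \<delta>\<^sup>2)) / Im z" using z by (intro divide_right_mono) auto
   then show ?thesis using p True unfolding im b_def by simp
  next
   case False
   have "0 \<le> 4 * \<delta> * (\<delta> / ((lam k)\<^sup>2 + \<delta>\<^sup>2)) / Im z" using \<delta> z by simp
   then show ?thesis using False unfolding im b_def by simp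
  qed
 qed
 also have "\<dots> = 4 * \<delta> * Im (\<Sum>k<d. 1 / (complex_of_real (lam k) - \<i> * of_real \<delta>)) / Im z + \<epsilon> / \<delta>\<^sup>2 * (\<Sum>k<d. N k) / (Im z)\<^sup>2"
  by (simp only: sum.distrib Im_sum sum_distrib_left sum_divide_distrib)
 also have "(\<Sum>k<d. 1 / (complex_of_real (lam k) - \<i> * of_real \<delta>)) = (\<Sum>i<d. finv d (shiftd A (\<lambda>_. \<i> * of_real \<delta>)) i i)"
 proof -
  have nz: "complex_of_real (lam k) - \<i> * of_real \<delta> \<noteq> 0" for k using \<delta> by (auto simp: complex_eq_iff)
  have "inv_pair d (shiftd A (\<lambda>_. \<i> * of_real \<delta>)) (udiag d U (\<lambda>k. 1 / (complex_of_real (lam k) - \<i> * of_real \<delta>)))"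
   by (rule udiag_inv_pair[OF U nz]) (simp add: udiag_shiftd[OF U AU])
  then have "(\<Sum>i<d. finv d (shiftd A (\<lambda>_. \<i> * of_real \<delta>)) i i) = (\<Sum>i<d. udiag d U (\<lambda>k. 1 / (complex_of_real (lam k) - \<i> * of_real \<delta>)) i i)"
   by (intro sum.cong refl inv_pair_unique) auto
  then show ?thesis by (simp add: udiag_trace[OF U])
 qed
 \<comment> \<open>The eigenvectors form an orthonormal basis, so the squared norms of the c_k add
   up to the squared Frobenius norm of B; this is the functional calculus of the constant 1.\<close>
 also have "(\<Sum>k<d. N k) = (\<Sum>a<d. \<Sum>i<e. (cmod (B a i))\<^sup>2)"
 proof -
  have "complex_of_real (\<Sum>k<d. N k) = (\<Sum>k<d. \<Sum>i<e. 1 * c k i * cnj (c k i))"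
   by (simp add: N_def complex_norm_square del: of_real_power)
  also have "\<dots> = (\<Sum>i<e. \<Sum>k<d. 1 * c k i * cnj (c k i))" by (rule sum.swap)
  also have "\<dots> = (\<Sum>i<e. \<Sum>a<d. \<Sum>b<d. cnj (B a i) * udiag d U (\<lambda>_. 1) a b * B b i)"
   by (simp only: sum_c)
  also have "\<dots> = (\<Sum>i<e. \<Sum>a<d. cnj (B a i) * B a i)"
  proof (intro sum.cong refl)
   fix i a assume "a \<in> {..<d}"
   then have "(\<Sum>b<d. cnj (B a i) * udiag d U (\<lambda>_. 1) a b * B b i) = (\<Sum>b<d. (if a = b then 1 else 0) * (cnj (B a i) * B b i))"
    by (intro sum.cong refl) (simp add: udiag_const[OF U])
   also have "\<dots> = cnj (B a i) * B a i" using \<open>a \<in> {..<d}\<close> by (intro sum_of_bool_mult) auto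
   finally show "(\<Sum>b<d. cnj (B a i) * udiag d U (\<lambda>_. 1) a b * B b i) = cnj (B a i) * B a i" .
  qed
  also have "\<dots> = (\<Sum>a<d. \<Sum>i<e. cnj (B a i) * B a i)" by (rule sum.swap)
  also have "\<dots> = complex_of_real (\<Sum>a<d. \<Sum>i<e. (cmod (B a i))\<^sup>2)"
   by (simp add: complex_norm_square mult.commute del: of_real_power)
  finally show ?thesis by (simp only: of_real_eq_iff)
 qed
 finally have bound: "cmod ((\<Sum>i<e. finv e (rank_update d T c \<psi>) i i) - (\<Sum>i<e. finv e (rank_update d T c \<phi>) i i))
   \<le> 4 * \<delta> * Im (\<Sum>i<d. finv d (shiftd A (\<lambda>_. \<i> * of_real \<delta>)) i i) / Im z
    + \<epsilon> / \<delta>\<^sup>2 * (\<Sum>a<d. \<Sum>i<e. (cmod (B a i))\<^sup>2) / (Im z)\<^sup>2" .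
 have "(\<Sum>i<e. finv e (rank_update d T c \<psi>) i i) = (\<Sum>i<e. finv (d + e) M (d + i) (d + i))"
  by (intro sum.cong refl 2) auto
 then show "cmod (?s - ?g) \<le> ?b"
  using bound unfolding 1 M_def Zeq by (simp only: norm_minus_commute)
qed

section \<open>Convergence of Stieltjes transforms\<close>

text \<open>The uniform closure of the span of constants and resolvents. With the limit rule built
  in, any property stable under sums, multiples and uniform limits follows by rule induction;
  closure under products is proved below.\<close>

inductive_set resolvent_alg :: "(real => complex) set" where
 const: "(\<lambda>_. c) \<in> resolvent_alg"
| res: "Im z \<noteq> 0 ==> (\<lambda>x. 1 / (of_real x - z)) \<in> resolvent_alg"
| add: "f \<in> resolvent_alg ==> g \<in> resolvent_alg ==> (\<lambda>x. f x + g x) \<in> resolvent_alg"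
| scale: "f \<in> resolvent_alg ==> (\<lambda>x. c * f x) \<in> resolvent_alg"
| limit: "(\<forall>e>0. \<exists>g. g \<in> resolvent_alg \<and> (\<forall>x. cmod (f x - g x) \<le> e)) ==> f \<in> resolvent_alg"

lemma norm_resolvent_le: "cmod (1 / (of_real x - z)) \<le> 1 / \<bar>Im z\<bar>" if "Im z \<noteq> 0"
proof -
 have "\<bar>Im z\<bar> \<le> cmod (of_real x - z)"
  using abs_Im_le_cmod[of "of_real x - z"] by simp
 then show ?thesis using that by (simp add: norm_divide frac_le)
qed

lemma resolvent_alg_bounded: "f \<in> resolvent_alg ==> \<exists>B>0. \<forall>x. cmod (f x) \<le> B"
proof (induction rule: resolvent_alg.induct)
 case (const c)
 show ?case by (intro exI[of _ "cmod c + 1"]) (auto intro: add_nonneg_pos)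
next
 case (res z)
 then show ?case using norm_resolvent_le[of z] by (intro exI[of _ "1 / \<bar>Im z\<bar>"]) auto
next
 case (add f g)
 then obtain B C where "B > 0" "\<And>x. cmod (f x) \<le> B" "C > 0" "\<And>x. cmod (g x) \<le> C" by blast
 then show ?case by (intro exI[of _ "B + C"]) (auto intro: norm_triangle_mono)
next
 case (scale f c)
 then obtain B where "B > 0" "\<And>x. cmod (f x) \<le> B" by blast
 then show ?case
  by (intro exI[of _ "(cmod c + 1) * B"]) (auto simp: norm_mult intro!: mult_mono mult_pos_pos add_nonneg_pos)
next
 case (limit f)
 obtain g where "\<forall>x. cmod (f x - g x) \<le> 1" "\<exists>B>0. \<forall>x. cmod (g x) \<le> B"
  using limit[rule_format, of 1] by auto
 then obtain B where g: "\<forall>x. cmod (f x - g x) \<le> 1" "B > 0" "\<forall>x. cmod (g x) \<le> B" by blast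
 have "cmod (f x) \<le> B + 1" for x
  using norm_triangle_ineq[of "f x - g x" "g x"] g(1)[rule_format, of x] g(3)[rule_format, of x] by simp
 then show ?case using g(2) by (intro exI[of _ "B + 1"]) auto
qed

text \<open>Resolvents at two different points multiply by partial fractions. A square is reached as
  the uniform limit of products with a second pole v tending to z.\<close>

lemma resolvent_alg_res_mult:
 assumes z: "Im z \<noteq> 0"
 shows "g \<in> resolvent_alg ==> (\<lambda>x. 1 / (of_real x - z) * g x) \<in> resolvent_alg"
proof (induction rule: resolvent_alg.induct)
 case (const c)
 show ?case using resolvent_alg.scale[OF resolvent_alg.res[OF z], of c] by (simp add: mult.commute)
next
 case (res u)
 have nz: "of_real x - v \<noteq> 0" if "Im v \<noteq> 0" for x v
  using that by (auto simp: complex_eq_iff)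
 have distinct: "(\<lambda>x. 1 / (of_real x - z) * (1 / (of_real x - v))) \<in> resolvent_alg"
  if v: "Im v \<noteq> 0" "v \<noteq> z" for v
 proof -
  have "(\<lambda>x. 1 / (of_real x - z) * (1 / (of_real x - v)))
   = (\<lambda>x. 1 / (z - v) * (1 / (of_real x - z) + (- 1) * (1 / (of_real x - v))))"
   using v nz[OF z] nz[OF v(1)] by (auto simp: fun_eq_iff field_simps)
  then show ?thesis
   using resolvent_alg.scale[OF resolvent_alg.add[OF resolvent_alg.res[OF z] resolvent_alg.scale[OF resolvent_alg.res[OF v(1)], of "-1"]], of "1 / (z - v)"]
   by simp
 qed
 show ?case
 proof (cases "u = z")
  case False
  then show ?thesis using distinct[OF res] by simp
 next
  case True
  show ?thesis unfolding True
  proof (rule resolvent_alg.limit, intro allI impI)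
   fix e :: real assume e: "e > 0"
   \<comment> \<open>The pole v is moved away from the real axis, so |Im v| >= |Im z| and the three
     resolvents in the difference are each at most 1 / |Im z|. With |z - v| = h the difference is at
     most e.\<close>
   define h where "h = e * \<bar>Im z\<bar> ^ 3"
   define v where "v = z + \<i> * of_real (h * sgn (Im z))"
   have h: "h > 0" using e z by (simp add: h_def)
   have Imv: "Im v = Im z + h * sgn (Im z)" by (simp add: v_def)
   have av: "\<bar>Im v\<bar> = \<bar>Im z\<bar> + h" unfolding Imv using h z by (simp add: sgn_if abs_if)
   have v: "Im v \<noteq> 0" "v \<noteq> z" using av h z by (auto simp: v_def sgn_if)
   have b: "cmod (1 / (of_real x - z) * (1 / (of_real x - z)) - 1 / (of_real x - z) * (1 / (of_real x - v))) \<le> e" for x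
   proof -
    have "1 / (of_real x - z) * (1 / (of_real x - z)) - 1 / (of_real x - z) * (1 / (of_real x - v))
      = (z - v) * (1 / (of_real x - z) * (1 / (of_real x - z)) * (1 / (of_real x - v)))"
     using nz[OF z, of x] nz[OF v(1), of x] by (simp add: divide_simps)
    also have "cmod \<dots> \<le> h * (1 / \<bar>Im z\<bar> * (1 / \<bar>Im z\<bar>) * (1 / \<bar>Im z\<bar>))"
     unfolding norm_mult
    proof (intro mult_mono)
     show "cmod (z - v) \<le> h" using h z by (simp add: v_def norm_mult sgn_if)
     show "cmod (1 / (of_real x - v)) \<le> 1 / \<bar>Im z\<bar>"
      using norm_resolvent_le[OF v(1), of x] av h z by (smt (verit) frac_le)
    qed (use norm_resolvent_le[OF z] h in auto)
    also have "\<dots> = e" using z by (simp add: h_def power3_eq_cube field_simps)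
    finally show ?thesis .
   qed
   show "\<exists>g. g \<in> resolvent_alg \<and> (\<forall>x. cmod (1 / (of_real x - z) * (1 / (of_real x - z)) - g x) \<le> e)"
    by (intro exI[of _ "\<lambda>x. 1 / (of_real x - z) * (1 / (of_real x - v))"] conjI allI distinct[OF v] b)
  qed
 qed
next
 case (add f g)
 then show ?case using resolvent_alg.add by (simp add: distrib_left)
next
 case (scale f c)
 show ?case using resolvent_alg.scale[OF scale.IH, of c] by (simp add: mult.left_commute)
next
 case (limit f)
 show ?case
 proof (rule resolvent_alg.limit, intro allI impI)
  fix e :: real assume "e > 0"
  then have "e * \<bar>Im z\<bar> > 0" using z by simp
  then obtain g where g: "(\<lambda>x. 1 / (of_real x - z) * g x) \<in> resolvent_alg" "\<forall>x. cmod (f x - g x) \<le> e * \<bar>Im z\<bar>"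
   using limit by blast
  have b: "cmod (1 / (of_real x - z) * f x - 1 / (of_real x - z) * g x) \<le> e" for x
  proof -
   have "cmod (1 / (of_real x - z) * f x - 1 / (of_real x - z) * g x) = cmod (1 / (of_real x - z)) * cmod (f x - g x)"
    by (simp only: norm_mult[symmetric] right_diff_distrib)
   also have "\<dots> \<le> (1 / \<bar>Im z\<bar>) * (e * \<bar>Im z\<bar>)"
    using g(2) norm_resolvent_le[OF z] by (intro mult_mono) auto
   finally show ?thesis using z by simp
  qed
  show "\<exists>g. g \<in> resolvent_alg \<and> (\<forall>x. cmod (1 / (of_real x - z) * f x - g x) \<le> e)"
   by (intro exI[of _ "\<lambda>x. 1 / (of_real x - z) * g x"] conjI allI g(1) b)
 qed
qed

lemma resolvent_alg_mult:
 assumes g: "g \<in> resolvent_alg"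
 shows "f \<in> resolvent_alg ==> (\<lambda>x. f x * g x) \<in> resolvent_alg"
proof (induction rule: resolvent_alg.induct)
 case (const c) then show ?case using g by (rule resolvent_alg.scale)
next
 case (res z) then show ?case using resolvent_alg_res_mult[OF _ g] by simp
next
 case (add f g) then show ?case using resolvent_alg.add by (simp add: distrib_right)
next
 case (scale f c) then show ?case using resolvent_alg.scale[of _ c] by (simp add: mult.assoc)
next
 case (limit f)
 obtain B where B: "B > 0" "\<And>x. cmod (g x) \<le> B" using resolvent_alg_bounded[OF g] by blast
 show ?case
 proof (rule resolvent_alg.limit, intro allI impI)
  fix e :: real assume "e > 0"
  then have "e / B > 0" using B by simp
  then obtain f' where f': "(\<lambda>x. f' x * g x) \<in> resolvent_alg" "\<forall>x. cmod (f x - f' x) \<le> e / B"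
   using limit by blast
  have b: "cmod (f x * g x - f' x * g x) \<le> e" for x
  proof -
   have "cmod (f x * g x - f' x * g x) = cmod (f x - f' x) * cmod (g x)"
    by (simp only: norm_mult[symmetric] left_diff_distrib)
   also have "\<dots> \<le> (e / B) * B"
    using f'(2) B by (intro mult_mono) (auto intro: order_trans[OF norm_ge_zero])
   finally show ?thesis using B by simp
  qed
  show "\<exists>h. h \<in> resolvent_alg \<and> (\<forall>x. cmod (f x * g x - h x) \<le> e)"
   by (intro exI[of _ "\<lambda>x. f' x * g x"] conjI allI f'(1) b)
 qed
qed

section \<open>The Cayley transform and density of the resolvent algebra\<close>

definition cayley :: "real => complex" where
 "cayley x = (of_real x + \<i>) / (of_real x - \<i>)"

lemma of_real_minus_i_nz: "of_real x - \<i> \<noteq> 0" "of_real x + \<i> \<noteq> 0"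
 by (auto simp: complex_eq_iff)

lemma norm_cayley: "cmod (cayley x) = 1"
proof -
 have "cmod (of_real x + \<i>) = cmod (of_real x - \<i>)" by (simp add: cmod_def)
 then show ?thesis using of_real_minus_i_nz[of x] by (simp add: cayley_def norm_divide)
qed

text \<open>The Cayley transform is 1 + 2 \<i> / (x - \<i>) and its conjugate is 1 - 2 \<i> / (x +
  \<i>). So its real and imaginary parts lie in the algebra, and with them every real polynomial in
  the two.\<close>

lemma cayley_poly_in_resolvent_alg:
 assumes "real_polynomial_function p"
 shows "(\<lambda>x. complex_of_real (p (cayley x))) \<in> resolvent_alg"
proof -
 have "(\<lambda>x. 1 + (2 * \<i>) * (1 / (complex_of_real x - \<i>))) \<in> resolvent_alg"
  by (intro resolvent_alg.add resolvent_alg.scale resolvent_alg.const resolvent_alg.res) simp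
 also have "(\<lambda>x. 1 + (2 * \<i>) * (1 / (complex_of_real x - \<i>))) = cayley"
  using of_real_minus_i_nz(1) by (auto simp: cayley_def fun_eq_iff field_simps)
 finally have w: "cayley \<in> resolvent_alg" .
 have "(\<lambda>x. 1 + (- 2 * \<i>) * (1 / (complex_of_real x - (- \<i>)))) \<in> resolvent_alg"
  by (intro resolvent_alg.add resolvent_alg.scale resolvent_alg.const resolvent_alg.res) simp
 also have "(\<lambda>x. 1 + (- 2 * \<i>) * (1 / (complex_of_real x - (- \<i>)))) = (\<lambda>x. cnj (cayley x))"
  using of_real_minus_i_nz(2) by (auto simp: cayley_def fun_eq_iff field_simps)
 finally have cw: "(\<lambda>x. cnj (cayley x)) \<in> resolvent_alg" .
 have "(\<lambda>x. (1 / 2) * (cayley x + cnj (cayley x))) \<in> resolvent_alg"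
  by (intro resolvent_alg.add resolvent_alg.scale w cw)
 also have "(\<lambda>x. (1 / 2) * (cayley x + cnj (cayley x))) = (\<lambda>x. complex_of_real (Re (cayley x)))"
  by (simp add: complex_add_cnj)
 finally have re: "(\<lambda>x. complex_of_real (Re (cayley x))) \<in> resolvent_alg" .
 have "(\<lambda>x. (1 / (2 * \<i>)) * (cayley x + (-1) * cnj (cayley x))) \<in> resolvent_alg"
  by (intro resolvent_alg.add resolvent_alg.scale w cw)
 also have "(\<lambda>x. (1 / (2 * \<i>)) * (cayley x + (-1) * cnj (cayley x))) = (\<lambda>x. complex_of_real (Im (cayley x)))"
  by (auto simp: complex_diff_cnj fun_eq_iff complex_eq_iff)
 finally have im: "(\<lambda>x. complex_of_real (Im (cayley x))) \<in> resolvent_alg" .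
 show ?thesis using assms
 proof (induction p rule: real_polynomial_function.induct)
  case (linear f)
  from linear interpret bounded_linear f .
  have fw: "f w = Re w * f 1 + Im w * f \<i>" for w
  proof -
   have "f w = f (Re w *\<^sub>R 1 + Im w *\<^sub>R \<i>)" by (rule arg_cong[where f = f]) (simp add: complex_eq_iff)
   then show ?thesis by (simp only: add scaleR) simp
  qed
  have "(\<lambda>x. complex_of_real (f (cayley x)))
    = (\<lambda>x. complex_of_real (f 1) * complex_of_real (Re (cayley x)) + complex_of_real (f \<i>) * complex_of_real (Im (cayley x)))"
  proof
   fix x
   show "complex_of_real (f (cayley x)) = complex_of_real (f 1) * complex_of_real (Re (cayley x)) + complex_of_real (f \<i>) * complex_of_real (Im (cayley x))"
    by (subst fw[of "cayley x"]) (simp add: mult.commute)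
  qed
  then show ?case by (simp only:) (intro resolvent_alg.add resolvent_alg.scale re im)
 next
  case (const c) show ?case by (rule resolvent_alg.const)
 next
  case (add f g) then show ?case using resolvent_alg.add by simp
 next
  case (mult f g) then show ?case using resolvent_alg_mult by simp
 qed
qed

text \<open>The Cayley transform maps the line onto the unit circle without the point 1. Bounded
  support makes F, carried over to the circle, vanish near 1 and hence extend continuously;
  polynomial approximation on the circle stays inside the algebra.\<close>

lemma real_cc_in_resolvent_alg:
 fixes F :: "real => real"
 assumes F: "continuous_on UNIV F" and "bounded {x. F x \<noteq> 0}"
 shows "(\<lambda>x. of_real (F x)) \<in> resolvent_alg"
proof -
 obtain M where M: "M > 0" "\<And>x. F x \<noteq> 0 ==> \<bar>x\<bar> \<le> M"
  using assms(2) by (auto simp: bounded_pos)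
 \<comment> \<open>The inverse of the Cayley transform, real on the unit circle away from 1.\<close>
 define q where "q u = \<i> * (u + 1) / (u - 1)" for u :: complex
 define \<Phi> where "\<Phi> u = (if u = 1 then 0 else F (Re (q u)))" for u
 have qreal: "Im (q u) = 0" if "cmod u = 1" "u \<noteq> 1" for u
 proof -
  have uu: "u * cnj u = 1" using that(1) by (simp add: complex_norm_square[symmetric])
  then have u0: "u \<noteq> 0" by auto
  have cu: "cnj u = 1 / u" using uu u0 by (simp add: field_simps)
  have "cnj u \<noteq> 1" using that(2) by (metis complex_cnj_one complex_cnj_cancel_iff)
  have "1 - u \<noteq> 0" using that by simp
  have "cnj (q u) = - \<i> * (cnj u + 1) / (cnj u - 1)" by (simp add: q_def)
  also have "\<dots> = - \<i> * (1 + u) / (1 - u)"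
   unfolding cu using u0 \<open>1 - u \<noteq> 0\<close> by (simp add: divide_simps)
  also have "\<dots> = q u" using that unfolding q_def by (simp add: divide_simps) (simp add: algebra_simps)
  finally show ?thesis by (simp add: complex_eq_iff)
 qed
 have qc: "q (cayley x) = of_real x" "cayley x \<noteq> 1" for x
 proof -
  have "cayley x - 1 = 2 * \<i> / (of_real x - \<i>)" "cayley x + 1 = 2 * of_real x / (of_real x - \<i>)"
   using of_real_minus_i_nz[of x] by (auto simp: cayley_def field_simps)
  then show "q (cayley x) = of_real x" "cayley x \<noteq> 1"
   using of_real_minus_i_nz[of x] by (auto simp: q_def)
 qed
 \<comment> \<open>Closer than 1 / (M + 1) to the point 1 one has |u + 1| > 1, so |q u| > 1 / |u -
   1| > M, which is outside the support of F.\<close>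
 have far: "\<Phi> u = 0" if "cmod u = 1" "dist u 1 < 1 / (M + 1)" for u
 proof (cases "u = 1")
  case False
  have "1 / (M + 1) < 1" using M by simp
  then have d: "0 < cmod (u - 1)" "cmod (u - 1) < 1" using that False by (auto simp: dist_norm)
  have "2 \<le> cmod (u + 1) + cmod (u - 1)"
   using norm_triangle_ineq4[of "u + 1" "u - 1"] by simp
  then have "1 < cmod (u + 1)" using d by simp
  then have "1 / cmod (u - 1) < cmod (q u)"
   using d unfolding q_def norm_divide norm_mult by (simp add: divide_strict_right_mono)
  moreover have "M < 1 / cmod (u - 1)"
  proof -
   have "cmod (u - 1) * (M + 1) < 1" using that(2) M by (simp add: dist_norm pos_less_divide_eq)
   moreover have "cmod (u - 1) * (M + 1) = M * cmod (u - 1) + cmod (u - 1)" by (simp add: algebra_simps)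
   ultimately have "M * cmod (u - 1) < 1" using d(1) by linarith
   then show ?thesis using d by (simp add: pos_less_divide_eq)
  qed
  moreover have "cmod (q u) = \<bar>Re (q u)\<bar>" using qreal[OF that(1) False] by (simp add: cmod_def)
  ultimately show ?thesis using M(2)[of "Re (q u)"] by (auto simp: \<Phi>_def)
 qed (simp add: \<Phi>_def)
 have "continuous_on (sphere 0 1) \<Phi>" unfolding continuous_on_eq_continuous_within
 proof
  fix u :: complex assume u: "u \<in> sphere 0 1"
  show "continuous (at u within sphere 0 1) \<Phi>"
  proof (cases "u = 1")
   case True
   show ?thesis
   proof (rule continuous_transform_within[of _ _ "\<lambda>_. 0" "1 / (M + 1)"])
    fix x assume "x \<in> sphere (0::complex) 1" "dist x u < 1 / (M + 1)"
    then show "(0::real) = \<Phi> x" using far[of x] True by simp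
   qed (use M u in auto)
  next
   case False
   have "continuous (at u) (\<lambda>u. F (Re (q u)))"
   proof (rule continuous_at_compose[of u "\<lambda>u. Re (q u)" F, unfolded o_def])
    have "continuous_on (- {1}) (\<lambda>u. Re (q u))"
     unfolding q_def by (intro continuous_intros) auto
    then show "continuous (at u) (\<lambda>u. Re (q u))"
     using False by (simp add: continuous_on_eq_continuous_at open_Compl)
    show "continuous (at (Re (q u))) F" using F by (simp add: continuous_on_eq_continuous_at)
   qed
   then have w: "continuous (at u within sphere 0 1) (\<lambda>u. F (Re (q u)))"
    by (rule continuous_at_imp_continuous_within)
   show ?thesis
   proof (rule continuous_transform_within[of _ _ "\<lambda>u. F (Re (q u))" "dist u 1"])
    fix x assume "x \<in> sphere (0::complex) 1" "dist x u < dist u 1"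
    then have "x \<noteq> 1" by (metis dist_commute less_irrefl)
    then show "F (Re (q x)) = \<Phi> x" by (simp add: \<Phi>_def)
   qed (use False u w in auto)
  qed
 qed
 then have cont: "continuous_on (sphere 0 1) \<Phi>" .
 show ?thesis
 proof (rule resolvent_alg.limit, intro allI impI)
  fix e :: real assume "e > 0"
  then obtain g where g: "real_polynomial_function g" "\<And>u. u \<in> sphere 0 1 ==> \<bar>\<Phi> u - g u\<bar> < e"
   using Stone_Weierstrass_real_polynomial_function[OF compact_sphere cont] by blast
  have b: "cmod (of_real (F x) - of_real (g (cayley x))) \<le> e" for x
  proof -
   have "\<Phi> (cayley x) = F x" using qc[of x] by (simp add: \<Phi>_def)
   moreover have "\<bar>\<Phi> (cayley x) - g (cayley x)\<bar> < e" by (rule g(2)) (simp add: norm_cayley)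
   ultimately show ?thesis unfolding of_real_diff[symmetric] norm_of_real by simp
  qed
  show "\<exists>h. h \<in> resolvent_alg \<and> (\<forall>x. cmod (of_real (F x) - h x) \<le> e)"
   by (intro exI[of _ "\<lambda>x. of_real (g (cayley x))"] conjI allI cayley_poly_in_resolvent_alg[OF g(1)] b)
 qed
qed

lemma cc_in_resolvent_alg:
 assumes "continuous_on UNIV F" "bounded {x. F x \<noteq> 0}"
 shows "F \<in> resolvent_alg"
proof -
 have "(\<lambda>x. of_real (Re (F x)) + \<i> * of_real (Im (F x))) \<in> resolvent_alg"
  by (intro resolvent_alg.add resolvent_alg.scale real_cc_in_resolvent_alg continuous_intros assms
    bounded_subset[OF assms(2)]) auto
 then show ?thesis by (simp add: complex_eq[symmetric])
qed

section \<open>Averages over eigenvalue multisets\<close>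

lemma norm_sum_mset_le:
 fixes f :: "real => complex"
 assumes "\<And>x. cmod (f x) \<le> B" shows "cmod (\<Sum>x\<in>#A. f x) \<le> of_nat (size A) * B"
proof (induction A)
 case (add x A)
 have "cmod (f x + (\<Sum>x\<in>#A. f x)) \<le> B + of_nat (size A) * B"
  by (intro norm_triangle_mono assms add)
 then show ?case by (simp add: algebra_simps)
qed simp

lemma norm_avg_mset_le:
 fixes f :: "real => complex"
 assumes "\<And>x. cmod (f x) \<le> B" "size A = s" "s > 0"
 shows "cmod ((\<Sum>x\<in>#A. f x) / of_nat s) \<le> B"
 using norm_sum_mset_le[where f = f and B = B and A = A] assms by (simp add: norm_divide pos_divide_le_eq mult.commute)

lemma sum_mset_diff: "(\<Sum>x\<in>#A. f x) - (\<Sum>x\<in>#A. g x) = (\<Sum>x\<in>#A. (f x - g x :: complex))"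
 by (induction A) auto

lemma cnj_sum_mset: "cnj (\<Sum>x\<in>#A. f x) = (\<Sum>x\<in>#A. cnj (f x))"
 by (induction A) auto

lemma norm_diff_three:
 fixes a b c d :: "'a::real_normed_vector"
 assumes "norm (a - b) \<le> x" "norm (b - c) < y" "norm (d - c) \<le> z"
 shows "norm (a - d) < x + y + z"
proof -
 have "a - d = (a - b) + (b - c) + (c - d)" by simp
 then have "norm (a - d) \<le> norm (a - b) + norm (b - c) + norm (c - d)"
  by (metis norm_triangle_ineq norm_triangle_mono order_refl)
 then show ?thesis using assms by (simp add: norm_minus_commute)
qed

text \<open>Rule induction over the algebra. Measurability is carried along because the integral of
  a sum is split, which needs integrable terms. Resolvents in the lower half-plane are conjugates of
  those in the upper one, and a uniform limit changes both normalized averages by at most the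
  uniform error.\<close>

theorem stieltjes_convergence:
 fixes \<Lambda> :: "nat => real multiset" and S :: "'a => real multiset"
 assumes M: "finite_measure M" "measure M (space M) > 0"
  and S: "\<And>x. x \<in> space M ==> size (S x) = s" "s > 0"
  and meas: "\<And>z. Im z > 0 ==> (\<lambda>x. \<Sum>t\<in>#S x. 1 / (of_real t - z)) \<in> borel_measurable M"
  and conv: "\<And>z. Im z > 0 ==> (\<lambda>n. (\<Sum>t\<in>#\<Lambda> n. 1 / (of_real t - z)) / of_nat (size (\<Lambda> n)))
    \<longlonglongrightarrow> (LINT x|M. (\<Sum>t\<in>#S x. 1 / (of_real t - z)) / of_nat s) / of_real (measure M (space M))"
  and ne: "eventually (\<lambda>n. size (\<Lambda> n) > 0) sequentially"
 shows "F \<in> resolvent_alg ==> (\<lambda>x. \<Sum>t\<in>#S x. F t) \<in> borel_measurable M \<and>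
  (\<lambda>n. (\<Sum>t\<in>#\<Lambda> n. F t) / of_nat (size (\<Lambda> n)))
    \<longlonglongrightarrow> (LINT x|M. (\<Sum>t\<in>#S x. F t) / of_nat s) / of_real (measure M (space M))"
proof (induction rule: resolvent_alg.induct)
 case (const c)
 interpret finite_measure M by fact
 have "(LINT x|M. (\<Sum>t\<in>#S x. c) / of_nat s) = (LINT x|M. c)"
  using S by (intro Bochner_Integration.integral_cong) (auto simp: sum_mset_constant)
 then have "(LINT x|M. (\<Sum>t\<in>#S x. c) / of_nat s) / of_real (measure M (space M)) = c"
  using M(2) by (simp add: scaleR_conv_of_real)
 moreover have "eventually (\<lambda>n. (\<Sum>t\<in>#\<Lambda> n. c) / of_nat (size (\<Lambda> n)) = c) sequentially"
  using ne by eventually_elim (auto simp: sum_mset_constant)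
 moreover have "(\<lambda>x. \<Sum>t\<in>#S x. c) \<in> borel_measurable M"
  using S by (subst measurable_cong[where g = "\<lambda>_. of_nat s * c"]) (auto simp: sum_mset_constant)
 ultimately show ?case by (auto intro: tendsto_eventually)
next
 case (res z)
 show ?case
 proof (cases "Im z > 0")
  case True then show ?thesis using meas conv by blast
 next
  case False
  then have z: "Im (cnj z) > 0" using res by simp

  have e: "(\<Sum>t\<in>#A. 1 / (of_real t - z)) = cnj (\<Sum>t\<in>#A. 1 / (of_real t - cnj z))" for A
   unfolding cnj_sum_mset by simp
  have "(\<lambda>x. cnj (\<Sum>t\<in>#S x. 1 / (of_real t - cnj z))) \<in> borel_measurable M"
   by (rule measurable_compose[OF meas[OF z], of cnj borel]) (intro borel_measurable_continuous_onI continuous_intros)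
  moreover have "(\<lambda>n. cnj ((\<Sum>t\<in>#\<Lambda> n. 1 / (of_real t - cnj z)) / of_nat (size (\<Lambda> n))))
   \<longlonglongrightarrow> cnj ((LINT x|M. (\<Sum>t\<in>#S x. 1 / (of_real t - cnj z)) / of_nat s) / of_real (measure M (space M)))"
   by (intro tendsto_cnj conv z)
  moreover have "(LINT x|M. cnj (\<Sum>t\<in>#S x. 1 / (of_real t - cnj z)) / of_nat s)
    = cnj (LINT x|M. (\<Sum>t\<in>#S x. 1 / (of_real t - cnj z)) / of_nat s)"
   using Bochner_Integration.integral_cnj[of M "\<lambda>x. (\<Sum>t\<in>#S x. 1 / (of_real t - cnj z)) / of_nat s"]
   by (simp only: complex_cnj_divide complex_cnj_of_nat)
  ultimately show ?thesis unfolding e by (simp only: complex_cnj_divide complex_cnj_of_nat complex_cnj_complex_of_real)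
 qed
next
 case (add f g)
 interpret finite_measure M by fact
 have int: "integrable M (\<lambda>x. (\<Sum>t\<in>#S x. h t) / of_nat s)"
  if h: "h \<in> resolvent_alg" and [measurable]: "(\<lambda>x. \<Sum>t\<in>#S x. h t) \<in> borel_measurable M" for h
 proof -
  obtain B where B: "\<And>x. cmod (h x) \<le> B" using resolvent_alg_bounded[OF h] by blast
  show ?thesis
  proof (rule integrable_const_bound[of _ B])
   show "AE x in M. cmod ((\<Sum>t\<in>#S x. h t) / of_nat s) \<le> B"
    using S by (intro AE_I2 norm_avg_mset_le[OF B])
  qed simp
 qed
 show ?case
 proof
  show "(\<lambda>x. \<Sum>t\<in>#S x. f t + g t) \<in> borel_measurable M" using add by (simp add: sum_mset.distrib borel_measurable_add)
  have "(LINT x|M. (\<Sum>t\<in>#S x. f t + g t) / of_nat s) = (LINT x|M. (\<Sum>t\<in>#S x. f t) / of_nat s) + (LINT x|M. (\<Sum>t\<in>#S x. g t) / of_nat s)"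
   using int add by (simp add: sum_mset.distrib add_divide_distrib)
  then show "(\<lambda>n. (\<Sum>t\<in>#\<Lambda> n. f t + g t) / of_nat (size (\<Lambda> n)))
   \<longlonglongrightarrow> (LINT x|M. (\<Sum>t\<in>#S x. f t + g t) / of_nat s) / of_real (measure M (space M))"
   using add by (simp add: sum_mset.distrib add_divide_distrib tendsto_add)
 qed
next
 case (scale f c)
 define P where "P A = (\<Sum>t\<in>#A. f t)" for A
 have e: "(\<Sum>t\<in>#A. c * f t) = c * P A" for A
  unfolding P_def by (induction A) (auto simp: distrib_left)
 note IH = scale.IH[folded P_def]
 have "(\<lambda>n. c * (P (\<Lambda> n) / of_nat (size (\<Lambda> n))))
   \<longlonglongrightarrow> c * ((LINT x|M. P (S x) / of_nat s) / of_real (measure M (space M)))"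
  using IH by (intro tendsto_mult_left) auto
 moreover have "(\<lambda>x. c * P (S x)) \<in> borel_measurable M" using IH by auto
 ultimately show ?case unfolding e by simp
next
 case (limit f)
 interpret finite_measure M by fact
 let ?L = "\<lambda>n f. (\<Sum>t\<in>#\<Lambda> n. f t) / of_nat (size (\<Lambda> n)) :: complex"
 let ?I = "\<lambda>f. (LINT x|M. (\<Sum>t\<in>#S x. f t) / of_nat s) / of_real (measure M (space M)) :: complex"
 have "\<forall>k. \<exists>g. g \<in> resolvent_alg \<and> (\<lambda>x. \<Sum>t\<in>#S x. g t) \<in> borel_measurable M \<and> (\<lambda>n. ?L n g) \<longlonglongrightarrow> ?I g
   \<and> (\<forall>x. cmod (f x - g x) \<le> 1 / real (Suc k))"
  using limit by (meson of_nat_0_less_iff zero_less_Suc zero_less_divide_1_iff)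
 from choice[OF this] obtain g where g0: "\<forall>k. g k \<in> resolvent_alg \<and> (\<lambda>x. \<Sum>t\<in>#S x. g k t) \<in> borel_measurable M
   \<and> (\<lambda>n. ?L n (g k)) \<longlonglongrightarrow> ?I (g k) \<and> (\<forall>x. cmod (f x - g k x) \<le> 1 / real (Suc k))" ..
 have g: "g k \<in> resolvent_alg" "(\<lambda>x. \<Sum>t\<in>#S x. g k t) \<in> borel_measurable M"
  "(\<lambda>n. ?L n (g k)) \<longlonglongrightarrow> ?I (g k)" "cmod (f x - g k x) \<le> 1 / real (Suc k)" for k x
  using g0[rule_format, of k] by blast+
 have diff: "cmod ((\<Sum>t\<in>#A. f t) - (\<Sum>t\<in>#A. g k t)) \<le> of_nat (size A) * (1 / real (Suc k))" for A k
  unfolding sum_mset_diff by (rule norm_sum_mset_le) (rule g(4))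
 have m: "(\<lambda>x. \<Sum>t\<in>#S x. f t) \<in> borel_measurable M"
 proof (rule borel_measurable_LIMSEQ_metric[OF g(2)])
  fix x assume x: "x \<in> space M"
  have "(\<lambda>k. real s * (1 / real (Suc k))) \<longlonglongrightarrow> real s * 0"
   by (intro tendsto_mult_left) (use LIMSEQ_inverse_real_of_nat in \<open>simp add: inverse_eq_divide\<close>)
  then have lim: "(\<lambda>k. real s * (1 / real (Suc k))) \<longlonglongrightarrow> 0" by simp
  have "(\<lambda>k. (\<Sum>t\<in>#S x. g k t) - (\<Sum>t\<in>#S x. f t)) \<longlonglongrightarrow> 0"
  proof (rule Lim_null_comparison[OF always_eventually lim], rule allI)
   fix k
   show "cmod ((\<Sum>t\<in>#S x. g k t) - (\<Sum>t\<in>#S x. f t)) \<le> real s * (1 / real (Suc k))"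
    using diff[of "S x" k] S(1)[OF x] by (simp only: norm_minus_commute)
  qed
  then show "(\<lambda>k. \<Sum>t\<in>#S x. g k t) \<longlonglongrightarrow> (\<Sum>t\<in>#S x. f t)"
   by (rule LIM_zero_cancel)
 qed
 obtain C where C: "\<And>x. cmod (f x) \<le> C" using resolvent_alg_bounded[OF resolvent_alg.limit] limit by blast
 have int: "integrable M (\<lambda>x. (\<Sum>t\<in>#S x. h t) / of_nat s)"
  if B: "\<And>x. cmod (h x) \<le> B" and [measurable]: "(\<lambda>x. \<Sum>t\<in>#S x. h t) \<in> borel_measurable M" for h B
 proof (rule integrable_const_bound[of _ B])
  show "AE x in M. cmod ((\<Sum>t\<in>#S x. h t) / of_nat s) \<le> B"
   using S by (intro AE_I2 norm_avg_mset_le[OF B])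
 qed simp
 have If: "cmod (?I f - ?I (g k)) \<le> 1 / real (Suc k)" for k
 proof -
  obtain B where B: "\<And>x. cmod (g k x) \<le> B" using resolvent_alg_bounded[OF g(1)] by blast
  note i = int[OF C m] int[OF B g(2)]
  have "?I f - ?I (g k) = (LINT x|M. (\<Sum>t\<in>#S x. f t) / of_nat s - (\<Sum>t\<in>#S x. g k t) / of_nat s) / of_real (measure M (space M))"
   by (subst Bochner_Integration.integral_diff[OF i]) (rule diff_divide_distrib[symmetric])
  then have "cmod (?I f - ?I (g k)) = cmod (LINT x|M. (\<Sum>t\<in>#S x. f t) / of_nat s - (\<Sum>t\<in>#S x. g k t) / of_nat s) / measure M (space M)"
   using M(2) by (simp only: norm_divide norm_of_real abs_of_pos)
  also have "\<dots> \<le> (LINT x|M. 1 / real (Suc k)) / measure M (space M)"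
  proof (intro divide_right_mono order_trans[OF integral_norm_bound] integral_mono)
   fix x assume "x \<in> space M"
   then show "cmod ((\<Sum>t\<in>#S x. f t) / of_nat s - (\<Sum>t\<in>#S x. g k t) / of_nat s) \<le> 1 / real (Suc k)"
    using diff[of "S x" k] S by (simp add: diff_divide_distrib[symmetric] norm_divide field_simps)
  qed (use i in auto)
  finally show ?thesis using M(2) by simp
 qed
 have "(\<lambda>n. ?L n f) \<longlonglongrightarrow> ?I f"
 proof (rule metric_LIMSEQ_I)
  fix r :: real assume r: "r > 0"
  then obtain k where k: "1 / real (Suc k) < r / 3"
   using nat_approx_posE[of "r / 3"] by auto
  obtain N where N: "\<And>n. n \<ge> N ==> cmod (?L n (g k) - ?I (g k)) < r / 3"
   using LIMSEQ_D[OF g(3)[of k], of "r / 3"] r by auto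
  have "dist (?L n f) (?I f) < r" if n: "n \<ge> N" for n
  proof -
   have L: "cmod (?L n f - ?L n (g k)) \<le> 1 / real (Suc k)"
   proof (cases "size (\<Lambda> n) = 0")
    case False
    have "cmod (?L n f - ?L n (g k)) = cmod ((\<Sum>t\<in>#\<Lambda> n. f t) - (\<Sum>t\<in>#\<Lambda> n. g k t)) / real (size (\<Lambda> n))"
     by (simp only: diff_divide_distrib[symmetric] norm_divide norm_of_nat)
    also have "\<dots> \<le> of_nat (size (\<Lambda> n)) * (1 / real (Suc k)) / real (size (\<Lambda> n))"
     by (intro divide_right_mono diff) auto
    finally show ?thesis using False by simp
   qed simp
   show ?thesis
    unfolding dist_norm using norm_diff_three[OF L N[OF n] If] k by linarith
  qed
  then show "\<exists>no. \<forall>n\<ge>no. dist (?L n f) (?I f) < r" by blast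
 qed
 with m show ?case by blast
qed

section \<open>Resolvents of banded symbols\<close>

abbreviation circle_measure :: "real measure" where
 "circle_measure \<equiv> restrict_space lborel {-pi..pi}"

definition fcoef :: "(real => complex) => int => complex" where
 "fcoef g s = (LINT \<theta>|circle_measure. g \<theta> * cis (- of_int s * \<theta>)) / of_real (2 * pi)"

lemma circle_finite: "finite_measure circle_measure"
proof (rule finite_measureI)
 have "emeasure lborel {-pi..pi} = ennreal (2 * pi)" by simp
 then show "emeasure circle_measure (space circle_measure) \<noteq> \<infinity>"
  by (simp add: space_restrict_space emeasure_restrict_space)
qed

lemma circle_measure_space: "measure circle_measure (space circle_measure) = 2 * pi"
 by (simp add: space_restrict_space measure_restrict_space)

lemma circle_integrable:
 fixes g :: "real => 'b::{banach, second_countable_topology}"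
 assumes "g \<in> borel_measurable borel" "\<And>\<theta>. norm (g \<theta>) \<le> B"
 shows "integrable circle_measure g"
proof -
 interpret finite_measure circle_measure by (rule circle_finite)
 show ?thesis
  by (rule integrable_const_bound[of _ B]) (use assms in \<open>auto intro: measurable_restrict_space1\<close>)
qed

lemma circle_cis: "(LINT \<theta>|circle_measure. cis (of_int s * \<theta>)) = (if s = 0 then of_real (2 * pi) else 0)"
proof (cases "s = 0")
 case True
 interpret finite_measure circle_measure by (rule circle_finite)
 show ?thesis using True circle_measure_space by (simp add: scaleR_conv_of_real)
next
 case False
 define F where "F \<theta> = cis (of_int s * \<theta>) / (\<i> * of_int s)" for \<theta>
 have d: "(F has_vector_derivative cis (of_int s * \<theta>)) (at \<theta> within {-pi..pi})" for \<theta>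
 proof -
  have "((\<lambda>z. exp (\<i> * of_int s * z) / (\<i> * of_int s)) has_field_derivative exp (\<i> * of_int s * of_real \<theta>)) (at (of_real \<theta>))"
   using False by (auto intro!: derivative_eq_intros)
  then have "((\<lambda>z. exp (\<i> * of_int s * of_real z) / (\<i> * of_int s)) has_vector_derivative exp (\<i> * of_int s * of_real \<theta>)) (at \<theta>)"
   by (rule has_vector_derivative_real_field)
  moreover have "exp (\<i> * of_int s * of_real z) = cis (of_int s * z)" for z
   by (simp add: cis_conv_exp mult.assoc)
  ultimately show ?thesis unfolding F_def[abs_def] by (auto intro: has_vector_derivative_at_within)
 qed
 have "(LINT \<theta>|circle_measure. cis (of_int s * \<theta>)) = (LINT \<theta>|lborel. indicator {-pi..pi} \<theta> *\<^sub>R cis (of_int s * \<theta>))"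
  by (subst integral_restrict_space) (auto simp: set_lebesgue_integral_def)
 also have "\<dots> = F pi - F (- pi)"
  by (rule integral_FTC_Icc[OF _ d]) (auto intro!: continuous_intros)
 also have "\<dots> = 0"
 proof -
  have "cis (of_int s * pi) = cis (- (of_int s * pi))"
   using sin_integer_2pi by (auto simp: complex_eq_iff sin_zero_iff_int2)
  then show ?thesis by (simp add: F_def)
 qed
 finally show ?thesis using False by simp
qed

lemma cis_borel [measurable]: "(\<lambda>\<theta>. cis (c * \<theta>)) \<in> borel_measurable borel"
 by (intro borel_measurable_continuous_onI continuous_intros)

lemma cnj_borel [measurable]: "f \<in> borel_measurable M ==> (\<lambda>x. cnj (f x)) \<in> borel_measurable M"
 by (rule measurable_compose[of f M borel cnj]) (assumption, intro borel_measurable_continuous_onI continuous_intros)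

lemma fcoef_integrable:
 assumes "g \<in> borel_measurable borel" "\<And>\<theta>. cmod (g \<theta>) \<le> B"
 shows "integrable circle_measure (\<lambda>\<theta>. g \<theta> * cis (c * \<theta>))"
 by (rule circle_integrable[of _ B]) (use assms in \<open>auto simp: norm_mult\<close>)

lemma fcoef_diff:
 assumes "g \<in> borel_measurable borel" "\<And>\<theta>. cmod (g \<theta>) \<le> B" "h \<in> borel_measurable borel" "\<And>\<theta>. cmod (h \<theta>) \<le> C"
 shows "fcoef g s - fcoef h s = fcoef (\<lambda>\<theta>. g \<theta> - h \<theta>) s"
 unfolding fcoef_def left_diff_distrib
 by (subst Bochner_Integration.integral_diff[OF fcoef_integrable[OF assms(1,2)] fcoef_integrable[OF assms(3,4)]])
   (rule diff_divide_distrib[symmetric])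

lemma circle_integral_bound:
 fixes g :: "real => 'b::{banach, second_countable_topology}"
 assumes "g \<in> borel_measurable borel" "\<And>\<theta>. norm (g \<theta>) \<le> B"
 shows "norm (LINT \<theta>|circle_measure. g \<theta>) \<le> 2 * pi * B"
proof -
 interpret finite_measure circle_measure by (rule circle_finite)
 have "norm (LINT \<theta>|circle_measure. g \<theta>) \<le> (LINT \<theta>|circle_measure. B)"
  using assms circle_integrable[OF assms] circle_integrable[of "\<lambda>_. B" "\<bar>B\<bar>"]
  by (intro order_trans[OF integral_norm_bound] integral_mono integrable_norm) auto
 then show ?thesis using circle_measure_space by simp
qed

lemma fcoef_bound:
 assumes "g \<in> borel_measurable borel" "\<And>\<theta>. cmod (g \<theta>) \<le> B"
 shows "cmod (fcoef g s) \<le> B"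
proof -
 have "cmod (LINT \<theta>|circle_measure. g \<theta> * cis (- of_int s * \<theta>)) \<le> 2 * pi * B"
  by (rule circle_integral_bound) (intro borel_measurable_times assms(1) cis_borel, simp add: norm_mult assms(2))
 then show ?thesis by (simp add: fcoef_def norm_divide field_simps)
qed

text \<open>Expand the integral of |g - P|^2 >= 0 for the partial Fourier sum P over
  \<open>S\<close>. As |g| <= B, the mean of |g|^2 is at most B^2, so the bound is uniform in
  \<open>S\<close>.\<close>

lemma bessel:
 assumes g: "g \<in> borel_measurable borel" "\<And>\<theta>. cmod (g \<theta>) \<le> B" and S: "finite S"
 shows "(\<Sum>s\<in>S. (cmod (fcoef g s))\<^sup>2) \<le> B\<^sup>2"
proof -
 let ?I = "integral\<^sup>L circle_measure :: (real => complex) => complex"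
 have [measurable]: "g \<in> borel_measurable borel" by fact
 have B0: "0 \<le> B" using g(2)[of 0] norm_ge_zero order_trans by blast
 define c where "c = fcoef g"
 define P where "P \<theta> = (\<Sum>s\<in>S. c s * cis (of_int s * \<theta>))" for \<theta>
 have [measurable]: "P \<in> borel_measurable borel" unfolding P_def by measurable
 define Q where "Q = (\<Sum>s\<in>S. (cmod (c s))\<^sup>2)"
 have Pb: "cmod (P \<theta>) \<le> (\<Sum>s\<in>S. cmod (c s))" for \<theta>
  unfolding P_def by (rule order_trans[OF norm_sum]) (simp add: norm_mult)
 define D where "D = (\<Sum>s\<in>S. cmod (c s))"
 have D0: "0 \<le> D" by (simp add: D_def sum_nonneg)
 have Pb: "cmod (P \<theta>) \<le> D" for \<theta> using Pb by (simp add: D_def)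
 have cc: "cnj (cis x) = cis (- x)" for x by (simp add: cis_cnj)
 have i1: "integrable circle_measure (\<lambda>\<theta>. g \<theta> * cnj (g \<theta>))"
  by (rule circle_integrable[of _ "B * B"], measurable) (auto simp: norm_mult intro!: mult_mono g B0)
 have i2: "integrable circle_measure (\<lambda>\<theta>. g \<theta> * cnj (P \<theta>))"
  by (rule circle_integrable[of _ "B * D"], measurable) (auto simp: norm_mult intro!: mult_mono g Pb B0)
 have i3: "integrable circle_measure (\<lambda>\<theta>. P \<theta> * cnj (P \<theta>))"
  by (rule circle_integrable[of _ "D * D"], measurable) (auto simp: norm_mult intro!: mult_mono Pb D0)
 have i4: "integrable circle_measure (\<lambda>\<theta>. P \<theta> * cnj (g \<theta>))"
  by (rule circle_integrable[of _ "D * B"], measurable) (auto simp: norm_mult intro!: mult_mono g Pb D0)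
 have cQ: "complex_of_real Q = (\<Sum>s\<in>S. cnj (c s) * c s)"
  unfolding Q_def of_real_sum by (intro sum.cong refl) (simp only: complex_norm_square, simp only: mult.commute)
 have "?I (\<lambda>\<theta>. g \<theta> * cnj (P \<theta>)) = ?I (\<lambda>\<theta>. \<Sum>s\<in>S. cnj (c s) * (g \<theta> * cis (- of_int s * \<theta>)))"
  by (intro Bochner_Integration.integral_cong refl) (simp add: P_def sum_distrib_left cc mult_ac)
 also have "\<dots> = (\<Sum>s\<in>S. ?I (\<lambda>\<theta>. cnj (c s) * (g \<theta> * cis (- of_int s * \<theta>))))"
  by (rule Bochner_Integration.integral_sum) (intro integrable_mult_right fcoef_integrable[OF g])
 also have "\<dots> = (\<Sum>s\<in>S. cnj (c s) * ?I (\<lambda>\<theta>. g \<theta> * cis (- of_int s * \<theta>)))"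
  by (intro sum.cong refl integral_mult_right_zero)
 also have "\<dots> = of_real (2 * pi) * complex_of_real Q"
  unfolding cQ sum_distrib_left by (intro sum.cong refl) (simp add: c_def fcoef_def)
 finally have gP: "?I (\<lambda>\<theta>. g \<theta> * cnj (P \<theta>)) = of_real (2 * pi) * complex_of_real Q" .
 have "?I (\<lambda>\<theta>. P \<theta> * cnj (g \<theta>)) = ?I (\<lambda>\<theta>. cnj (g \<theta> * cnj (P \<theta>)))"
  by (simp add: mult.commute)
 also have "\<dots> = cnj (?I (\<lambda>\<theta>. g \<theta> * cnj (P \<theta>)))" by (rule Bochner_Integration.integral_cnj)
 finally have Pg: "?I (\<lambda>\<theta>. P \<theta> * cnj (g \<theta>)) = of_real (2 * pi) * complex_of_real Q" unfolding gP by simp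
 have ii: "integrable circle_measure (\<lambda>\<theta>. cis (x * \<theta>))" for x
  by (rule circle_integrable[of _ 1]) auto
 have "?I (\<lambda>\<theta>. P \<theta> * cnj (P \<theta>)) = ?I (\<lambda>\<theta>. \<Sum>s\<in>S. \<Sum>t\<in>S. c s * cnj (c t) * cis (of_int (s - t) * \<theta>))"
  by (intro Bochner_Integration.integral_cong refl)
    (simp add: P_def sum_product cc cis_mult mult_ac left_diff_distrib right_diff_distrib)
 also have "\<dots> = (\<Sum>s\<in>S. \<Sum>t\<in>S. c s * cnj (c t) * ?I (\<lambda>\<theta>. cis (of_int (s - t) * \<theta>)))"
  using ii by (simp add: Bochner_Integration.integral_sum)
 also have "\<dots> = (\<Sum>s\<in>S. \<Sum>t\<in>S. if s = t then c s * cnj (c t) * of_real (2 * pi) else 0)"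
  unfolding circle_cis by (intro sum.cong refl) auto
 also have "\<dots> = of_real (2 * pi) * complex_of_real Q"
  unfolding cQ using S by (simp add: sum_distrib_left mult_ac)
 finally have PP: "?I (\<lambda>\<theta>. P \<theta> * cnj (P \<theta>)) = of_real (2 * pi) * complex_of_real Q" .
 have e: "complex_of_real ((cmod (g \<theta> - P \<theta>))\<^sup>2) = g \<theta> * cnj (g \<theta>) - g \<theta> * cnj (P \<theta>) - P \<theta> * cnj (g \<theta>) + P \<theta> * cnj (P \<theta>)" for \<theta>
  by (simp add: complex_norm_square algebra_simps del: of_real_power)
 have "complex_of_real (LINT \<theta>|circle_measure. (cmod (g \<theta> - P \<theta>))\<^sup>2) = ?I (\<lambda>\<theta>. complex_of_real ((cmod (g \<theta> - P \<theta>))\<^sup>2))"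
 proof (rule integral_of_real[symmetric])
  have "cmod (g \<theta> - P \<theta>) \<le> B + D" for \<theta>
   by (rule order_trans[OF norm_triangle_ineq4]) (intro add_mono g Pb)
  then show "integrable circle_measure (\<lambda>\<theta>. (cmod (g \<theta> - P \<theta>))\<^sup>2)"
   by (intro circle_integrable[of _ "(B + D)\<^sup>2"]) (auto intro: power_mono)
 qed
 also have "\<dots> = ?I (\<lambda>\<theta>. g \<theta> * cnj (g \<theta>)) - of_real (2 * pi) * complex_of_real Q"
  unfolding e using i1 i2 i3 i4 gP Pg PP by simp
 finally have 1: "complex_of_real (LINT \<theta>|circle_measure. (cmod (g \<theta> - P \<theta>))\<^sup>2) = ?I (\<lambda>\<theta>. g \<theta> * cnj (g \<theta>)) - complex_of_real (2 * pi * Q)"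
  by simp
 have 2: "?I (\<lambda>\<theta>. g \<theta> * cnj (g \<theta>)) = complex_of_real (LINT \<theta>|circle_measure. (cmod (g \<theta>))\<^sup>2)"
  by (simp add: complex_norm_square[symmetric] integral_of_real[symmetric] del: integral_of_real of_real_power)
 have "complex_of_real (LINT \<theta>|circle_measure. (cmod (g \<theta> - P \<theta>))\<^sup>2) = complex_of_real ((LINT \<theta>|circle_measure. (cmod (g \<theta>))\<^sup>2) - 2 * pi * Q)"
  using 1 unfolding 2 by simp
 then have "(LINT \<theta>|circle_measure. (cmod (g \<theta> - P \<theta>))\<^sup>2) = (LINT \<theta>|circle_measure. (cmod (g \<theta>))\<^sup>2) - 2 * pi * Q"
  by (simp only: of_real_eq_iff)
 moreover have "0 \<le> (LINT \<theta>|circle_measure. (cmod (g \<theta> - P \<theta>))\<^sup>2)" by (rule Bochner_Integration.integral_nonneg) auto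
 moreover have "(LINT \<theta>|circle_measure. (cmod (g \<theta>))\<^sup>2) \<le> 2 * pi * B\<^sup>2"
  using circle_integral_bound[of "\<lambda>\<theta>. (cmod (g \<theta>))\<^sup>2" "B\<^sup>2"] g B0 by (auto simp: power_mono)
 ultimately have "2 * pi * Q \<le> 2 * pi * B\<^sup>2" by linarith
 then show ?thesis by (simp add: Q_def c_def)
qed

lemma L2_set_sum_mult_le:
 fixes c :: "'b => complex"
 assumes "finite S"
 shows "L2_set (\<lambda>j. cmod (\<Sum>k\<in>S. c k * y k j)) A \<le> (\<Sum>k\<in>S. cmod (c k) * L2_set (\<lambda>j. cmod (y k j)) A)"
 using assms
proof (induction S)
 case (insert k S)
 have "L2_set (\<lambda>j. cmod (\<Sum>k\<in>insert k S. c k * y k j)) A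
   \<le> L2_set (\<lambda>j. cmod (c k) * cmod (y k j) + cmod (\<Sum>k\<in>S. c k * y k j)) A"
  using insert by (intro L2_set_mono) (auto simp: norm_mult[symmetric] norm_triangle_ineq)
 also have "\<dots> \<le> L2_set (\<lambda>j. cmod (c k) * cmod (y k j)) A + L2_set (\<lambda>j. cmod (\<Sum>k\<in>S. c k * y k j)) A"
  by (rule L2_set_triangle_ineq)
 also have "L2_set (\<lambda>j. cmod (c k) * cmod (y k j)) A = cmod (c k) * L2_set (\<lambda>j. cmod (y k j)) A"
  by (simp add: L2_set_right_distrib)
 finally show ?case using insert by simp
qed (simp add: L2_set_def)

lemma norm_triangle3: "norm (a + (b + c)) \<le> norm a + (norm b + norm c)"
 by (rule order_trans[OF norm_triangle_ineq]) (intro add_left_mono norm_triangle_ineq)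

text \<open>Sort the indices j by their component \<open>rho j\<close>. Inside one component the
  frequencies t - m j are distinct, so Bessel's inequality bounds each of the r groups by B^2. The
  bound does not grow with \<open>d\<close>, which makes rows of the approximate resolvent
  bounded.\<close>

lemma coef_row_bound:
 fixes rho :: "nat => nat" and m :: "nat => int"
 assumes inj: "inj_on (\<lambda>i. (rho i, m i)) {..<d}" and rho: "\<And>i. i < d ==> rho i < r"
  and g: "\<And>c. c < r ==> g c \<in> borel_measurable borel" "\<And>c \<theta>. c < r ==> cmod (g c \<theta>) \<le> B" and B: "0 \<le> B"
 shows "L2_set (\<lambda>j. cmod (fcoef (g (rho j)) (t - m j))) {..<d} \<le> sqrt (real r) * B"
proof -
 have "(\<Sum>j<d. (cmod (fcoef (g (rho j)) (t - m j)))\<^sup>2)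
   = (\<Sum>c<r. \<Sum>j\<in>{j \<in> {..<d}. rho j = c}. (cmod (fcoef (g (rho j)) (t - m j)))\<^sup>2)"
  by (rule sum.group[symmetric]) (use rho in auto)
 also have "\<dots> \<le> (\<Sum>c<r. B\<^sup>2)"
 proof (rule sum_mono)
  fix c assume c: "c \<in> {..<r}"
  let ?S = "{j \<in> {..<d}. rho j = c}"
  have i: "inj_on (\<lambda>j. t - m j) ?S" using inj by (auto simp: inj_on_def)
  have "(\<Sum>j\<in>?S. (cmod (fcoef (g (rho j)) (t - m j)))\<^sup>2) = (\<Sum>s\<in>(\<lambda>j. t - m j) ` ?S. (cmod (fcoef (g c) s))\<^sup>2)"
   by (subst sum.reindex[OF i]) (auto intro!: sum.cong)
  also have "\<dots> \<le> B\<^sup>2" using c by (intro bessel g) auto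
  finally show "(\<Sum>j\<in>?S. (cmod (fcoef (g (rho j)) (t - m j)))\<^sup>2) \<le> B\<^sup>2" .
 qed
 also have "\<dots> = (sqrt (real r) * B)\<^sup>2" by (simp add: power_mult_distrib)
 finally have "L2_set (\<lambda>j. cmod (fcoef (g (rho j)) (t - m j))) {..<d} \<le> sqrt ((sqrt (real r) * B)\<^sup>2)"
  unfolding L2_set_def by (rule real_sqrt_le_mono)
 then show ?thesis using B by simp
qed

locale banded_symbol =
 fixes r w :: nat and K L :: "int => nat => nat => real" and Z :: "nat => complex" and \<eta> :: real
 assumes \<eta>: "0 < \<eta>" and Z: "\<And>c. c < r ==> \<eta> \<le> Im (Z c)"
  and K_band: "\<And>s c d. \<bar>s\<bar> > int w ==> K s c d = 0" and L_band: "\<And>s c d. \<bar>s\<bar> > int w ==> L s c d = 0"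
  and K_sym: "\<And>s c d. K (- s) d c = K s c d" and L_sym: "\<And>s c d. L (- s) d c = L s c d"
begin

definition sym :: "real => real => mat_fun" where
 "sym \<alpha> \<theta> c d = (\<Sum>s\<in>{- int w..int w}. of_real (\<alpha> * K s c d + L s c d) * cis (of_int s * \<theta>))"

definition res :: "real => real => mat_fun" where
 "res \<alpha> \<theta> = finv r (shiftd (sym \<alpha> \<theta>) Z)"

definition fc :: "real => int => mat_fun" where
 "fc \<alpha> s c d = fcoef (\<lambda>\<theta>. res \<alpha> \<theta> c d) s"

definition Kb :: real where "Kb = (\<Sum>c<r. \<Sum>d<r. \<Sum>s\<in>{- int w..int w}. \<bar>K s c d\<bar>)"
definition Lb :: real where "Lb = (\<Sum>c<r. \<Sum>d<r. \<Sum>s\<in>{- int w..int w}. \<bar>L s c d\<bar>)"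
definition Zb :: real where "Zb = (\<Sum>c<r. cmod (Z c))"

lemma entry_le_sum:
 assumes "c < r" "d < r" and s: "\<bar>s\<bar> \<le> int w"
 shows "\<bar>f s c d\<bar> \<le> (\<Sum>c<r. \<Sum>d<r. \<Sum>s\<in>{- int w..int w}. \<bar>f s c d :: real\<bar>)"
proof -
 have "\<bar>f s c d\<bar> \<le> (\<Sum>s\<in>{- int w..int w}. \<bar>f s c d\<bar>)" using s by (intro member_le_sum) auto
 also have "\<dots> \<le> (\<Sum>d<r. \<Sum>s\<in>{- int w..int w}. \<bar>f s c d\<bar>)"
  using assms by (intro member_le_sum[of d "{..<r}" "\<lambda>d. \<Sum>s\<in>{- int w..int w}. \<bar>f s c d\<bar>"]) (auto intro: sum_nonneg)
 also have "\<dots> \<le> (\<Sum>c<r. \<Sum>d<r. \<Sum>s\<in>{- int w..int w}. \<bar>f s c d\<bar>)"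
  using assms by (intro member_le_sum[of c "{..<r}" "\<lambda>c. \<Sum>d<r. \<Sum>s\<in>{- int w..int w}. \<bar>f s c d\<bar>"]) (auto intro!: sum_nonneg)
 finally show ?thesis .
qed

lemma K_le: "c < r ==> d < r ==> \<bar>K s c d\<bar> \<le> Kb"
 using entry_le_sum[of c d s K] K_band[of s c d] unfolding Kb_def
 by (cases "\<bar>s\<bar> \<le> int w") (auto intro!: sum_nonneg)
lemma L_le: "c < r ==> d < r ==> \<bar>L s c d\<bar> \<le> Lb"
 using entry_le_sum[of c d s L] L_band[of s c d] unfolding Lb_def
 by (cases "\<bar>s\<bar> \<le> int w") (auto intro!: sum_nonneg)
lemma Z_le: "c < r ==> cmod (Z c) \<le> Zb"
 unfolding Zb_def by (intro member_le_sum) auto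
lemma bounds_nonneg: "0 \<le> Kb" "0 \<le> Lb" "0 \<le> Zb"
 by (auto simp: Kb_def Lb_def Zb_def intro!: sum_nonneg)

lemma sym_herm: "herm r (sym \<alpha> \<theta>)"
 unfolding herm_def
proof (intro allI impI)
 fix c d
 have "cnj (sym \<alpha> \<theta> d c) = (\<Sum>s\<in>{- int w..int w}. of_real (\<alpha> * K s d c + L s d c) * cis (- (of_int s * \<theta>)))"
  by (simp add: sym_def cis_cnj)
 also have "\<dots> = sym \<alpha> \<theta> c d"
  unfolding sym_def
  by (rule sum.reindex_bij_witness[of _ uminus uminus]) (auto simp: K_sym L_sym)
 finally show "sym \<alpha> \<theta> c d = cnj (sym \<alpha> \<theta> d c)" by simp
qed

lemma sym_dissipative: "dissipative \<eta> r (shiftd (sym \<alpha> \<theta>) Z)"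
 by (rule dissipative_shiftd[OF sym_herm Z])

lemma res_inv: "inv_pair r (shiftd (sym \<alpha> \<theta>) Z) (res \<alpha> \<theta>)"
 unfolding res_def by (rule dissipative_inv[OF sym_dissipative \<eta>])

lemma res_bound: "c < r ==> d < r ==> cmod (res \<alpha> \<theta> c d) \<le> 1 / \<eta>"
 by (rule dissipative_entry[OF sym_dissipative res_inv \<eta>])

lemma res_diff:
 assumes "c < r" "d < r"
 shows "cmod (res \<alpha> \<theta> c d - res \<beta> \<theta>' c d) \<le> 1 / \<eta>\<^sup>2 * (\<Sum>c<r. \<Sum>d<r. cmod (sym \<alpha> \<theta> c d - sym \<beta> \<theta>' c d))"
 using resolvent_entry_perturb[OF sym_dissipative res_inv sym_dissipative res_inv \<eta> assms, of \<alpha> \<theta> \<beta> \<theta>']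
 by (simp add: shiftd_def)

lemma sym_lipschitz: "(\<Sum>c<r. \<Sum>d<r. cmod (sym \<alpha> \<theta> c d - sym \<beta> \<theta> c d)) \<le> \<bar>\<alpha> - \<beta>\<bar> * Kb"
proof -
 have "cmod (sym \<alpha> \<theta> c d - sym \<beta> \<theta> c d) \<le> \<bar>\<alpha> - \<beta>\<bar> * (\<Sum>s\<in>{- int w..int w}. \<bar>K s c d\<bar>)" for c d
 proof -
  have "sym \<alpha> \<theta> c d - sym \<beta> \<theta> c d = (\<Sum>s\<in>{- int w..int w}. of_real ((\<alpha> - \<beta>) * K s c d) * cis (of_int s * \<theta>))"
   unfolding sym_def sum_subtractf[symmetric] by (intro sum.cong refl) (simp add: algebra_simps)
  also have "cmod \<dots> \<le> (\<Sum>s\<in>{- int w..int w}. \<bar>\<alpha> - \<beta>\<bar> * \<bar>K s c d\<bar>)"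
   by (rule order_trans[OF norm_sum]) (auto simp: norm_mult abs_mult intro!: sum_mono simp del: of_real_mult of_real_diff)
  finally show ?thesis by (simp add: sum_distrib_left)
 qed
 then show ?thesis unfolding Kb_def sum_distrib_left by (intro sum_mono) (simp add: sum_distrib_left)
qed

lemma res_lipschitz: "c < r ==> d < r ==> cmod (res \<alpha> \<theta> c d - res \<beta> \<theta> c d) \<le> \<bar>\<alpha> - \<beta>\<bar> * Kb / \<eta>\<^sup>2"
 using res_diff[of c d \<alpha> \<theta> \<beta> \<theta>] sym_lipschitz[of \<alpha> \<theta> \<beta>] \<eta>
 by (smt (verit) divide_right_mono mult_cancel_right1 times_divide_eq_left zero_le_power2)

lemma sym_continuous: "continuous_on UNIV (\<lambda>(\<alpha>, \<theta>). sym \<alpha> \<theta> c d)"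
 unfolding sym_def case_prod_beta by (intro continuous_intros)

text \<open>The perturbation bound makes the resolvent as continuous as the symbol. Joint continuity
  in (\<alpha>, \<theta>) is what makes compositions with a Borel coefficient measurable.\<close>

lemma res_continuous:
 assumes "c < r" "d < r" shows "continuous_on UNIV (\<lambda>(\<alpha>, \<theta>). res \<alpha> \<theta> c d)"
 unfolding continuous_on_def
proof
 fix p :: "real \<times> real"
 have s: "((\<lambda>x. sym (fst x) (snd x) c d) \<longlongrightarrow> sym (fst p) (snd p) c d) (at p)" for c d
  using sym_continuous[of c d] unfolding continuous_on_def case_prod_beta by blast
 have "((\<lambda>x. 1 / \<eta>\<^sup>2 * (\<Sum>c<r. \<Sum>d<r. cmod (sym (fst x) (snd x) c d - sym (fst p) (snd p) c d))) \<longlongrightarrow>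
   1 / \<eta>\<^sup>2 * (\<Sum>c<r. \<Sum>d<r. cmod (sym (fst p) (snd p) c d - sym (fst p) (snd p) c d))) (at p)"
  by (intro tendsto_intros s)
 then have z: "((\<lambda>x. 1 / \<eta>\<^sup>2 * (\<Sum>c<r. \<Sum>d<r. cmod (sym (fst x) (snd x) c d - sym (fst p) (snd p) c d))) \<longlongrightarrow> 0) (at p)"
  by simp
 have "((\<lambda>x. res (fst x) (snd x) c d - res (fst p) (snd p) c d) \<longlongrightarrow> 0) (at p)"
  by (rule Lim_null_comparison[OF always_eventually z]) (rule allI, rule res_diff[OF assms])
 then show "((\<lambda>(\<alpha>, \<theta>). res \<alpha> \<theta> c d) \<longlongrightarrow> (case p of (\<alpha>, \<theta>) => res \<alpha> \<theta> c d)) (at p within UNIV)"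
  unfolding case_prod_beta by (rule LIM_zero_cancel)
qed

lemma res_borel2 [measurable]: "c < r ==> d < r ==> (\<lambda>(\<alpha>, \<theta>). res \<alpha> \<theta> c d) \<in> borel_measurable borel"
 by (intro borel_measurable_continuous_onI res_continuous)

lemma res_borel: "c < r ==> d < r ==> (\<lambda>\<theta>. res \<alpha> \<theta> c d) \<in> borel_measurable borel"
proof -
 assume cd: "c < r" "d < r"
 have "continuous_on UNIV ((\<lambda>(\<alpha>, \<theta>). res \<alpha> \<theta> c d) \<circ> (\<lambda>\<theta>. (\<alpha>, \<theta>)))"
  by (intro continuous_on_compose continuous_intros continuous_on_subset[OF res_continuous[OF cd]]) auto
 then show ?thesis by (intro borel_measurable_continuous_onI) (simp add: o_def)
qed

lemma fc_bound: "c < r ==> d < r ==> cmod (fc \<alpha> s c d) \<le> 1 / \<eta>"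
 unfolding fc_def by (intro fcoef_bound res_borel res_bound)

lemma fc_lipschitz: "c < r ==> d < r ==> cmod (fc \<alpha> s c d - fc \<beta> s c d) \<le> \<bar>\<alpha> - \<beta>\<bar> * Kb / \<eta>\<^sup>2"
 unfolding fc_def
 by (subst fcoef_diff[OF res_borel res_bound res_borel res_bound]) 
   (auto intro!: fcoef_bound res_lipschitz borel_measurable_diff res_borel)

text \<open>The identity (sym - Z) res = 1, multiplied by the exponential of frequency -t and
  averaged over \<theta>: the coefficients \<open>fc\<close> invert the bi-infinite Toeplitz
  matrix.\<close>

lemma fc_convolution:
 assumes cd: "c < r" "d < r"
 shows "(\<Sum>e<r. \<Sum>s\<in>{- int w..int w}. of_real (\<alpha> * K s c e + L s c e) * fc \<alpha> (t - s) e d) - Z c * fc \<alpha> t c d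
   = (if t = 0 \<and> c = d then 1 else 0)"
proof -
 let ?I = "integral\<^sup>L circle_measure :: (real => complex) => complex"
 let ?F = "\<lambda>s e. of_real (\<alpha> * K s c e + L s c e)"
 have i: "integrable circle_measure (\<lambda>\<theta>. res \<alpha> \<theta> e d * cis (x * \<theta>))" if "e < r" for e x
  by (rule fcoef_integrable[OF res_borel res_bound]) (use that cd in auto)
 have "(\<Sum>e<r. \<Sum>s\<in>{- int w..int w}. ?F s e * ?I (\<lambda>\<theta>. res \<alpha> \<theta> e d * cis (- of_int (t - s) * \<theta>))) - Z c * ?I (\<lambda>\<theta>. res \<alpha> \<theta> c d * cis (- of_int t * \<theta>))
  = ?I (\<lambda>\<theta>. (\<Sum>e<r. \<Sum>s\<in>{- int w..int w}. ?F s e * (res \<alpha> \<theta> e d * cis (- of_int (t - s) * \<theta>))) - Z c * (res \<alpha> \<theta> c d * cis (- of_int t * \<theta>)))"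
 proof -
  have iS: "integrable circle_measure (\<lambda>\<theta>. ?F s e * (res \<alpha> \<theta> e d * cis (- of_int (t - s) * \<theta>)))" if "e \<in> {..<r}" for s e
   by (intro integrable_mult_right i) (use that in auto)
  have "?I (\<lambda>\<theta>. (\<Sum>e<r. \<Sum>s\<in>{- int w..int w}. ?F s e * (res \<alpha> \<theta> e d * cis (- of_int (t - s) * \<theta>))) - Z c * (res \<alpha> \<theta> c d * cis (- of_int t * \<theta>)))
   = ?I (\<lambda>\<theta>. \<Sum>e<r. \<Sum>s\<in>{- int w..int w}. ?F s e * (res \<alpha> \<theta> e d * cis (- of_int (t - s) * \<theta>))) - ?I (\<lambda>\<theta>. Z c * (res \<alpha> \<theta> c d * cis (- of_int t * \<theta>)))"
   by (intro Bochner_Integration.integral_diff Bochner_Integration.integrable_sum iS integrable_mult_right i cd(1))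
  also have "?I (\<lambda>\<theta>. \<Sum>e<r. \<Sum>s\<in>{- int w..int w}. ?F s e * (res \<alpha> \<theta> e d * cis (- of_int (t - s) * \<theta>)))
   = (\<Sum>e<r. ?I (\<lambda>\<theta>. \<Sum>s\<in>{- int w..int w}. ?F s e * (res \<alpha> \<theta> e d * cis (- of_int (t - s) * \<theta>))))"
   by (intro Bochner_Integration.integral_sum Bochner_Integration.integrable_sum iS)
  also have "\<dots> = (\<Sum>e<r. \<Sum>s\<in>{- int w..int w}. ?I (\<lambda>\<theta>. ?F s e * (res \<alpha> \<theta> e d * cis (- of_int (t - s) * \<theta>))))"
   by (intro sum.cong refl Bochner_Integration.integral_sum iS)
  also have "\<dots> = (\<Sum>e<r. \<Sum>s\<in>{- int w..int w}. ?F s e * ?I (\<lambda>\<theta>. res \<alpha> \<theta> e d * cis (- of_int (t - s) * \<theta>)))"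
   by (intro sum.cong refl integral_mult_right_zero)
  finally show ?thesis unfolding integral_mult_right_zero ..
 qed
 also have "\<dots> = ?I (\<lambda>\<theta>. (if c = d then 1 else 0) * cis (of_int (- t) * \<theta>))"
 proof (intro Bochner_Integration.integral_cong refl)
  fix \<theta>
  have "(\<Sum>e<r. \<Sum>s\<in>{- int w..int w}. ?F s e * (res \<alpha> \<theta> e d * cis (- of_int (t - s) * \<theta>)))
    = (\<Sum>e<r. sym \<alpha> \<theta> c e * res \<alpha> \<theta> e d) * cis (- of_int t * \<theta>)"
   unfolding sym_def sum_distrib_right
  proof (intro sum.cong refl)
   fix e s
   have "cis (- of_int (t - s) * \<theta>) = cis (of_int s * \<theta>) * cis (- of_int t * \<theta>)"
    by (simp add: cis_mult algebra_simps)
   then show "?F s e * (res \<alpha> \<theta> e d * cis (- of_int (t - s) * \<theta>)) = ?F s e * cis (of_int s * \<theta>) * res \<alpha> \<theta> e d * cis (- of_int t * \<theta>)"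
    by (simp only: mult_ac)
  qed
  moreover have "(\<Sum>e<r. sym \<alpha> \<theta> c e * res \<alpha> \<theta> e d) - Z c * res \<alpha> \<theta> c d = (if c = d then 1 else 0)"
  proof -
   have "(\<Sum>e<r. shiftd (sym \<alpha> \<theta>) Z c e * res \<alpha> \<theta> e d) = (if c = d then 1 else 0)"
    using res_inv[of \<alpha> \<theta>] cd by (simp add: inv_pair_def)
   moreover have "(\<Sum>e<r. shiftd (sym \<alpha> \<theta>) Z c e * res \<alpha> \<theta> e d)
     = (\<Sum>e<r. sym \<alpha> \<theta> c e * res \<alpha> \<theta> e d) - (\<Sum>e<r. if c = e then Z c * res \<alpha> \<theta> e d else 0)"
    unfolding sum_subtractf[symmetric] by (intro sum.cong refl) (simp add: shiftd_def algebra_simps)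
   ultimately show ?thesis using cd by simp
  qed
  ultimately show "(\<Sum>e<r. \<Sum>s\<in>{- int w..int w}. ?F s e * (res \<alpha> \<theta> e d * cis (- of_int (t - s) * \<theta>))) - Z c * (res \<alpha> \<theta> c d * cis (- of_int t * \<theta>))
   = (if c = d then 1 else 0) * cis (of_int (- t) * \<theta>)"
   by (simp only: mult.assoc[symmetric] left_diff_distrib[symmetric] of_int_minus)
 qed
 also have "\<dots> = (if c = d then 1 else 0) * ?I (\<lambda>\<theta>. cis (of_int (- t) * \<theta>))" by simp
 also have "\<dots> = (if t = 0 \<and> c = d then 1 else 0) * of_real (2 * pi)" unfolding circle_cis by auto
 finally have "((\<Sum>e<r. \<Sum>s\<in>{- int w..int w}. ?F s e * ?I (\<lambda>\<theta>. res \<alpha> \<theta> e d * cis (- of_int (t - s) * \<theta>))) - Z c * ?I (\<lambda>\<theta>. res \<alpha> \<theta> c d * cis (- of_int t * \<theta>)))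
   / of_real (2 * pi) = (if t = 0 \<and> c = d then 1 else 0)" by simp
 then show ?thesis
  unfolding fc_def fcoef_def by (simp only: diff_divide_distrib sum_divide_distrib times_divide_eq_right)
qed


lemma resolvent_trace_step:
 fixes X :: mat_fun and rho :: "nat => nat" and m :: "nat => int" and \<alpha> :: "nat => real"
 defines "N \<equiv> real (r * (2 * w + 1))"
 assumes X: "herm d X" and rho: "\<And>i. i < d ==> rho i < r" and inj: "inj_on (\<lambda>i. (rho i, m i)) {..<d}"
  and band: "\<And>i j. i < d ==> j < d ==> \<bar>m i - m j\<bar> > int w ==> X i j = 0"
  and bnd: "\<And>i j. i < d ==> j < d ==> cmod (X i j) \<le> b"
  and G: "G \<subseteq> {..<d}"
  and compl: "\<And>i c s. i \<in> G ==> c < r ==> \<bar>s\<bar> \<le> int w ==> \<exists>j<d. rho j = c \<and> m j = m i - s"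
  and close: "\<And>i j. i \<in> G ==> j < d ==> \<bar>m i - m j\<bar> \<le> int w ==>
    cmod (X i j - complex_of_real (\<alpha> i * K (m i - m j) (rho i) (rho j) + L (m i - m j) (rho i) (rho j))) \<le> \<delta>"
  and \<alpha>close: "\<And>i j. i \<in> G ==> j < d ==> \<bar>m i - m j\<bar> \<le> int w ==> \<bar>\<alpha> j - \<alpha> i\<bar> \<le> \<delta>"
  and A: "\<And>i. i < d ==> \<bar>\<alpha> i\<bar> \<le> A" and W: "\<And>c. c < r ==> cmod (W c) \<le> BW" and nn: "0 \<le> b" "0 \<le> \<delta>" "0 \<le> A" "0 \<le> BW"
 shows "cmod ((\<Sum>i<d. W (rho i) * fc (\<alpha> i) 0 (rho i) (rho i))
    - (\<Sum>i<d. W (rho i) * finv d (shiftd X (\<lambda>i. Z (rho i))) i i))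
   \<le> BW / \<eta> * (real d * (N * (sqrt r / \<eta>) + (N * (A * Kb + Lb) + Zb) * (sqrt r * (Kb / \<eta>\<^sup>2))) * \<delta>
     + real (card ({..<d} - G)) * ((N * b + Zb) * (sqrt r / \<eta>) + 1))"
proof -
 define T where "T = shiftd X (\<lambda>i. Z (rho i))"
 have dT: "dissipative \<eta> d T" unfolding T_def by (rule dissipative_shiftd[OF X]) (use Z rho in auto)
 define H where "H = finv d T"
 have H: "inv_pair d T H" unfolding H_def by (rule dissipative_inv[OF dT \<eta>])
 define R where "R i j = fc (\<alpha> i) (m i - m j) (rho i) (rho j)" for i j
 define E where "E i j = (\<Sum>k<d. T i k * R k j) - (if i = j then 1 else 0)" for i j
 let ?n = "\<lambda>f. L2_set (\<lambda>j. cmod (f j)) {..<d}"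
 define B where "B i = {j \<in> {..<d}. \<bar>m i - m j\<bar> \<le> int w}" for i
 have finB: "finite (B i)" for i by (simp add: B_def)
 have injB: "inj_on (\<lambda>j. (rho j, m i - m j)) (B i)" for i
  using inj unfolding inj_on_def B_def by auto
 have cardB: "real (card (B i)) \<le> N" for i
 proof -
  have "card (B i) = card ((\<lambda>j. (rho j, m i - m j)) ` B i)" by (simp add: card_image[OF injB])
  also have "\<dots> \<le> card ({..<r} \<times> {- int w..int w})"
   by (rule card_mono) (auto simp: B_def rho)
  also have "\<dots> = r * (2 * w + 1)" by (simp add: card_cartesian_product nat_add_distrib nat_mult_distrib)
  finally show ?thesis unfolding N_def by (simp only: of_nat_le_iff)
 qed
 have Rn: "?n (R i) \<le> sqrt r / \<eta>" if "i < d" for i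
  unfolding R_def fc_def
  using coef_row_bound[OF inj rho, of "\<lambda>c \<theta>. res (\<alpha> i) \<theta> (rho i) c" "1 / \<eta>" "m i"] res_borel res_bound rho[OF that] \<eta>
  by simp
 have split: "(\<Sum>k<d. shiftd Y (\<lambda>i. Z (rho i)) i k * S k) = (\<Sum>k\<in>B i. Y i k * S k) - Z (rho i) * S i"
  if i: "i < d" and Y: "\<And>k. k < d ==> \<bar>m i - m k\<bar> > int w ==> Y i k = 0" for Y i S
 proof -
  have "(\<Sum>k<d. shiftd Y (\<lambda>i. Z (rho i)) i k * S k) = (\<Sum>k<d. Y i k * S k) - (\<Sum>k<d. if i = k then Z (rho i) * S k else 0)"
   unfolding sum_subtractf[symmetric] by (intro sum.cong refl) (simp add: shiftd_def algebra_simps)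
  also have "(\<Sum>k<d. Y i k * S k) = (\<Sum>k\<in>B i. Y i k * S k)"
  proof (rule sum.mono_neutral_right)
   show "\<forall>k\<in>{..<d} - B i. Y i k * S k = 0"
   proof
    fix k assume "k \<in> {..<d} - B i"
    then have "k < d" "\<bar>m i - m k\<bar> > int w" by (auto simp: B_def)
    then show "Y i k * S k = 0" by (simp add: Y)
   qed
  qed (auto simp: B_def)
  finally show ?thesis using i by simp
 qed
 have Ebad: "?n (E i) \<le> (N * b + Zb) * (sqrt r / \<eta>) + 1" if i: "i < d" for i
 proof -
  have Eb: "E i j = (\<Sum>k\<in>B i. X i k * R k j) + ((- Z (rho i)) * R i j + - (if i = j then 1 else 0))" for j
   unfolding E_def T_def using split[OF i, of X "\<lambda>k. R k j"] band[OF i] by simp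
  have "cmod (E i j) \<le> cmod (\<Sum>k\<in>B i. X i k * R k j) + (cmod (- Z (rho i)) * cmod (R i j) + cmod (if i = j then 1 else 0))" for j
   unfolding Eb by (rule order_trans[OF norm_triangle3]) (simp add: norm_mult)
  then have "?n (E i) \<le> L2_set (\<lambda>j. cmod (\<Sum>k\<in>B i. X i k * R k j) + (cmod (- Z (rho i)) * cmod (R i j) + cmod (if i = j then 1 else 0))) {..<d}"
   by (intro L2_set_mono) auto
  also have "\<dots> \<le> ?n (\<lambda>j. \<Sum>k\<in>B i. X i k * R k j) + (L2_set (\<lambda>j. cmod (- Z (rho i)) * cmod (R i j)) {..<d} + ?n (\<lambda>j. if i = j then 1 else 0))"
   by (intro order_trans[OF L2_set_triangle_ineq] add_left_mono L2_set_triangle_ineq)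
  also have "?n (\<lambda>j. \<Sum>k\<in>B i. X i k * R k j) \<le> (\<Sum>k\<in>B i. b * (sqrt r / \<eta>))"
   using bnd[OF i] Rn nn by (intro order_trans[OF L2_set_sum_mult_le[OF finB]] sum_mono mult_mono) (auto simp: B_def L2_set_nonneg)
  also have "\<dots> = real (card (B i)) * (b * (sqrt r / \<eta>))" by simp
  also have "\<dots> \<le> N * (b * (sqrt r / \<eta>))" using cardB nn \<eta> by (intro mult_right_mono) auto
  also have "L2_set (\<lambda>j. cmod (- Z (rho i)) * cmod (R i j)) {..<d} = cmod (Z (rho i)) * ?n (R i)"
   by (simp add: L2_set_right_distrib)
  also have "\<dots> \<le> Zb * (sqrt r / \<eta>)"
   using Rn[OF i] Z_le[OF rho[OF i]] bounds_nonneg by (intro mult_mono) (auto simp: L2_set_nonneg)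
  also have "?n (\<lambda>j. if i = j then 1 else 0) = 1"
  proof -
   have "(\<Sum>j<d. (cmod (if i = j then 1 else 0))\<^sup>2) = (\<Sum>j<d. if i = j then 1 else (0::real))"
    by (intro sum.cong) auto
   then show ?thesis using i by (simp add: L2_set_def)
  qed
  finally show ?thesis by (simp add: algebra_simps)
 qed
 have Egood: "?n (E i) \<le> (N * (sqrt r / \<eta>) + (N * (A * Kb + Lb) + Zb) * (sqrt r * (Kb / \<eta>\<^sup>2))) * \<delta>" if i: "i \<in> G" for i
 proof -
  have id: "i < d" using i G by auto
  define F where "F k = complex_of_real (\<alpha> i * K (m i - m k) (rho i) (rho k) + L (m i - m k) (rho i) (rho k))" for k
  \<comment> \<open>The rows of R inside the band are frozen at different values
    \<open>\<alpha> k\<close>. Q freezes all of them at \<open>\<alpha> i\<close>, so that the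
    convolution identity holds exactly and R - Q is a Lipschitz error.\<close>
  define Q where "Q k j = fc (\<alpha> i) (m k - m j) (rho k) (rho j)" for k j
  \<comment> \<open>Completeness of the band and injectivity turn the sum over the neighbours of i
    into the full sum over components and offsets in the convolution identity.\<close>
  have bij: "bij_betw (\<lambda>j. (rho j, m i - m j)) (B i) ({..<r} \<times> {- int w..int w})"
   unfolding bij_betw_def
  proof
   show "(\<lambda>j. (rho j, m i - m j)) ` B i = {..<r} \<times> {- int w..int w}"
   proof
    show "{..<r} \<times> {- int w..int w} \<subseteq> (\<lambda>j. (rho j, m i - m j)) ` B i"
    proof
     fix p assume "p \<in> {..<r} \<times> {- int w..int w}"
     then obtain c s where p: "p = (c, s)" "c < r" "\<bar>s\<bar> \<le> int w" by auto
     then obtain j where "j < d" "rho j = c" "m j = m i - s" using compl[OF i] by blast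
     then show "p \<in> (\<lambda>j. (rho j, m i - m j)) ` B i" using p by (auto simp: B_def image_iff intro!: exI[of _ j])
    qed
   qed (auto simp: B_def rho)
  qed (rule injB)
  have FQ: "(\<Sum>k\<in>B i. F k * Q k j) - Z (rho i) * Q i j = (if i = j then 1 else 0)" if j: "j < d" for j
  proof -
   have "(\<Sum>k\<in>B i. F k * Q k j)
     = (\<Sum>k\<in>B i. (\<lambda>(e, s). complex_of_real (\<alpha> i * K s (rho i) e + L s (rho i) e) * fc (\<alpha> i) ((m i - m j) - s) e (rho j)) (rho k, m i - m k))"
    by (intro sum.cong refl) (simp add: F_def Q_def)
   also have "\<dots> = (\<Sum>(e, s)\<in>{..<r} \<times> {- int w..int w}. complex_of_real (\<alpha> i * K s (rho i) e + L s (rho i) e) * fc (\<alpha> i) ((m i - m j) - s) e (rho j))"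
    by (rule sum.reindex_bij_betw[OF bij])
   also have "\<dots> = (\<Sum>e<r. \<Sum>s\<in>{- int w..int w}. complex_of_real (\<alpha> i * K s (rho i) e + L s (rho i) e) * fc (\<alpha> i) ((m i - m j) - s) e (rho j))"
    by (simp add: sum.cartesian_product)
   finally have "(\<Sum>k\<in>B i. F k * Q k j) - Z (rho i) * Q i j = (if m i - m j = 0 \<and> rho i = rho j then 1 else 0)"
    unfolding Q_def using fc_convolution[OF rho[OF id] rho[OF j], of "\<alpha> i" "m i - m j"] by simp
   moreover have "m i - m j = 0 \<and> rho i = rho j \<longleftrightarrow> i = j" using inj id j by (auto simp: inj_on_def)
   ultimately show ?thesis by simp
  qed
  have Eeq: "E i j = (\<Sum>k\<in>B i. (X i k - F k) * R k j) + ((\<Sum>k\<in>B i. F k * (R k j - Q k j)) + (- Z (rho i)) * (R i j - Q i j))" if j: "j < d" for j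
  proof -
   have "E i j = (\<Sum>k\<in>B i. X i k * R k j) - Z (rho i) * R i j - ((\<Sum>k\<in>B i. F k * Q k j) - Z (rho i) * Q i j)"
    unfolding FQ[OF j] E_def T_def using split[OF id, of X "\<lambda>k. R k j"] band[OF id] by simp
   then show ?thesis by (simp add: algebra_simps sum_subtractf)
  qed
  have RQ: "?n (\<lambda>j. R k j - Q k j) \<le> sqrt r * (Kb / \<eta>\<^sup>2) * \<delta>" if k: "k \<in> B i" for k
  proof -
   have kd: "k < d" "rho k < r" using k rho by (auto simp: B_def)
   have ak: "\<bar>\<alpha> k - \<alpha> i\<bar> \<le> \<delta>" using \<alpha>close[OF i kd(1)] k by (simp add: B_def)
   have "R k j - Q k j = fcoef (\<lambda>\<theta>. res (\<alpha> k) \<theta> (rho k) (rho j) - res (\<alpha> i) \<theta> (rho k) (rho j)) (m k - m j)" if "j < d" for j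
    unfolding R_def Q_def fc_def
    by (rule fcoef_diff[OF res_borel res_bound res_borel res_bound]) (use kd rho that in auto)
   then have "?n (\<lambda>j. R k j - Q k j) = L2_set (\<lambda>j. cmod (fcoef (\<lambda>\<theta>. res (\<alpha> k) \<theta> (rho k) (rho j) - res (\<alpha> i) \<theta> (rho k) (rho j)) (m k - m j))) {..<d}"
    by (intro L2_set_cong) auto
   also have "\<dots> \<le> sqrt r * (\<bar>\<alpha> k - \<alpha> i\<bar> * Kb / \<eta>\<^sup>2)"
    using bounds_nonneg by (intro coef_row_bound[OF inj rho, of "\<lambda>c \<theta>. res (\<alpha> k) \<theta> (rho k) c - res (\<alpha> i) \<theta> (rho k) c"] borel_measurable_diff res_borel res_lipschitz kd)
      auto
   also have "\<dots> \<le> sqrt r * (\<delta> * Kb / \<eta>\<^sup>2)"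
    using ak bounds_nonneg by (intro mult_left_mono divide_right_mono mult_right_mono) auto
   finally show ?thesis by (simp add: mult_ac)
  qed
  have iB: "i \<in> B i" using id by (simp add: B_def)
  have ring: "N * (\<delta> * u) + (N * (M * (v * \<delta>)) + Zb * (v * \<delta>)) = (N * u + (N * M + Zb) * v) * \<delta>" for u v M
   by (simp add: algebra_simps)
  have "?n (E i) = L2_set (\<lambda>j. cmod ((\<Sum>k\<in>B i. (X i k - F k) * R k j) + ((\<Sum>k\<in>B i. F k * (R k j - Q k j)) + (- Z (rho i)) * (R i j - Q i j)))) {..<d}"
   by (intro L2_set_cong) (auto simp: Eeq)
  also have "\<dots> \<le> L2_set (\<lambda>j. cmod (\<Sum>k\<in>B i. (X i k - F k) * R k j) + (cmod (\<Sum>k\<in>B i. F k * (R k j - Q k j)) + cmod (- Z (rho i)) * cmod (R i j - Q i j))) {..<d}"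
   by (intro L2_set_mono) (rule order_trans[OF norm_triangle3], simp add: norm_mult, simp)
  also have "\<dots> \<le> ?n (\<lambda>j. \<Sum>k\<in>B i. (X i k - F k) * R k j) + (?n (\<lambda>j. \<Sum>k\<in>B i. F k * (R k j - Q k j)) + L2_set (\<lambda>j. cmod (- Z (rho i)) * cmod (R i j - Q i j)) {..<d})"
   by (intro order_trans[OF L2_set_triangle_ineq] add_left_mono L2_set_triangle_ineq)
  also have "?n (\<lambda>j. \<Sum>k\<in>B i. (X i k - F k) * R k j) \<le> (\<Sum>k\<in>B i. \<delta> * (sqrt r / \<eta>))"
   using close[OF i] Rn nn unfolding F_def
   by (intro order_trans[OF L2_set_sum_mult_le[OF finB]] sum_mono mult_mono) (auto simp: B_def L2_set_nonneg)
  also have "\<dots> = real (card (B i)) * (\<delta> * (sqrt r / \<eta>))" by simp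
  also have "\<dots> \<le> N * (\<delta> * (sqrt r / \<eta>))" using cardB nn \<eta> by (intro mult_right_mono) auto
  also have "?n (\<lambda>j. \<Sum>k\<in>B i. F k * (R k j - Q k j)) \<le> (\<Sum>k\<in>B i. (A * Kb + Lb) * (sqrt r * (Kb / \<eta>\<^sup>2) * \<delta>))"
  proof (intro order_trans[OF L2_set_sum_mult_le[OF finB]] sum_mono mult_mono)
   fix k assume k: "k \<in> B i"
   then have kr: "rho k < r" using rho by (auto simp: B_def)
   have "cmod (F k) \<le> \<bar>\<alpha> i\<bar> * \<bar>K (m i - m k) (rho i) (rho k)\<bar> + \<bar>L (m i - m k) (rho i) (rho k)\<bar>"
    unfolding F_def norm_of_real by (rule order_trans[OF abs_triangle_ineq]) (simp add: abs_mult)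
   also have "\<dots> \<le> A * Kb + Lb"
    using A[OF id] K_le[OF rho[OF id] kr] L_le[OF rho[OF id] kr] nn by (intro add_mono mult_mono) auto
   finally show "cmod (F k) \<le> A * Kb + Lb" .
  qed (use RQ bounds_nonneg nn in \<open>auto simp: L2_set_nonneg\<close>)
  also have "\<dots> = real (card (B i)) * ((A * Kb + Lb) * (sqrt r * (Kb / \<eta>\<^sup>2) * \<delta>))" by simp
  also have "\<dots> \<le> N * ((A * Kb + Lb) * (sqrt r * (Kb / \<eta>\<^sup>2) * \<delta>))"
   using cardB nn bounds_nonneg by (intro mult_right_mono) auto
  also have "L2_set (\<lambda>j. cmod (- Z (rho i)) * cmod (R i j - Q i j)) {..<d} = cmod (Z (rho i)) * ?n (\<lambda>j. R i j - Q i j)"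
   by (simp add: L2_set_right_distrib)
  also have "\<dots> \<le> Zb * (sqrt r * (Kb / \<eta>\<^sup>2) * \<delta>)"
   using RQ[OF iB] Z_le[OF rho[OF id]] bounds_nonneg by (intro mult_mono) (auto simp: L2_set_nonneg)
  finally have "?n (E i) \<le> N * (\<delta> * (sqrt r / \<eta>)) + (N * ((A * Kb + Lb) * (sqrt r * (Kb / \<eta>\<^sup>2) * \<delta>)) + Zb * (sqrt r * (Kb / \<eta>\<^sup>2) * \<delta>))"
   by simp
  then show ?thesis unfolding ring .
 qed
 have RH: "R i j - H i j = (\<Sum>k<d. H i k * E k j)" if ij: "i < d" "j < d" for i j
 proof -
  have "(\<Sum>k<d. H i k * E k j) = (\<Sum>k<d. H i k * (\<Sum>l<d. T k l * R l j)) - (\<Sum>k<d. if k = j then H i k else 0)"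
   unfolding E_def sum_subtractf[symmetric] by (intro sum.cong refl) (simp add: algebra_simps)
  also have "(\<Sum>k<d. H i k * (\<Sum>l<d. T k l * R l j)) = R i j"
  proof (rule inv_pair_apply[where T = H and G = T])
   show "inv_pair d H T" using H by (auto simp: inv_pair_def)
  qed fact
  finally show ?thesis using ij by simp
 qed
 have "(\<Sum>i<d. W (rho i) * fc (\<alpha> i) 0 (rho i) (rho i)) - (\<Sum>i<d. W (rho i) * H i i)
   = (\<Sum>i<d. \<Sum>k<d. W (rho i) * (H i k * E k i))"
  unfolding sum_subtractf[symmetric]
 proof (intro sum.cong refl)
  fix i assume "i \<in> {..<d}"
  then have "R i i - H i i = (\<Sum>k<d. H i k * E k i)" by (intro RH) auto
  moreover have "fc (\<alpha> i) 0 (rho i) (rho i) = R i i" by (simp add: R_def)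
  ultimately show "W (rho i) * fc (\<alpha> i) 0 (rho i) (rho i) - W (rho i) * H i i = (\<Sum>k<d. W (rho i) * (H i k * E k i))"
   by (simp add: right_diff_distrib[symmetric] sum_distrib_left[symmetric])
 qed
 also have "\<dots> = (\<Sum>k<d. \<Sum>i<d. (W (rho i) * H i k) * E k i)"
  by (subst sum.swap) (simp add: mult.assoc)
 also have "cmod \<dots> \<le> (\<Sum>k<d. BW / \<eta> * ?n (E k))"
 proof (rule order_trans[OF norm_sum], rule sum_mono)
  fix k assume k: "k \<in> {..<d}"
  have "?n (\<lambda>i. W (rho i) * H i k) \<le> L2_set (\<lambda>i. BW * cmod (H i k)) {..<d}"
   using W rho by (intro L2_set_mono) (auto simp: norm_mult intro!: mult_right_mono)
  also have "\<dots> = BW * ?n (\<lambda>i. H i k)" using nn by (simp add: L2_set_right_distrib)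
  also have "\<dots> \<le> BW * (1 / \<eta>)" using dissipative_col_row(1)[OF dT H \<eta>] k nn by (intro mult_left_mono) auto
  finally have "?n (\<lambda>i. W (rho i) * H i k) * ?n (E k) \<le> BW / \<eta> * ?n (E k)"
   by (intro mult_right_mono) (auto simp: L2_set_nonneg)
  then show "cmod (\<Sum>i<d. W (rho i) * H i k * E k i) \<le> BW / \<eta> * ?n (E k)"
   using norm_sum_mult_le_L2[of "\<lambda>i. W (rho i) * H i k" "E k" "{..<d}"] by linarith
 qed
 also have "\<dots> = BW / \<eta> * (\<Sum>k<d. ?n (E k))" by (simp add: sum_distrib_left)
 finally have main: "cmod ((\<Sum>i<d. W (rho i) * fc (\<alpha> i) 0 (rho i) (rho i)) - (\<Sum>i<d. W (rho i) * H i i)) \<le> BW / \<eta> * (\<Sum>k<d. ?n (E k))" .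
 have "(\<Sum>k<d. ?n (E k)) = (\<Sum>k\<in>G. ?n (E k)) + (\<Sum>k\<in>{..<d} - G. ?n (E k))"
  using G by (simp add: sum.subset_diff add.commute)
 also have "\<dots> \<le> real (card G) * ((N * (sqrt r / \<eta>) + (N * (A * Kb + Lb) + Zb) * (sqrt r * (Kb / \<eta>\<^sup>2))) * \<delta>)
   + real (card ({..<d} - G)) * ((N * b + Zb) * (sqrt r / \<eta>) + 1)"
  using Egood Ebad by (intro add_mono sum_bounded_above) auto
 also have "\<dots> \<le> real d * ((N * (sqrt r / \<eta>) + (N * (A * Kb + Lb) + Zb) * (sqrt r * (Kb / \<eta>\<^sup>2))) * \<delta>)
   + real (card ({..<d} - G)) * ((N * b + Zb) * (sqrt r / \<eta>) + 1)"
 proof (intro add_right_mono mult_right_mono)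
  show "real (card G) \<le> real d" using card_mono[OF _ G] by simp
  show "0 \<le> (N * (sqrt r / \<eta>) + (N * (A * Kb + Lb) + Zb) * (sqrt r * (Kb / \<eta>\<^sup>2))) * \<delta>"
   using nn \<eta> bounds_nonneg by (simp add: N_def)
 qed
 finally have "BW / \<eta> * (\<Sum>k<d. ?n (E k)) \<le> BW / \<eta> * (real d * ((N * (sqrt r / \<eta>) + (N * (A * Kb + Lb) + Zb) * (sqrt r * (Kb / \<eta>\<^sup>2))) * \<delta>)
   + real (card ({..<d} - G)) * ((N * b + Zb) * (sqrt r / \<eta>) + 1))"
  using nn \<eta> by (intro mult_left_mono) auto
 from order_trans[OF main this] show ?thesis
  unfolding H_def T_def by (simp only: mult.assoc)
qed

end

section \<open>Trace limits with variable coefficients\<close>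

lemma uniformly_continuous_UNIV_E:
 assumes "uniformly_continuous_on UNIV f" "0 < e"
 obtains \<delta> where "0 < \<delta>" "\<And>x y. dist x y < \<delta> ==> dist (f x) (f y) < e"
proof -
 obtain \<delta> where "0 < \<delta>" "\<forall>x y. dist y x < \<delta> \<longrightarrow> dist (f y) (f x) < e"
  using assms unfolding uniformly_continuous_on_def by auto
 then show thesis using that by blast
qed

lemma uniformly_continuous_on_subset:
 fixes f :: "'a::metric_space => 'b::metric_space"
 shows "uniformly_continuous_on A f ==> B \<subseteq> A ==> uniformly_continuous_on B f"
 unfolding uniformly_continuous_on_def by (meson subsetD)

lemma riemann_sum_limit:
 fixes g :: "real => complex"
 assumes uc: "uniformly_continuous_on UNIV g"
 shows "(\<lambda>n. (\<Sum>k<n. g (real k / real n)) / of_nat n) \<longlonglongrightarrow> integral {0..1} g"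
proof (rule metric_LIMSEQ_I)
 fix e :: real assume e: "0 < e"
 then obtain \<delta> where \<delta>: "0 < \<delta>" "\<And>x y. dist x y < \<delta> ==> dist (g x) (g y) < e / 2"
  using uniformly_continuous_UNIV_E[OF uc, of "e / 2"] by auto
 obtain N where N: "0 < N" "1 / real N < \<delta>"
  using real_arch_inverse[of \<delta>] \<delta>(1) by (auto simp: inverse_eq_divide)
 have cont: "continuous_on S g" for S
  using uniformly_continuous_imp_continuous[OF uc] continuous_on_subset by blast
 have "dist ((\<Sum>k<n. g (real k / real n)) / of_nat n) (integral {0..1} g) < e" if n: "N \<le> n" for n
 proof -
  have n0: "0 < n" using n N by simp
  have h: "1 / real n < \<delta>" using N n n0 by (smt (verit) frac_le of_nat_0_less_iff of_nat_le_iff)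
  have I: "integral {0..real k / real n} g = (\<Sum>j<k. integral {real j / real n..real (Suc j) / real n} g)" for k
  proof (induction k)
   case (Suc k)
   have "integral {0..real (Suc k) / real n} g = integral {0..real k / real n} g + integral {real k / real n..real (Suc k) / real n} g"
    by (rule Henstock_Kurzweil_Integration.integral_combine[symmetric]) (auto intro!: integrable_continuous_real cont divide_right_mono)
   then show ?case using Suc by simp
  qed simp
  have piece: "cmod (integral {real j / real n..real (Suc j) / real n} g - g (real j / real n) / of_nat n) \<le> e / 2 * (1 / real n)" for j
  proof -
   have le: "real j / real n \<le> real (Suc j) / real n" by (intro divide_right_mono) auto
   have w: "real (Suc j) / real n - real j / real n = 1 / real n" by (simp add: diff_divide_distrib[symmetric])
   have "integral {real j / real n..real (Suc j) / real n} (\<lambda>x. g x - g (real j / real n))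
     = integral {real j / real n..real (Suc j) / real n} g - integral {real j / real n..real (Suc j) / real n} (\<lambda>x. g (real j / real n))"
    by (rule Henstock_Kurzweil_Integration.integral_diff) (auto intro!: integrable_continuous_real cont)
   also have "integral {real j / real n..real (Suc j) / real n} (\<lambda>x. g (real j / real n)) = g (real j / real n) / of_nat n"
    using le w by (simp add: scaleR_conv_of_real field_simps)
   finally have eq: "integral {real j / real n..real (Suc j) / real n} g - g (real j / real n) / of_nat n
     = integral {real j / real n..real (Suc j) / real n} (\<lambda>x. g x - g (real j / real n))" by simp
   show ?thesis unfolding eq w[symmetric]
   proof (rule integral_bound[OF le])
    show "continuous_on {real j / real n..real (Suc j) / real n} (\<lambda>x. g x - g (real j / real n))"
     by (intro continuous_intros cont)
    fix t assume t: "t \<in> {real j / real n..real (Suc j) / real n}"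
    then have "\<bar>t - real j / real n\<bar> \<le> 1 / real n" using w by auto
    then have "dist t (real j / real n) < \<delta>" using h by (simp add: dist_real_def)
    then show "cmod (g t - g (real j / real n)) \<le> e / 2" using \<delta>(2) by (fastforce simp: dist_norm)
   qed
  qed
  have "integral {0..1} g - (\<Sum>k<n. g (real k / real n)) / of_nat n
    = (\<Sum>j<n. integral {real j / real n..real (Suc j) / real n} g - g (real j / real n) / of_nat n)"
   using I[of n] n0 by (simp add: sum_subtractf sum_divide_distrib)
  also have "cmod \<dots> \<le> (\<Sum>j<n. e / 2 * (1 / real n))"
   by (rule order_trans[OF norm_sum], rule sum_mono, rule piece)
  also have "\<dots> = e / 2" using n0 by simp
  finally show ?thesis using e by (simp add: dist_norm norm_minus_commute)
 qed
 then show "\<exists>N. \<forall>n\<ge>N. dist ((\<Sum>k<n. g (real k / real n)) / of_nat n) (integral {0..1} g) < e" by blast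
qed

text \<open>Truncate at a level K, then take continuous functions converging almost everywhere to
  the truncation, clamped to the same level; dominated convergence is used for both. Composing with
  the projection \<open>c\<close> onto [0, 1] keeps the values there and gives uniform continuity on
  the whole line.\<close>

lemma L1_uniformly_continuous_approx:
 fixes a :: "real => real"
 assumes a[measurable]: "a \<in> borel_measurable borel" and int: "set_integrable lborel {0..1} a" and e: "0 < e"
 obtains f where "uniformly_continuous_on UNIV f" "\<exists>A. \<forall>x. \<bar>f x\<bar> \<le> A"
  "(LINT x:{0..1}|lborel. \<bar>a x - f x\<bar>) < e"
proof -
 define T where "T K x = max (- real K) (min (real K) (a x))" for K :: nat and x
 have [measurable]: "T K \<in> borel_measurable borel" for K unfolding T_def by measurable
 have Tb: "\<bar>T K x\<bar> \<le> real K" for K x unfolding T_def by auto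
 have Ta: "\<bar>a x - T K x\<bar> \<le> \<bar>a x\<bar>" for K x unfolding T_def by auto
 have lim1: "(\<lambda>K. LINT x|lborel. indicator {0..1} x * \<bar>a x - T K x\<bar>) \<longlonglongrightarrow> (LINT x|(lborel :: real measure). 0)"
 proof (rule integral_dominated_convergence[where w = "\<lambda>x. indicator {0..1} x * \<bar>a x\<bar>"])
  show "integrable lborel (\<lambda>x. indicator {0..1} x * \<bar>a x\<bar>)"
   using set_integrable_abs[OF int] by (simp add: set_integrable_def)
  show "AE x in lborel. (\<lambda>K. indicator {0..1} x * \<bar>a x - T K x\<bar>) \<longlonglongrightarrow> 0"
  proof (intro AE_I2)
   fix x :: real
   obtain K0 :: nat where "\<bar>a x\<bar> \<le> real K0" using real_arch_simple by blast
   then have "\<forall>K\<ge>K0. indicator {0..1} x * \<bar>a x - T K x\<bar> = 0" unfolding T_def by auto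
   then show "(\<lambda>K. indicator {0..1} x * \<bar>a x - T K x\<bar>) \<longlonglongrightarrow> 0"
    by (intro tendsto_eventually) (auto simp: eventually_sequentially)
  qed
  show "AE x in lborel. norm (indicator {0..1} x * \<bar>a x - T K x\<bar>) \<le> indicator {0..1} x * \<bar>a x\<bar>" for K
   using Ta by (auto simp: abs_mult intro!: AE_I2 mult_left_mono)
 qed auto
 then obtain K where K: "\<bar>LINT x|lborel. indicator {0..1} x * \<bar>a x - T K x\<bar>\<bar> < e / 2"
  using LIMSEQ_D[OF lim1, of "e / 2"] e by auto
 have "T K \<in> borel_measurable lebesgue" by (simp add: measurable_completion)
 then have "T K measurable_on UNIV" by (rule lebesgue_measurable_imp_measurable_on_real) simp
 then obtain N g where N: "negligible N" and g: "\<And>n. continuous_on UNIV (g n)"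
  and lim: "\<And>x. x \<notin> N ==> (\<lambda>n. g n x) \<longlonglongrightarrow> T K x"
  unfolding measurable_on_def by auto
 define G where "G n x = max (- real K) (min (real K) (g n x))" for n :: nat and x
 have Gc: "continuous_on UNIV (G n)" for n unfolding G_def by (intro continuous_intros g)
 have [measurable]: "G n \<in> borel_measurable borel" for n by (rule borel_measurable_continuous_onI[OF Gc])
 have Gb: "\<bar>G n x\<bar> \<le> real K" for n x unfolding G_def by auto
 have lim2: "(\<lambda>n. LINT x|lborel. indicator {0..1} x * \<bar>T K x - G n x\<bar>) \<longlonglongrightarrow> (LINT x|(lborel :: real measure). 0)"
 proof (rule integral_dominated_convergence[where w = "\<lambda>x. indicator {0..1} x * (2 * real K)"])
  show "integrable lborel (\<lambda>x::real. indicator {0..1} x * (2 * real K))"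
   by (intro integrable_mult_left integrable_real_indicator) (auto simp: emeasure_lborel_Icc_eq)
  have "AE x in lborel. x \<notin> N"
  proof -
   have "AE x in lebesgue. x \<notin> N" using N unfolding negligible_iff_null_sets by (rule AE_not_in)
   then show ?thesis by (simp only: AE_completion_iff)
  qed
  then show "AE x in lborel. (\<lambda>n. indicator {0..1} x * \<bar>T K x - G n x\<bar>) \<longlonglongrightarrow> 0"
  proof eventually_elim
   fix x assume "x \<notin> N"
   then have "(\<lambda>n. G n x) \<longlonglongrightarrow> max (- real K) (min (real K) (T K x))"
    unfolding G_def by (intro tendsto_intros lim)
   moreover have "max (- real K) (min (real K) (T K x)) = T K x" using Tb[of K x] by auto
   ultimately have "(\<lambda>n. indicator {0..1} x * \<bar>T K x - G n x\<bar>) \<longlonglongrightarrow> indicator {0..1} x * \<bar>T K x - T K x\<bar>"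
    by (intro tendsto_intros) auto
   then show "(\<lambda>n. indicator {0..1} x * \<bar>T K x - G n x\<bar>) \<longlonglongrightarrow> 0" by simp
  qed
  show "AE x in lborel. norm (indicator {0..1} x * \<bar>T K x - G n x\<bar>) \<le> indicator {0..1} x * (2 * real K)" for n
  proof (intro AE_I2)
   fix x
   have "\<bar>T K x - G n x\<bar> \<le> 2 * real K" using Tb[of K x] Gb[of n x] by linarith
   then show "norm (indicator {0..1} x * \<bar>T K x - G n x\<bar>) \<le> indicator {0..1} x * (2 * real K)"
    by (auto simp: indicator_def)
  qed
 qed auto
 then obtain n where n: "\<bar>LINT x|lborel. indicator {0..1} x * \<bar>T K x - G n x\<bar>\<bar> < e / 2"
  using LIMSEQ_D[OF lim2, of "e / 2"] e by auto
 define c where "c x = max 0 (min 1 x)" for x :: real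
 have c: "c x \<in> {0..1}" "x \<in> {0..1} ==> c x = x" for x by (auto simp: c_def)
 have "uniformly_continuous_on {0..1} (G n)"
  by (intro compact_uniformly_continuous continuous_on_subset[OF Gc]) auto
 moreover have "uniformly_continuous_on UNIV c"
  unfolding uniformly_continuous_on_def
 proof (intro allI impI)
  fix e :: real assume "0 < e"
  moreover have "dist (c x) (c y) \<le> dist x y" for x y unfolding c_def dist_real_def by auto
  ultimately show "\<exists>d>0. \<forall>x\<in>UNIV. \<forall>x'\<in>UNIV. dist x' x < d \<longrightarrow> dist (c x') (c x) < e"
   using order_le_less_trans by (intro exI[of _ e]) blast
 qed
 ultimately have uc: "uniformly_continuous_on UNIV (\<lambda>x. G n (c x))"
  using uniformly_continuous_on_compose[of UNIV c "G n"] uniformly_continuous_on_subset[of "{0..1}" "G n" "c ` UNIV"] c(1)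
  by (simp add: image_subset_iff)
 have i1: "integrable lborel (\<lambda>x. indicator {0..1} x * \<bar>a x - T K x\<bar>)"
 proof (rule Bochner_Integration.integrable_bound)
  show "integrable lborel (\<lambda>x. indicator {0..1} x * \<bar>a x\<bar>)"
   using set_integrable_abs[OF int] by (simp add: set_integrable_def)
 qed (use Ta in \<open>auto simp: abs_mult intro!: AE_I2 mult_left_mono\<close>)
 have i2: "integrable lborel (\<lambda>x. indicator {0..1} x * \<bar>T K x - G n x\<bar>)"
 proof (rule Bochner_Integration.integrable_bound)
  show "integrable lborel (\<lambda>x. indicator {0..1::real} x * (2 * real K))"
   by (intro integrable_mult_left integrable_real_indicator) auto
  have "\<bar>T K x - G n x\<bar> \<le> 2 * real K" for x using Tb[of K x] Gb[of n x] by linarith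
  then show "AE x in lborel. norm (indicator {0..1} x * \<bar>T K x - G n x\<bar>) \<le> norm (indicator {0..1} x * (2 * real K))"
   by (auto simp: indicator_def intro!: AE_I2)
 qed auto
 have "(LINT x:{0..1}|lborel. \<bar>a x - G n (c x)\<bar>) = (LINT x|lborel. indicator {0..1} x * \<bar>a x - G n x\<bar>)"
  unfolding set_lebesgue_integral_def
  by (intro Bochner_Integration.integral_cong) (auto simp: indicator_def c(2))
 also have "\<dots> \<le> (LINT x|lborel. indicator {0..1} x * \<bar>a x - T K x\<bar> + indicator {0..1} x * \<bar>T K x - G n x\<bar>)"
 proof (rule integral_mono)
  show "integrable lborel (\<lambda>x. indicator {0..1} x * \<bar>a x - G n x\<bar>)"
  proof (rule Bochner_Integration.integrable_bound[OF Bochner_Integration.integrable_add[OF i1 i2]])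
   show "AE x in lborel. norm (indicator {0..1} x * \<bar>a x - G n x\<bar>)
     \<le> norm (indicator {0..1} x * \<bar>a x - T K x\<bar> + indicator {0..1} x * \<bar>T K x - G n x\<bar>)"
    by (auto simp: indicator_def intro!: AE_I2)
  qed auto
 qed (use i1 i2 in \<open>auto simp: indicator_def\<close>)
 also have "\<dots> = (LINT x|lborel. indicator {0..1} x * \<bar>a x - T K x\<bar>) + (LINT x|lborel. indicator {0..1} x * \<bar>T K x - G n x\<bar>)"
  using i1 i2 by simp
 also have "\<dots> < e" using K n by linarith
 finally have "(LINT x:{0..1}|lborel. \<bar>a x - G n (c x)\<bar>) < e" .
 then show thesis using that[OF uc] Gb by blast
qed

lemma norm_sum_card_le: "(\<And>i. i \<in> A ==> norm (f i) \<le> B) ==> norm (sum f A) \<le> real (card A) * B"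
 by (rule order_trans[OF norm_sum]) (rule sum_bounded_above)

section \<open>The limit functional and the convergence of weighted traces\<close>

context banded_symbol
begin

text \<open>The mean over \<theta> of the weighted diagonal of the resolvent: the limit density of
  the trace at a point where the coefficient has the value \<alpha>.\<close>

definition hsym :: "(nat => complex) => real => complex" where
 "hsym W \<alpha> = (\<Sum>c<r. W c * fc \<alpha> 0 c c)"

lemma hsym_lipschitz: "cmod (hsym W \<alpha> - hsym W \<beta>) \<le> (\<Sum>c<r. cmod (W c)) * (Kb / \<eta>\<^sup>2) * \<bar>\<alpha> - \<beta>\<bar>"
proof -
 have "cmod (hsym W \<alpha> - hsym W \<beta>) \<le> (\<Sum>c<r. cmod (W c) * (\<bar>\<alpha> - \<beta>\<bar> * Kb / \<eta>\<^sup>2))"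
  unfolding hsym_def sum_subtractf[symmetric] right_diff_distrib[symmetric]
  by (rule order_trans[OF norm_sum], rule sum_mono) (simp only: norm_mult, intro mult_left_mono fc_lipschitz, auto)
 also have "\<dots> = (\<Sum>c<r. cmod (W c)) * (\<bar>\<alpha> - \<beta>\<bar> * Kb / \<eta>\<^sup>2)" by (simp only: sum_distrib_right)
 finally show ?thesis by (simp add: mult_ac)
qed

lemma hsym_bound:
 assumes "\<And>c. c < r ==> cmod (W c) \<le> BW" shows "cmod (hsym W \<alpha>) \<le> real r * (BW / \<eta>)"
proof -
 have "cmod (hsym W \<alpha>) \<le> (\<Sum>c<r. BW * (1 / \<eta>))"
  unfolding hsym_def
  by (rule order_trans[OF norm_sum], rule sum_mono)
    (simp only: norm_mult, intro mult_mono fc_bound assms, auto intro: order_trans[OF norm_ge_zero assms])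
 then show ?thesis by simp
qed

lemma hsym_uniformly_continuous: "uniformly_continuous_on UNIV (hsym W)"
 unfolding uniformly_continuous_on_def
proof (intro allI impI)
 fix e :: real assume e: "0 < e"
 define C where "C = (\<Sum>c<r. cmod (W c)) * (Kb / \<eta>\<^sup>2) + 1"
 have C: "0 < C" unfolding C_def using bounds_nonneg by (intro add_nonneg_pos mult_nonneg_nonneg sum_nonneg) auto
 have "dist (hsym W x) (hsym W y) < e" if "dist x y < e / C" for x y
 proof -
  have "dist (hsym W x) (hsym W y) \<le> (C - 1) * \<bar>x - y\<bar>"
   unfolding dist_norm C_def using hsym_lipschitz[of W x y] by simp
  also have "\<dots> \<le> C * \<bar>x - y\<bar>" by (intro mult_right_mono) auto
  also have "\<dots> < e" using that C by (simp add: dist_real_def pos_less_divide_eq mult.commute)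
  finally show ?thesis .
 qed
 then show "\<exists>d>0. \<forall>x\<in>UNIV. \<forall>x'\<in>UNIV. dist x' x < d \<longrightarrow> dist (hsym W x') (hsym W x) < e"
  using C e by (intro exI[of _ "e / C"]) auto
qed

text \<open>\<open>rho n i\<close> and \<open>m n i\<close> are the component and the cell of index
  i; a cell between w0 and n - w0 contains every component exactly once. There the rows agree, up to
  any e, with those of the Toeplitz matrix frozen at m n i / n. Up to boundedly many rows and a
  small error per row, the weighted trace is the sum of \<open>hsym W (f (k / n))\<close> over the
  cells k, which is a Riemann sum.\<close>

lemma trace_limit_continuous:
 fixes X :: "nat => mat_fun" and rho :: "nat => nat => nat" and m :: "nat => nat => int" and f :: "real => real"
 assumes uc: "uniformly_continuous_on UNIV f" and A: "\<And>x. \<bar>f x\<bar> \<le> A"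
  and X: "\<And>n. 1 \<le> n ==> herm (d n) (X n)"
  and rho: "\<And>n i. 1 \<le> n ==> i < d n ==> rho n i < r"
  and inj: "\<And>n. 1 \<le> n ==> inj_on (\<lambda>i. (rho n i, m n i)) {..<d n}"
  and range: "\<And>n i. 1 \<le> n ==> i < d n ==> - int w0 \<le> m n i \<and> m n i \<le> int n + int w0"
  and compl: "\<And>n c \<mu>. 1 \<le> n ==> c < r ==> int w0 \<le> \<mu> ==> \<mu> \<le> int n - int w0 ==> \<exists>j<d n. rho n j = c \<and> m n j = \<mu>"
  and band: "\<And>n i j. 1 \<le> n ==> i < d n ==> j < d n ==> \<bar>m n i - m n j\<bar> > int w ==> X n i j = 0"
  and bnd: "\<And>n i j. 1 \<le> n ==> i < d n ==> j < d n ==> cmod (X n i j) \<le> b"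
  and close: "\<And>e. 0 < e ==> \<forall>\<^sub>F n in sequentially. \<forall>i<d n. \<forall>j<d n. int w0 \<le> m n i \<longrightarrow> m n i \<le> int n - int w0 \<longrightarrow> \<bar>m n i - m n j\<bar> \<le> int w \<longrightarrow>
    cmod (X n i j - of_real (f (of_int (m n i) / real n) * K (m n i - m n j) (rho n i) (rho n j) + L (m n i - m n j) (rho n i) (rho n j))) \<le> e"
 shows "(\<lambda>n. (\<Sum>i<d n. W (rho n i) * finv (d n) (shiftd (X n) (\<lambda>i. Z (rho n i))) i i) / of_nat n) \<longlonglongrightarrow> integral {0..1} (\<lambda>x. hsym W (f x))"
proof -
 define BW where "BW = (\<Sum>c<r. cmod (W c))"
 have W: "cmod (W c) \<le> BW" if "c < r" for c unfolding BW_def using that by (intro member_le_sum) auto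
 have BW0: "0 \<le> BW" unfolding BW_def by (intro sum_nonneg) auto
 have A0: "0 \<le> A" using A[of 0] by linarith
 define b' where "b' = max b 0"
 define \<alpha> where "\<alpha> n i = f (of_int (m n i) / real n)" for n i
 define tr where "tr n = (\<Sum>i<d n. W (rho n i) * finv (d n) (shiftd (X n) (\<lambda>i. Z (rho n i))) i i)" for n
 define sr where "sr n = (\<Sum>i<d n. W (rho n i) * fc (\<alpha> n i) 0 (rho n i) (rho n i))" for n
 \<comment> \<open>A further margin \<open>w\<close>, so that all cells within the bandwidth of a
   cell of \<open>G\<close> are complete.\<close>
 define G where "G n = {i \<in> {..<d n}. int w0 + int w \<le> m n i \<and> m n i \<le> int n - int w0 - int w}" for n
 define Mid where "Mid n = {i \<in> {..<d n}. int w0 \<le> m n i \<and> m n i \<le> int n - int w0}" for n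
 have card_le: "card {i \<in> {..<d n}. m n i \<in> S} \<le> r * card S" if "1 \<le> n" "finite S" for n S
 proof -
  have "card {i \<in> {..<d n}. m n i \<in> S} \<le> card ({..<r} \<times> S)"
   by (rule card_inj_on_le[of "\<lambda>i. (rho n i, m n i)"]) (use inj[OF that(1)] rho[OF that(1)] that(2) in \<open>auto simp: inj_on_def\<close>)
  then show ?thesis by (simp add: card_cartesian_product)
 qed
 have dcard: "real (d n) \<le> real r * (real n + 2 * real w0 + 1)" if n: "1 \<le> n" for n
 proof -
  have "{i \<in> {..<d n}. m n i \<in> {- int w0..int n + int w0}} = {..<d n}" using range[OF n] by auto
  then have "d n \<le> r * card {- int w0..int n + int w0}" using card_le[OF n, of "{- int w0..int n + int w0}"] by simp
  then have "real (d n) \<le> real (r * card {- int w0..int n + int w0})" by (simp only: of_nat_le_iff)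
  also have "\<dots> = real r * (real n + 2 * real w0 + 1)" by simp
  finally show ?thesis .
 qed
 define Cb where "Cb = real r * (4 * real w0 + 2 * real w)"
 have edge: "real (card ({..<d n} - {i \<in> {..<d n}. int w0 + v \<le> m n i \<and> m n i \<le> int n - int w0 - v})) \<le> Cb"
  if n: "1 \<le> n" and v: "0 \<le> v" "v \<le> int w" for n v
 proof -
  let ?S = "{- int w0..<int w0 + v} \<union> {int n - int w0 - v<..int n + int w0}"
  have "card ({..<d n} - {i \<in> {..<d n}. int w0 + v \<le> m n i \<and> m n i \<le> int n - int w0 - v}) \<le> card {i \<in> {..<d n}. m n i \<in> ?S}"
   using range[OF n] by (intro card_mono) auto
  also have "\<dots> \<le> r * card ?S" by (rule card_le[OF n]) simp
  also have "\<dots> \<le> r * (card {- int w0..<int w0 + v} + card {int n - int w0 - v<..int n + int w0})"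
   by (intro mult_left_mono card_Un_le) auto
  also have "\<dots> \<le> r * (4 * w0 + 2 * w)" using v by (intro mult_left_mono) auto
  finally show ?thesis unfolding Cb_def by (simp only: of_nat_le_iff[symmetric, where 'a = real]) simp
 qed
 have Cb0: "0 \<le> Cb" by (simp add: Cb_def)
 \<comment> \<open>The constant is fixed before e. Boundedly many bad rows and an error proportional
   to e in the good ones give n e + 1; e is made small after division by n.\<close>
 have step: "\<exists>C. \<forall>e>0. \<forall>\<^sub>F n in sequentially. cmod (sr n - tr n) \<le> C * (real n * e + 1)"
 proof -
  define N where "N = real (r * (2 * w + 1))"
  define C1 where "C1 = N * (sqrt r / \<eta>) + (N * (A * Kb + Lb) + Zb) * (sqrt r * (Kb / \<eta>\<^sup>2))"
  define C2 where "C2 = (N * b' + Zb) * (sqrt r / \<eta>) + 1"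
  have C10: "0 \<le> C1" unfolding C1_def N_def using bounds_nonneg \<eta> A0 by simp
  have C20: "0 \<le> C2" unfolding C2_def N_def b'_def using bounds_nonneg \<eta> by simp
  define C where "C = BW / \<eta> * (real r * (2 * real w0 + 2) * C1 + Cb * C2)"
  have "\<forall>\<^sub>F n in sequentially. cmod (sr n - tr n) \<le> C * (real n * e + 1)" if e: "0 < e" for e
  proof -
   obtain \<delta> where \<delta>: "0 < \<delta>" "\<And>x y. dist x y < \<delta> ==> dist (f x) (f y) < e"
    using uniformly_continuous_UNIV_E[OF uc e] by blast
   obtain N1 :: nat where N1: "real w / \<delta> < real N1" using reals_Archimedean2 by blast
   have "\<forall>\<^sub>F n in sequentially. max 1 N1 \<le> n" by (rule eventually_ge_at_top)
   with close[OF e] show ?thesis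
   proof eventually_elim
    case (elim n)
    have n: "1 \<le> n" "N1 \<le> n" using elim(2) by auto
    have wn: "real w / real n < \<delta>"
    proof -
     have "real w / \<delta> < real n" using N1 n by linarith
     then show ?thesis using \<delta>(1) n by (simp add: divide_less_eq mult.commute)
    qed
    have "cmod (sr n - tr n) \<le> BW / \<eta> * (real (d n) * C1 * e + real (card ({..<d n} - G n)) * C2)"
     unfolding sr_def tr_def C1_def C2_def N_def
    proof (rule resolvent_trace_step[OF X[OF n(1)] rho[OF n(1)] inj[OF n(1)] band[OF n(1)] _ _ _ _ _ _ W])
     show "cmod (X n i j) \<le> b'" if "i < d n" "j < d n" for i j using bnd[OF n(1) that] by (simp add: b'_def)
     show "G n \<subseteq> {..<d n}" by (auto simp: G_def)
     show "\<exists>j<d n. rho n j = c \<and> m n j = m n i - s" if "i \<in> G n" "c < r" "\<bar>s\<bar> \<le> int w" for i c s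
      using that by (intro compl[OF n(1)]) (auto simp: G_def)
     show "cmod (X n i j - of_real (\<alpha> n i * K (m n i - m n j) (rho n i) (rho n j) + L (m n i - m n j) (rho n i) (rho n j))) \<le> e"
      if "i \<in> G n" "j < d n" "\<bar>m n i - m n j\<bar> \<le> int w" for i j
      using elim(1)[rule_format, of i j] that unfolding \<alpha>_def by (auto simp: G_def)
     show "\<bar>\<alpha> n j - \<alpha> n i\<bar> \<le> e" if "i \<in> G n" "j < d n" "\<bar>m n i - m n j\<bar> \<le> int w" for i j
     proof -
      have "\<bar>of_int (m n j) - of_int (m n i)\<bar> \<le> real w" using that(3) by linarith
      then have "\<bar>of_int (m n j) / real n - of_int (m n i) / real n\<bar> \<le> real w / real n"
       unfolding diff_divide_distrib[symmetric] abs_divide by (simp add: divide_right_mono)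
      then have "dist (of_int (m n j) / real n) (of_int (m n i) / real n) < \<delta>" using wn by (simp add: dist_real_def)
      then show ?thesis using \<delta>(2) unfolding \<alpha>_def by (fastforce simp: dist_real_def)
     qed
     show "\<bar>\<alpha> n i\<bar> \<le> A" for i unfolding \<alpha>_def by (rule A)
    qed (use A0 BW0 e in \<open>auto simp: b'_def\<close>)
    also have "\<dots> \<le> BW / \<eta> * (real r * (2 * real w0 + 2) * real n * C1 * e + Cb * C2)"
    proof (intro mult_left_mono add_mono mult_right_mono)
     have "real (d n) \<le> real r * (real n + 2 * real w0 + 1)" by (rule dcard[OF n(1)])
     also have "\<dots> \<le> real r * ((2 * real w0 + 2) * real n)"
     proof (intro mult_left_mono)
      have "(2 * real w0 + 1) * 1 \<le> (2 * real w0 + 1) * real n" using n by (intro mult_left_mono) auto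
      then show "real n + 2 * real w0 + 1 \<le> (2 * real w0 + 2) * real n" by (simp add: algebra_simps)
     qed simp
     finally show "real (d n) \<le> real r * (2 * real w0 + 2) * real n" by (simp add: mult.assoc)
     show "real (card ({..<d n} - G n)) \<le> Cb" using edge[OF n(1), of "int w"] unfolding G_def by simp
    qed (use C10 C20 e BW0 \<eta> in auto)
    also have "\<dots> \<le> C * (real n * e + 1)"
    proof -
     have "0 \<le> real r * (2 * real w0 + 2) * C1" "0 \<le> Cb * C2 * (real n * e)"
      using C10 C20 Cb0 e by simp_all
     then have "real r * (2 * real w0 + 2) * real n * C1 * e + Cb * C2 \<le> (real r * (2 * real w0 + 2) * C1 + Cb * C2) * (real n * e + 1)"
      by (simp add: algebra_simps)
     then show ?thesis unfolding C_def mult.assoc using BW0 \<eta> by (intro mult_left_mono) auto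
    qed
    finally show ?case .
   qed
  qed
  then show ?thesis by blast
 qed
 then obtain C where C: "\<And>e. 0 < e ==> \<forall>\<^sub>F n in sequentially. cmod (sr n - tr n) \<le> C * (real n * e + 1)" by blast
 \<comment> \<open>The indices outside \<open>Mid\<close>, each with a term of at most BW / \<eta>,
   plus the at most 2 w0 + 1 cells in which {w0..n - w0} and {..<n} differ.\<close>
 define D where "D = Cb * (BW / \<eta>) + (2 * real w0 + 1) * (real r * (BW / \<eta>))"
 have srsum: "cmod (sr n - (\<Sum>k<n. hsym W (f (real k / real n)))) \<le> D" if n: "1 \<le> n" "2 * w0 + 1 \<le> n" for n
 proof -
  let ?t = "\<lambda>i. W (rho n i) * fc (\<alpha> n i) 0 (rho n i) (rho n i)"
  have tb: "cmod (?t i) \<le> BW / \<eta>" if "i < d n" for i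
   using mult_mono[OF W[OF rho[OF n(1) that]] fc_bound[OF rho[OF n(1) that] rho[OF n(1) that]], of "\<alpha> n i" 0] BW0
   by (simp add: norm_mult)
  have "sr n = (\<Sum>i\<in>Mid n. ?t i) + (\<Sum>i\<in>{..<d n} - Mid n. ?t i)"
   unfolding sr_def by (subst sum.subset_diff[of "Mid n" "{..<d n}"]) (auto simp: Mid_def add.commute)
  moreover have "cmod (\<Sum>i\<in>{..<d n} - Mid n. ?t i) \<le> Cb * (BW / \<eta>)"
  proof -
   have "cmod (\<Sum>i\<in>{..<d n} - Mid n. ?t i) \<le> real (card ({..<d n} - Mid n)) * (BW / \<eta>)"
    by (rule norm_sum_card_le) (use tb in auto)
   also have "\<dots> \<le> Cb * (BW / \<eta>)"
    using edge[OF n(1), of 0] BW0 \<eta> unfolding Mid_def by (intro mult_right_mono) auto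
   finally show ?thesis .
  qed
  moreover have "(\<Sum>i\<in>Mid n. ?t i) = (\<Sum>k\<in>{w0..n - w0}. hsym W (f (real k / real n)))"
  proof -
   have bij: "bij_betw (\<lambda>i. (rho n i, nat (m n i))) (Mid n) ({..<r} \<times> {w0..n - w0})"
    unfolding bij_betw_def
   proof
    show "inj_on (\<lambda>i. (rho n i, nat (m n i))) (Mid n)"
     using inj[OF n(1)] unfolding inj_on_def Mid_def by auto
    show "(\<lambda>i. (rho n i, nat (m n i))) ` Mid n = {..<r} \<times> {w0..n - w0}"
    proof
     show "{..<r} \<times> {w0..n - w0} \<subseteq> (\<lambda>i. (rho n i, nat (m n i))) ` Mid n"
     proof
      fix p assume "p \<in> {..<r} \<times> {w0..n - w0}"
      then obtain c k where p: "p = (c, k)" "c < r" "w0 \<le> k" "k \<le> n - w0" by auto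
      then have "int w0 \<le> int k" "int k \<le> int n - int w0" using n by linarith+
      then obtain j where "j < d n" "rho n j = c" "m n j = int k" using compl[OF n(1) p(2)] by blast
      then show "p \<in> (\<lambda>i. (rho n i, nat (m n i))) ` Mid n"
       using p n by (intro image_eqI[of _ _ j]) (auto simp: Mid_def)
     qed
     show "(\<lambda>i. (rho n i, nat (m n i))) ` Mid n \<subseteq> {..<r} \<times> {w0..n - w0}"
      using rho[OF n(1)] by (auto simp: Mid_def)
    qed
   qed
   have "(\<Sum>i\<in>Mid n. ?t i) = (\<Sum>i\<in>Mid n. (\<lambda>(c, k). W c * fc (f (real k / real n)) 0 c c) (rho n i, nat (m n i)))"
    by (intro sum.cong refl) (auto simp: \<alpha>_def Mid_def)
   also have "\<dots> = (\<Sum>(c, k)\<in>{..<r} \<times> {w0..n - w0}. W c * fc (f (real k / real n)) 0 c c)"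
    by (rule sum.reindex_bij_betw[OF bij])
   also have "\<dots> = (\<Sum>c<r. \<Sum>k\<in>{w0..n - w0}. W c * fc (f (real k / real n)) 0 c c)"
    by (simp add: sum.cartesian_product)
   also have "\<dots> = (\<Sum>k\<in>{w0..n - w0}. hsym W (f (real k / real n)))"
    unfolding hsym_def by (rule sum.swap)
   finally show ?thesis .
  qed
  moreover have "cmod ((\<Sum>k\<in>{w0..n - w0}. hsym W (f (real k / real n))) - (\<Sum>k<n. hsym W (f (real k / real n)))) \<le> (2 * real w0 + 1) * (real r * (BW / \<eta>))"
  proof -
   let ?h = "\<lambda>k. hsym W (f (real k / real n))"
   have hb: "cmod (?h k) \<le> real r * (BW / \<eta>)" for k by (rule hsym_bound[OF W])
   have split: "(\<Sum>k\<in>{w0..n - w0}. ?h k) - (\<Sum>k<n. ?h k) = (\<Sum>k\<in>{w0..n - w0} - {..<n}. ?h k) - (\<Sum>k\<in>{..<n} - {w0..n - w0}. ?h k)"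
   proof -
    have "(\<Sum>k\<in>{w0..n - w0}. ?h k) = (\<Sum>k\<in>{w0..n - w0} - {..<n}. ?h k) + (\<Sum>k\<in>{w0..n - w0} \<inter> {..<n}. ?h k)"
     by (subst sum.union_disjoint[symmetric]) (auto intro!: sum.cong)
    moreover have "(\<Sum>k<n. ?h k) = (\<Sum>k\<in>{..<n} - {w0..n - w0}. ?h k) + (\<Sum>k\<in>{w0..n - w0} \<inter> {..<n}. ?h k)"
     by (subst sum.union_disjoint[symmetric]) (auto intro!: sum.cong)
    ultimately show ?thesis by simp
   qed
   define U where "U = real r * (BW / \<eta>)"
   have U0: "0 \<le> U" using BW0 \<eta> by (simp add: U_def)
   have "card ({w0..n - w0} - {..<n}) \<le> card {n}" by (rule card_mono) auto
   then have c1: "real (card ({w0..n - w0} - {..<n})) \<le> 1" by simp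
   have "card ({..<n} - {w0..n - w0}) \<le> card ({..<w0} \<union> {n - w0<..<n})" by (rule card_mono) auto
   also have "\<dots> \<le> card {..<w0} + card {n - w0<..<n}" by (rule card_Un_le)
   finally have c2: "real (card ({..<n} - {w0..n - w0})) \<le> 2 * real w0" by simp
   have "cmod (sum ?h ({w0..n - w0} - {..<n})) \<le> real (card ({w0..n - w0} - {..<n})) * U"
    using norm_sum_card_le[of "{w0..n - w0} - {..<n}" ?h U] hb by (simp add: U_def)
   moreover have "cmod (sum ?h ({..<n} - {w0..n - w0})) \<le> real (card ({..<n} - {w0..n - w0})) * U"
    using norm_sum_card_le[of "{..<n} - {w0..n - w0}" ?h U] hb by (simp add: U_def)
   moreover have "cmod (sum ?h ({w0..n - w0} - {..<n}) - sum ?h ({..<n} - {w0..n - w0}))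
     \<le> cmod (sum ?h ({w0..n - w0} - {..<n})) + cmod (sum ?h ({..<n} - {w0..n - w0}))"
    by (rule norm_triangle_ineq4)
   moreover have "real (card ({w0..n - w0} - {..<n})) * U \<le> 1 * U" by (rule mult_right_mono[OF c1 U0])
   moreover have "real (card ({..<n} - {w0..n - w0})) * U \<le> 2 * real w0 * U" by (rule mult_right_mono[OF c2 U0])
   ultimately show ?thesis unfolding split U_def[symmetric] by (simp only: distrib_right)
  qed
  ultimately show ?thesis unfolding D_def
   using norm_diff_triangle_le[of "sr n" "\<Sum>i\<in>Mid n. ?t i" "Cb * (BW / \<eta>)" "\<Sum>k<n. hsym W (f (real k / real n))" "(2 * real w0 + 1) * (real r * (BW / \<eta>))"]
   by simp
 qed
 have lim0: "(\<lambda>n. ((\<Sum>k<n. hsym W (f (real k / real n))) - tr n) / of_nat n) \<longlonglongrightarrow> 0"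
 proof (rule metric_LIMSEQ_I)
  fix e :: real assume e: "0 < e"
  define e' where "e' = e / (4 * (\<bar>C\<bar> + 1))"
  have e': "0 < e'" using e by (simp add: e'_def)
  have Ce: "\<bar>C\<bar> * e' < e / 2"
  proof -
   have "\<bar>C\<bar> * e' < (\<bar>C\<bar> + 1) * e'" using e' by (intro mult_strict_right_mono) auto
   also have "\<dots> = e / 4" by (simp add: e'_def field_simps)
   finally show ?thesis using e by simp
  qed
  obtain N2 :: nat where N2: "2 * (\<bar>C\<bar> + D) / e < real N2" using reals_Archimedean2 by blast
  have "\<forall>\<^sub>F n in sequentially. max (2 * w0 + 1) (max 1 N2) \<le> n" by (rule eventually_ge_at_top)
  with C[OF e'] have "\<forall>\<^sub>F n in sequentially. dist (((\<Sum>k<n. hsym W (f (real k / real n))) - tr n) / of_nat n) 0 < e"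
  proof eventually_elim
   case (elim n)
   have n: "1 \<le> n" "2 * w0 + 1 \<le> n" "N2 \<le> n" using elim(2) by auto
   have "cmod ((\<Sum>k<n. hsym W (f (real k / real n))) - tr n) \<le> D + C * (real n * e' + 1)"
    using norm_diff_triangle_le[of "\<Sum>k<n. hsym W (f (real k / real n))" "sr n" D "tr n"] srsum[OF n(1,2)] elim(1)
    by (simp add: norm_minus_commute)
   also have "\<dots> \<le> D + \<bar>C\<bar> * (real n * e' + 1)" using e' by (intro add_left_mono mult_right_mono) auto
   also have "\<dots> = real n * (\<bar>C\<bar> * e') + (\<bar>C\<bar> + D)" by (simp add: algebra_simps)
   also have "\<dots> < real n * (e / 2) + real n * (e / 2)"
   proof (rule add_less_le_mono)
    show "real n * (\<bar>C\<bar> * e') < real n * (e / 2)" using Ce n by simp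
    have "2 * (\<bar>C\<bar> + D) / e < real n" using N2 n by linarith
    then show "\<bar>C\<bar> + D \<le> real n * (e / 2)" using e by (simp add: pos_divide_less_eq)
   qed
   finally have "cmod ((\<Sum>k<n. hsym W (f (real k / real n))) - tr n) < real n * e" by (simp add: mult.commute)
   then show ?case using n by (simp add: dist_norm norm_divide pos_divide_less_eq mult.commute)
  qed
  then show "\<exists>no. \<forall>n\<ge>no. dist (((\<Sum>k<n. hsym W (f (real k / real n))) - tr n) / of_nat n) 0 < e"
   by (simp add: eventually_sequentially)
 qed
 have "uniformly_continuous_on UNIV (\<lambda>x. hsym W (f x))"
  using uniformly_continuous_on_compose[OF uc uniformly_continuous_on_subset[OF hsym_uniformly_continuous]] by (simp add: o_def)
 from tendsto_diff[OF riemann_sum_limit[OF this] lim0]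
 show ?thesis by (simp add: tr_def diff_divide_distrib)
qed

text \<open>
 Traces of resolvents are Lipschitz in the entrywise \<open>\<ell>\<^sup>1\<close> norm of the matrix, which carries
 the limit from uniformly continuous to integrable coefficients.
\<close>

theorem trace_limit:
 fixes X :: "(real => real) => nat => mat_fun"
 assumes a[measurable]: "a \<in> borel_measurable borel" and int: "set_integrable lborel {0..1} a"
  and X: "\<And>f n. 1 \<le> n ==> herm (d n) (X f n)"
  and rho: "\<And>n i. 1 \<le> n ==> i < d n ==> rho n i < r"
  and cont: "\<And>f A. uniformly_continuous_on UNIV f ==> (\<And>x. \<bar>f x\<bar> \<le> A) ==>
   (\<lambda>n. (\<Sum>i<d n. W (rho n i) * finv (d n) (shiftd (X f n) (\<lambda>i. Z (rho n i))) i i) / of_nat n) \<longlonglongrightarrow> integral {0..1} (\<lambda>x. hsym W (f x))"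
  and l1: "\<And>f n. f \<in> borel_measurable borel ==> set_integrable lborel {0..1} f ==> 1 \<le> n ==>
    (\<Sum>i<d n. \<Sum>j<d n. cmod (X a n i j - X f n i j)) \<le> C * real n * (LINT x:{0..1}|lborel. \<bar>a x - f x\<bar>)"
 shows "(\<lambda>n. (\<Sum>i<d n. W (rho n i) * finv (d n) (shiftd (X a n) (\<lambda>i. Z (rho n i))) i i) / of_nat n) \<longlonglongrightarrow> (LINT x:{0..1}|lborel. hsym W (a x))"
proof (rule metric_LIMSEQ_I)
 fix e :: real assume e: "0 < e"
 define BW where "BW = (\<Sum>c<r. cmod (W c))"
 have W: "cmod (W c) \<le> BW" if "c < r" for c unfolding BW_def using that by (intro member_le_sum) auto
 have BW0: "0 \<le> BW" unfolding BW_def by (intro sum_nonneg) auto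
 \<comment> \<open>The sum of two Lipschitz constants with respect to the L1 distance, that of the
   normalized trace and that of the limit integral; 1 is added for positivity.\<close>
 define M where "M = BW / \<eta>\<^sup>2 * \<bar>C\<bar> + BW * (Kb / \<eta>\<^sup>2) + 1"
 have M1: "0 < M" unfolding M_def using BW0 bounds_nonneg \<eta> by (intro add_nonneg_pos) auto
 obtain f where f: "uniformly_continuous_on UNIV f" "\<exists>A. \<forall>x. \<bar>f x\<bar> \<le> A"
  and fe: "(LINT x:{0..1}|lborel. \<bar>a x - f x\<bar>) < e / (3 * M)"
  using L1_uniformly_continuous_approx[OF a int, of "e / (3 * M)"] e M1 by auto
 obtain A where A: "\<And>x. \<bar>f x\<bar> \<le> A" using f(2) by blast
 have fc: "continuous_on S f" for S
  using uniformly_continuous_imp_continuous[OF f(1)] continuous_on_subset by blast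
 have [measurable]: "f \<in> borel_measurable borel" by (rule borel_measurable_continuous_onI[OF fc])
 have fint: "set_integrable lborel {0..1} f" unfolding set_integrable_def by (rule borel_integrable_compact[OF compact_Icc fc])
 let ?tr = "\<lambda>f n. (\<Sum>i<d n. W (rho n i) * finv (d n) (shiftd (X f n) (\<lambda>i. Z (rho n i))) i i) / of_nat n"
 let ?\<Delta> = "LINT x:{0..1}|lborel. \<bar>a x - f x\<bar>"
 have \<Delta>0: "0 \<le> ?\<Delta>" unfolding set_lebesgue_integral_def by (rule Bochner_Integration.integral_nonneg) auto
 have hc: "continuous_on UNIV (hsym W)" by (rule uniformly_continuous_imp_continuous[OF hsym_uniformly_continuous])
 have [measurable]: "hsym W \<in> borel_measurable borel" by (rule borel_measurable_continuous_onI[OF hc])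
 have hint: "set_integrable lborel {0..1} (\<lambda>x. hsym W (g x))" if [measurable]: "g \<in> borel_measurable borel" for g :: "real => real"
  unfolding set_integrable_def
 proof (rule integrableI_bounded_set_indicator[where B = "real r * (BW / \<eta>)"])
  show "AE x in lborel. x \<in> {0..1} \<longrightarrow> cmod (hsym W (g x)) \<le> real r * (BW / \<eta>)"
   using hsym_bound[OF W] by auto
 qed (auto simp: emeasure_lborel_Icc_eq)
 have I: "integral {0..1} (\<lambda>x. hsym W (f x)) = (LINT x:{0..1}|lborel. hsym W (f x))"
  using set_borel_integral_eq_integral(2)[OF hint[of f]] by simp
 have lim: "(\<lambda>n. ?tr f n) \<longlonglongrightarrow> (LINT x:{0..1}|lborel. hsym W (f x))"
  using cont[OF f(1) A] unfolding I .
 obtain N where N: "\<And>n. N \<le> n ==> cmod (?tr f n - (LINT x:{0..1}|lborel. hsym W (f x))) < e / 3"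
  using LIMSEQ_D[OF lim, of "e / 3"] e by auto
 have int2: "cmod ((LINT x:{0..1}|lborel. hsym W (a x)) - (LINT x:{0..1}|lborel. hsym W (f x))) \<le> BW * (Kb / \<eta>\<^sup>2) * ?\<Delta>"
 proof -
  have eq: "(LINT x:{0..1}|lborel. hsym W (a x)) - (LINT x:{0..1}|lborel. hsym W (f x)) = (LINT x:{0..1}|lborel. hsym W (a x) - hsym W (f x))"
   by (rule set_integral_diff(2)[symmetric]) (auto intro: hint)
  have i1: "set_integrable lborel {0..1} (\<lambda>x. hsym W (a x) - hsym W (f x))"
   by (rule set_integral_diff(1)[OF hint hint]) auto
  have i2: "set_integrable lborel {0..1} (\<lambda>x. BW * (Kb / \<eta>\<^sup>2) * \<bar>a x - f x\<bar>)"
   by (rule set_integrable_mult_right, rule set_integrable_abs, rule set_integral_diff(1)[OF int fint])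
  have "cmod (LINT x:{0..1}|lborel. hsym W (a x) - hsym W (f x)) \<le> (LINT x:{0..1}|lborel. cmod (hsym W (a x) - hsym W (f x)))"
   by (rule set_integral_norm_bound[OF i1])
  moreover have "(LINT x:{0..1}|lborel. cmod (hsym W (a x) - hsym W (f x))) \<le> (LINT x:{0..1}|lborel. BW * (Kb / \<eta>\<^sup>2) * \<bar>a x - f x\<bar>)"
   by (rule set_integral_mono[OF set_integrable_norm[OF i1] i2]) (use hsym_lipschitz in \<open>auto simp: BW_def\<close>)
  moreover have "(LINT x:{0..1}|lborel. BW * (Kb / \<eta>\<^sup>2) * \<bar>a x - f x\<bar>) = BW * (Kb / \<eta>\<^sup>2) * ?\<Delta>"
   by (rule set_integral_mult_right)
  ultimately show ?thesis unfolding eq by simp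
 qed
 have "dist (?tr a n) (LINT x:{0..1}|lborel. hsym W (a x)) < e" if n: "max 1 N \<le> n" for n
 proof -
  have n1: "1 \<le> n" "N \<le> n" using n by auto
  have dis: "dissipative \<eta> (d n) (shiftd (X g n) (\<lambda>i. Z (rho n i)))" for g
   by (rule dissipative_shiftd[OF X[OF n1(1)]]) (use Z rho[OF n1(1)] in auto)
  have "cmod (\<Sum>i<d n. W (rho n i) * (finv (d n) (shiftd (X a n) (\<lambda>i. Z (rho n i))) i i - finv (d n) (shiftd (X f n) (\<lambda>i. Z (rho n i))) i i))
    \<le> BW / \<eta>\<^sup>2 * (\<Sum>i<d n. \<Sum>j<d n. cmod (shiftd (X a n) (\<lambda>i. Z (rho n i)) i j - shiftd (X f n) (\<lambda>i. Z (rho n i)) i j))"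
   by (rule resolvent_trace_perturb[OF dis dissipative_inv[OF dis \<eta>] dis dissipative_inv[OF dis \<eta>] \<eta>]) (use W rho[OF n1(1)] in auto)
  also have "\<dots> \<le> BW / \<eta>\<^sup>2 * (\<bar>C\<bar> * real n * ?\<Delta>)"
  proof (intro mult_left_mono)
   have "(\<Sum>i<d n. \<Sum>j<d n. cmod (shiftd (X a n) (\<lambda>i. Z (rho n i)) i j - shiftd (X f n) (\<lambda>i. Z (rho n i)) i j)) \<le> C * real n * ?\<Delta>"
    using l1[of f n] fint n1 by (simp add: shiftd_def)
   also have "\<dots> \<le> \<bar>C\<bar> * real n * ?\<Delta>" using \<Delta>0 by (intro mult_right_mono) auto
   finally show "(\<Sum>i<d n. \<Sum>j<d n. cmod (shiftd (X a n) (\<lambda>i. Z (rho n i)) i j - shiftd (X f n) (\<lambda>i. Z (rho n i)) i j)) \<le> \<bar>C\<bar> * real n * ?\<Delta>" .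
  qed (use BW0 in simp)
  finally have le: "cmod (\<Sum>i<d n. W (rho n i) * (finv (d n) (shiftd (X a n) (\<lambda>i. Z (rho n i))) i i - finv (d n) (shiftd (X f n) (\<lambda>i. Z (rho n i))) i i))
    \<le> BW / \<eta>\<^sup>2 * (\<bar>C\<bar> * real n * ?\<Delta>)" .
  have "cmod (?tr a n - ?tr f n) \<le> BW / \<eta>\<^sup>2 * (\<bar>C\<bar> * real n * ?\<Delta>) / real n"
   using divide_right_mono[OF le, of "real n"] n1
   by (simp add: diff_divide_distrib[symmetric] sum_subtractf[symmetric] right_diff_distrib[symmetric] norm_divide)
  also have "\<dots> = BW / \<eta>\<^sup>2 * \<bar>C\<bar> * ?\<Delta>" using n1 by simp
  finally have 1: "cmod (?tr a n - ?tr f n) \<le> BW / \<eta>\<^sup>2 * \<bar>C\<bar> * ?\<Delta>" .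
  have "BW / \<eta>\<^sup>2 * \<bar>C\<bar> * ?\<Delta> + BW * (Kb / \<eta>\<^sup>2) * ?\<Delta> \<le> M * ?\<Delta>"
   using \<Delta>0 unfolding M_def by (simp add: distrib_right)
  also have "\<dots> < M * (e / (3 * M))" using fe M1 by (rule mult_strict_left_mono)
  also have "\<dots> = e / 3" using M1 by simp
  finally have small: "BW / \<eta>\<^sup>2 * \<bar>C\<bar> * ?\<Delta> + BW * (Kb / \<eta>\<^sup>2) * ?\<Delta> < e / 3" .
  have arith: "cmod (x - u) < e" if "cmod (x - y) \<le> B1" "cmod (y - v) < e / 3" "cmod (u - v) \<le> B2" "B1 + B2 < e / 3" for x y u v :: complex and B1 B2
  proof -
   have "cmod (x - u) \<le> cmod (x - y) + cmod (y - v) + cmod (v - u)"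
    using norm_triangle_ineq[of "x - y" "y - v"] norm_triangle_ineq[of "x - v" "v - u"] by simp
   then show ?thesis using that e by (simp add: norm_minus_commute[of v u])
  qed
  show ?thesis unfolding dist_norm by (rule arith[OF 1 N[OF n1(2)] int2 small])
 qed
 then show "\<exists>no. \<forall>n\<ge>no. dist (?tr a n) (LINT x:{0..1}|lborel. hsym W (a x)) < e" by blast
qed

end

section \<open>B-splines and their derivatives\<close>

text \<open>The Cox-de Boor recursion differentiated term by term. It is the derivative off the
  knots, and unlike \<open>deriv\<close> it is accessible to induction at every point; its values at
  the knots form a null set for the integrals.\<close>

fun dbspline :: "real list => nat => nat => real => real" where
 "dbspline t 0 i x = 0"
| "dbspline t (Suc p) i x =
   bspline t p i x / (t ! (i + p + 1) - t ! i)
   + (x - t ! i) / (t ! (i + p + 1) - t ! i) * dbspline t p i x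
   - bspline t p (i + 1) x / (t ! (i + p + 2) - t ! (i + 1))
   + (t ! (i + p + 2) - x) / (t ! (i + p + 2) - t ! (i + 1)) * dbspline t p (i + 1) x"

lemma bspline_has_derivative:
 assumes "x \<notin> (\<lambda>j. t ! j) ` {i..i + p + 1}"
 shows "(bspline t p i has_real_derivative dbspline t p i x) (at x)"
 using assms
proof (induction p arbitrary: i)
 case 0
 then have x: "x \<noteq> t ! i" "x \<noteq> t ! (i + 1)" by auto
 obtain e where e: "e > 0" "\<And>y. dist y x < e ==> y \<noteq> t ! i \<and> y \<noteq> t ! (i + 1) \<and> (t ! i < y \<longleftrightarrow> t ! i < x) \<and> (y < t ! (i + 1) \<longleftrightarrow> x < t ! (i + 1))"
 proof (rule that[of "min \<bar>x - t ! i\<bar> \<bar>x - t ! (i + 1)\<bar>"])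
  show "0 < min \<bar>x - t ! i\<bar> \<bar>x - t ! (i + 1)\<bar>" using x by simp
 next
  fix y assume "dist y x < min \<bar>x - t ! i\<bar> \<bar>x - t ! (i + 1)\<bar>"
  then show "y \<noteq> t ! i \<and> y \<noteq> t ! (i + 1) \<and> (t ! i < y \<longleftrightarrow> t ! i < x) \<and> (y < t ! (i + 1) \<longleftrightarrow> x < t ! (i + 1))"
   unfolding dist_real_def by (smt (verit))
 qed
 have "((\<lambda>_. bspline t 0 i x) has_real_derivative 0) (at x)" by simp
 then have "(bspline t 0 i has_real_derivative 0) (at x)"
 proof (rule has_field_derivative_transform_within[OF _ e(1)])
  fix y assume y: "dist y x < e"
  show "bspline t 0 i x = bspline t 0 i y" using e(2)[OF y] x by auto
 qed simp
 then show ?case by (simp only: dbspline.simps)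
next
 case (Suc p)
 have 1: "(bspline t p i has_real_derivative dbspline t p i x) (at x)"
  by (rule Suc.IH) (use Suc.prems in auto)
 have 2: "(bspline t p (i + 1) has_real_derivative dbspline t p (i + 1) x) (at x)"
  by (rule Suc.IH) (use Suc.prems in auto)
 define A where "A = t ! (i + p + 1) - t ! i"
 define B where "B = t ! (i + p + 2) - t ! (i + 1)"
 have dA: "((\<lambda>x. (x - t ! i) / A) has_real_derivative 1 / A) (at x)"
  by (rule DERIV_cdivide) (auto intro!: derivative_eq_intros)
 have dB: "((\<lambda>x. (t ! (i + p + 2) - x) / B) has_real_derivative (- 1) / B) (at x)"
  by (rule DERIV_cdivide) (auto intro!: derivative_eq_intros)
 have "((\<lambda>x. (x - t ! i) / A * bspline t p i x + (t ! (i + p + 2) - x) / B * bspline t p (i + 1) x)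
   has_real_derivative (1 / A * bspline t p i x + (x - t ! i) / A * dbspline t p i x)
    + (- 1 / B * bspline t p (i + 1) x + (t ! (i + p + 2) - x) / B * dbspline t p (i + 1) x)) (at x)"
  by (rule DERIV_cong[OF DERIV_add[OF DERIV_mult[OF dA 1] DERIV_mult[OF dB 2]]]) (simp add: mult.commute)
 moreover have "(\<lambda>x. (x - t ! i) / A * bspline t p i x + (t ! (i + p + 2) - x) / B * bspline t p (i + 1) x) = bspline t (Suc p) i"
  by (simp add: fun_eq_iff A_def B_def)
 moreover have "(1 / A * bspline t p i x + (x - t ! i) / A * dbspline t p i x)
    + (- 1 / B * bspline t p (i + 1) x + (t ! (i + p + 2) - x) / B * dbspline t p (i + 1) x) = dbspline t (Suc p) i x"
  by (simp add: A_def B_def)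
 ultimately show ?case by (simp only:)
qed

lemma bspline_borel [measurable]: "bspline t p i \<in> borel_measurable borel"
proof (induction p arbitrary: i)
 case 0
 have "bspline t 0 i = (\<lambda>x. if t ! i \<le> x \<and> x < t ! (i + 1) then 1 else 0)" by (simp add: fun_eq_iff)
 then show ?case by simp
next
 case (Suc p)
 have "bspline t (Suc p) i = (\<lambda>x. (x - t ! i) / (t ! (i + p + 1) - t ! i) * bspline t p i x
   + (t ! (i + p + 2) - x) / (t ! (i + p + 2) - t ! (i + 1)) * bspline t p (i + 1) x)" by (simp add: fun_eq_iff)
 note [measurable] = Suc
 show ?case unfolding \<open>bspline t (Suc p) i = _\<close> by measurable
qed

lemma dbspline_borel [measurable]: "dbspline t p i \<in> borel_measurable borel"
proof (induction p arbitrary: i)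
 case 0
 have "dbspline t 0 i = (\<lambda>x. 0)" by (simp add: fun_eq_iff)
 then show ?case by simp
next
 case (Suc p)
 note [measurable] = Suc
 show ?case unfolding dbspline.simps(2)[abs_def] by measurable
qed

text \<open>The recursion contains argument and knots only through quotients of differences, so a
  common translation and scaling of the knots passes to the argument; each derivative gains a factor
  n.\<close>

lemma bspline_affine:
 assumes "0 < n" "\<And>j. j \<le> p + 1 ==> t' ! (i' + j) = (t ! (i + j) + c) / n"
 shows "bspline t' p i' x = bspline t p i (n * x - c)" "dbspline t' p i' x = n * dbspline t p i (n * x - c)"
proof -
 have "bspline t' p i' x = bspline t p i (n * x - c) \<and> dbspline t' p i' x = n * dbspline t p i (n * x - c)"
  using assms(2)
 proof (induction p arbitrary: i i')
  case 0
  have "t' ! i' = (t ! i + c) / n" "t' ! (i' + 1) = (t ! (i + 1) + c) / n" using 0[of 0] 0[of 1] by simp_all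
  then show ?case
   unfolding bspline.simps dbspline.simps using assms(1)
   by (simp add: pos_divide_le_eq pos_less_divide_eq) (auto simp: algebra_simps)
 next
  case (Suc p)
  have k: "t' ! i' = (t ! i + c) / n" "t' ! (i' + 1) = (t ! (i + 1) + c) / n"
   "t' ! (i' + p + 1) = (t ! (i + p + 1) + c) / n" "t' ! (i' + p + 2) = (t ! (i + p + 2) + c) / n"
   using Suc.prems[of 0] Suc.prems[of 1] Suc.prems[of "p + 1"] Suc.prems[of "p + 2"] by (simp_all add: add.assoc)
  have 1: "bspline t' p i' x = bspline t p i (n * x - c)" "dbspline t' p i' x = n * dbspline t p i (n * x - c)"
   using Suc.IH[of i' i] Suc.prems by auto
  have 2: "bspline t' p (i' + 1) x = bspline t p (i + 1) (n * x - c)" "dbspline t' p (i' + 1) x = n * dbspline t p (i + 1) (n * x - c)"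
   using Suc.IH[of "i' + 1" "i + 1"] Suc.prems[of "Suc _"] by (auto simp: add.assoc)
  have quot: "(x - (a + c) / n) / ((b + c) / n - (z + c) / n) = ((n * x - c) - a) / (b - z)"
   "((a + c) / n - x) / ((b + c) / n - (z + c) / n) = (a - (n * x - c)) / (b - z)"
   "y / ((b + c) / n - (z + c) / n) = n * (y / (b - z))" for a b z y
  proof -
   have "x - (a + c) / n = ((n * x - c) - a) / n" "(a + c) / n - x = (a - (n * x - c)) / n"
    "(b + c) / n - (z + c) / n = (b - z) / n" using assms(1) by (simp_all add: field_simps)
   then show "(x - (a + c) / n) / ((b + c) / n - (z + c) / n) = ((n * x - c) - a) / (b - z)"
    "((a + c) / n - x) / ((b + c) / n - (z + c) / n) = (a - (n * x - c)) / (b - z)"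
    "y / ((b + c) / n - (z + c) / n) = n * (y / (b - z))" using assms(1) by simp_all
  qed
  have ring: "n * a + q * (n * d) - n * b + s * (n * e) = n * (a + q * d - b + s * e)" for a q d b s e :: real
   by (simp add: algebra_simps)
  show ?case
  proof
   show "bspline t' (Suc p) i' x = bspline t (Suc p) i (n * x - c)"
    by (simp only: bspline.simps(2) k quot(1,2) 1 2)
   show "dbspline t' (Suc p) i' x = n * dbspline t (Suc p) i (n * x - c)"
    by (simp only: dbspline.simps(2) k quot(1,2) 1 2) (simp only: quot(3) ring)
  qed
 qed
 then show "bspline t' p i' x = bspline t p i (n * x - c)" "dbspline t' p i' x = n * dbspline t p i (n * x - c)" by auto
qed

section \<open>Supports and uniform bounds of B-splines\<close>

definition sorted_knots :: "real list => nat => nat => bool" where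
 "sorted_knots t i p \<longleftrightarrow> (\<forall>a b. i \<le> a \<longrightarrow> a \<le> b \<longrightarrow> b \<le> i + p + 1 \<longrightarrow> t ! a \<le> t ! b)"

lemma bspline_support:
 assumes "sorted_knots t i p" "x < t ! i \<or> t ! (i + p + 1) < x"
 shows "bspline t p i x = 0 \<and> dbspline t p i x = 0"
 using assms
proof (induction p arbitrary: i)
 case (Suc p)
 have s: "sorted_knots t i p" "sorted_knots t (i + 1) p" using Suc.prems(1) by (auto simp: sorted_knots_def)
 have m: "t ! i \<le> t ! (i + 1)" "t ! (i + p + 1) \<le> t ! (i + p + 2)"
  using Suc.prems(1) by (auto simp: sorted_knots_def)
 have "bspline t p i x = 0 \<and> dbspline t p i x = 0" by (rule Suc.IH[OF s(1)]) (use Suc.prems(2) m in auto)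
 moreover have "bspline t p (i + 1) x = 0 \<and> dbspline t p (i + 1) x = 0" by (rule Suc.IH[OF s(2)]) (use Suc.prems(2) m in auto)
 ultimately show ?case by simp
qed auto

lemma quotient_unit_bound: "a \<le> x ==> x \<le> b ==> \<bar>(x - a) / (b - a)\<bar> \<le> 1 \<and> \<bar>(b - x) / (b - a)\<bar> \<le> (1::real)"
 by (cases "a = b") (auto simp: field_simps)

lemma abs_sum_bounds:
 fixes a b c d :: real
 shows "\<bar>a\<bar> \<le> A ==> \<bar>b\<bar> \<le> B ==> \<bar>a + b\<bar> \<le> A + B"
  and "\<bar>a\<bar> \<le> A ==> \<bar>b\<bar> \<le> B ==> \<bar>c\<bar> \<le> C ==> \<bar>d\<bar> \<le> D ==> \<bar>a + b - c + d\<bar> \<le> A + B + C + D"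
 by linarith+

text \<open>Each recursion step at most doubles the bound, since on the support of a spline its
  linear factor has modulus at most 1.\<close>

lemma bspline_bound:
 assumes "sorted_knots t i p" shows "\<bar>bspline t p i x\<bar> \<le> 2 ^ p"
 using assms
proof (induction p arbitrary: i)
 case (Suc p)
 have s: "sorted_knots t i p" "sorted_knots t (i + 1) p" using Suc.prems(1) by (auto simp: sorted_knots_def)
 have 1: "\<bar>(x - t ! i) / (t ! (i + p + 1) - t ! i) * bspline t p i x\<bar> \<le> 2 ^ p"
 proof (cases "t ! i \<le> x \<and> x \<le> t ! (i + p + 1)")
  case True
  then show ?thesis unfolding abs_mult
   using mult_mono[OF conjunct1[OF quotient_unit_bound[of "t ! i" x "t ! (i + p + 1)"]] Suc.IH[OF s(1)]] by auto
 qed (use bspline_support[OF s(1), of x] in auto)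
 have 2: "\<bar>(t ! (i + p + 2) - x) / (t ! (i + p + 2) - t ! (i + 1)) * bspline t p (i + 1) x\<bar> \<le> 2 ^ p"
 proof (cases "t ! (i + 1) \<le> x \<and> x \<le> t ! (i + p + 2)")
  case True
  then show ?thesis unfolding abs_mult
   using mult_mono[OF conjunct2[OF quotient_unit_bound[of "t ! (i + 1)" x "t ! (i + p + 2)"]] Suc.IH[OF s(2)]] by auto
 qed (use bspline_support[OF s(2), of x] in auto)
 show ?case using abs_sum_bounds(1)[OF 1 2] unfolding bspline.simps(2) by simp
qed auto

text \<open>When all nonzero knot gaps are at least h, a recursion step doubles the old bound and
  adds 2^p / h twice; p 2^p / h solves this recursion. Coincident knots produce a division by 0,
  hence the value 0.\<close>

lemma dbspline_bound:
 assumes "sorted_knots t i p" and h: "0 < h"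
  and gap: "\<And>a b. i \<le> a ==> a \<le> b ==> b \<le> i + p + 1 ==> t ! a < t ! b ==> h \<le> t ! b - t ! a"
 shows "\<bar>dbspline t p i x\<bar> \<le> real p * 2 ^ p / h"
 using assms(1) gap
proof (induction p arbitrary: i)
 case (Suc p)
 have s: "sorted_knots t i p" "sorted_knots t (i + 1) p" using Suc.prems(1) by (auto simp: sorted_knots_def)
 have D: "\<bar>dbspline t p i x\<bar> \<le> real p * 2 ^ p / h" "\<bar>dbspline t p (i + 1) x\<bar> \<le> real p * 2 ^ p / h"
  using Suc.IH[OF s(1)] Suc.IH[OF s(2)] Suc.prems(2) by auto
 have pos: "0 \<le> real p * 2 ^ p / h" using h by simp
 have q: "\<bar>bspline t p j x / (t ! (j + p + 1) - t ! j)\<bar> \<le> 2 ^ p / h" if j: "sorted_knots t j p" "j = i \<or> j = i + 1" for j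
 proof (cases "t ! j < t ! (j + p + 1)")
  case True
  then have "h \<le> t ! (j + p + 1) - t ! j" using Suc.prems(2)[of j "j + p + 1"] j(2) by auto
  then show ?thesis using bspline_bound[OF j(1), of x] h by (simp add: abs_divide frac_le)
 next
  case False
  then have "t ! (j + p + 1) = t ! j" using j(1) unfolding sorted_knots_def by (metis add.assoc le_add1 linorder_not_le order_antisym order_refl order_le_imp_less_or_eq)
  then show ?thesis using h by simp
 qed
 have q1: "\<bar>bspline t p i x / (t ! (i + p + 1) - t ! i)\<bar> \<le> 2 ^ p / h" using q[OF s(1)] by simp
 have q2: "\<bar>bspline t p (i + 1) x / (t ! (i + p + 2) - t ! (i + 1))\<bar> \<le> 2 ^ p / h" using q[OF s(2)] by simp
 have 1: "\<bar>(x - t ! i) / (t ! (i + p + 1) - t ! i) * dbspline t p i x\<bar> \<le> real p * 2 ^ p / h"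
 proof (cases "t ! i \<le> x \<and> x \<le> t ! (i + p + 1)")
  case True
  then show ?thesis unfolding abs_mult
   using mult_mono[OF conjunct1[OF quotient_unit_bound[of "t ! i" x "t ! (i + p + 1)"]] D(1)] by auto
 qed (use bspline_support[OF s(1), of x] pos in auto)
 have 2: "\<bar>(t ! (i + p + 2) - x) / (t ! (i + p + 2) - t ! (i + 1)) * dbspline t p (i + 1) x\<bar> \<le> real p * 2 ^ p / h"
 proof (cases "t ! (i + 1) \<le> x \<and> x \<le> t ! (i + p + 2)")
  case True
  then show ?thesis unfolding abs_mult
   using mult_mono[OF conjunct2[OF quotient_unit_bound[of "t ! (i + 1)" x "t ! (i + p + 2)"]] D(2)] by auto
 qed (use bspline_support[OF s(2), of x] pos in auto)
 have "\<bar>dbspline t (Suc p) i x\<bar> \<le> 2 ^ p / h + real p * 2 ^ p / h + 2 ^ p / h + real p * 2 ^ p / h"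
  unfolding dbspline.simps(2) by (rule abs_sum_bounds(2)[OF q1 1 q2 2])
 also have "\<dots> = real (Suc p) * 2 ^ Suc p / h" by (simp add: add_divide_distrib algebra_simps)
 finally show ?case .
qed auto

section \<open>Knot vectors as clamped integer quotients\<close>

lemma concat_replicate_nth:
 assumes "0 < P" "a \<le> b" "j < (b - a) * P"
 shows "concat (map (\<lambda>i. replicate P (f i)) [a..<b]) ! j = f (a + j div P)"
  and "length (concat (map (\<lambda>i. replicate P (f i)) [a..<b])) = (b - a) * P"
proof -
 have len: "length (concat (map (\<lambda>i. replicate P (f i)) [a..<b])) = (b - a) * P" for a b
  by (simp add: length_concat o_def sum_list_triv)
 then show "length (concat (map (\<lambda>i. replicate P (f i)) [a..<b])) = (b - a) * P" .
 show "concat (map (\<lambda>i. replicate P (f i)) [a..<b]) ! j = f (a + j div P)"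
  using assms(2,3)
 proof (induction b)
  case (Suc b)
  show ?case
  proof (cases "a \<le> b")
   case True
   have c: "concat (map (\<lambda>i. replicate P (f i)) [a..<Suc b]) = concat (map (\<lambda>i. replicate P (f i)) [a..<b]) @ replicate P (f b)"
    using True by simp
   show ?thesis
   proof (cases "j < (b - a) * P")
    case j: True
    then show ?thesis unfolding c using Suc.IH[OF True j] by (simp add: nth_append len)
   next
    case j: False
    have "j < (b - a) * P + P" using Suc.prems(2) True by (simp add: Suc_diff_le)
    then have "j div P = b - a" using j assms(1) by (intro div_nat_eqI) (auto simp: mult.commute)
    then show ?thesis unfolding c using j True \<open>j < (b - a) * P + P\<close> by (simp add: nth_append len)
   qed
  next
   case False
   then have "a = Suc b" using Suc.prems by simp
   then show ?thesis using Suc.prems by simp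
  qed
 qed simp
qed

text \<open>Matrix index i stands for the spline with number i + 2, whose knots start at position i
  + 1. Dividing i - k by p - k, rounding down, gives the cell where its support would start in the
  variable n x before clamping to [0, 1], and as remainder the position among the p - k reference
  splines. Cells near the left end can be negative.\<close>

definition spline_comp :: "nat => nat => nat => nat" where
 "spline_comp p k i = nat ((int i - int k) mod int (p - k))"
definition spline_cell :: "nat => nat => nat => int" where
 "spline_cell p k i = (int i - int k) div int (p - k)"
definition spline_D :: "nat => nat => nat => nat => real => real" where
 "spline_D p k n i = dbspline (open_knots p k n) p (i - 1)"
definition beta_D :: "nat => nat => nat => real => real" where
 "beta_D p k i = dbspline (reference_knots p k) p (i - 1)"

context
 fixes p k P :: nat
 assumes pk: "p = k + P" and P0: "0 < P"
begin

lemma kp: "k < p" "p - k = P" using pk P0 by auto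

lemma zdiv_less: "a div b < c" if "a < c * b" "0 < b" for a b c :: int
proof (rule ccontr)
 assume "\<not> a div b < c"
 then have "c * b \<le> (a div b) * b" using that by (intro mult_right_mono) auto
 also have "\<dots> \<le> a" using that pos_mod_sign[of b a] div_mult_mod_eq[of a b] by linarith
 finally show False using that by simp
qed

lemma zle_div: "c \<le> a div b" if "c * b \<le> a" "0 < b" for a b c :: int
proof (rule ccontr)
 assume "\<not> c \<le> a div b"
 then have "(a div b + 1) * b \<le> c * b" using that by (intro mult_right_mono) auto
 moreover have "a < (a div b + 1) * b" 
  unfolding distrib_right using that pos_mod_bound[of b a] div_mult_mod_eq[of a b] by linarith
 ultimately show False using that by linarith
qed

text \<open>Continued periodically, the interior knots would be floor((j - k - 1) / P) / n. Clamping
  the numerator to {0..n} reproduces the p + 1 copies of 0 and of 1, so one formula serves boundary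
  and interior splines.\<close>

lemma open_knots_nth:
 assumes n: "1 \<le> n" and j: "j < n * P + p + k + 2"
 shows "open_knots p k n ! j = real_of_int (max 0 (min (int n) ((int j - int k - 1) div int P))) / real n"
proof -
 define C where "C = concat (map (\<lambda>i. replicate P (real i / real n)) [1..<n])"
 have lC: "length C = (n - 1) * P" by (simp add: C_def length_concat o_def sum_list_triv)
 have kn: "open_knots p k n = replicate (p + 1) 0 @ C @ replicate (p + 1) 1"
  by (simp only: open_knots_def kp C_def)
 have nP: "n * P = (n - 1) * P + P" using n by (metis Suc_diff_1 add.commute mult_Suc not_one_le_zero bot_nat_0.not_eq_extremum)
 consider "j \<le> p" | "p < j" "j < p + 1 + (n - 1) * P" | "p + 1 + (n - 1) * P \<le> j" by linarith
 then show ?thesis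
 proof cases
  case 1
  then have "open_knots p k n ! j = 0"
   unfolding kn by (simp add: nth_append less_Suc_eq_le del: replicate_Suc)
  moreover have "(int j - int k - 1) div int P \<le> 0"
  proof -
   have "int j - int k - 1 < 1 * int P" using 1 pk by simp
   then have "(int j - int k - 1) div int P < 1" using P0 by (intro zdiv_less) auto
   then show ?thesis by simp
  qed
  ultimately show ?thesis by simp
 next
  case 2
  define a where "a = j - (p + 1)"
  have ja: "j = p + 1 + a" and a: "a < (n - 1) * P" using 2 by (auto simp: a_def)
  have "open_knots p k n ! j = C ! a"
   using a unfolding ja kn by (simp add: nth_append lC del: replicate_Suc)
  also have "\<dots> = real (1 + a div P) / real n"
   unfolding C_def by (rule concat_replicate_nth(1)) (use P0 n a in auto)
  finally have o: "open_knots p k n ! j = real (1 + a div P) / real n" .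
  have "int j - int k - 1 = int a + 1 * int P" using pk by (simp add: ja)
  then have "(int j - int k - 1) div int P = 1 + int a div int P"
   using P0 div_mult_self1[of "int P" "int a" 1] by simp
  then have e: "(int j - int k - 1) div int P = int (1 + a div P)" by (simp add: zdiv_int)
  have "a div P < n - 1" using a P0 by (simp add: less_mult_imp_div_less)
  then have "max 0 (min (int n) (int (1 + a div P))) = int (1 + a div P)" by simp
  then show ?thesis unfolding o e by simp
 next
  case 3
  have "j - (p + 1) - (n - 1) * P < p + 1" using j nP pk by linarith
  then have "open_knots p k n ! j = 1"
   using 3 unfolding kn by (simp add: nth_append lC del: replicate_Suc)
  moreover have "int n \<le> (int j - int k - 1) div int P"
  proof -
   have "n * P + k + 1 \<le> j" using 3 nP pk by linarith
   then have "int (n * P) + int k + 1 \<le> int j" by linarith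
   then show ?thesis using P0 by (intro zle_div) auto
  qed
  ultimately show ?thesis using n by simp
 qed
qed

lemma reference_knots_nth:
 assumes "j \<le> P + p"
 shows "reference_knots p k ! j = real (j div P)"
proof -
 have "real (p + 1) / real P \<le> real (spline_eta p k)"
  unfolding spline_eta_def kp by (simp add: of_nat_nat)
 then have "real (p + 1) \<le> real (spline_eta p k * P)" using P0 by (simp add: pos_divide_le_eq)
 then have "p + 1 \<le> spline_eta p k * P" by (simp only: of_nat_le_iff)
 then have "j < (spline_eta p k + 1 - 0) * P" using assms by simp
 then show ?thesis unfolding reference_knots_def kp
  using concat_replicate_nth(1)[of P 0 "spline_eta p k + 1" j real] P0 by simp
qed

lemma cell_comp: "int i - int k = spline_cell p k i * int P + int (spline_comp p k i)"
 using P0 by (simp add: spline_cell_def spline_comp_def kp)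

lemma comp_less: "spline_comp p k i < P"
 using P0 by (simp add: spline_comp_def kp nat_less_iff)

lemma comp_cell_inj: "spline_comp p k i = spline_comp p k j ==> spline_cell p k i = spline_cell p k j ==> i = j"
 using cell_comp[of i] cell_comp[of j] by simp

lemma open_knots_cell:
 assumes n: "1 \<le> n" and i: "i < spline_dim p k n" and j: "j \<le> p + 1"
 shows "open_knots p k n ! (i + 1 + j)
  = real_of_int (max 0 (min (int n) (spline_cell p k i + int ((spline_comp p k i + j) div P)))) / real n"
proof -
 have "i + 1 + j < n * P + p + k + 2" using i j unfolding spline_dim_def kp by linarith
 then have "open_knots p k n ! (i + 1 + j) = real_of_int (max 0 (min (int n) ((int (i + 1 + j) - int k - 1) div int P))) / real n"
  by (rule open_knots_nth[OF n])
 also have "int (i + 1 + j) - int k - 1 = int (spline_comp p k i + j) + spline_cell p k i * int P"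
  using cell_comp[of i] by simp
 also have "\<dots> div int P = spline_cell p k i + int ((spline_comp p k i + j) div P)"
  using P0 by (simp add: zdiv_int)
 finally show ?thesis .
qed

lemma cell_lower: "- int p \<le> spline_cell p k i"
proof -
 have "k * 1 \<le> p * P" using pk P0 by (intro mult_mono) auto
 then have "int k \<le> int (p * P)" by (simp only: of_nat_le_iff mult_1_right)
 then have "- int p * int P \<le> int i - int k" by simp
 then show ?thesis unfolding spline_cell_def kp using P0 by (intro zle_div) auto
qed

lemma cell_upper:
 assumes "i < spline_dim p k n" shows "spline_cell p k i \<le> int n"
proof -
 have "i + 1 < n * P + k" using assms by (simp add: spline_dim_def kp)
 then have "int i + 1 < int (n * P + k)" by linarith
 then have "int i - int k < (int n + 1) * int P" by (simp add: distrib_right)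
 then have "spline_cell p k i < int n + 1" unfolding spline_cell_def kp using P0 by (intro zdiv_less) auto
 then show ?thesis by simp
qed

lemma comp_cell_complete:
 assumes "c < P" "0 \<le> \<mu>" "\<mu> \<le> int n - 2"
 shows "\<exists>i<spline_dim p k n. spline_comp p k i = c \<and> spline_cell p k i = \<mu>"
proof -
 define i where "i = k + nat \<mu> * P + c"
 have "nat \<mu> + 2 \<le> n" using assms by linarith
 then have "(nat \<mu> + 2) * P \<le> n * P" by (rule mult_le_mono1)
 then have "nat \<mu> * P + 2 * P \<le> n * P" by (simp only: distrib_right)
 then have "i < spline_dim p k n" using assms(1) P0 unfolding i_def spline_dim_def kp by linarith
 moreover have e: "int i - int k = int c + \<mu> * int P" using assms by (simp add: i_def)
 have "spline_cell p k i = \<mu>" unfolding spline_cell_def e kp using assms(1) by simp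
 moreover have "spline_comp p k i = c" unfolding spline_comp_def e kp using assms(1) by simp
 ultimately show ?thesis by blast
qed

lemma div_sum_le: "(spline_comp p k i + j) div P \<le> j"
proof -
 have "j * 1 \<le> j * P" using P0 by (intro mult_left_mono) auto
 then have "spline_comp p k i + j < (j + 1) * P" using comp_less[of i] unfolding distrib_right by linarith
 then have "(spline_comp p k i + j) div P < j + 1" by (rule less_mult_imp_div_less)
 then show ?thesis by simp
qed

context
 fixes n i :: nat
 assumes n: "1 \<le> n" and i: "i < spline_dim p k n"
begin

lemma open_knots_sorted: "sorted_knots (open_knots p k n) (i + 1) p"
 unfolding sorted_knots_def
proof (intro allI impI)
 fix a b assume ab: "i + 1 \<le> a" "a \<le> b" "b \<le> i + 1 + p + 1"
 define a' b' where "a' = a - (i + 1)" and "b' = b - (i + 1)"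
 have e: "a = i + 1 + a'" "b = i + 1 + b'" "a' \<le> p + 1" "b' \<le> p + 1" "a' \<le> b'" using ab by (auto simp: a'_def b'_def)
 have "(spline_comp p k i + a') div P \<le> (spline_comp p k i + b') div P" using e by (intro div_le_mono) auto
 then show "open_knots p k n ! a \<le> open_knots p k n ! b"
  unfolding e(1,2) open_knots_cell[OF n i e(3)] open_knots_cell[OF n i e(4)]
  by (intro divide_right_mono) (auto simp: max_def min_def)
qed

lemma open_knots_gap:
 assumes ab: "i + 1 \<le> a" "a \<le> b" "b \<le> i + 1 + p + 1" and lt: "open_knots p k n ! a < open_knots p k n ! b"
 shows "1 / real n \<le> open_knots p k n ! b - open_knots p k n ! a"
proof -
 define a' b' where "a' = a - (i + 1)" and "b' = b - (i + 1)"
 have e: "a = i + 1 + a'" "b = i + 1 + b'" "a' \<le> p + 1" "b' \<le> p + 1" using ab by (auto simp: a'_def b'_def)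
 define u v where "u = max 0 (min (int n) (spline_cell p k i + int ((spline_comp p k i + a') div P)))"
  and "v = max 0 (min (int n) (spline_cell p k i + int ((spline_comp p k i + b') div P)))"
 have o: "open_knots p k n ! a = real_of_int u / real n" "open_knots p k n ! b = real_of_int v / real n"
  unfolding e(1,2) u_def v_def by (rule open_knots_cell[OF n i e(3)], rule open_knots_cell[OF n i e(4)])
 have "u < v" using lt n unfolding o by (simp add: divide_less_cancel)
 then have "1 \<le> real_of_int v - real_of_int u" by linarith
 then show ?thesis unfolding o using n by (simp add: diff_divide_distrib[symmetric] divide_right_mono)
qed

text \<open>The knots of one spline span at most p + 1 cells, fewer if knots are repeated. All
  nonzero gaps are at least 1 / n, which gives the factor n in the bound for the derivative.\<close>

lemma spline_facts:
 shows "\<bar>spline_B p k n (i + 2) x\<bar> \<le> 2 ^ p"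
  and "\<bar>spline_D p k n (i + 2) x\<bar> \<le> real p * 2 ^ p * real n"
  and "\<not> (0 \<le> x \<and> x \<le> 1 \<and> of_int (spline_cell p k i) \<le> real n * x \<and> real n * x \<le> of_int (spline_cell p k i) + real p + 1)
   ==> spline_B p k n (i + 2) x = 0 \<and> spline_D p k n (i + 2) x = 0"
  and "finite {x. deriv (spline_B p k n (i + 2)) x \<noteq> spline_D p k n (i + 2) x}"
proof -
 have e: "i + 2 - 1 = i + 1" by simp
 show "\<bar>spline_B p k n (i + 2) x\<bar> \<le> 2 ^ p"
  unfolding spline_B_def e by (rule bspline_bound[OF open_knots_sorted])
 show "\<bar>spline_D p k n (i + 2) x\<bar> \<le> real p * 2 ^ p * real n"
  unfolding spline_D_def e using dbspline_bound[OF open_knots_sorted, of "1 / real n" x] open_knots_gap n by simp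
 have "{x. deriv (spline_B p k n (i + 2)) x \<noteq> spline_D p k n (i + 2) x} \<subseteq> (\<lambda>j. open_knots p k n ! j) ` {i + 1..i + 1 + p + 1}"
  unfolding spline_B_def spline_D_def e using bspline_has_derivative[THEN DERIV_imp_deriv] by blast
 then show "finite {x. deriv (spline_B p k n (i + 2)) x \<noteq> spline_D p k n (i + 2) x}" by (rule finite_subset) simp
 let ?c = "spline_cell p k i"
 have k0: "open_knots p k n ! (i + 1) = real_of_int (max 0 (min (int n) ?c)) / real n"
  using open_knots_cell[OF n i, of 0] comp_less[of i] by simp
 have k1: "open_knots p k n ! (i + 1 + p + 1) \<le> real_of_int (max 0 (min (int n) (?c + int (p + 1)))) / real n"
 proof -
  have "open_knots p k n ! (i + 1 + (p + 1)) = real_of_int (max 0 (min (int n) (?c + int ((spline_comp p k i + (p + 1)) div P)))) / real n"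
   by (rule open_knots_cell[OF n i]) simp
  also have "\<dots> \<le> real_of_int (max 0 (min (int n) (?c + int (p + 1)))) / real n"
   using div_sum_le[of i "p + 1"] by (intro divide_right_mono) (auto simp: max_def min_def)
  finally show ?thesis by (simp add: add.assoc)
 qed
 have c: "- int p \<le> ?c" "?c \<le> int n" using cell_lower cell_upper[OF i] by auto
 assume x: "\<not> (0 \<le> x \<and> x \<le> 1 \<and> of_int ?c \<le> real n * x \<and> real n * x \<le> of_int ?c + real p + 1)"
 have "x < open_knots p k n ! (i + 1) \<or> open_knots p k n ! (i + 1 + p + 1) < x"
 proof (rule ccontr)
  assume "\<not> ?thesis"
  then have "real_of_int (max 0 (min (int n) ?c)) / real n \<le> x" "x \<le> real_of_int (max 0 (min (int n) (?c + int (p + 1)))) / real n"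
   using k0 k1 by auto
  then have a: "real_of_int (max 0 (min (int n) ?c)) \<le> real n * x" "real n * x \<le> real_of_int (max 0 (min (int n) (?c + int (p + 1))))"
   using n by (simp_all add: pos_divide_le_eq pos_le_divide_eq mult.commute)
  have "max 0 (min (int n) (?c + int (p + 1))) \<le> int n" by simp
  then have "real_of_int (max 0 (min (int n) (?c + int (p + 1)))) \<le> real n" by linarith
  moreover have "0 \<le> real_of_int (max 0 (min (int n) ?c))" by simp
  ultimately have "0 \<le> real n * x" "real n * x \<le> real n * 1" using a by linarith+
  then have "0 \<le> x" "x \<le> 1" using n by (simp_all add: zero_le_mult_iff mult_le_cancel_left)
  moreover have "of_int ?c \<le> real n * x" using a(1) c by (simp add: max_def min_def split: if_splits)
  moreover have "real n * x \<le> of_int ?c + real p + 1" using a(2) c by (simp add: max_def min_def split: if_splits)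
  ultimately show False using x by blast
 qed
 then show "spline_B p k n (i + 2) x = 0 \<and> spline_D p k n (i + 2) x = 0"
  unfolding spline_B_def spline_D_def e using bspline_support[OF open_knots_sorted] by blast
qed

text \<open>Under these bounds on the cell the clamping is inactive, and the knots are those of a
  reference spline translated by the cell and scaled by 1 / n.\<close>

lemma spline_interior:
 assumes "0 \<le> spline_cell p k i" "spline_cell p k i + int p + 1 \<le> int n"
 shows "spline_B p k n (i + 2) x = spline_beta p k (spline_comp p k i + 1) (real n * x - of_int (spline_cell p k i))"
  and "spline_D p k n (i + 2) x = real n * beta_D p k (spline_comp p k i + 1) (real n * x - of_int (spline_cell p k i))"
proof -
 have kn: "open_knots p k n ! (i + 1 + j) = (reference_knots p k ! (spline_comp p k i + j) + of_int (spline_cell p k i)) / real n"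
  if j: "j \<le> p + 1" for j
 proof -
  have "spline_comp p k i + j \<le> P + p" using comp_less[of i] j by linarith
  moreover have "(spline_comp p k i + j) div P \<le> p + 1" using div_sum_le[of i j] j by linarith
  ultimately show ?thesis
   unfolding open_knots_cell[OF n i j] using assms by (simp add: reference_knots_nth)
 qed
 note a = bspline_affine[of "real n" p "open_knots p k n" "i + 1" "reference_knots p k" "spline_comp p k i" "of_int (spline_cell p k i)" x]
 show "spline_B p k n (i + 2) x = spline_beta p k (spline_comp p k i + 1) (real n * x - of_int (spline_cell p k i))"
  unfolding spline_B_def spline_beta_def using a(1) kn n by simp
 show "spline_D p k n (i + 2) x = real n * beta_D p k (spline_comp p k i + 1) (real n * x - of_int (spline_cell p k i))"
  unfolding spline_D_def beta_D_def using a(2) kn n by simp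
qed

end

lemma reference_sorted: "c < P ==> sorted_knots (reference_knots p k) c p"
 unfolding sorted_knots_def
proof (intro allI impI)
 fix a b assume "c < P" "c \<le> a" "a \<le> b" "b \<le> c + p + 1"
 then have "a \<le> P + p" "b \<le> P + p" "a div P \<le> b div P" by (auto intro: div_le_mono)
 then show "reference_knots p k ! a \<le> reference_knots p k ! b" by (simp add: reference_knots_nth)
qed

lemma beta_facts:
 assumes c: "c < P"
 shows "\<bar>spline_beta p k (c + 1) x\<bar> \<le> 2 ^ p"
  and "\<bar>beta_D p k (c + 1) x\<bar> \<le> real p * 2 ^ p"
  and "\<not> (0 \<le> x \<and> x \<le> real p + 1) ==> spline_beta p k (c + 1) x = 0 \<and> beta_D p k (c + 1) x = 0"
  and "finite {x. deriv (spline_beta p k (c + 1)) x \<noteq> beta_D p k (c + 1) x}"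
proof -
 have e: "c + 1 - 1 = c" by simp
 show "\<bar>spline_beta p k (c + 1) x\<bar> \<le> 2 ^ p"
  unfolding spline_beta_def e by (rule bspline_bound[OF reference_sorted[OF c]])
 show "\<bar>beta_D p k (c + 1) x\<bar> \<le> real p * 2 ^ p"
 proof -
  have "1 \<le> reference_knots p k ! b - reference_knots p k ! a"
   if "c \<le> a" "a \<le> b" "b \<le> c + p + 1" "reference_knots p k ! a < reference_knots p k ! b" for a b
  proof -
   have "a \<le> P + p" "b \<le> P + p" using that c by auto
   then show ?thesis using that(4) by (simp add: reference_knots_nth)
  qed
  then show ?thesis unfolding beta_D_def e using dbspline_bound[OF reference_sorted[OF c], of 1 x] by simp
 qed
 have "{x. deriv (spline_beta p k (c + 1)) x \<noteq> beta_D p k (c + 1) x} \<subseteq> (\<lambda>j. reference_knots p k ! j) ` {c..c + p + 1}"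
  unfolding spline_beta_def beta_D_def e using bspline_has_derivative[THEN DERIV_imp_deriv] by blast
 then show "finite {x. deriv (spline_beta p k (c + 1)) x \<noteq> beta_D p k (c + 1) x}" by (rule finite_subset) simp
 have "reference_knots p k ! c = 0" using c by (simp add: reference_knots_nth)
 moreover have "reference_knots p k ! (c + p + 1) \<le> real p + 1"
 proof -
  have "(p + 1) * 1 \<le> (p + 1) * P" using P0 by (intro mult_left_mono) auto
  then have "c + p + 1 < (p + 2) * P" using c by (simp add: distrib_right)
  then have "(c + p + 1) div P < p + 2" by (rule less_mult_imp_div_less)
  moreover have "c + p + 1 \<le> P + p" using c by simp
  ultimately show ?thesis by (simp add: reference_knots_nth)
 qed
 moreover assume "\<not> (0 \<le> x \<and> x \<le> real p + 1)"
 ultimately have "x < reference_knots p k ! c \<or> reference_knots p k ! (c + p + 1) < x" by auto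
 then show "spline_beta p k (c + 1) x = 0 \<and> beta_D p k (c + 1) x = 0"
  unfolding spline_beta_def beta_D_def e by (rule bspline_support[OF reference_sorted[OF c]])
qed

end

lemma spline_borel [measurable]:
 "spline_B p k n i \<in> borel_measurable borel" "spline_D p k n i \<in> borel_measurable borel"
 "spline_beta p k c \<in> borel_measurable borel" "beta_D p k c \<in> borel_measurable borel"
 by (simp_all add: spline_B_def spline_D_def spline_beta_def beta_D_def)

section \<open>The matrices of the splines\<close>

text \<open>The common shape of the entries of \<open>K_block\<close>, \<open>H_block\<close> and
  \<open>M_block\<close>.\<close>

definition shift_prod :: "(real => real) => (real => real) => int => real" where
 "shift_prod F G s = (LINT y|lborel. F y * G (y - of_int s))"

lemma shift_prod_minus: "shift_prod F G (- s) = shift_prod G F s"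
 unfolding shift_prod_def
 by (subst lborel_integral_real_affine[of 1 _ "- of_int s"]) (auto simp: mult.commute intro!: Bochner_Integration.integral_cong)

text \<open>\<open>P\<close> and \<open>Q\<close> are p - k and q - l. The coupling blocks carry a
  factor \<tau>: the case 1 is the one of the theorem, and the case 0 decouples the blocks and
  isolates the stiffness matrix.\<close>

locale spline_pair =
 fixes p k P q l Q :: nat and \<rho> \<tau> :: real
 assumes pk: "p = k + P" and P0: "0 < P" and ql: "q = l + Q" and Q0: "0 < Q"
begin

definition dP :: "nat => nat" where "dP n = spline_dim p k n"
definition dQ :: "nat => nat" where "dQ n = spline_dim q l n"
definition N :: "nat => nat" where "N n = dP n + dQ n"
text \<open>A common bound for the widths p + 1 and q + 1 of the two kinds of supports, measured in
  cells; it also serves as bandwidth.\<close>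

definition wd :: nat where "wd = p + q + 2"
definition comp :: "nat => nat => nat" where
 "comp n i = (if i < dP n then spline_comp p k i else P + spline_comp q l (i - dP n))"
definition cell :: "nat => nat => int" where
 "cell n i = (if i < dP n then spline_cell p k i else spline_cell q l (i - dP n))"
definition u :: "nat => nat => real => real" where
 "u n i x = (if i < dP n then spline_B p k n (i + 2) x else spline_B q l n (i - dP n + 2) x)"
text \<open>Derivatives are divided by n so that they stay bounded uniformly in n.\<close>

definition v :: "nat => nat => real => real" where
 "v n i x = (if i < dP n then spline_D p k n (i + 2) x else spline_D q l n (i - dP n + 2) x) / real n"
text \<open>The value 0 from P + Q on lets bounds and supports be stated for every index.\<close>

definition bu :: "nat => real => real" where
 "bu c = (if c < P then spline_beta p k (c + 1) else if c < P + Q then spline_beta q l (c - P + 1) else (\<lambda>_. 0))"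
definition bv :: "nat => real => real" where
 "bv c = (if c < P then beta_D p k (c + 1) else if c < P + Q then beta_D q l (c - P + 1) else (\<lambda>_. 0))"
definition Cb :: real where "Cb = (real p + 1) * 2 ^ p + (real q + 1) * 2 ^ q"

lemma Cb_ge: "2 ^ p \<le> Cb" "real p * 2 ^ p \<le> Cb" "2 ^ q \<le> Cb" "real q * 2 ^ q \<le> Cb" "0 \<le> Cb"
proof -
 have "0 \<le> real p * 2 ^ p" "0 \<le> real q * 2 ^ q" "(0::real) \<le> 2 ^ p" "(0::real) \<le> 2 ^ q" by auto
 then show "2 ^ p \<le> Cb" "real p * 2 ^ p \<le> Cb" "2 ^ q \<le> Cb" "real q * 2 ^ q \<le> Cb" "0 \<le> Cb"
  unfolding Cb_def distrib_right by linarith+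
qed

lemma uv_borel [measurable]: "u n i \<in> borel_measurable borel" "v n i \<in> borel_measurable borel"
 "bu c \<in> borel_measurable borel" "bv c \<in> borel_measurable borel"
 unfolding u_def v_def bu_def bv_def using spline_borel by auto

lemma comp_less_iff: "1 \<le> n ==> i < N n ==> comp n i < P + Q"
 "comp n i < P \<longleftrightarrow> i < dP n"
 unfolding comp_def using comp_less[OF pk P0, of i] comp_less[OF ql Q0, of "i - dP n"] by auto

lemma N_index: "i < N n ==> \<not> i < dP n ==> i - dP n < spline_dim q l n"
 unfolding N_def dQ_def by auto

lemma uv_bound:
 assumes n: "1 \<le> n" and i: "i < N n"
 shows "\<bar>u n i x\<bar> \<le> Cb" "\<bar>v n i x\<bar> \<le> Cb"
proof -
 show "\<bar>u n i x\<bar> \<le> Cb"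
  using spline_facts(1)[OF pk P0 n, of i x] spline_facts(1)[OF ql Q0 n N_index[OF i], of x] Cb_ge
  unfolding u_def dP_def by (cases "i < spline_dim p k n") (force simp: dP_def)+
 have n0: "0 < real n" using n by simp
 have scale: "\<bar>y\<bar> \<le> c * real n ==> c \<le> Cb ==> \<bar>y / real n\<bar> \<le> Cb" for y c :: real
  using n0 by (simp add: pos_divide_le_eq) (meson mult_right_mono order_trans of_nat_0_le_iff)
 show "\<bar>v n i x\<bar> \<le> Cb"
 proof (cases "i < dP n")
  case True
  then show ?thesis unfolding v_def
   using scale[OF spline_facts(2)[OF pk P0 n, of i x]] Cb_ge by (simp add: dP_def)
 next
  case False
  then show ?thesis unfolding v_def
   using scale[OF spline_facts(2)[OF ql Q0 n N_index[OF i False], of x]] Cb_ge by simp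
 qed
qed

lemma uv_support:
 assumes n: "1 \<le> n" and i: "i < N n"
  and x: "\<not> (0 \<le> x \<and> x \<le> 1 \<and> of_int (cell n i) \<le> real n * x \<and> real n * x \<le> of_int (cell n i) + real wd)"
 shows "u n i x = 0" "v n i x = 0"
proof -
 have "u n i x = 0 \<and> v n i x = 0"
 proof (cases "i < dP n")
  case True
  then have "\<not> (0 \<le> x \<and> x \<le> 1 \<and> of_int (spline_cell p k i) \<le> real n * x \<and> real n * x \<le> of_int (spline_cell p k i) + real p + 1)"
   using x unfolding cell_def wd_def by auto
  from spline_facts(3)[OF pk P0 n _ this] True show ?thesis unfolding u_def v_def by (simp add: dP_def)
 next
  case False
  then have "\<not> (0 \<le> x \<and> x \<le> 1 \<and> of_int (spline_cell q l (i - dP n)) \<le> real n * x \<and> real n * x \<le> of_int (spline_cell q l (i - dP n)) + real q + 1)"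
   using x unfolding cell_def wd_def by auto
  from spline_facts(3)[OF ql Q0 n N_index[OF i False] this] False show ?thesis unfolding u_def v_def by simp
 qed
 then show "u n i x = 0" "v n i x = 0" by auto
qed

lemma uv_interior:
 assumes n: "1 \<le> n" and i: "i < N n" and c: "0 \<le> cell n i" "cell n i + int wd \<le> int n"
 shows "u n i x = bu (comp n i) (real n * x - of_int (cell n i))"
  "v n i x = bv (comp n i) (real n * x - of_int (cell n i))"
proof -
 have n0: "real n \<noteq> 0" using n by simp
 have "u n i x = bu (comp n i) (real n * x - of_int (cell n i)) \<and> v n i x = bv (comp n i) (real n * x - of_int (cell n i))"
 proof (cases "i < dP n")
  case True
  then have "0 \<le> spline_cell p k i" "spline_cell p k i + int p + 1 \<le> int n" using c unfolding cell_def wd_def by auto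
  from spline_interior[OF pk P0 n _ this, of x] True comp_less[OF pk P0, of i] n0
  show ?thesis unfolding u_def v_def bu_def bv_def comp_def cell_def by (simp add: dP_def)
 next
  case False
  then have "0 \<le> spline_cell q l (i - dP n)" "spline_cell q l (i - dP n) + int q + 1 \<le> int n" using c unfolding cell_def wd_def by auto
  from spline_interior[OF ql Q0 n N_index[OF i False] this, of x] False comp_less[OF ql Q0, of "i - dP n"] n0
  show ?thesis unfolding u_def v_def bu_def bv_def comp_def cell_def by simp
 qed
 then show "u n i x = bu (comp n i) (real n * x - of_int (cell n i))"
  "v n i x = bv (comp n i) (real n * x - of_int (cell n i))" by auto
qed

lemma b_facts: "\<bar>bu c y\<bar> \<le> Cb" "\<bar>bv c y\<bar> \<le> Cb"
 "\<not> (0 \<le> y \<and> y \<le> real wd) ==> bu c y = 0" "\<not> (0 \<le> y \<and> y \<le> real wd) ==> bv c y = 0"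
proof -
 have A: "\<bar>bu c y\<bar> \<le> Cb \<and> \<bar>bv c y\<bar> \<le> Cb"
  using beta_facts(1,2)[OF pk P0, of c y] beta_facts(1,2)[OF ql Q0, of "c - P" y] Cb_ge
   Q0 less_diff_conv2[of P c Q]
  unfolding bu_def bv_def by (cases "c < P"; cases "c < P + Q") (auto simp: add.commute)
 have B: "bu c y = 0 \<and> bv c y = 0" if "\<not> (0 \<le> y \<and> y \<le> real wd)"
 proof -
  have "\<not> (0 \<le> y \<and> y \<le> real p + 1)" "\<not> (0 \<le> y \<and> y \<le> real q + 1)" using that unfolding wd_def by auto
  then show ?thesis using beta_facts(3)[OF pk P0, of c y] beta_facts(3)[OF ql Q0, of "c - P" y]
   unfolding bu_def bv_def by auto
 qed
 show "\<bar>bu c y\<bar> \<le> Cb" "\<bar>bv c y\<bar> \<le> Cb"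
  "\<not> (0 \<le> y \<and> y \<le> real wd) ==> bu c y = 0" "\<not> (0 \<le> y \<and> y \<le> real wd) ==> bv c y = 0"
  using A B by auto
qed

lemma N_bounds:
 assumes "1 \<le> n"
 shows "i < N n ==> - int wd \<le> cell n i" "i < N n ==> cell n i \<le> int n"
  "inj_on (\<lambda>i. (comp n i, cell n i)) {..<N n}"
  "c < P + Q ==> 0 \<le> \<mu> ==> \<mu> \<le> int n - 2 ==> \<exists>j<N n. comp n j = c \<and> cell n j = \<mu>"
proof -
 show "- int wd \<le> cell n i" if "i < N n"
  using cell_lower[OF pk P0, of i] cell_lower[OF ql Q0, of "i - dP n"] unfolding cell_def wd_def by auto
 show "cell n i \<le> int n" if "i < N n"
  using cell_upper[OF pk P0, of i n] cell_upper[OF ql Q0 N_index[OF that]] unfolding cell_def dP_def by auto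
 show "inj_on (\<lambda>i. (comp n i, cell n i)) {..<N n}"
 proof (rule inj_onI)
  fix i j assume e: "(comp n i, cell n i) = (comp n j, cell n j)"
  have lt: "i < dP n \<longleftrightarrow> j < dP n" using comp_less_iff(2)[of n i] comp_less_iff(2)[of n j] e by simp
  show "i = j"
  proof (cases "i < dP n")
   case True
   then show ?thesis using e lt comp_cell_inj[OF pk P0, of i j] unfolding comp_def cell_def by simp
  next
   case False
   then have "i - dP n = j - dP n" using e lt comp_cell_inj[OF ql Q0, of "i - dP n" "j - dP n"] unfolding comp_def cell_def by simp
   then show ?thesis using False lt by simp
  qed
 qed
 show "\<exists>j<N n. comp n j = c \<and> cell n j = \<mu>" if c: "c < P + Q" and \<mu>: "0 \<le> \<mu>" "\<mu> \<le> int n - 2"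
 proof (cases "c < P")
  case True
  from comp_cell_complete[OF pk P0 this \<mu>] show ?thesis unfolding N_def comp_def cell_def dP_def by force
 next
  case False
  then have "c - P < Q" using c by simp
  from comp_cell_complete[OF ql Q0 this \<mu>] obtain i where "i < spline_dim q l n" "spline_comp q l i = c - P" "spline_cell q l i = \<mu>" by blast
  then show ?thesis using False unfolding N_def comp_def cell_def dQ_def by (intro exI[of _ "dP n + i"]) auto
 qed
qed

text \<open>With derivatives rescaled by 1 / n, the blocks A11 / n, A12 and n A22 are all n times an
  integral of a product of splines and rescaled derivatives, with the coefficient in the first one;
  hence the single factor \<open>real n\<close>.\<close>

definition ent :: "(real => real) => nat => (real => real) => (real => real) => real" where
 "ent f n g h = real n * (LINT x|lborel. indicator {0..1} x * (f x * (g x * h x)))"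

definition X :: "(real => real) => nat => mat_fun" where
 "X f n i j = of_real
   (if i < dP n then if j < dP n then ent f n (v n j) (v n i) else \<tau> * ent (\<lambda>_. 1) n (v n j) (u n i)
   else if j < dP n then \<tau> * ent (\<lambda>_. 1) n (v n i) (u n j) else - \<rho> * ent (\<lambda>_. 1) n (u n j) (u n i))"

definition K :: "int => nat => nat => real" where
 "K s c d = (if c < P \<and> d < P then shift_prod (bv d) (bv c) s else 0)"

text \<open>The lower left part uses -s because the coefficient of index s of the adjoint of \<xi>
  is the transposed coefficient of index -s of \<xi>.\<close>

definition L :: "int => nat => nat => real" where
 "L s c d = (if c < P then if d < P then 0 else \<tau> * shift_prod (bv d) (bu c) s
   else if d < P then \<tau> * shift_prod (bv c) (bu d) (- s) else - \<rho> * shift_prod (bu d) (bu c) s)"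

lemma ent_commute: "ent f n g h = ent f n h g"
 unfolding ent_def by (simp add: mult.commute)

lemma X_herm: "herm (N n) (X f n)"
 unfolding herm_def X_def using ent_commute by (auto simp: ent_commute)

lemma shift_prod_zero:
 assumes "\<bar>s\<bar> > int wd"
  and "\<And>y. \<not> (0 \<le> y \<and> y \<le> real wd) ==> F y = 0" "\<And>y. \<not> (0 \<le> y \<and> y \<le> real wd) ==> G y = 0"
 shows "shift_prod F G s = 0"
proof -
 have "F y * G (y - of_int s) = 0" for y
 proof (cases "0 \<le> y \<and> y \<le> real wd")
  case True
  have "real wd < \<bar>of_int s\<bar>" using assms(1) by (metis of_int_abs of_int_less_iff of_int_of_nat_eq)
  then have "\<not> (0 \<le> y - of_int s \<and> y - of_int s \<le> real wd)" using True by auto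
  then show ?thesis using assms(3) by simp
 qed (use assms(2) in simp)
 then show ?thesis unfolding shift_prod_def by (simp only: Bochner_Integration.integral_zero)
qed

lemma spline_symbol:
 assumes "0 < \<eta>" "\<And>c. c < P + Q ==> \<eta> \<le> Im (Z c)"
 shows "banded_symbol (P + Q) wd K L Z \<eta>"
proof
 fix s c d assume s: "\<bar>s\<bar> > int wd"
 then have s': "\<bar>- s\<bar> > int wd" by simp
 note b = b_facts(3,4)
 show "K s c d = 0" unfolding K_def using shift_prod_zero[OF s b(2) b(2)] by simp
 show "L s c d = 0" unfolding L_def
  using shift_prod_zero[OF s b(2) b(1)] shift_prod_zero[OF s' b(2) b(1)] shift_prod_zero[OF s b(1) b(1)] by simp
next
 fix s c d
 show "K (- s) d c = K s c d" unfolding K_def by (simp add: shift_prod_minus)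
 show "L (- s) d c = L s c d" unfolding L_def by (simp add: shift_prod_minus)
qed (use assms in auto)

text \<open>The factor n cancels against the length w / n of the support.\<close>

lemma scaled_Icc_integral:
 assumes n: "1 \<le> n" and g: "g \<in> borel_measurable borel" and b: "\<And>x. \<bar>g x\<bar> \<le> c" and c: "0 \<le> c"
  and s: "\<And>x. \<not> (\<mu> \<le> real n * x \<and> real n * x \<le> \<mu> + w) ==> g x = 0" and w: "0 \<le> w"
 shows "integrable lborel g" "\<bar>real n * (LINT x|lborel. g x)\<bar> \<le> c * w"
proof -
 have n0: "0 < real n" using n by simp
 let ?I = "{\<mu> / real n..(\<mu> + w) / real n}"
 have supp: "\<bar>g x\<bar> \<le> indicator ?I x * c" for x
  using b[of x] s[of x] n0 by (cases "x \<in> ?I") (auto simp: field_simps)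
 have I: "integrable lborel (\<lambda>x. indicator ?I x * c)"
  by (intro integrable_mult_left integrable_real_indicator) (auto simp: emeasure_lborel_Icc_eq)
 show int: "integrable lborel g"
  by (rule Bochner_Integration.integrable_bound[OF I]) (use g supp c in \<open>auto intro!: AE_I2 simp: abs_mult\<close>)
 have "\<bar>LINT x|lborel. g x\<bar> \<le> (LINT x|lborel. \<bar>g x\<bar>)" by (rule integral_abs_bound)
 also have "\<dots> \<le> (LINT x|lborel. indicator ?I x * c)"
  by (rule integral_mono[OF integrable_abs[OF int] I]) (rule supp)
 also have "\<dots> = c * w / real n"
  using w n0 by (simp add: divide_right_mono measure_lborel_Icc diff_divide_distrib[symmetric])
 finally show "\<bar>real n * (LINT x|lborel. g x)\<bar> \<le> c * w"
  using n0 by (simp add: abs_mult pos_le_divide_eq mult.commute)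
qed

lemma prod_bound: "\<bar>a\<bar> \<le> A ==> \<bar>b\<bar> \<le> B ==> \<bar>c\<bar> \<le> C ==> \<bar>a * (b * c)\<bar> \<le> A * (B * C)" for a b c :: real
 unfolding abs_mult by (intro mult_mono) auto

lemma ent_bound:
 assumes n: "1 \<le> n" and [measurable]: "f \<in> borel_measurable borel" "g \<in> borel_measurable borel" "h \<in> borel_measurable borel"
  and A: "\<And>x. \<bar>f x\<bar> \<le> A" and g: "\<And>x. \<bar>g x\<bar> \<le> Cb" and h: "\<And>x. \<bar>h x\<bar> \<le> Cb"
  and s: "\<And>x. \<not> (\<mu> \<le> real n * x \<and> real n * x \<le> \<mu> + real wd) ==> h x = 0"
 shows "integrable lborel (\<lambda>x. indicator {0..1} x * (f x * (g x * h x)))"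
  "\<bar>ent f n g h\<bar> \<le> A * (Cb * Cb) * real wd"
proof -
 have A0: "0 \<le> A" using A[of 0] by linarith
 have b: "\<bar>indicator {0..1} x * (f x * (g x * h x))\<bar> \<le> A * (Cb * Cb)" for x :: real
  using prod_bound[OF A g h, of x x x] A0 Cb_ge by (auto simp: indicator_def)
 have z: "indicator {0..1} x * (f x * (g x * h x)) = 0" if "\<not> (\<mu> \<le> real n * x \<and> real n * x \<le> \<mu> + real wd)" for x
  using s[OF that] by simp
 have m: "(\<lambda>x. indicator {0..1} x * (f x * (g x * h x))) \<in> borel_measurable borel" by measurable
 have c0: "0 \<le> A * (Cb * Cb)" using A0 Cb_ge by simp
 show "integrable lborel (\<lambda>x. indicator {0..1} x * (f x * (g x * h x)))"
  by (rule scaled_Icc_integral(1)[OF n m b c0 z]) auto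
 show "\<bar>ent f n g h\<bar> \<le> A * (Cb * Cb) * real wd"
  unfolding ent_def by (rule scaled_Icc_integral(2)[OF n m b c0 z]) auto
qed

text \<open>Substituting y = n x - \<nu> turns the integral with the coefficient frozen at c into
  the shifted product; by the bounds on \<mu> the support of g lies in [0, 1], so the indicator
  drops out. On that support, of length wd / n, f is within e of c.\<close>

lemma ent_close:
 assumes n: "1 \<le> n" and [measurable]: "f \<in> borel_measurable borel" "G \<in> borel_measurable borel" "H \<in> borel_measurable borel"
  and A: "\<And>x. \<bar>f x\<bar> \<le> A" and g: "\<And>x. g x = G (real n * x - of_int \<mu>)" and h: "\<And>x. h x = H (real n * x - of_int \<nu>)"
  and Gb: "\<And>x. \<bar>G x\<bar> \<le> Cb" and Hb: "\<And>x. \<bar>H x\<bar> \<le> Cb"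
  and Gs: "\<And>y. \<not> (0 \<le> y \<and> y \<le> real wd) ==> G y = 0"
  and \<mu>: "0 \<le> \<mu>" "\<mu> + int wd \<le> int n" and e: "0 \<le> e"
  and close: "\<And>x. of_int \<mu> \<le> real n * x ==> real n * x \<le> of_int \<mu> + real wd ==> \<bar>f x - c\<bar> \<le> e"
 shows "\<bar>ent f n h g - c * shift_prod H G (\<mu> - \<nu>)\<bar> \<le> e * (Cb * Cb) * real wd"
proof -
 have n0: "0 < real n" using n by simp
 have [measurable]: "g \<in> borel_measurable borel" "h \<in> borel_measurable borel"
  unfolding g[abs_def] h[abs_def] by measurable
 have gb: "\<bar>g x\<bar> \<le> Cb" and hb: "\<bar>h x\<bar> \<le> Cb" for x using Gb Hb g h by auto
 have gs: "g x = 0" if "\<not> (of_int \<mu> \<le> real n * x \<and> real n * x \<le> of_int \<mu> + real wd)" for x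
  unfolding g by (rule Gs) (use that in auto)
 have in01: "x \<in> {0..1}" if x: "g x \<noteq> 0" for x
 proof -
  have "of_int \<mu> \<le> real n * x" "real n * x \<le> of_int \<mu> + real wd" using gs[of x] x by auto
  moreover have "(0::real) \<le> of_int \<mu>" "of_int \<mu> + real wd \<le> real n" using \<mu> by linarith+
  ultimately have "0 \<le> real n * x" "real n * x \<le> real n * 1" by auto
  then show ?thesis using n0 by (simp add: zero_le_mult_iff)
 qed
 have "shift_prod H G (\<mu> - \<nu>) = real n * (LINT x|lborel. h x * g x)"
  unfolding shift_prod_def
  by (subst lborel_integral_real_affine[of "real n" _ "- of_int \<nu>"]) (use n0 in \<open>auto simp: g h algebra_simps\<close>)
 moreover have "(LINT x|lborel. h x * g x) = (LINT x|lborel. indicator {0..1} x * (1 * (h x * g x)))"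
  by (rule Bochner_Integration.integral_cong) (use in01 in \<open>force simp: indicator_def\<close>)+
 ultimately have sp: "shift_prod H G (\<mu> - \<nu>) = ent (\<lambda>_. 1) n h g" by (simp add: ent_def)
 have i1: "integrable lborel (\<lambda>x. indicator {0..1} x * (f x * (h x * g x)))"
  by (rule ent_bound(1)[OF n _ _ _ A hb gb gs]) auto
 have i2: "integrable lborel (\<lambda>x. indicator {0..1} x * (1 * (h x * g x)))"
  by (rule ent_bound(1)[where f = "\<lambda>_. 1" and A = 1, OF n _ _ _ _ hb gb gs]) auto
 have "ent f n h g - c * shift_prod H G (\<mu> - \<nu>)
   = real n * (LINT x|lborel. indicator {0..1} x * (f x * (h x * g x)) - c * (indicator {0..1} x * (1 * (h x * g x))))"
  unfolding sp ent_def using i1 i2 by (subst Bochner_Integration.integral_diff) (auto simp: algebra_simps)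
 also have "(\<lambda>x. indicator {0..1} x * (f x * (h x * g x)) - c * (indicator {0..1} x * (1 * (h x * g x))))
   = (\<lambda>x. indicator {0..1} x * ((f x - c) * (h x * g x)))" by (auto simp: algebra_simps)
 also have "\<bar>real n * (LINT x|lborel. indicator {0..1} x * ((f x - c) * (h x * g x)))\<bar> \<le> e * (Cb * Cb) * real wd"
 proof (rule scaled_Icc_integral(2)[OF n])
  show "\<bar>indicator {0..1} x * ((f x - c) * (h x * g x))\<bar> \<le> e * (Cb * Cb)" for x
  proof (cases "of_int \<mu> \<le> real n * x \<and> real n * x \<le> of_int \<mu> + real wd")
   case True
   then show ?thesis using prod_bound[OF close[of x] hb gb, of x x] e Cb_ge by (auto simp: indicator_def)
  next
   case False
   then show ?thesis using gs[of x] e Cb_ge by simp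
  qed
  show "indicator {0..1} x * ((f x - c) * (h x * g x)) = 0" if "\<not> (of_int \<mu> \<le> real n * x \<and> real n * x \<le> of_int \<mu> + real wd)" for x
   using gs[OF that] by simp
 qed (use e Cb_ge in auto)
 finally show ?thesis .
qed

text \<open>If v n i x is nonzero, the cell of i is one of the wd + 1 cells ending at floor(n x),
  and a cell holds at most P + Q splines. This bounded overlap is what makes the l1 estimate of the
  matrices linear in n.\<close>

lemma support_sum_le:
 assumes n: "1 \<le> n"
 shows "(\<Sum>i<N n. \<bar>v n i x\<bar>) \<le> real ((P + Q) * (wd + 2)) * Cb"
proof -
 define S where "S = {\<lfloor>real n * x\<rfloor> - int wd..\<lfloor>real n * x\<rfloor>}"
 define I where "I = {i \<in> {..<N n}. cell n i \<in> S}"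
 have z: "v n i x = 0" if "i < N n" "i \<notin> I" for i
 proof (rule uv_support(2)[OF n that(1)])
  have c: "cell n i \<notin> S" using that unfolding I_def by auto
  show "\<not> (0 \<le> x \<and> x \<le> 1 \<and> of_int (cell n i) \<le> real n * x \<and> real n * x \<le> of_int (cell n i) + real wd)"
  proof
   assume a: "0 \<le> x \<and> x \<le> 1 \<and> of_int (cell n i) \<le> real n * x \<and> real n * x \<le> of_int (cell n i) + real wd"
   then have "cell n i \<le> \<lfloor>real n * x\<rfloor>" by (simp add: le_floor_iff)
   moreover have "of_int \<lfloor>real n * x\<rfloor> \<le> (of_int (cell n i + int wd) :: real)"
    using a of_int_floor_le[of "real n * x"] by (simp only: of_int_add of_int_of_nat_eq) linarith
   then have "\<lfloor>real n * x\<rfloor> \<le> cell n i + int wd" by (simp only: of_int_le_iff)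
   ultimately show False using c unfolding S_def by auto
  qed
 qed
 have "card I \<le> card ({..<P + Q} \<times> S)"
  by (rule card_inj_on_le[of "\<lambda>i. (comp n i, cell n i)"])
    (use N_bounds(3)[OF n] comp_less_iff(1)[OF n] in \<open>auto simp: I_def inj_on_def S_def\<close>)
 also have "\<dots> \<le> (P + Q) * (wd + 2)" unfolding S_def card_cartesian_product by (intro mult_mono) auto
 finally have cI: "card I \<le> (P + Q) * (wd + 2)" .
 have "(\<Sum>i<N n. \<bar>v n i x\<bar>) = (\<Sum>i\<in>I. \<bar>v n i x\<bar>)"
  by (rule sum.mono_neutral_right) (use z in \<open>auto simp: I_def\<close>)
 also have "\<dots> \<le> (\<Sum>i\<in>I. Cb)" by (rule sum_mono) (use uv_bound(2)[OF n] in \<open>auto simp: I_def\<close>)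
 also have "\<dots> \<le> real ((P + Q) * (wd + 2)) * Cb" 
  using mult_right_mono[OF of_nat_mono[OF cI, where 'a = real] Cb_ge(5)] by simp
 finally show ?thesis .
qed

definition C1 :: real where "C1 = (real ((P + Q) * (wd + 2)) * Cb)\<^sup>2"

lemma ent_integrable:
 assumes n: "1 \<le> n" and h: "set_integrable lborel {0..1} h" and [measurable]: "h \<in> borel_measurable borel"
  and ij: "i < N n" "j < N n"
 shows "integrable lborel (\<lambda>x. indicator {0..1} x * (h x * (v n j x * v n i x)))"
proof (rule Bochner_Integration.integrable_bound)
 have vb: "\<bar>v n j x * v n i x\<bar> \<le> Cb * Cb" for x
  unfolding abs_mult by (intro mult_mono uv_bound(2) n ij Cb_ge) auto
 show "integrable lborel (\<lambda>x. indicator {0..1} x * \<bar>h x\<bar> * (Cb * Cb))"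
  using set_integrable_abs[OF h] by (intro integrable_mult_left) (simp add: set_integrable_def)
 show "AE x in lborel. norm (indicator {0..1} x * (h x * (v n j x * v n i x))) \<le> norm (indicator {0..1} x * \<bar>h x\<bar> * (Cb * Cb))"
 proof (intro AE_I2)
  fix x
  show "norm (indicator {0..1} x * (h x * (v n j x * v n i x))) \<le> norm (indicator {0..1} x * \<bar>h x\<bar> * (Cb * Cb))"
   using mult_left_mono[OF vb[of x], of "\<bar>indicator {0..1} x * h x\<bar>"] Cb_ge by (simp add: abs_mult mult_ac)
 qed
qed measurable

text \<open>Only the stiffness block contains the coefficient. Summing |a - f| |v i| |v j| over i
  and j under the integral gives |a - f| times the square of the overlap sum, so the total is of
  order n times the L1 distance although there are order n^2 pairs.\<close>

lemma X_l1:
 assumes n: "1 \<le> n" and [measurable]: "a \<in> borel_measurable borel" "f \<in> borel_measurable borel"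
  and a: "set_integrable lborel {0..1} a" and f: "set_integrable lborel {0..1} f"
 shows "(\<Sum>i<N n. \<Sum>j<N n. cmod (X a n i j - X f n i j)) \<le> C1 * real n * (LINT x:{0..1}|lborel. \<bar>a x - f x\<bar>)"
proof -
 define I where "I i j x = indicator {0..1} x * \<bar>a x - f x\<bar> * (\<bar>v n i x\<bar> * \<bar>v n j x\<bar>)" for i j x
 have d: "integrable lborel (\<lambda>x. indicator {0..1} x * \<bar>a x - f x\<bar>)"
  using set_integrable_abs[OF set_integral_diff(1)[OF a f]] by (simp add: set_integrable_def)
 note ig = ent_integrable[OF n]
 have ab: "integrable lborel (I i j)" if ij: "i < N n" "j < N n" for i j
  using integrable_abs[OF ig[OF set_integral_diff(1)[OF a f] _ ij]] unfolding I_def[abs_def] by (simp add: abs_mult mult_ac)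
 have abs_eq: "\<bar>K * (s * (y * z)) - K * (t * (y * z))\<bar> = K * \<bar>s - t\<bar> * (\<bar>z\<bar> * \<bar>y\<bar>)" if "0 \<le> K" for K s t y z :: real
 proof -
  have "K * (s * (y * z)) - K * (t * (y * z)) = K * (s - t) * (z * y)" by (simp add: algebra_simps)
  then show ?thesis using that by (simp add: abs_mult)
 qed
 have entry: "cmod (X a n i j - X f n i j) \<le> real n * (LINT x|lborel. I i j x)"
  if ij: "i < N n" "j < N n" for i j
 proof -
  let ?D = "\<lambda>x. indicator {0..1} x * (a x * (v n j x * v n i x)) - indicator {0..1} x * (f x * (v n j x * v n i x))"
  have nn: "0 \<le> (LINT x|lborel. I i j x)"
   by (rule Bochner_Integration.integral_nonneg) (simp add: I_def)
  have split: "cmod (X a n i j - X f n i j) = (if i < dP n \<and> j < dP n then \<bar>ent a n (v n j) (v n i) - ent f n (v n j) (v n i)\<bar> else 0)"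
   unfolding X_def by (auto simp flip: of_real_diff)
  have e: "ent a n (v n j) (v n i) - ent f n (v n j) (v n i) = real n * (LINT x|lborel. ?D x)"
   unfolding ent_def using ig[OF a _ ij] ig[OF f _ ij] by (simp add: right_diff_distrib)
  have "\<bar>LINT x|lborel. ?D x\<bar> \<le> (LINT x|lborel. \<bar>?D x\<bar>)" by (rule integral_abs_bound)
  moreover have "(LINT x|lborel. \<bar>?D x\<bar>) = (LINT x|lborel. I i j x)"
   unfolding I_def by (rule Bochner_Integration.integral_cong[OF refl], rule abs_eq, simp)
  ultimately show ?thesis unfolding split e abs_mult using nn by (simp add: mult_left_mono)
 qed
 have le: "(LINT x|lborel. (\<Sum>i<N n. \<Sum>j<N n. I i j x)) \<le> (LINT x|lborel. indicator {0..1} x * \<bar>a x - f x\<bar> * C1)"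
 proof (rule integral_mono)
  show "integrable lborel (\<lambda>x. \<Sum>i<N n. \<Sum>j<N n. I i j x)"
   using ab by (intro Bochner_Integration.integrable_sum) auto
  show "integrable lborel (\<lambda>x. indicator {0..1} x * \<bar>a x - f x\<bar> * C1)" by (rule integrable_mult_left[OF d])
  fix x
  have "(\<Sum>i<N n. \<Sum>j<N n. \<bar>v n i x\<bar> * \<bar>v n j x\<bar>) = (\<Sum>i<N n. \<bar>v n i x\<bar>)\<^sup>2"
   by (simp add: power2_eq_square sum_product)
  also have "\<dots> \<le> C1" unfolding C1_def by (intro power_mono support_sum_le n sum_nonneg) auto
  finally show "(\<Sum>i<N n. \<Sum>j<N n. I i j x) \<le> indicator {0..1} x * \<bar>a x - f x\<bar> * C1"
   unfolding I_def sum_distrib_left[symmetric] by (intro mult_left_mono) auto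
 qed
 have ab': "integrable lborel (I i j)" if "i \<in> {..<N n}" "j \<in> {..<N n}" for i j
  using that ab by simp
 have "(\<Sum>i<N n. \<Sum>j<N n. cmod (X a n i j - X f n i j)) \<le> (\<Sum>i<N n. \<Sum>j<N n. real n * (LINT x|lborel. I i j x))"
  by (rule sum_mono, rule sum_mono, rule entry) auto
 also have "\<dots> = real n * (\<Sum>i<N n. \<Sum>j<N n. (LINT x|lborel. I i j x))" by (simp add: sum_distrib_left)
 also have "(\<Sum>i<N n. \<Sum>j<N n. (LINT x|lborel. I i j x)) = (\<Sum>i<N n. (LINT x|lborel. (\<Sum>j<N n. I i j x)))"
  by (rule sum.cong[OF refl], rule Bochner_Integration.integral_sum[symmetric], rule ab')
 also have "\<dots> = (LINT x|lborel. (\<Sum>i<N n. \<Sum>j<N n. I i j x))"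
  by (rule Bochner_Integration.integral_sum[symmetric], rule Bochner_Integration.integrable_sum, rule ab')
 finally have "(\<Sum>i<N n. \<Sum>j<N n. cmod (X a n i j - X f n i j)) \<le> real n * (LINT x|lborel. (\<Sum>i<N n. \<Sum>j<N n. I i j x))" .
 also have "\<dots> \<le> real n * (LINT x|lborel. indicator {0..1} x * \<bar>a x - f x\<bar> * C1)"
  by (rule mult_left_mono[OF le]) simp
 also have "(LINT x|lborel. indicator {0..1} x * \<bar>a x - f x\<bar> * C1) = (LINT x:{0..1}|lborel. \<bar>a x - f x\<bar>) * C1"
  unfolding set_lebesgue_integral_def by simp
 finally show ?thesis by (simp add: mult_ac)
qed

lemma X_bound:
 assumes n: "1 \<le> n" and f: "f \<in> borel_measurable borel" and A: "\<And>x. \<bar>f x\<bar> \<le> A" and ij: "i < N n" "j < N n"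
 shows "cmod (X f n i j) \<le> (A + \<bar>\<tau>\<bar> + \<bar>\<rho>\<bar>) * ((Cb * Cb) * real wd)"
proof -
 have A0: "0 \<le> A" using A[of 0] by linarith
 define U where "U = (Cb * Cb) * real wd"
 have U0: "0 \<le> U" unfolding U_def using Cb_ge by simp
 have us: "h x = 0" if "h = u n i \<or> h = v n i" "\<not> (of_int (cell n i) \<le> real n * x \<and> real n * x \<le> of_int (cell n i) + real wd)" "i < N n" for h i x
  using uv_support[OF n that(3), of x] that by auto
 have ub: "\<bar>h x\<bar> \<le> Cb" if "h = u n i \<or> h = v n i" "i < N n" for h i x
  using uv_bound[OF n that(2)] that by auto
 have m: "h \<in> borel_measurable borel" if "h = u n i \<or> h = v n i" for h i
  using uv_borel that by auto
 have e: "\<bar>ent \<phi> n g h\<bar> \<le> B * U"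
  if "\<phi> \<in> borel_measurable borel" "\<And>x. \<bar>\<phi> x\<bar> \<le> B" and g: "g = u n i' \<or> g = v n i'" and h: "h = u n j' \<or> h = v n j'" and lt: "i' < N n" "j' < N n" for \<phi> B g h i' j'
 proof -
  have "\<bar>ent \<phi> n g h\<bar> \<le> B * (Cb * Cb) * real wd"
   by (rule ent_bound(2)[OF n that(1) m[OF g] m[OF h] that(2) ub[OF g lt(1)] ub[OF h lt(2)] us[OF h _ lt(2)]])
  then show ?thesis unfolding U_def by (simp add: mult.assoc)
 qed
 have e1: "\<bar>ent (\<lambda>_. 1) n g h\<bar> \<le> U" if g: "g = u n i' \<or> g = v n i'" and h: "h = u n j' \<or> h = v n j'" and lt: "i' < N n" "j' < N n" for g h i' j'
  using e[OF _ _ g h lt, of "\<lambda>_. 1" 1] by simp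
 have p: "A * U \<le> (A + \<bar>\<tau>\<bar> + \<bar>\<rho>\<bar>) * U" "\<bar>\<tau>\<bar> * U \<le> (A + \<bar>\<tau>\<bar> + \<bar>\<rho>\<bar>) * U" "\<bar>\<rho>\<bar> * U \<le> (A + \<bar>\<tau>\<bar> + \<bar>\<rho>\<bar>) * U"
  by (intro mult_right_mono; use A0 U0 in simp)+
 have q: "\<bar>t\<bar> * \<bar>y\<bar> \<le> \<bar>t\<bar> * U" if "\<bar>y\<bar> \<le> U" for t y :: real using that by (intro mult_left_mono) auto
 have r11: "\<bar>ent f n (v n j) (v n i)\<bar> \<le> (A + \<bar>\<tau>\<bar> + \<bar>\<rho>\<bar>) * U"
  by (rule order_trans[OF e[OF f A _ _ ij(2,1)] p(1)]) auto
 have r12: "\<bar>\<tau>\<bar> * \<bar>ent (\<lambda>_. 1) n (v n j) (u n i)\<bar> \<le> (A + \<bar>\<tau>\<bar> + \<bar>\<rho>\<bar>) * U"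
  by (rule order_trans[OF q[OF e1[OF _ _ ij(2,1)]] p(2)]) auto
 have r21: "\<bar>\<tau>\<bar> * \<bar>ent (\<lambda>_. 1) n (v n i) (u n j)\<bar> \<le> (A + \<bar>\<tau>\<bar> + \<bar>\<rho>\<bar>) * U"
  by (rule order_trans[OF q[OF e1[OF _ _ ij]] p(2)]) auto
 have r22: "\<bar>\<rho>\<bar> * \<bar>ent (\<lambda>_. 1) n (u n j) (u n i)\<bar> \<le> (A + \<bar>\<tau>\<bar> + \<bar>\<rho>\<bar>) * U"
  by (rule order_trans[OF q[OF e1[OF _ _ ij(2,1)]] p(3)]) auto
 show ?thesis unfolding X_def norm_of_real U_def[symmetric]
  using r11 r12 r21 r22 by (simp add: abs_mult)
qed

lemma X_band:
 assumes n: "1 \<le> n" and ij: "i < N n" "j < N n" and far: "\<bar>cell n i - cell n j\<bar> > int wd"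
 shows "X f n i j = 0"
proof -
 have z: "g x * h x = 0" if "g = u n i \<or> g = v n i" "h = u n j \<or> h = v n j" for g h x
 proof (rule ccontr)
  assume "g x * h x \<noteq> 0"
  then have nz: "g x \<noteq> 0" "h x \<noteq> 0" by auto
  then have "u n i x \<noteq> 0 \<or> v n i x \<noteq> 0" "u n j x \<noteq> 0 \<or> v n j x \<noteq> 0" using that by auto
  then have "of_int (cell n i) \<le> real n * x" "real n * x \<le> of_int (cell n i) + real wd"
   "of_int (cell n j) \<le> real n * x" "real n * x \<le> of_int (cell n j) + real wd"
   using uv_support[OF n ij(1), of x] uv_support[OF n ij(2), of x] by auto
  then have "of_int (cell n i) \<le> (of_int (cell n j + int wd) :: real)" "of_int (cell n j) \<le> (of_int (cell n i + int wd) :: real)"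
   by auto
  then have "cell n i \<le> cell n j + int wd" "cell n j \<le> cell n i + int wd" by (simp_all only: of_int_le_iff)
  then show False using far by linarith
 qed
 have e: "ent \<phi> n g h = 0" "ent \<phi> n h g = 0" if "g = u n i \<or> g = v n i" "h = u n j \<or> h = v n j" for g h \<phi>
 proof -
  have "(\<lambda>x. indicator {0..1} x * (\<phi> x * (g x * h x))) = (\<lambda>_. 0)" using z[OF that] by auto
  then show "ent \<phi> n g h = 0" by (simp only: ent_def) simp
  then show "ent \<phi> n h g = 0" by (simp only: ent_commute)
 qed
 show ?thesis unfolding X_def using e by auto
qed

text \<open>The margin 2 wd makes i and every j within the bandwidth interior, so both are scaled
  reference splines. Uniform continuity of f over a support of length wd / n gives the error in the
  stiffness block; the other blocks agree exactly.\<close>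

lemma X_close:
 assumes uc: "uniformly_continuous_on UNIV f" and A: "\<And>x. \<bar>f x\<bar> \<le> A" and e: "0 < e"
 shows "\<forall>\<^sub>F n in sequentially. \<forall>i<N n. \<forall>j<N n. int (2 * wd) \<le> cell n i \<longrightarrow> cell n i \<le> int n - int (2 * wd) \<longrightarrow> \<bar>cell n i - cell n j\<bar> \<le> int wd \<longrightarrow>
    cmod (X f n i j - of_real (f (of_int (cell n i) / real n) * K (cell n i - cell n j) (comp n i) (comp n j) + L (cell n i - cell n j) (comp n i) (comp n j))) \<le> e"
proof -
 define U where "U = (Cb * Cb) * real wd"
 have U0: "0 \<le> U" unfolding U_def using Cb_ge by simp
 define e' where "e' = e / (U + 1)"
 have e': "0 < e'" "e' * U \<le> e"
 proof -
  show "0 < e'" unfolding e'_def using e U0 by simp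
  have "e' * U = e * (U / (U + 1))" unfolding e'_def by simp
  also have "\<dots> \<le> e * 1" using e U0 by (intro mult_left_mono) auto
  finally show "e' * U \<le> e" by simp
 qed
 obtain \<delta> where \<delta>: "0 < \<delta>" "\<And>x y. dist x y < \<delta> ==> dist (f x) (f y) < e'"
  using uniformly_continuous_UNIV_E[OF uc e'(1)] by blast
 have [measurable]: "f \<in> borel_measurable borel"
  by (rule borel_measurable_continuous_onI[OF uniformly_continuous_imp_continuous[OF uc]])
 obtain n0 :: nat where n0: "real wd / \<delta> < real n0" using reals_Archimedean2 by blast
 have "\<forall>\<^sub>F n in sequentially. max 1 n0 \<le> n" by (rule eventually_ge_at_top)
 then show ?thesis
 proof (eventually_elim, intro allI impI)
  fix n i j assume nn: "max 1 n0 \<le> n" and i: "i < N n" and j: "j < N n"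
   and c: "int (2 * wd) \<le> cell n i" "cell n i \<le> int n - int (2 * wd)" "\<bar>cell n i - cell n j\<bar> \<le> int wd"
  have n: "1 \<le> n" using nn by simp
  have "real wd / \<delta> < real n" using nn n0 by linarith
  then have wn: "real wd < \<delta> * real n" using \<delta>(1) by (simp add: pos_divide_less_eq mult.commute)
  have n0: "0 < real n" using n by simp
  have ci: "0 \<le> cell n i" "cell n i + int wd \<le> int n" using c by auto
  have cj: "0 \<le> cell n j" "cell n j + int wd \<le> int n" using c by auto
  note ui = uv_interior[OF n i ci] and uj = uv_interior[OF n j cj]
  have cl: "\<bar>f x - f (of_int (cell n i) / real n)\<bar> \<le> e'"
   if "of_int (cell n i) \<le> real n * x" "real n * x \<le> of_int (cell n i) + real wd" for x
  proof -
   have "real n * (x - of_int (cell n i) / real n) = real n * x - of_int (cell n i)" using n0 by (simp add: right_diff_distrib)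
   then have "\<bar>real n * (x - of_int (cell n i) / real n)\<bar> < \<delta> * real n" using that wn by linarith
   then have "\<bar>x - of_int (cell n i) / real n\<bar> < \<delta>" using n0 by (simp add: abs_mult mult.commute)
   then have "dist x (of_int (cell n i) / real n) < \<delta>" by (simp add: dist_real_def)
   from \<delta>(2)[OF this] show ?thesis by (simp add: dist_real_def)
  qed
  have r11: "\<bar>ent f n (v n j) (v n i) - f (of_int (cell n i) / real n) * shift_prod (bv (comp n j)) (bv (comp n i)) (cell n i - cell n j)\<bar> \<le> e"
  proof -
   have "\<bar>ent f n (v n j) (v n i) - f (of_int (cell n i) / real n) * shift_prod (bv (comp n j)) (bv (comp n i)) (cell n i - cell n j)\<bar>
     \<le> e' * (Cb * Cb) * real wd"
   proof (rule ent_close[where f = f and A = A and G = "bv (comp n i)" and H = "bv (comp n j)" and g = "v n i" and h = "v n j"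
      and \<mu> = "cell n i" and \<nu> = "cell n j" and e = e' and c = "f (of_int (cell n i) / real n)"])
    show "1 \<le> n" "0 \<le> cell n i" "cell n i + int wd \<le> int n" "0 \<le> e'" using n ci e'(1) by auto
    show "f \<in> borel_measurable borel" by measurable
    show "bv (comp n i) \<in> borel_measurable borel" "bv (comp n j) \<in> borel_measurable borel" by (rule uv_borel)+
    show "\<bar>f x\<bar> \<le> A" for x by (rule A)
    show "v n i x = bv (comp n i) (real n * x - of_int (cell n i))" for x by (rule ui(2))
    show "v n j x = bv (comp n j) (real n * x - of_int (cell n j))" for x by (rule uj(2))
    show "\<bar>f x - f (of_int (cell n i) / real n)\<bar> \<le> e'"
     if "of_int (cell n i) \<le> real n * x" "real n * x \<le> of_int (cell n i) + real wd" for x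
     by (rule cl[OF that])
    show "bv (comp n i) y = 0" if "\<not> (0 \<le> y \<and> y \<le> real wd)" for y by (rule b_facts(4)[OF that])
   qed (rule b_facts(2), rule b_facts(2))
   also have "\<dots> \<le> e" using e'(2) by (simp add: U_def mult.assoc)
   finally show ?thesis .
  qed
  have one: "ent (\<lambda>_. 1) n h g = shift_prod H G (\<mu> - \<nu>)"
   if "G \<in> borel_measurable borel" "H \<in> borel_measurable borel"
    "\<And>x. g x = G (real n * x - of_int \<mu>)" "\<And>x. h x = H (real n * x - of_int \<nu>)" "\<And>x. \<bar>G x\<bar> \<le> Cb" "\<And>x. \<bar>H x\<bar> \<le> Cb"
    "\<And>y. \<not> (0 \<le> y \<and> y \<le> real wd) ==> G y = 0" "0 \<le> \<mu>" "\<mu> + int wd \<le> int n" for G H g h \<mu> \<nu>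
  proof -
   have "\<bar>ent (\<lambda>_. 1) n h g - 1 * shift_prod H G (\<mu> - \<nu>)\<bar> \<le> 0 * (Cb * Cb) * real wd"
    by (rule ent_close[where f = "\<lambda>_. 1" and A = 1 and e = 0 and c = 1 and G = G and H = H and g = g and h = h and \<mu> = \<mu> and \<nu> = \<nu>])
      (use that n in simp_all)
   then show ?thesis by simp
  qed
  have r12: "ent (\<lambda>_. 1) n (v n j) (u n i) = shift_prod (bv (comp n j)) (bu (comp n i)) (cell n i - cell n j)"
   by (rule one[where G = "bu (comp n i)" and H = "bv (comp n j)" and g = "u n i" and h = "v n j" and \<mu> = "cell n i" and \<nu> = "cell n j"])
     (use ui uj ci cj b_facts uv_borel in blast)+
  have r21: "ent (\<lambda>_. 1) n (v n i) (u n j) = shift_prod (bv (comp n i)) (bu (comp n j)) (cell n j - cell n i)"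
   by (rule one[where G = "bu (comp n j)" and H = "bv (comp n i)" and g = "u n j" and h = "v n i" and \<mu> = "cell n j" and \<nu> = "cell n i"])
     (use ui uj ci cj b_facts uv_borel in blast)+
  have r22: "ent (\<lambda>_. 1) n (u n j) (u n i) = shift_prod (bu (comp n j)) (bu (comp n i)) (cell n i - cell n j)"
   by (rule one[where G = "bu (comp n i)" and H = "bu (comp n j)" and g = "u n i" and h = "u n j" and \<mu> = "cell n i" and \<nu> = "cell n j"])
     (use ui uj ci cj b_facts uv_borel in blast)+
  show "cmod (X f n i j - of_real (f (of_int (cell n i) / real n) * K (cell n i - cell n j) (comp n i) (comp n j) + L (cell n i - cell n j) (comp n i) (comp n j))) \<le> e"
   unfolding X_def K_def L_def comp_less_iff(2) of_real_diff[symmetric] norm_of_real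
   using r11 r12 r21 r22 e by auto
 qed
qed

theorem spline_trace_limit:
 assumes a: "a \<in> borel_measurable borel" "set_integrable lborel {0..1} a"
  and \<eta>: "0 < \<eta>" "\<And>c. c < P + Q ==> \<eta> \<le> Im (Z c)"
 shows "(\<lambda>n. (\<Sum>i<N n. W (comp n i) * finv (N n) (shiftd (X a n) (\<lambda>i. Z (comp n i))) i i) / of_nat n)
  \<longlonglongrightarrow> (LINT x:{0..1}|lborel. banded_symbol.hsym (P + Q) wd K L Z W (a x))"
proof -
 interpret banded_symbol "P + Q" wd K L Z \<eta> by (rule spline_symbol[OF \<eta>])
 show ?thesis
 proof (rule trace_limit[OF a X_herm])
  show "comp n i < P + Q" if "1 \<le> n" "i < N n" for n i using comp_less_iff(1)[OF that] .
  fix f :: "real => real" and A assume uc: "uniformly_continuous_on UNIV f" and A: "\<And>x. \<bar>f x\<bar> \<le> A"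
  have m: "f \<in> borel_measurable borel"
   by (rule borel_measurable_continuous_onI[OF uniformly_continuous_imp_continuous[OF uc]])
  show "(\<lambda>n. (\<Sum>i<N n. W (comp n i) * finv (N n) (shiftd (X f n) (\<lambda>i. Z (comp n i))) i i) / of_nat n)
   \<longlonglongrightarrow> integral {0..1} (\<lambda>x. hsym W (f x))"
  proof (rule trace_limit_continuous[where ?w0.0 = "2 * wd" and m = cell, OF uc A X_herm])
   show "- int (2 * wd) \<le> cell n i \<and> cell n i \<le> int n + int (2 * wd)" if "1 \<le> n" "i < N n" for n i
    using N_bounds(1,2)[OF that] by auto
   show "\<exists>j<N n. comp n j = c \<and> cell n j = \<mu>"
    if "1 \<le> n" "c < P + Q" "int (2 * wd) \<le> \<mu>" "\<mu> \<le> int n - int (2 * wd)" for n c \<mu>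
    using that by (intro N_bounds(4)) (auto simp: wd_def)
  qed (use comp_less_iff(1) N_bounds(3) X_band X_bound[OF _ m A] X_close[OF uc A] in auto)
 next
  fix f :: "real => real" and n :: nat
  assume "f \<in> borel_measurable borel" "set_integrable lborel {0..1} f" "1 \<le> n"
  then show "(\<Sum>i<N n. \<Sum>j<N n. cmod (X a n i j - X f n i j)) \<le> C1 * real n * (LINT x:{0..1}|lborel. \<bar>a x - f x\<bar>)"
   using X_l1 a by blast
 qed
qed

lemma dP_eq: "1 \<le> n ==> dP n = n * P + k - 1" and dQ_eq: "1 \<le> n ==> dQ n = n * Q + l - 1"
 unfolding dP_def dQ_def spline_dim_def using pk ql by auto

lemma size_limits:
 "(\<lambda>n. real (dQ n) / real n) \<longlonglongrightarrow> real Q" "(\<lambda>n. real (N n) / real n) \<longlonglongrightarrow> real (P + Q)"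
 "filterlim dQ at_top sequentially" "filterlim N at_top sequentially"
proof -
 have lim: "(\<lambda>n. c + b / real n) \<longlonglongrightarrow> c" for b c :: real
  using tendsto_add[OF tendsto_const[of c] tendsto_mult[OF tendsto_const[of b] lim_inverse_n]] by (simp add: divide_inverse)
 have pos: "1 \<le> n * P" "1 \<le> n * Q" if "1 \<le> n" for n using that P0 Q0 by (simp_all add: Suc_le_eq)
 have dreal: "real (dQ n) = real n * real Q + real l - 1" "real (dP n) = real n * real P + real k - 1" if n: "1 \<le> n" for n
 proof -
  have "1 \<le> n * P + k" "1 \<le> n * Q + l" using pos[OF n] by linarith+
  then show "real (dQ n) = real n * real Q + real l - 1" "real (dP n) = real n * real P + real k - 1"
   by (simp_all only: dP_eq[OF n] dQ_eq[OF n] of_nat_diff of_nat_add of_nat_mult of_nat_1)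
 qed
 have "\<forall>\<^sub>F n in sequentially. real Q + (real l - 1) / real n = real (dQ n) / real n"
  using eventually_ge_at_top[of 1]
 proof eventually_elim
  case (elim n)
  then have "real (dQ n) = real n * real Q + real l - 1" by (rule dreal)
  then show ?case using elim by (simp add: field_simps)
 qed
 with lim show "(\<lambda>n. real (dQ n) / real n) \<longlonglongrightarrow> real Q" by (rule Lim_transform_eventually)
 have "\<forall>\<^sub>F n in sequentially. real (P + Q) + (real k + real l - 2) / real n = real (N n) / real n"
  using eventually_ge_at_top[of 1]
 proof eventually_elim
  case (elim n)
  then have "real (dQ n) = real n * real Q + real l - 1" "real (dP n) = real n * real P + real k - 1"
   by (rule dreal)+
  then show ?case using elim by (simp add: N_def field_simps)
 qed
 with lim show "(\<lambda>n. real (N n) / real n) \<longlonglongrightarrow> real (P + Q)" by (rule Lim_transform_eventually)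
 have id: "filterlim (\<lambda>n. n - 1) at_top sequentially" by (rule filterlim_minus_const_nat_at_top)
 have le: "n - 1 \<le> dQ n" for n
 proof (cases "1 \<le> n")
  case True
  have "n * 1 \<le> n * Q" using Q0 by (intro mult_left_mono) auto
  then show ?thesis unfolding dQ_eq[OF True] by linarith
 qed simp
 show "filterlim dQ at_top sequentially"
  by (rule filterlim_at_top_mono[OF id]) (use le in auto)
 then show "filterlim N at_top sequentially"
  by (rule filterlim_at_top_mono) (auto simp: N_def)
qed

end

section \<open>Distributions of Hermitian matrices\<close>

text \<open>Completeness of Lebesgue measure: two almost everywhere equal functions are both
  measurable or both not, and in the latter case both integrals have the default value 0.\<close>

lemma integral_lebesgue_cong_AE:
 fixes f g :: "'a::euclidean_space => 'b::euclidean_space"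
 assumes "AE x in lebesgue. f x = g x"
 shows "integral\<^sup>L lebesgue f = integral\<^sup>L lebesgue g"
proof (cases "f \<in> borel_measurable lebesgue")
 case True
 then have "g \<in> borel_measurable lebesgue" using borel_measurable_AE[OF _ assms] by simp
 with True assms show ?thesis by (intro integral_cong_AE)
next
 case False
 have "AE x in lebesgue. g x = f x" using assms by eventually_elim simp
 from borel_measurable_AE[OF _ this] False have "g \<notin> borel_measurable lebesgue" by auto
 with False show ?thesis
  by (metis borel_measurable_integrable not_integrable_integral_eq)
qed

lemma set_integral_lebesgue_cong_AE:
 fixes f g :: "'a::euclidean_space => complex"
 assumes D: "D \<in> sets lebesgue" and ae: "AE x in lebesgue_on D. f x = g x"
 shows "(LINT x:D|lebesgue. f x) = (LINT x:D|lebesgue. g x)"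
 unfolding set_lebesgue_integral_def
proof (rule integral_lebesgue_cong_AE)
 have "AE x in lebesgue. x \<in> D \<longrightarrow> f x = g x" using ae D by (simp add: AE_restrict_space_iff)
 then show "AE x in lebesgue. indicat_real D x *\<^sub>R f x = indicat_real D x *\<^sub>R g x"
  by eventually_elim (auto simp: indicator_def)
qed

lemma borel_measurable_lebesgue_on_cong_AE:
 fixes f g :: "'a::euclidean_space => complex"
 assumes D: "D \<in> sets lebesgue" and g: "g \<in> borel_measurable (lebesgue_on D)" and ae: "AE x in lebesgue_on D. f x = g x"
 shows "f \<in> borel_measurable (lebesgue_on D)"
proof -
 have D': "D \<inter> space lebesgue \<in> sets lebesgue" using D by simp
 have "AE x in lebesgue. x \<in> D \<longrightarrow> f x = g x" using ae D by (simp add: AE_restrict_space_iff)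
 then have "AE x in lebesgue. indicat_real D x *\<^sub>R g x = indicat_real D x *\<^sub>R f x"
  by eventually_elim (auto simp: indicator_def)
 from borel_measurable_AE[OF _ this] g show ?thesis
  unfolding borel_measurable_restrict_space_iff[OF D'] by blast
qed

text \<open>Allows the coefficient to be replaced by a Borel representative, and the Schur symbol to
  be redefined where an inverse fails to exist.\<close>

lemma sv_eig_distributed_cong_AE:
 assumes g: "sv_eig_distributed A D s g" and f: "\<And>x. x \<in> D ==> f x \<in> carrier_mat s s"
  and ae: "AE x in lebesgue_on D. f x = g x"
 shows "sv_eig_distributed A D s f"
proof -
 have sg: "symbol_on D s s g" using g unfolding sv_eig_distributed_def sv_distributed_def by simp
 then have D: "D \<in> sets lebesgue" unfolding symbol_on_def by auto
 have "(\<lambda>x. f x $$ (i, j)) \<in> borel_measurable (lebesgue_on D)" if "i < s" "j < s" for i j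
 proof (rule borel_measurable_lebesgue_on_cong_AE[OF D])
  show "(\<lambda>x. g x $$ (i, j)) \<in> borel_measurable (lebesgue_on D)" using sg that unfolding symbol_on_def by auto
  show "AE x in lebesgue_on D. f x $$ (i, j) = g x $$ (i, j)" using ae by eventually_elim simp
 qed
 then have sf: "symbol_on D s s f" using sg f unfolding symbol_on_def by auto
 have eq: "(LINT x:D|lebesgue. \<Phi> (f x)) = (LINT x:D|lebesgue. \<Phi> (g x))" for \<Phi> :: "complex mat => complex"
  by (rule set_integral_lebesgue_cong_AE[OF D]) (use ae in eventually_elim, simp)
 have e1: "(LINT x:D|lebesgue. (\<Sum>\<sigma>\<in>#singular_values_mset (f x). F \<sigma>) / of_nat (min s s))
   = (LINT x:D|lebesgue. (\<Sum>\<sigma>\<in>#singular_values_mset (g x). F \<sigma>) / of_nat (min s s))" for F :: "real => complex"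
  by (rule eq[of "\<lambda>m. (\<Sum>\<sigma>\<in>#singular_values_mset m. F \<sigma>) / of_nat (min s s)"])
 have e2: "(LINT x:D|lebesgue. (\<Sum>z\<in>#eigenvalues_mset (f x). F z) / of_nat s)
   = (LINT x:D|lebesgue. (\<Sum>z\<in>#eigenvalues_mset (g x). F z) / of_nat s)" for F :: "complex => complex"
  by (rule eq[of "\<lambda>m. (\<Sum>z\<in>#eigenvalues_mset m. F z) / of_nat s"])
 have "sv_distributed A D s s f" using g sf unfolding sv_eig_distributed_def sv_distributed_def e1 by argo
 moreover have "eig_distributed A D s f" using g sf unfolding sv_eig_distributed_def eig_distributed_def e2 by argo
 ultimately show ?thesis unfolding sv_eig_distributed_def ..
qed

text \<open>
 For Hermitian matrices both distributions follow from the convergence of the normalized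
 Stieltjes transforms, since the singular values are the moduli of the real eigenvalues.
\<close>

theorem hermitian_distributedI:
 fixes D :: "'a::euclidean_space set"
 assumes sym: "symbol_on D s s f" and s: "0 < s"
  and herm_f: "\<And>x. x \<in> D ==> herm s (\<lambda>i j. f x $$ (i, j))"
  and A: "\<And>n. A n \<in> carrier_mat (d n) (d n)" and d: "filterlim d at_top sequentially"
  and herm_A: "\<And>n. herm (d n) (\<lambda>i j. A n $$ (i, j))"
  and meas: "\<And>z. 0 < Im z ==> (\<lambda>x. \<Sum>i<s. finv s (shiftd (\<lambda>i j. f x $$ (i, j)) (\<lambda>_. z)) i i) \<in> borel_measurable (lebesgue_on D)"
  and tr: "\<And>z. 0 < Im z ==> (\<lambda>n. (\<Sum>i<d n. finv (d n) (shiftd (\<lambda>i j. A n $$ (i, j)) (\<lambda>_. z)) i i) / of_nat (d n))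
   \<longlonglongrightarrow> (LINT x:D|lebesgue. (\<Sum>i<s. finv s (shiftd (\<lambda>i j. f x $$ (i, j)) (\<lambda>_. z)) i i) / of_nat s) / of_real (measure lebesgue D)"
 shows "sv_eig_distributed A D s f"
proof -
 have D: "D \<in> lmeasurable" "0 < measure lebesgue D" "D \<in> sets lebesgue" and fc: "\<And>x. x \<in> D ==> f x \<in> carrier_mat s s"
  using sym unfolding symbol_on_def by auto
 define M where "M = lebesgue_on D"
 have sp: "space M = D" unfolding M_def by simp
 have mM: "measure M (space M) = measure lebesgue D"
  unfolding sp M_def using D(3) by (subst measure_restrict_space) auto
 have fin: "finite_measure M"
  unfolding M_def by (rule finite_measure_lebesgue_on[OF D(1)])
 define S where "S x = herm_eigs s (\<lambda>i j. f x $$ (i, j))" for x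
 define \<Lambda> where "\<Lambda> n = herm_eigs (d n) (\<lambda>i j. A n $$ (i, j))" for n
 note hf = herm_eigs[OF herm_f fc] and hA = herm_eigs[OF herm_A A]
 have int: "(LINT x:D|lebesgue. g x) = (LINT x|M. g x)" for g :: "'a => complex"
  unfolding set_lebesgue_integral_def M_def using D(3) by (subst integral_restrict_space) auto
 have Ssum: "(\<Sum>t\<in>#S x. 1 / (of_real t - z)) = (\<Sum>i<s. finv s (shiftd (\<lambda>i j. f x $$ (i, j)) (\<lambda>_. z)) i i)"
  if "x \<in> D" "0 < Im z" for x z
  unfolding S_def using hf(4)[OF that(1,1) refl] that(2) by simp
 have sz: "size (\<Lambda> n) = d n" for n unfolding \<Lambda>_def by (rule hA(3)) simp
 have lim: "(\<lambda>n. (\<Sum>t\<in>#\<Lambda> n. F t) / of_nat (d n)) \<longlonglongrightarrow> (LINT x:D|lebesgue. (\<Sum>t\<in>#S x. F t) / of_nat s) / of_real (measure lebesgue D)"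
  if F: "continuous_on UNIV F" "bounded {x. F x \<noteq> 0}" for F :: "real => complex"
 proof -
  have "(\<lambda>n. (\<Sum>t\<in>#\<Lambda> n. F t) / of_nat (size (\<Lambda> n))) \<longlonglongrightarrow> (LINT x|M. (\<Sum>t\<in>#S x. F t) / of_nat s) / of_real (measure M (space M))"
  proof (rule conjunct2[OF stieltjes_convergence[where M = M and S = S and s = s and \<Lambda> = \<Lambda> and F = F]])
   show "finite_measure M" "0 < s" by (rule fin s)+
   show "F \<in> resolvent_alg" by (rule cc_in_resolvent_alg[OF F])
   show "measure M (space M) > 0" using D mM by simp
   show "size (S x) = s" if "x \<in> space M" for x
    unfolding S_def using that hf(3)[of x x] by (simp add: sp)
   show "(\<lambda>x. \<Sum>t\<in>#S x. 1 / (of_real t - z)) \<in> borel_measurable M" if "Im z > 0" for z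
    using meas[OF that] by (subst measurable_cong[OF Ssum[OF _ that]]) (auto simp: sp M_def)
   show "(\<lambda>n. (\<Sum>t\<in>#\<Lambda> n. 1 / (of_real t - z)) / of_nat (size (\<Lambda> n)))
    \<longlonglongrightarrow> (LINT x|M. (\<Sum>t\<in>#S x. 1 / (of_real t - z)) / of_nat s) / of_real (measure M (space M))" if z: "Im z > 0" for z
   proof -
    have "(LINT x|M. (\<Sum>t\<in>#S x. 1 / (of_real t - z)) / of_nat s)
      = (LINT x|M. (\<Sum>i<s. finv s (shiftd (\<lambda>i j. f x $$ (i, j)) (\<lambda>_. z)) i i) / of_nat s)"
     by (rule Bochner_Integration.integral_cong) (use Ssum z in \<open>auto simp: sp\<close>)
    moreover have "(\<Sum>t\<in>#\<Lambda> n. 1 / (of_real t - z)) = (\<Sum>i<d n. finv (d n) (shiftd (\<lambda>i j. A n $$ (i, j)) (\<lambda>_. z)) i i)" for n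
     unfolding \<Lambda>_def using hA(4)[OF refl] z by simp
    ultimately show ?thesis using tr[OF z] by (simp only: int mM sz)
   qed
   show "\<forall>\<^sub>F n in sequentially. size (\<Lambda> n) > 0"
    using d[unfolded filterlim_at_top, rule_format, of 1] by (simp add: sz Suc_le_eq)
  qed
  then show ?thesis by (simp add: int mM sz)
 qed
 have cA: "dim_row (A n) = d n" "dim_col (A n) = d n" for n using A[of n] by auto
 have sv: "(\<lambda>n. (\<Sum>\<sigma>\<in>#singular_values_mset (A n). F \<sigma>) / of_nat (d n))
   \<longlonglongrightarrow> (LINT x:D|lebesgue. (\<Sum>\<sigma>\<in>#singular_values_mset (f x). F \<sigma>) / of_nat s) / of_real (measure lebesgue D)"
  if F: "continuous_on UNIV F" "bounded {t. F t \<noteq> 0}" for F :: "real => complex"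
 proof -
  have c: "continuous_on UNIV (\<lambda>t. F \<bar>t\<bar>)"
   by (rule continuous_on_compose2[OF F(1)]) (auto intro: continuous_intros)
  obtain B where B: "\<And>t. F t \<noteq> 0 ==> \<bar>t\<bar> \<le> B" using F(2) by (auto simp: bounded_iff)
  have b: "bounded {t. F \<bar>t\<bar> \<noteq> 0}"
   by (rule boundedI[of _ B]) (use B in force)
  have "(LINT x:D|lebesgue. (\<Sum>\<sigma>\<in>#singular_values_mset (f x). F \<sigma>) / of_nat s) = (LINT x:D|lebesgue. (\<Sum>t\<in>#S x. F \<bar>t\<bar>) / of_nat s)"
   unfolding int
   by (rule Bochner_Integration.integral_cong) (use hf(2) in \<open>auto simp: sp S_def image_mset.compositionality o_def\<close>)
  moreover have "(\<Sum>\<sigma>\<in>#singular_values_mset (A n). F \<sigma>) = (\<Sum>t\<in>#\<Lambda> n. F \<bar>t\<bar>)" for n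
  proof -
   have "singular_values_mset (A n) = image_mset abs (\<Lambda> n)" unfolding \<Lambda>_def by (rule hA(2)) simp
   then show ?thesis by (simp add: image_mset.compositionality o_def)
  qed
  ultimately show ?thesis using lim[OF c b] by (simp only:)
 qed
 have ev: "(\<lambda>n. (\<Sum>z\<in>#eigenvalues_mset (A n). F z) / of_nat (d n))
   \<longlonglongrightarrow> (LINT x:D|lebesgue. (\<Sum>z\<in>#eigenvalues_mset (f x). F z) / of_nat s) / of_real (measure lebesgue D)"
  if F: "continuous_on UNIV F" "bounded {t. F t \<noteq> 0}" for F :: "complex => complex"
 proof -
  have c: "continuous_on UNIV (\<lambda>t. F (of_real t))"
   by (rule continuous_on_compose2[OF F(1)]) (auto intro: continuous_intros)
  obtain B where B: "\<And>t. F t \<noteq> 0 ==> cmod t \<le> B" using F(2) by (auto simp: bounded_iff)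
  have b: "bounded {t. F (of_real t) \<noteq> 0}"
   by (rule boundedI[of _ B]) (use B in force)
  have "(LINT x:D|lebesgue. (\<Sum>z\<in>#eigenvalues_mset (f x). F z) / of_nat s) = (LINT x:D|lebesgue. (\<Sum>t\<in>#S x. F (of_real t)) / of_nat s)"
   unfolding int
   by (rule Bochner_Integration.integral_cong) (use hf(1) in \<open>auto simp: sp S_def image_mset.compositionality o_def\<close>)
  moreover have "(\<Sum>z\<in>#eigenvalues_mset (A n). F z) = (\<Sum>t\<in>#\<Lambda> n. F (of_real t))" for n
  proof -
   have "eigenvalues_mset (A n) = image_mset of_real (\<Lambda> n)" unfolding \<Lambda>_def by (rule hA(1)) simp
   then show ?thesis by (simp add: image_mset.compositionality o_def)
  qed
  ultimately show ?thesis using lim[OF c b] by (simp only:)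
 qed
 show ?thesis
  unfolding sv_eig_distributed_def sv_distributed_def eig_distributed_def cA min.idem
  using sym d sv ev by auto
qed

section \<open>Integration over the rectangle\<close>

lemma rectangle_measure: "{0..1::real} \<times> {-pi..pi} \<in> lmeasurable" "measure lebesgue ({0..1::real} \<times> {-pi..pi}) = 2 * pi"
proof -
 have e: "emeasure lborel ({0..1::real} \<times> {-pi..pi}) = ennreal (2 * pi)"
  unfolding lborel_prod[symmetric] by (subst lborel.emeasure_pair_measure_Times) (auto simp: ennreal_mult[symmetric])
 have b: "{0..1::real} \<times> {-pi..pi} \<in> sets borel" by (simp add: borel_closed closed_Times)
 have e': "emeasure lebesgue ({0..1::real} \<times> {-pi..pi}) = ennreal (2 * pi)" using e b by simp
 show "{0..1::real} \<times> {-pi..pi} \<in> lmeasurable" by (rule fmeasurableI) (use b e' in auto)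
 show "measure lebesgue ({0..1::real} \<times> {-pi..pi}) = 2 * pi" unfolding measure_def e' by simp
qed

lemma rectangle_integral:
 fixes g :: "real \<times> real => complex"
 assumes [measurable]: "g \<in> borel_measurable borel" and b: "\<And>w. cmod (g w) \<le> B"
 shows "(LINT w:{0..1}\<times>{-pi..pi}|lebesgue. g w) = (LINT x:{0..1}|lborel. (LINT \<theta>|circle_measure. g (x, \<theta>)))"
  and "set_integrable lebesgue ({0..1}\<times>{-pi..pi}) g"
proof -
 have D: "{0..1::real} \<times> {-pi..pi} \<in> sets borel" by (simp add: borel_closed closed_Times)
 have "integrable lborel (\<lambda>w. indicat_real ({0..1} \<times> {-pi..pi}) w *\<^sub>R g w)"
 proof (rule integrableI_bounded_set_indicator[where B = B])
  show "emeasure lborel ({0..1::real} \<times> {-pi..pi}) < \<infinity>"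
   by (rule emeasure_bounded_finite) (simp add: bounded_Times)
 qed (use b D in auto)
 then have i: "integrable (lborel \<Otimes>\<^sub>M lborel) (\<lambda>w. indicat_real ({0..1} \<times> {-pi..pi}) w *\<^sub>R g w)" and
  i': "integrable lebesgue (\<lambda>w. indicat_real ({0..1} \<times> {-pi..pi}) w *\<^sub>R g w)"
  by (simp_all add: lborel_prod integrable_completion)
 from i' show "set_integrable lebesgue ({0..1}\<times>{-pi..pi}) g" unfolding set_integrable_def .
 have "(LINT w:{0..1}\<times>{-pi..pi}|lebesgue. g w) = (LINT w|lborel. indicat_real ({0..1} \<times> {-pi..pi}) w *\<^sub>R g w)"
  unfolding set_lebesgue_integral_def by (rule integral_completion) (use D in measurable)
 also have "\<dots> = (LINT w|(lborel \<Otimes>\<^sub>M lborel). indicat_real ({0..1} \<times> {-pi..pi}) w *\<^sub>R g w)" by (simp add: lborel_prod)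
 also have "\<dots> = (LINT x|lborel. (LINT y|lborel. indicat_real ({0..1} \<times> {-pi..pi}) (x, y) *\<^sub>R g (x, y)))"
  by (rule lborel_pair.integral_fst'[OF i, symmetric])
 also have "\<dots> = (LINT x|lborel. indicat_real {0..1} x *\<^sub>R (LINT y|lborel. indicat_real {-pi..pi} y *\<^sub>R g (x, y)))"
  by (simp only: indicator_times fst_conv snd_conv scaleR_scaleR[symmetric] integral_scaleR_right)
 also have "\<dots> = (LINT x:{0..1}|lborel. (LINT \<theta>|circle_measure. g (x, \<theta>)))"
  unfolding set_lebesgue_integral_def by (subst integral_restrict_space) auto
 finally show "(LINT w:{0..1}\<times>{-pi..pi}|lebesgue. g w) = (LINT x:{0..1}|lborel. (LINT \<theta>|circle_measure. g (x, \<theta>)))" .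
qed

context banded_symbol
begin

lemma res_borel_comp:
 fixes a :: "real => real"
 assumes "c < r" "d < r" "a \<in> borel_measurable borel"
 shows "(\<lambda>(x, \<theta>). res (a x) \<theta> c d) \<in> borel_measurable borel"
proof -
 have f: "(\<lambda>w::real \<times> real. a (fst w)) \<in> borel_measurable borel"
  by (rule measurable_compose[OF _ assms(3)]) (intro borel_measurable_continuous_onI continuous_intros)
 have s: "(\<lambda>w::real \<times> real. snd w) \<in> borel_measurable borel"
  by (intro borel_measurable_continuous_onI continuous_intros)
 have "(\<lambda>(\<alpha>, \<theta>). res \<alpha> \<theta> c d) \<circ> (\<lambda>w::real \<times> real. (a (fst w), snd w)) \<in> borel_measurable borel"
  by (rule measurable_comp[OF borel_measurable_Pair[OF f s] res_borel2[OF assms(1,2)]])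
 then show ?thesis by (simp add: o_def case_prod_beta')
qed

text \<open>The Fourier coefficient of index 0 is a mean over \<theta>, which Fubini merges with the
  integral over x.\<close>

lemma hsym_integral:
 fixes a :: "real => real"
 assumes a: "a \<in> borel_measurable borel"
 shows "(LINT x:{0..1}|lborel. hsym W (a x)) = (LINT w:{0..1}\<times>{-pi..pi}|lebesgue. (\<Sum>c<r. W c * res (a (fst w)) (snd w) c c)) / of_real (2 * pi)"
proof -
 define g where "g w = (\<Sum>c<r. W c * res (a (fst w)) (snd w) c c)" for w
 have gm: "g \<in> borel_measurable borel"
  unfolding g_def[abs_def] using res_borel_comp[OF _ _ a]
  by (intro borel_measurable_sum borel_measurable_times) (auto simp: case_prod_beta')
 have gb: "cmod (g w) \<le> (\<Sum>c<r. cmod (W c) * (1 / \<eta>))" for w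
  unfolding g_def by (rule order_trans[OF norm_sum], rule sum_mono)
   (simp only: norm_mult, intro mult_left_mono res_bound, auto)
 have ci: "integrable circle_measure (\<lambda>\<theta>. res \<alpha> \<theta> c c)" if "c < r" for \<alpha> c
  by (rule circle_integrable[OF res_borel[OF that that] res_bound[OF that that]])
 have "hsym W \<alpha> = (LINT \<theta>|circle_measure. (\<Sum>c<r. W c * res \<alpha> \<theta> c c)) / of_real (2 * pi)" for \<alpha>
 proof -
  have "(LINT \<theta>|circle_measure. (\<Sum>c<r. W c * res \<alpha> \<theta> c c)) = (\<Sum>c<r. W c * (LINT \<theta>|circle_measure. res \<alpha> \<theta> c c))"
   using ci by (subst Bochner_Integration.integral_sum) auto
  then show ?thesis unfolding hsym_def fc_def fcoef_def by (simp add: sum_divide_distrib)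
 qed
 then have h: "hsym W (a x) = (LINT \<theta>|circle_measure. g (x, \<theta>)) / of_real (2 * pi)" for x unfolding g_def by simp
 show ?thesis unfolding h g_def[symmetric] rectangle_integral(1)[OF gm gb]
  unfolding set_lebesgue_integral_def scaleR_conv_of_real times_divide_eq_right by simp
qed

end

section \<open>The symbols\<close>

lemma AE_rectangle:
 assumes "AE x in lborel. P x"
 shows "AE w in lebesgue_on ({0..1::real}\<times>{-pi..pi}). P (fst w)"
  and "AE w in lebesgue_on ({0..1::real}\<times>{-pi..pi}). P (snd w)"
proof -
 have D: "{0..1::real} \<times> {-pi..pi} \<in> sets lebesgue" using rectangle_measure(1) by auto
 obtain N where N: "N \<in> null_sets lborel" "{x. \<not> P x} \<subseteq> N"
  using assms unfolding eventually_ae_filter by auto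
 have "N \<times> (UNIV :: real set) \<in> null_sets lborel" "(UNIV :: real set) \<times> N \<in> null_sets lborel"
  using N(1) unfolding lborel_prod[symmetric] null_sets_def
  by (auto simp: lborel.emeasure_pair_measure_Times)
 note ae = this[THEN AE_not_in, THEN AE_completion]
 have "AE w in lebesgue. P (fst (w :: real \<times> real))" using ae(1) by eventually_elim (use N(2) in \<open>auto simp: mem_Times_iff\<close>)
 then show "AE w in lebesgue_on ({0..1::real}\<times>{-pi..pi}). P (fst w)"
  using D by (simp add: AE_restrict_space_iff, eventually_elim) simp
 have "AE w in lebesgue. P (snd (w :: real \<times> real))" using ae(2) by eventually_elim (use N(2) in \<open>auto simp: mem_Times_iff\<close>)
 then show "AE w in lebesgue_on ({0..1::real}\<times>{-pi..pi}). P (snd w)"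
  using D by (simp add: AE_restrict_space_iff, eventually_elim) simp
qed

lemma integral_lebesgue_eq_lborel:
 fixes f g :: "'a::euclidean_space => 'b::euclidean_space"
 assumes "AE x in lebesgue. f x = g x" "g \<in> borel_measurable borel"
 shows "integral\<^sup>L lebesgue f = integral\<^sup>L lborel g"
 unfolding integral_lebesgue_cong_AE[OF assms(1)] using assms(2) by (intro integral_completion) simp

lemma AE_lebesgue_finite:
 assumes "finite {x::real. f x \<noteq> g x}" shows "AE x in lebesgue. f x = g x"
proof -
 have "AE x in lborel. x \<notin> {x. f x \<noteq> g x}" by (rule AE_not_in[OF finite_imp_null_set_lborel[OF assms]])
 then show ?thesis by (intro AE_completion) auto
qed

lemma finv_cong:
 assumes "\<And>i j. i < d ==> j < d ==> T i j = T' i j"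
 shows "finv d T = finv d T'"
proof -
 have "Matrix.mat d d (\<lambda>(i, j). T i j) = Matrix.mat d d (\<lambda>(i, j). T' i j)" using assms by (intro cong_mat) auto
 then show ?thesis unfolding finv_def[abs_def] by simp
qed

lemma mat_adjoint_entry:
 assumes "A \<in> carrier_mat n m" "i < m" "j < n"
 shows "mat_adjoint A $$ (i, j) = cnj (A $$ (j, i))"
 using assms unfolding mat_adjoint_def by (simp add: mat_of_rows_def carrier_matD)

lemma mat_adjoint_carrier: "A \<in> carrier_mat n m ==> mat_adjoint A \<in> carrier_mat m n"
 by (auto simp: mat_adjoint_def)

context spline_pair
begin

text \<open>The symbols \<kappa>, \<xi> and \<mu> as finite sums over the common bandwidth, with the
  formal derivative in place of \<open>deriv\<close>.\<close>

definition kap :: "real => mat_fun" where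
 "kap \<theta> c d = (\<Sum>s\<in>{- int wd..int wd}. of_real (shift_prod (bv d) (bv c) s) * cis (of_int s * \<theta>))"
definition xif :: "real => mat_fun" where
 "xif \<theta> c j = (\<Sum>s\<in>{- int wd..int wd}. of_real (shift_prod (bv (P + j)) (bu c) s) * cis (of_int s * \<theta>))"
definition muf :: "real => mat_fun" where
 "muf \<theta> i j = (\<Sum>s\<in>{- int wd..int wd}. of_real (shift_prod (bu (P + j)) (bu (P + i)) s) * cis (of_int s * \<theta>))"

lemma block_entries:
 "c < P ==> d < P ==> K_block p k s $$ (c, d) = shift_prod (bv d) (bv c) s"
 "c < P ==> j < Q ==> H_block p k q l s $$ (c, j) = shift_prod (bv (P + j)) (bu c) s"
 "i < Q ==> j < Q ==> M_block q l s $$ (i, j) = shift_prod (bu (P + j)) (bu (P + i)) s"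
proof -
 have PQ: "p - k = P" "q - l = Q" using pk ql by auto
 have shift: "finite {y::real. f y \<noteq> g y} ==> finite {y. f (y - of_int s) \<noteq> g (y - of_int s)}" for f g :: "real => real"
  by (rule finite_subset[of _ "(\<lambda>y. y + of_int s) ` {y. f y \<noteq> g y}"]) (auto intro: image_eqI[of _ _ "_ - of_int s"])
 show "K_block p k s $$ (c, d) = shift_prod (bv d) (bv c) s" if "c < P" "d < P"
 proof -
  have "(LINT y|lebesgue. deriv (spline_beta p k (d + 1)) y * deriv (spline_beta p k (c + 1)) (y - of_int s)) = (LINT y|lborel. bv d y * bv c (y - of_int s))"
  proof (rule integral_lebesgue_eq_lborel)
   show "AE y in lebesgue. deriv (spline_beta p k (d + 1)) y * deriv (spline_beta p k (c + 1)) (y - of_int s) = bv d y * bv c (y - of_int s)"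
    using AE_lebesgue_finite[OF beta_facts(4)[OF pk P0 that(2)]] AE_lebesgue_finite[OF shift[OF beta_facts(4)[OF pk P0 that(1)]]]
    by eventually_elim (simp add: bv_def that)
  qed measurable
  then show ?thesis unfolding K_block_def shift_prod_def using that by (simp add: PQ)
 qed
 show "H_block p k q l s $$ (c, j) = shift_prod (bv (P + j)) (bu c) s" if "c < P" "j < Q"
 proof -
  have "(LINT y|lebesgue. deriv (spline_beta q l (j + 1)) y * spline_beta p k (c + 1) (y - of_int s)) = (LINT y|lborel. bv (P + j) y * bu c (y - of_int s))"
  proof (rule integral_lebesgue_eq_lborel)
   show "AE y in lebesgue. deriv (spline_beta q l (j + 1)) y * spline_beta p k (c + 1) (y - of_int s) = bv (P + j) y * bu c (y - of_int s)"
    using AE_lebesgue_finite[OF beta_facts(4)[OF ql Q0 that(2)]]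
    by eventually_elim (simp add: bv_def bu_def that)
  qed measurable
  then show ?thesis unfolding H_block_def shift_prod_def using that by (simp add: PQ)
 qed
 show "M_block q l s $$ (i, j) = shift_prod (bu (P + j)) (bu (P + i)) s" if "i < Q" "j < Q"
 proof -
  have "(LINT y|lebesgue. spline_beta q l (j + 1) y * spline_beta q l (i + 1) (y - of_int s)) = (LINT y|lborel. bu (P + j) y * bu (P + i) (y - of_int s))"
   by (rule integral_lebesgue_eq_lborel) (use that in \<open>auto simp: bu_def\<close>)
  then show ?thesis unfolding M_block_def shift_prod_def using that by (simp add: PQ)
 qed
qed

lemma band_infsum:
 assumes "\<And>s. \<bar>s\<bar> > int wd ==> f s = 0"
 shows "(\<Sum>\<^sub>\<infinity>s. of_real (f s) * cis (of_int s * \<theta>)) = (\<Sum>s\<in>{- int wd..int wd}. of_real (f s) * cis (of_int s * \<theta>))"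
proof -
 have "(\<Sum>\<^sub>\<infinity>s. of_real (f s) * cis (of_int s * \<theta>)) = (\<Sum>\<^sub>\<infinity>s\<in>{- int wd..int wd}. of_real (f s) * cis (of_int s * \<theta>))"
  by (rule infsum_cong_neutral) (use assms in auto)
 then show ?thesis by simp
qed

lemma symbol_entries:
 "c < P ==> d < P ==> kappa_symbol p k \<theta> $$ (c, d) = kap \<theta> c d"
 "c < P ==> j < Q ==> xi_symbol p k q l \<theta> $$ (c, j) = xif \<theta> c j"
 "i < Q ==> j < Q ==> mu_symbol q l \<theta> $$ (i, j) = muf \<theta> i j"
 "kappa_symbol p k \<theta> \<in> carrier_mat P P" "xi_symbol p k q l \<theta> \<in> carrier_mat P Q" "mu_symbol q l \<theta> \<in> carrier_mat Q Q"
proof -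
 have PQ: "p - k = P" "q - l = Q" using pk ql by auto
 note b = b_facts(3,4)
 show "kappa_symbol p k \<theta> $$ (c, d) = kap \<theta> c d" if "c < P" "d < P"
  unfolding kappa_symbol_def fourier_mat_def PQ kap_def using that
  by (simp add: block_entries band_infsum[OF shift_prod_zero[OF _ b(2) b(2)]])
 show "xi_symbol p k q l \<theta> $$ (c, j) = xif \<theta> c j" if "c < P" "j < Q"
  unfolding xi_symbol_def fourier_mat_def PQ xif_def using that
  by (simp add: block_entries band_infsum[OF shift_prod_zero[OF _ b(2) b(1)]])
 show "mu_symbol q l \<theta> $$ (i, j) = muf \<theta> i j" if "i < Q" "j < Q"
  unfolding mu_symbol_def fourier_mat_def PQ muf_def using that
  by (simp add: block_entries band_infsum[OF shift_prod_zero[OF _ b(1) b(1)]])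
 show "kappa_symbol p k \<theta> \<in> carrier_mat P P" "xi_symbol p k q l \<theta> \<in> carrier_mat P Q" "mu_symbol q l \<theta> \<in> carrier_mat Q Q"
  unfolding kappa_symbol_def xi_symbol_def mu_symbol_def fourier_mat_def PQ by auto
qed

definition block_sym :: "real => real => mat_fun" where
 "block_sym \<alpha> \<theta> = block_fun P (\<lambda>c d. of_real \<alpha> * kap \<theta> c d) (\<lambda>c j. of_real \<tau> * xif \<theta> c j) (\<lambda>i j. of_real (- \<rho>) * muf \<theta> i j)"

lemma sym_block:
 assumes "0 < \<eta>" "\<And>c. c < P + Q ==> \<eta> \<le> Im (Z c)" and cd: "c < P + Q" "d < P + Q"
 shows "banded_symbol.sym wd K L \<alpha> \<theta> c d = block_sym \<alpha> \<theta> c d"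
proof -
 interpret banded_symbol "P + Q" wd K L Z \<eta> by (rule spline_symbol[OF assms(1,2)])
 have sum_mult: "(\<Sum>s\<in>S. of_real (t * f s) * cis (of_int s * \<theta>)) = of_real t * (\<Sum>s\<in>S. of_real (f s) * cis (of_int s * \<theta>))" for t f and S :: "int set"
  by (simp add: sum_distrib_left mult.assoc)
 have refl: "(\<Sum>s\<in>{- int wd..int wd}. of_real (f (- s)) * cis (of_int s * \<theta>)) = cnj (\<Sum>s\<in>{- int wd..int wd}. of_real (f s) * cis (of_int s * \<theta>))" for f
  unfolding cnj_sum by (rule sum.reindex_bij_witness[of _ uminus uminus]) (auto simp: cis_cnj)
 show ?thesis
 proof (cases "c < P"; cases "d < P")
  assume "c < P" "d < P"
  then show ?thesis unfolding sym_def K_def L_def block_sym_def block_fun_def kap_def by (simp add: sum_distrib_left mult.assoc)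
 next
  assume "c < P" "\<not> d < P"
  then show ?thesis unfolding sym_def K_def L_def block_sym_def block_fun_def xif_def by (simp add: sum_distrib_left mult.assoc)
 next
  assume a: "\<not> c < P" "d < P"
  have "sym \<alpha> \<theta> c d = of_real \<tau> * (\<Sum>s\<in>{- int wd..int wd}. of_real (shift_prod (bv c) (bu d) (- s)) * cis (of_int s * \<theta>))"
   using a unfolding sym_def K_def L_def by (simp add: sum_distrib_left mult.assoc)
  then show ?thesis using a unfolding refl[of "shift_prod (bv c) (bu d)"] block_sym_def block_fun_def xif_def by simp
 next
  assume "\<not> c < P" "\<not> d < P"
  then show ?thesis unfolding sym_def K_def L_def block_sym_def block_fun_def muf_def using sum_mult[of "- \<rho>"] by simp
 qed
qed

text \<open>Passage from the integrals of the statement to Borel integrands: the coefficient is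
  replaced by its representative b and the classical derivatives by the formal ones, each changing
  the integrand on a null set only.\<close>

lemma ent_eq:
 fixes a b f f' g h :: "real => real"
 assumes n: "1 \<le> n"
  and b: "b \<in> borel_measurable borel" "AE x in lborel. x \<in> {0..1} \<longrightarrow> a x = b x"
  and g: "finite {x. f x \<noteq> g x}" "g \<in> borel_measurable borel" and h: "finite {x. f' x \<noteq> h x}" "h \<in> borel_measurable borel"
 shows "(LINT x:{0..1}|lebesgue. a x * f x * f' x) = (LINT x|lborel. indicator {0..1} x * (b x * (g x * h x)))"
 unfolding set_lebesgue_integral_def
proof (rule integral_lebesgue_eq_lborel)
 show "AE x in lebesgue. indicat_real {0..1} x *\<^sub>R (a x * f x * f' x) = indicator {0..1} x * (b x * (g x * h x))"
  using AE_lebesgue_finite[OF g(1)] AE_lebesgue_finite[OF h(1)] AE_completion[OF b(2)]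
  by eventually_elim (auto simp: indicator_def)
qed (use b g h in measurable)

lemma matrix_entries:
 assumes n: "1 \<le> n" and b: "b \<in> borel_measurable borel" "AE x in lborel. x \<in> {0..1} \<longrightarrow> a x = b x"
 shows "i < dP n ==> j < dP n ==> A11 a p k n $$ (i, j) = real n * ent b n (v n j) (v n i)"
  "i < dP n ==> j < dQ n ==> A12 p k q l n $$ (i, j) = ent (\<lambda>_. 1) n (v n (dP n + j)) (u n i)"
  "i < dQ n ==> j < dQ n ==> A22 \<rho> q l n $$ (i, j) = - \<rho> * ent (\<lambda>_. 1) n (u n (dP n + j)) (u n (dP n + i)) / real n"
proof -
 have n0: "real n \<noteq> 0" using n by simp
 show "A11 a p k n $$ (i, j) = real n * ent b n (v n j) (v n i)" if "i < dP n" "j < dP n"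
 proof -
  have "A11 a p k n $$ (i, j) = (LINT x|lborel. indicator {0..1} x * (b x * (spline_D p k n (j + 2) x * spline_D p k n (i + 2) x)))"
   using that ent_eq[OF n b spline_facts(4)[OF pk P0 n] _ spline_facts(4)[OF pk P0 n], of j i] spline_borel
   by (simp add: A11_def dP_def)
  also have "\<dots> = real n * (real n * (LINT x|lborel. indicator {0..1} x * (b x * (v n j x * v n i x))))"
   unfolding Bochner_Integration.integral_mult_right_zero[symmetric]
   by (rule Bochner_Integration.integral_cong) (use that n0 in \<open>auto simp: v_def\<close>)
  finally show ?thesis by (simp add: ent_def)
 qed
 show "A12 p k q l n $$ (i, j) = ent (\<lambda>_. 1) n (v n (dP n + j)) (u n i)" if "i < dP n" "j < dQ n"
 proof -
  have "A12 p k q l n $$ (i, j) = (LINT x|lborel. indicator {0..1} x * (1 * (spline_D q l n (j + 2) x * spline_B p k n (i + 2) x)))"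
   using that ent_eq[OF n _ _ spline_facts(4)[OF ql Q0 n], of "\<lambda>_. 1" "\<lambda>_. 1" j "spline_B p k n (i + 2)" "spline_B p k n (i + 2)"] spline_borel
   by (simp add: A12_def dP_def dQ_def)
  also have "\<dots> = real n * (LINT x|lborel. indicator {0..1} x * (1 * (v n (dP n + j) x * u n i x)))"
   unfolding Bochner_Integration.integral_mult_right_zero[symmetric]
   by (rule Bochner_Integration.integral_cong) (use that n0 in \<open>auto simp: v_def u_def\<close>)
  finally show ?thesis by (simp add: ent_def)
 qed
 show "A22 \<rho> q l n $$ (i, j) = - \<rho> * ent (\<lambda>_. 1) n (u n (dP n + j)) (u n (dP n + i)) / real n" if "i < dQ n" "j < dQ n"
 proof -
  have "A22 \<rho> q l n $$ (i, j) = - \<rho> * (LINT x|lborel. indicator {0..1} x * (1 * (spline_B q l n (j + 2) x * spline_B q l n (i + 2) x)))"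
   using that ent_eq[OF n _ _, of "\<lambda>_. 1" "\<lambda>_. 1" "spline_B q l n (j + 2)" "spline_B q l n (j + 2)" "spline_B q l n (i + 2)" "spline_B q l n (i + 2)"] spline_borel
   by (simp add: A22_def dQ_def)
  then show ?thesis using n0 by (simp add: ent_def u_def)
 qed
qed

lemma matrix_carriers: "A11 a p k n \<in> carrier_mat (dP n) (dP n)" "A12 p k q l n \<in> carrier_mat (dP n) (dQ n)"
 "A22 \<rho> q l n \<in> carrier_mat (dQ n) (dQ n)"
 unfolding A11_def A12_def A22_def dP_def dQ_def by auto

lemma trace_limit_normalized:
 assumes b: "b \<in> borel_measurable borel" "set_integrable lborel {0..1} b"
  and eta: "0 < \<eta>" "\<And>c. c < P + Q ==> \<eta> \<le> Im (Z c)"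
 shows "(\<lambda>n. (\<Sum>i<N n. W (comp n i) * finv (N n) (shiftd (X b n) (\<lambda>i. Z (comp n i))) i i) / of_nat n)
  \<longlonglongrightarrow> (LINT w:{0..1}\<times>{-pi..pi}|lebesgue. (\<Sum>c<P + Q. W c * finv (P + Q) (shiftd (block_sym (b (fst w)) (snd w)) Z) c c)) / of_real (2 * pi)"
  and "c < P + Q ==> d < P + Q ==> (\<lambda>w::real \<times> real. finv (P + Q) (shiftd (block_sym (b (fst w)) (snd w)) Z) c d) \<in> borel_measurable borel"
  and "c < P + Q ==> d < P + Q ==> cmod (finv (P + Q) (shiftd (block_sym \<alpha> \<theta>) Z) c d) \<le> 1 / \<eta>"
proof -
 interpret banded_symbol "P + Q" wd K L Z \<eta> by (rule spline_symbol[OF eta])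
 have res: "res \<alpha> \<theta> = finv (P + Q) (shiftd (block_sym \<alpha> \<theta>) Z)" for \<alpha> \<theta>
  unfolding res_def by (rule finv_cong) (simp add: shiftd_def sym_block[where Z = Z, OF eta])
 show "(\<lambda>n. (\<Sum>i<N n. W (comp n i) * finv (N n) (shiftd (X b n) (\<lambda>i. Z (comp n i))) i i) / of_nat n)
  \<longlonglongrightarrow> (LINT w:{0..1}\<times>{-pi..pi}|lebesgue. (\<Sum>c<P + Q. W c * finv (P + Q) (shiftd (block_sym (b (fst w)) (snd w)) Z) c c)) / of_real (2 * pi)"
  using spline_trace_limit[where Z = Z and W = W, OF b eta] unfolding hsym_integral[OF b(1)] res .
 show "c < P + Q ==> d < P + Q ==> (\<lambda>w::real \<times> real. finv (P + Q) (shiftd (block_sym (b (fst w)) (snd w)) Z) c d) \<in> borel_measurable borel"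
  using res_borel_comp[OF _ _ b(1), of c d] unfolding res by (simp add: case_prod_beta')
 show "c < P + Q ==> d < P + Q ==> cmod (finv (P + Q) (shiftd (block_sym \<alpha> \<theta>) Z) c d) \<le> 1 / \<eta>"
  using res_bound[of c d] unfolding res by simp
qed

lemma coefficient_borel:
 "(\<lambda>w::real \<times> real. kap (snd w) c d) \<in> borel_measurable borel" "(\<lambda>w::real \<times> real. xif (snd w) c j) \<in> borel_measurable borel"
 "(\<lambda>w::real \<times> real. muf (snd w) i j) \<in> borel_measurable borel"
 unfolding kap_def xif_def muf_def by (intro borel_measurable_continuous_onI continuous_intros)+

end

section \<open>Invertibility of the stiffness symbol\<close>

context spline_pair
begin

lemma bv_shift_integral:
 "integrable lborel (\<lambda>y. bv d (y - real t') * bv c (y - real t))"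
 "(LINT y|lborel. bv d (y - real t') * bv c (y - real t)) = shift_prod (bv d) (bv c) (int t - int t')"
proof -
 have "\<bar>bv d (y - real t') * bv c (y - real t)\<bar> \<le> Cb * Cb" for y
  unfolding abs_mult by (intro mult_mono b_facts Cb_ge) auto
 moreover have "bv d (y - real t') * bv c (y - real t) = 0" if "\<not> (real t' \<le> real 1 * y \<and> real 1 * y \<le> real t' + real wd)" for y
  using b_facts(4)[of "y - real t'" d] that by auto
 ultimately show "integrable lborel (\<lambda>y. bv d (y - real t') * bv c (y - real t))"
  by (intro scaled_Icc_integral(1)[where n = 1 and c = "Cb * Cb" and \<mu> = "real t'" and w = "real wd"]) (use Cb_ge in auto)
 show "(LINT y|lborel. bv d (y - real t') * bv c (y - real t)) = shift_prod (bv d) (bv c) (int t - int t')"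
  unfolding shift_prod_def
  by (subst lborel_integral_real_affine[of 1 _ "real t'"]) (auto intro!: Bochner_Integration.integral_cong simp: algebra_simps)
qed

lemma integral_double_sum:
 fixes F :: "'b => 'c => 'd => complex"
 assumes "\<And>x x'. integrable M (F x x')"
 shows "(LINT y|M. (\<Sum>x\<in>A. \<Sum>x'\<in>B. F x x' y)) = (\<Sum>x\<in>A. \<Sum>x'\<in>B. (LINT y|M. F x x' y))"
proof -
 have "(LINT y|M. (\<Sum>x\<in>A. \<Sum>x'\<in>B. F x x' y)) = (\<Sum>x\<in>A. (LINT y|M. (\<Sum>x'\<in>B. F x x' y)))"
  by (rule Bochner_Integration.integral_sum) (rule Bochner_Integration.integrable_sum, rule assms)
 also have "\<dots> = (\<Sum>x\<in>A. \<Sum>x'\<in>B. (LINT y|M. F x x' y))"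
  by (rule sum.cong[OF refl], rule Bochner_Integration.integral_sum, rule assms)
 finally show ?thesis .
qed

text \<open>The numbers \<open>shift_prod\<close> are inner products of shifted reference
  derivatives, so the hypothesis says that a Gram matrix annihilates \<open>vc\<close>. Pairing with
  \<open>vc\<close> gives the squared L2 norm of the combination, which is therefore 0.\<close>

lemma spline_combination_zero:
 fixes vc :: mat_fun
 assumes eq: "\<And>c t. c < P ==> t < T ==>
   (\<Sum>d<P. \<Sum>t'<T. complex_of_real (shift_prod (bv d) (bv c) (int t - int t')) * vc d t') = 0"
 shows "AE y in lborel. (\<Sum>c<P. \<Sum>t<T. vc c t * complex_of_real (bv c (y - real t))) = 0"
proof -
 let ?I = "{..<P} \<times> {..<T}"
 define G where "G y = (\<Sum>(c, t)\<in>?I. vc c t * complex_of_real (bv c (y - real t)))" for y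
 have [measurable]: "G \<in> borel_measurable borel" unfolding G_def[abs_def] case_prod_beta' by measurable
 have GG: "complex_of_real ((cmod (G y))\<^sup>2) = (\<Sum>(c, t)\<in>?I. \<Sum>(d, t')\<in>?I. cnj (vc c t) * vc d t' * complex_of_real (bv d (y - real t') * bv c (y - real t)))" for y
 proof -
  have "complex_of_real ((cmod (G y))\<^sup>2) = cnj (G y) * G y" by (simp only: complex_norm_square mult.commute)
  then show ?thesis unfolding G_def cnj_sum sum_product by (simp add: case_prod_beta' mult_ac)
 qed
 have int: "integrable lborel (\<lambda>y. cnj (vc c t) * vc d t' * complex_of_real (bv d (y - real t') * bv c (y - real t)))" for c t d t'
  by (intro integrable_mult_right integrable_of_real bv_shift_integral)
 have intG: "integrable lborel (\<lambda>y. complex_of_real ((cmod (G y))\<^sup>2))"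
  unfolding GG case_prod_beta' by (intro Bochner_Integration.integrable_sum int)
 have "(LINT y|lborel. complex_of_real ((cmod (G y))\<^sup>2))
   = (\<Sum>(c, t)\<in>?I. \<Sum>(d, t')\<in>?I. cnj (vc c t) * vc d t' * complex_of_real (shift_prod (bv d) (bv c) (int t - int t')))"
 proof -
  have i: "(LINT y|lborel. cnj (vc c t) * vc d t' * complex_of_real (bv d (y - real t') * bv c (y - real t)))
    = cnj (vc c t) * vc d t' * complex_of_real (shift_prod (bv d) (bv c) (int t - int t'))" for c t d t'
   unfolding bv_shift_integral(2)[symmetric] integral_complex_of_real[symmetric] by (rule integral_mult_right_zero)
  define F where "F x x' y = cnj (vc (fst x) (snd x)) * vc (fst x') (snd x') * complex_of_real (bv (fst x') (y - real (snd x')) * bv (fst x) (y - real (snd x)))" for x x' y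
  have Fi: "integrable lborel (F x x')" for x x' unfolding F_def[abs_def] by (rule int)
  have Fe: "(LINT y|lborel. F x x' y) = cnj (vc (fst x) (snd x)) * vc (fst x') (snd x') * complex_of_real (shift_prod (bv (fst x')) (bv (fst x)) (int (snd x) - int (snd x')))" for x x'
   unfolding F_def by (rule i)
  have GF: "complex_of_real ((cmod (G y))\<^sup>2) = (\<Sum>x\<in>?I. \<Sum>x'\<in>?I. F x x' y)" for y
   unfolding GG case_prod_beta' F_def ..
  show ?thesis unfolding GF integral_double_sum[OF Fi] Fe case_prod_beta' ..
 qed
 also have "\<dots> = (\<Sum>(c, t)\<in>?I. cnj (vc c t) * (\<Sum>d<P. \<Sum>t'<T. complex_of_real (shift_prod (bv d) (bv c) (int t - int t')) * vc d t'))"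
 proof -
  have "(\<Sum>(d, t')\<in>?I. cnj (vc c t) * vc d t' * complex_of_real (shift_prod (bv d) (bv c) (int t - int t')))
   = cnj (vc c t) * (\<Sum>d<P. \<Sum>t'<T. complex_of_real (shift_prod (bv d) (bv c) (int t - int t')) * vc d t')" for c t
   unfolding sum.cartesian_product sum_distrib_left by (rule sum.cong[OF refl]) (auto simp: mult_ac)
  then show ?thesis by (simp only:)
 qed
 also have "\<dots> = 0" by (rule sum.neutral) (auto simp: eq)
 finally have "complex_of_real (LINT y|lborel. (cmod (G y))\<^sup>2) = 0" unfolding integral_complex_of_real .
 then have z: "(LINT y|lborel. (cmod (G y))\<^sup>2) = 0" by simp
 have "integrable lborel (\<lambda>y. (cmod (G y))\<^sup>2)" using intG by (simp only: complex_of_real_integrable_eq)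
 then have "AE y in lborel. (cmod (G y))\<^sup>2 = 0" using z by (subst (asm) integral_nonneg_eq_0_iff_AE) auto
 then have "AE y in lborel. G y = 0" by eventually_elim simp
 then show ?thesis unfolding G_def sum.cartesian_product .
qed

text \<open>
 A polynomial vector annihilated by the symbol of the stiffness matrix is a finite combination of
 reference B-splines with vanishing derivative, hence a kernel vector of all large stiffness matrices.
\<close>

lemma stiffness_kernel:
 fixes vc :: mat_fun
 assumes b: "b \<in> borel_measurable borel" "set_integrable lborel {0..1} b"
  and eq: "\<And>c t. c < P ==> t < T ==>
   (\<Sum>d<P. \<Sum>t'<T. of_real (shift_prod (bv d) (bv c) (int t - int t')) * vc d t') = 0"
  and inv: "inv_pair (dP (T + wd + 2)) (X b (T + wd + 2)) G'"
  and c: "c < P" and t: "t < T"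
 shows "vc c t = 0"
proof -
 \<comment> \<open>Large enough that the splines in the cells 0, ..., T - 1 are all interior, so the
   combination of shifted reference splines is realised by the vector \<open>y\<close> of this
   size.\<close>
 define n where "n = T + wd + 2"
 have n: "1 \<le> n" and n0: "real n \<noteq> 0" unfolding n_def by auto
 define y where "y j = (if 0 \<le> cell n j \<and> cell n j < int T then vc (comp n j) (nat (cell n j)) else 0)" for j
 define g where "g z = (\<Sum>c<P. \<Sum>t<T. vc c t * of_real (bv c (z - real t)))" for z
 have [measurable]: "g \<in> borel_measurable borel" unfolding g_def[abs_def] by measurable
 have dPN: "j < dP n ==> j < N n" for j unfolding N_def by simp
 define J where "J = {j \<in> {..<dP n}. 0 \<le> cell n j \<and> cell n j < int T}"
 have bij: "bij_betw (\<lambda>j. (comp n j, nat (cell n j))) J ({..<P} \<times> {..<T})"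
  unfolding bij_betw_def
 proof
  show "inj_on (\<lambda>j. (comp n j, nat (cell n j))) J"
  proof (rule inj_onI)
   fix i j assume "i \<in> J" "j \<in> J" "(comp n i, nat (cell n i)) = (comp n j, nat (cell n j))"
   then have "i < N n" "j < N n" "(comp n i, cell n i) = (comp n j, cell n j)" using dPN unfolding J_def by auto
   then show "i = j" using inj_onD[OF N_bounds(3)[OF n], of i j] by simp
  qed
  show "(\<lambda>j. (comp n j, nat (cell n j))) ` J = {..<P} \<times> {..<T}"
  proof
   show "(\<lambda>j. (comp n j, nat (cell n j))) ` J \<subseteq> {..<P} \<times> {..<T}"
   proof (rule image_subsetI)
    fix j assume "j \<in> J"
    then have j: "j < dP n" "0 \<le> cell n j" "cell n j < int T" unfolding J_def by auto
    have "comp n j < P" by (rule comp_less_iff(2)[THEN iffD2, OF j(1)])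
    moreover have "nat (cell n j) < T" using j by simp
    ultimately show "(comp n j, nat (cell n j)) \<in> {..<P} \<times> {..<T}" by simp
   qed
   show "{..<P} \<times> {..<T} \<subseteq> (\<lambda>j. (comp n j, nat (cell n j))) ` J"
   proof
    fix z assume z: "z \<in> {..<P} \<times> {..<T}"
    define c' t' where "c' = fst z" and "t' = snd z"
    have ct: "c' < P" "t' < T" "z = (c', t')" using z unfolding c'_def t'_def by auto
    have "c' < P + Q" "0 \<le> int t'" "int t' \<le> int n - 2" using ct unfolding n_def by auto
    from N_bounds(4)[OF n this] obtain j where j: "j < N n" "comp n j = c'" "cell n j = int t'" by blast
    have "j < dP n" by (rule comp_less_iff(2)[THEN iffD1]) (simp add: j ct)
    then have "j \<in> J" using ct j unfolding J_def by simp
    then show "z \<in> (\<lambda>j. (comp n j, nat (cell n j))) ` J" using j ct by (intro image_eqI[of _ _ j]) simp_all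
   qed
  qed
 qed
 have comb: "(\<Sum>j<dP n. y j * of_real (v n j x)) = g (real n * x)" for x
 proof -
  have "(\<Sum>j<dP n. y j * of_real (v n j x)) = (\<Sum>j\<in>J. y j * of_real (v n j x))"
   by (rule sum.mono_neutral_right) (auto simp: J_def y_def)
  also have "\<dots> = (\<Sum>j\<in>J. (\<lambda>(c, t). vc c t * of_real (bv c (real n * x - real t))) (comp n j, nat (cell n j)))"
  proof (rule sum.cong[OF refl])
   fix j assume j: "j \<in> J"
   then have "j < N n" "0 \<le> cell n j" "cell n j + int wd \<le> int n" using dPN unfolding J_def n_def by auto
   from uv_interior(2)[OF n this, of x] j
   show "y j * of_real (v n j x) = (\<lambda>(c, t). vc c t * of_real (bv c (real n * x - real t))) (comp n j, nat (cell n j))"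
    by (simp add: J_def y_def)
  qed
  also have "\<dots> = (\<Sum>(c, t)\<in>{..<P} \<times> {..<T}. vc c t * of_real (bv c (real n * x - real t)))"
   by (rule sum.reindex_bij_betw[OF bij])
  finally show ?thesis unfolding g_def sum.cartesian_product .
 qed
 have "AE z in lborel. g z = 0" using spline_combination_zero[OF eq] unfolding g_def .
 then have g0: "AE x in lborel. g (real n * x) = 0"
 proof -
  have "AE z in lborel. g z = 0" by fact
  then have "{z. g z \<noteq> 0} \<in> null_sets lborel" by (subst (asm) AE_iff_null) auto
  then have e: "emeasure lborel {z. g z \<noteq> 0} = 0" by auto
  have "emeasure lborel {z. g z \<noteq> 0} = \<bar>real n\<bar> * (\<integral>\<^sup>+ x. indicator {z. g z \<noteq> 0} (0 + real n * x) \<partial>lborel)"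
   using nn_integral_real_affine[of "indicator {z. g z \<noteq> 0}" "real n" 0] n0 by simp
  then have "(\<integral>\<^sup>+ x. indicator {z. g z \<noteq> 0} (0 + real n * x) \<partial>lborel) = 0" using e n0 by simp
  then have "AE x in lborel. indicator {z. g z \<noteq> 0} (0 + real n * x) = (0 :: ennreal)"
   by (subst (asm) nn_integral_0_iff_AE) auto
  then show ?thesis by eventually_elim (auto simp: indicator_def split: if_splits)
 qed
 \<comment> \<open>The combination of the derivatives vanishes almost everywhere, so every row
   applied to \<open>y\<close> integrates 0, whatever the coefficient is.\<close>
 have row: "(\<Sum>j<dP n. X b n i j * y j) = 0" if i: "i < dP n" for i
 proof -
  have int: "integrable lborel (\<lambda>x. y j * of_real (indicator {0..1} x * (b x * (v n j x * v n i x))))" if "j \<in> {..<dP n}" for j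
   using ent_integrable[OF n b(2,1) dPN[OF i] dPN, of j] that by (intro integrable_mult_right integrable_of_real) auto
  have "(\<Sum>j<dP n. X b n i j * y j) = of_nat n * (\<Sum>j<dP n. (LINT x|lborel. y j * of_real (indicator {0..1} x * (b x * (v n j x * v n i x)))))"
   unfolding sum_distrib_left
  proof (rule sum.cong[OF refl])
   fix j assume "j \<in> {..<dP n}"
   then have "X b n i j = of_nat n * of_real (LINT x|lborel. indicator {0..1} x * (b x * (v n j x * v n i x)))"
    using i by (simp add: X_def ent_def)
   then show "X b n i j * y j = of_nat n * (LINT x|lborel. y j * of_real (indicator {0..1} x * (b x * (v n j x * v n i x))))"
    by (simp only: integral_mult_right_zero integral_complex_of_real mult_ac)
  qed
  also have "(\<Sum>j<dP n. (LINT x|lborel. y j * of_real (indicator {0..1} x * (b x * (v n j x * v n i x)))))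
    = (LINT x|lborel. (\<Sum>j<dP n. y j * of_real (indicator {0..1} x * (b x * (v n j x * v n i x)))))"
   by (rule Bochner_Integration.integral_sum[symmetric], rule int)
  also have "\<dots> = (LINT x|(lborel :: real measure). 0)"
  proof (rule integral_cong_AE)
   show "AE x in lborel. (\<Sum>j<dP n. y j * of_real (indicator {0..1} x * (b x * (v n j x * v n i x)))) = 0"
    using g0
   proof eventually_elim
    fix x assume "g (real n * x) = 0"
    then have "of_real (indicator {0..1} x * (b x * v n i x)) * (\<Sum>j<dP n. y j * of_real (v n j x)) = 0"
     unfolding comb by simp
    then show "(\<Sum>j<dP n. y j * of_real (indicator {0..1} x * (b x * (v n j x * v n i x)))) = 0"
     unfolding sum_distrib_left by (simp only: of_real_mult mult_ac)
   qed
  qed (use int in \<open>auto intro: borel_measurable_integrable\<close>)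
  finally show ?thesis by simp
 qed
 have "c < P + Q" "0 \<le> int t" "int t \<le> int n - 2" using c t unfolding n_def by auto
 from N_bounds(4)[OF n this] obtain j where j: "j < N n" "comp n j = c" "cell n j = int t" by blast
 have jP: "j < dP n" by (rule comp_less_iff(2)[THEN iffD1]) (simp add: j c)
 have "(\<Sum>i<dP n. G' j i * (\<Sum>k<dP n. X b n i k * y k)) = (\<Sum>k<dP n. (\<Sum>i<dP n. G' j i * X b n i k) * y k)"
  unfolding sum_distrib_left sum_distrib_right by (subst sum.swap) (simp add: mult.assoc)
 also have "\<dots> = (\<Sum>k<dP n. (if j = k then 1 else 0) * y k)"
  using inv jP unfolding inv_pair_def n_def[symmetric] by (intro sum.cong) auto
 also have "\<dots> = y j" using jP by (simp add: of_bool_def if_distrib[of "\<lambda>x. x * _"] cong: if_cong)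
 finally have "y j = 0" using row by simp
 then show ?thesis using j t by (simp add: y_def)
qed

definition kap_det :: "real => complex" where
 "kap_det \<theta> = Determinant.det (Matrix.mat P P (\<lambda>(c, d). kap \<theta> c d))"

text \<open>Multiplied by the power \<open>wd\<close> of cis \<theta>, the entries of \<kappa> are
  polynomials in cis \<theta>, so the determinant has finitely many zeros unless it vanishes
  identically. In that case the matrix of polynomials has a nonzero polynomial kernel vector, and
  its coefficients satisfy the convolution equations that an invertible stiffness matrix
  excludes.\<close>

lemma kap_det_finite:
 assumes b: "b \<in> borel_measurable borel" "set_integrable lborel {0..1} b"
  and inv: "\<And>n. 1 \<le> n ==> inv_pair (dP n) (X b n) (G n)"
 shows "finite {\<theta> \<in> {-pi..pi}. kap_det \<theta> = 0}"
proof -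
 define pe where "pe c d = (\<Sum>s\<in>{- int wd..int wd}. monom (complex_of_real (shift_prod (bv d) (bv c) s)) (nat (s + int wd)))" for c d
 define KP where "KP = Matrix.mat P P (\<lambda>(c, d). pe c d)"
 have KPc: "KP \<in> carrier_mat P P" unfolding KP_def by simp
 have pe: "poly (pe c d) (cis \<theta>) = cis (real wd * \<theta>) * kap \<theta> c d" for c d \<theta>
  unfolding pe_def poly_sum kap_def sum_distrib_left
 proof (rule sum.cong[OF refl])
  fix s assume "s \<in> {- int wd..int wd}"
  then have "real (nat (s + int wd)) = of_int s + real wd" by (simp add: of_nat_nat)
  then show "poly (monom (complex_of_real (shift_prod (bv d) (bv c) s)) (nat (s + int wd))) (cis \<theta>)
    = cis (real wd * \<theta>) * (complex_of_real (shift_prod (bv d) (bv c) s) * cis (of_int s * \<theta>))"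
   by (simp add: poly_monom Complex.DeMoivre cis_mult algebra_simps)
 qed
 have det: "poly (Determinant.det KP) (cis \<theta>) = cis (real wd * \<theta>) ^ P * kap_det \<theta>" for \<theta>
 proof -
  have h: "comm_ring_hom (\<lambda>r. poly r (cis \<theta>))" by unfold_locales auto
  have "map_mat (\<lambda>r. poly r (cis \<theta>)) KP = cis (real wd * \<theta>) \<cdot>\<^sub>m Matrix.mat P P (\<lambda>(c, d). kap \<theta> c d)"
   unfolding KP_def by (intro eq_matI) (auto simp: pe)
  then show ?thesis using comm_ring_hom.hom_det[OF h, of KP] by (simp add: kap_det_def)
 qed
 have "Determinant.det KP \<noteq> 0"
 proof
  assume "Determinant.det KP = 0"
  then obtain w where w: "w \<in> carrier_vec P" "w \<noteq> 0\<^sub>v P" "KP *\<^sub>v w = 0\<^sub>v P"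
   using det_0_iff_vec_prod_zero[OF KPc] by blast
  define vc where "vc d t = poly.coeff (w $ d) t" for d t
  define T where "T = Suc (\<Sum>d<P. degree (w $ d))"
  have high: "vc d t = 0" if "d < P" "T \<le> t" for d t
  proof -
   have "degree (w $ d) \<le> (\<Sum>d<P. degree (w $ d))" using that by (intro member_le_sum) auto
   then show ?thesis unfolding vc_def using that by (intro coeff_eq_0) (simp add: T_def)
  qed
  have eq: "(\<Sum>d<P. \<Sum>t'<T. complex_of_real (shift_prod (bv d) (bv c) (int t - int t')) * vc d t') = 0" if c: "c < P" and t: "t < T" for c t
  proof -
   have "(KP *\<^sub>v w) $ c = (\<Sum>d<P. pe c d * w $ d)"
    using c w(1) unfolding KP_def by (simp add: scalar_prod_def lessThan_atLeast0)
   \<comment> \<open>The coefficient of degree t + wd, where wd undoes the shift built into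
     \<open>pe\<close>, is the convolution at t.\<close>
   then have "poly.coeff (\<Sum>d<P. pe c d * w $ d) (t + wd) = 0" using w(3) c by simp
   then have "(\<Sum>d<P. \<Sum>s\<in>{- int wd..int wd}. if nat (s + int wd) \<le> t + wd then complex_of_real (shift_prod (bv d) (bv c) s) * vc d (t + wd - nat (s + int wd)) else 0) = 0"
    by (simp only: pe_def sum_distrib_right coeff_sum coeff_monom_mult vc_def)
   moreover have "(\<Sum>s\<in>{- int wd..int wd}. if nat (s + int wd) \<le> t + wd then complex_of_real (shift_prod (bv d) (bv c) s) * vc d (t + wd - nat (s + int wd)) else 0)
    = (\<Sum>t'<T. complex_of_real (shift_prod (bv d) (bv c) (int t - int t')) * vc d t')" if d: "d < P" for d
   proof -
    have "(\<Sum>s\<in>{- int wd..int wd}. if nat (s + int wd) \<le> t + wd then complex_of_real (shift_prod (bv d) (bv c) s) * vc d (t + wd - nat (s + int wd)) else 0)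
     = (\<Sum>s\<in>{s \<in> {- int wd..int wd}. s \<le> int t \<and> int t - s < int T}. complex_of_real (shift_prod (bv d) (bv c) s) * vc d (nat (int t - s)))"
    proof (rule sum.mono_neutral_cong_right)
     show "\<forall>s\<in>{- int wd..int wd} - {s \<in> {- int wd..int wd}. s \<le> int t \<and> int t - s < int T}.
      (if nat (s + int wd) \<le> t + wd then complex_of_real (shift_prod (bv d) (bv c) s) * vc d (t + wd - nat (s + int wd)) else 0) = 0"
     proof
      fix s assume s: "s \<in> {- int wd..int wd} - {s \<in> {- int wd..int wd}. s \<le> int t \<and> int t - s < int T}"
      show "(if nat (s + int wd) \<le> t + wd then complex_of_real (shift_prod (bv d) (bv c) s) * vc d (t + wd - nat (s + int wd)) else 0) = 0"
      proof (cases "s \<le> int t")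
       case True
       then have "T \<le> t + wd - nat (s + int wd)" using s by auto
       then show ?thesis using high[OF d] by simp
      qed (use s in auto)
     qed
    next
     fix s assume "s \<in> {s \<in> {- int wd..int wd}. s \<le> int t \<and> int t - s < int T}"
     then have "nat (s + int wd) \<le> t + wd" "t + wd - nat (s + int wd) = nat (int t - s)" by auto
     then show "(if nat (s + int wd) \<le> t + wd then complex_of_real (shift_prod (bv d) (bv c) s) * vc d (t + wd - nat (s + int wd)) else 0)
      = complex_of_real (shift_prod (bv d) (bv c) s) * vc d (nat (int t - s))" by simp
    qed auto
    also have "\<dots> = (\<Sum>t'\<in>{t' \<in> {..<T}. \<bar>int t - int t'\<bar> \<le> int wd}. complex_of_real (shift_prod (bv d) (bv c) (int t - int t')) * vc d t')"
     by (rule sum.reindex_bij_witness[of _ "\<lambda>t'. int t - int t'" "\<lambda>s. nat (int t - s)"]) auto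
    also have "\<dots> = (\<Sum>t'<T. complex_of_real (shift_prod (bv d) (bv c) (int t - int t')) * vc d t')"
    proof (rule sum.mono_neutral_left)
     show "\<forall>t'\<in>{..<T} - {t' \<in> {..<T}. \<bar>int t - int t'\<bar> \<le> int wd}. complex_of_real (shift_prod (bv d) (bv c) (int t - int t')) * vc d t' = 0"
     proof
      fix t' assume "t' \<in> {..<T} - {t' \<in> {..<T}. \<bar>int t - int t'\<bar> \<le> int wd}"
      then have "shift_prod (bv d) (bv c) (int t - int t') = 0" by (intro shift_prod_zero b_facts(4)) auto
      then show "complex_of_real (shift_prod (bv d) (bv c) (int t - int t')) * vc d t' = 0" by simp
     qed
    qed auto
    finally show ?thesis .
   qed
   ultimately show ?thesis by simp
  qed
  have "vc c t = 0" if "c < P" for c t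
   using stiffness_kernel[OF b eq inv that] high[OF that] by (cases "t < T") auto
  then have "w $ c = 0" if "c < P" for c using that unfolding vc_def by (intro poly_eqI) simp
  then have "w = 0\<^sub>v P" using w(1) by (intro eq_vecI) auto
  then show False using w(2) by simp
 qed
 then have fin: "finite {x. poly (Determinant.det KP) x = 0}" by (rule poly_roots_finite)
 \<comment> \<open>\<open>Arg\<close> takes its values in (-pi, pi], so the left end point is added
   by hand.\<close>
 have "{\<theta> \<in> {-pi..pi}. kap_det \<theta> = 0} \<subseteq> insert (-pi) (Arg ` {x. poly (Determinant.det KP) x = 0})"
 proof
  fix \<theta> assume th: "\<theta> \<in> {\<theta> \<in> {-pi..pi}. kap_det \<theta> = 0}"
  show "\<theta> \<in> insert (-pi) (Arg ` {x. poly (Determinant.det KP) x = 0})"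
  proof (cases "\<theta> = -pi")
   case False
   then have "Arg (cis \<theta>) = \<theta>" using th by (intro cis_Arg_unique) auto
   moreover have "poly (Determinant.det KP) (cis \<theta>) = 0" using th by (simp add: det)
   ultimately show ?thesis by (intro insertI2 image_eqI[of _ _ "cis \<theta>"]) auto
  qed simp
 qed
 then show ?thesis using fin finite_subset by blast
qed

end

section \<open>Trace limits of the Schur complements\<close>

text \<open>The order of the choices matters: \<delta> makes V \<delta>, the count of small
  eigenvalues, small; \<epsilon> then makes \<epsilon> / \<delta>^2 small; n grows last. So the
  convergence of T and U is used at one fixed \<epsilon> and \<delta>.\<close>

lemma two_parameter_limit:
 fixes t :: "nat => complex" and T :: "real => nat => complex" and U :: "real => nat => real"
 assumes n: "\<And>\<delta> \<epsilon> n. 0 < \<delta> ==> 0 < \<epsilon> ==> 1 \<le> n ==> cmod (t n - T \<epsilon> n) \<le> c * U \<delta> n + \<epsilon> / \<delta>\<^sup>2 * C"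
  and sym: "\<And>\<delta> \<epsilon>. 0 < \<delta> ==> 0 < \<epsilon> ==> cmod (I - J \<epsilon>) \<le> c * V \<delta> + \<epsilon> / \<delta>\<^sup>2 * C"
  and T: "\<And>\<epsilon>. 0 < \<epsilon> ==> T \<epsilon> \<longlonglongrightarrow> J \<epsilon>" and U: "\<And>\<delta>. 0 < \<delta> ==> U \<delta> \<longlonglongrightarrow> V \<delta>"
  and V: "(\<lambda>m. V (1 / real (Suc m))) \<longlonglongrightarrow> 0" and c: "0 < c" and C: "0 < C"
 shows "t \<longlonglongrightarrow> I"
proof (rule metric_LIMSEQ_I)
 fix e :: real assume e: "0 < e"
 obtain m where m: "\<bar>V (1 / real (Suc m))\<bar> < e / (8 * c)"
  using LIMSEQ_D[OF V, of "e / (8 * c)"] e c by auto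
 define \<delta> where "\<delta> = 1 / real (Suc m)"
 have \<delta>: "0 < \<delta>" by (simp add: \<delta>_def)
 have Vd: "c * V \<delta> < e / 8"
 proof -
  have "c * V \<delta> < c * (e / (8 * c))" using m c unfolding \<delta>_def by (intro mult_strict_left_mono) auto
  then show ?thesis using c by simp
 qed
 \<comment> \<open>Makes the error term equal to e / 8 for the \<delta> already chosen.\<close>
 define \<epsilon> where "\<epsilon> = \<delta>\<^sup>2 * e / (8 * C)"
 have \<epsilon>: "0 < \<epsilon>" "\<epsilon> / \<delta>\<^sup>2 * C = e / 8" using \<delta> e C by (auto simp: \<epsilon>_def)
 obtain N1 where N1: "\<And>n. N1 \<le> n ==> cmod (T \<epsilon> n - J \<epsilon>) < e / 8"
  using LIMSEQ_D[OF T[OF \<epsilon>(1)], of "e / 8"] e by auto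
 obtain N2 where N2: "\<And>n. N2 \<le> n ==> \<bar>U \<delta> n - V \<delta>\<bar> < e / (8 * c)"
  using LIMSEQ_D[OF U[OF \<delta>], of "e / (8 * c)"] e c by auto
 have "dist (t n) I < e" if nn: "max 1 (max N1 N2) \<le> n" for n
 proof -
  have 1: "cmod (t n - T \<epsilon> n) \<le> c * U \<delta> n + e / 8" using n[OF \<delta> \<epsilon>(1), of n] nn unfolding \<epsilon>(2) by simp
  have "c * (U \<delta> n - V \<delta>) < c * (e / (8 * c))" using N2[of n] nn c by (intro mult_strict_left_mono) auto
  then have 2: "c * U \<delta> n < c * V \<delta> + e / 8" using c by (simp add: right_diff_distrib)
  have 3: "cmod (T \<epsilon> n - J \<epsilon>) < e / 8" using N1 nn by simp
  have 4: "cmod (J \<epsilon> - I) \<le> c * V \<delta> + e / 8" using sym[OF \<delta> \<epsilon>(1)] unfolding \<epsilon>(2) by (simp add: norm_minus_commute)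
  have "cmod (t n - I) \<le> cmod (t n - T \<epsilon> n) + (cmod (T \<epsilon> n - J \<epsilon>) + cmod (J \<epsilon> - I))"
   using norm_triangle_ineq[of "t n - T \<epsilon> n" "T \<epsilon> n - I"] norm_triangle_ineq[of "T \<epsilon> n - J \<epsilon>" "J \<epsilon> - I"] by simp
  then show ?thesis unfolding dist_norm using 1 2 3 4 Vd e by linarith
 qed
 then show "\<exists>no. \<forall>n\<ge>no. dist (t n) I < e" by blast
qed

text \<open>The upper right block of M vanishes, so the upper left block of the inverse inverts the
  upper left block of M.\<close>

lemma block_diag_trace:
 assumes G: "inv_pair (d + e) M (finv (d + e) M)" and z: "\<And>i j. i < d ==> d \<le> j ==> j < d + e ==> M i j = 0"
 shows "(\<Sum>i<d. finv (d + e) M i i) = (\<Sum>i<d. finv d M i i)"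
proof (rule sum.cong[OF refl])
 fix i assume i: "i \<in> {..<d}"
 show "finv (d + e) M i i = finv d M i i"
 proof (rule finv_eqI(2)[where G = "finv (d + e) M", symmetric])
  fix i j assume ij: "i < d" "j < d"
  have "(\<Sum>k<d + e. M i k * finv (d + e) M k j) = (\<Sum>k<d. M i k * finv (d + e) M k j)"
   by (rule sum.mono_neutral_right) (use z ij in auto)
  then show "(\<Sum>k<d. M i k * finv (d + e) M k j) = (if i = j then 1 else 0)"
   using G ij unfolding inv_pair_def by (simp add: trans_less_add1)
 qed (use i in auto)
qed

section \<open>Measurability and boundedness of inverses\<close>

lemma det_measurable:
 fixes T :: "'a => mat_fun"
 assumes T: "\<And>i j. i < d ==> j < d ==> (\<lambda>w. T w i j) \<in> borel_measurable M"
 shows "(\<lambda>w. Determinant.det (Matrix.mat d d (\<lambda>(i, j). T w i j))) \<in> borel_measurable M"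
proof -
 have lt: "p i < d" if "p permutes {0..<d}" "i \<in> {0..<d}" for p i using that permutes_in_image by fastforce
 have "Determinant.det (Matrix.mat d d (\<lambda>(i, j). T w i j)) = (\<Sum>p\<in>{p. p permutes {0..<d}}. signof p * (\<Prod>i = 0..<d. T w i (p i)))" for w
  by (subst det_def'[of _ d]) (auto intro!: sum.cong prod.cong simp: lt)
 then show ?thesis by (simp only:) (intro borel_measurable_sum borel_measurable_times borel_measurable_const borel_measurable_prod T; use lt in auto)
qed

text \<open>By the adjugate formula the entries of the inverse are quotients of determinants, which
  are polynomials in the entries.\<close>

lemma finv_measurable:
 fixes T :: "'a => mat_fun"
 assumes T: "\<And>i j. i < d ==> j < d ==> (\<lambda>w. T w i j) \<in> borel_measurable M"
  and det: "\<And>w. w \<in> space M ==> Determinant.det (Matrix.mat d d (\<lambda>(i, j). T w i j)) \<noteq> 0"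
  and ij: "i < d" "j < d"
 shows "(\<lambda>w. finv d (T w) i j) \<in> borel_measurable M"
proof -
 define A where "A w = Matrix.mat d d (\<lambda>(i, j). T w i j)" for w
 have Ac: "A w \<in> carrier_mat d d" for w unfolding A_def by simp
 have eq: "finv d (T w) i j = cofactor (A w) j i / Determinant.det (A w)" if w: "w \<in> space M" for w
 proof -
  have d0: "Determinant.det (A w) \<noteq> 0" using det[OF w] unfolding A_def .
  have "A w * ((1 / Determinant.det (A w)) \<cdot>\<^sub>m adj_mat (A w)) = (1 / Determinant.det (A w)) \<cdot>\<^sub>m (A w * adj_mat (A w))"
   by (rule mult_smult_distrib[OF Ac adj_mat(1)[OF Ac]])
  also have "\<dots> = 1\<^sub>m d" unfolding adj_mat(2)[OF Ac] using d0 by (intro eq_matI) auto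
  finally have "minv (A w) = (1 / Determinant.det (A w)) \<cdot>\<^sub>m adj_mat (A w)"
   by (intro minv_eqI(1)[OF Ac]) (auto intro: smult_carrier_mat adj_mat(1)[OF Ac])
  then show ?thesis using ij Ac[of w] adj_mat(1)[OF Ac, of w] unfolding finv_def A_def[symmetric] by (simp add: adj_mat_def)
 qed
 have "mat_delete (A w) j i = Matrix.mat (d - 1) (d - 1) (\<lambda>(i', j'). T w (if i' < j then i' else Suc i') (if j' < i then j' else Suc j'))" for w
  unfolding mat_delete_def A_def by (intro eq_matI) auto
 then have cof: "(\<lambda>w. cofactor (A w) j i) \<in> borel_measurable M"
  unfolding cofactor_def by (simp only:) (intro borel_measurable_times borel_measurable_const det_measurable T; auto)
 have "(\<lambda>w. cofactor (A w) j i / Determinant.det (A w)) \<in> borel_measurable M"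
  by (intro borel_measurable_divide cof) (unfold A_def, intro det_measurable T)
 then show ?thesis by (subst measurable_cong[OF eq])
qed

text \<open>Compare with the inverse at 0 by the resolvent identity: the matrices differ by
  \<i>\<delta> on the diagonal and the entries of the resolvent are at most 1 / \<delta>, so the
  bound is independent of \<delta>.\<close>

lemma resolvent_bound_invertible:
 assumes h: "herm d T" and G: "inv_pair d T G" and \<delta>: "0 < \<delta>" and c: "c < d"
 shows "cmod (finv d (shiftd T (\<lambda>_. \<i> * of_real \<delta>)) c c) \<le> cmod (G c c) + (\<Sum>k<d. cmod (G c k))"
proof -
 let ?S = "shiftd T (\<lambda>_. \<i> * of_real \<delta>)" let ?R = "finv d ?S"
 have dis: "dissipative \<delta> d ?S" by (rule dissipative_shiftd[OF h]) simp
 note R = dissipative_inv[OF dis \<delta>]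
 have "G c c - ?R c c = (\<Sum>k<d. \<Sum>l<d. G c k * (?S k l - T k l) * ?R l c)" by (rule resolvent_identity[OF G R c c])
 also have "\<dots> = (\<Sum>k<d. G c k * (- (\<i> * of_real \<delta>) * ?R k c))"
 proof (rule sum.cong[OF refl])
  fix k assume "k \<in> {..<d}"
  then have "(\<Sum>l<d. G c k * (?S k l - T k l) * ?R l c) = (\<Sum>l<d. if l = k then G c k * (- (\<i> * of_real \<delta>) * ?R k c) else 0)"
   by (intro sum.cong refl) (auto simp: shiftd_def)
  then show "(\<Sum>l<d. G c k * (?S k l - T k l) * ?R l c) = G c k * (- (\<i> * of_real \<delta>) * ?R k c)" using \<open>k \<in> {..<d}\<close> by simp
 qed
 finally have e: "G c c - ?R c c = (\<Sum>k<d. G c k * (- (\<i> * of_real \<delta>) * ?R k c))" .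
 have "?R c c = G c c - (\<Sum>k<d. G c k * (- (\<i> * of_real \<delta>) * ?R k c))" unfolding e[symmetric] by simp
 then have "cmod (?R c c) \<le> cmod (G c c) + cmod (\<Sum>k<d. G c k * (- (\<i> * of_real \<delta>) * ?R k c))"
  using norm_triangle_ineq4[of "G c c" "\<Sum>k<d. G c k * (- (\<i> * of_real \<delta>) * ?R k c)"] by (simp only:)
 moreover have "cmod (\<Sum>k<d. G c k * (- (\<i> * of_real \<delta>) * ?R k c)) \<le> (\<Sum>k<d. cmod (G c k))"
 proof (rule order_trans[OF norm_sum], rule sum_mono)
  fix k assume "k \<in> {..<d}"
  then have "\<delta> * cmod (?R k c) \<le> \<delta> * (1 / \<delta>)" using \<delta> dissipative_entry[OF dis R \<delta> _ c, of k] by (intro mult_left_mono) auto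
  then have "cmod (G c k) * (\<delta> * cmod (?R k c)) \<le> cmod (G c k) * 1" using \<delta> by (intro mult_left_mono) auto
  then show "cmod (G c k * (- (\<i> * of_real \<delta>) * ?R k c)) \<le> cmod (G c k)" using \<delta> by (simp add: norm_mult)
 qed
 ultimately show ?thesis by linarith
qed

abbreviation rect :: "(real \<times> real) set" where "rect \<equiv> {0..1} \<times> {-pi..pi}"

lemma rect_borel: "g \<in> borel_measurable borel ==> g \<in> borel_measurable (lebesgue_on rect)"
 by (intro measurable_restrict_space1 measurable_completion) simp

lemma rect_set_integral: "(LINT w:rect|lebesgue. g w) = (LINT w|lebesgue_on rect. (g w :: complex))"
 unfolding set_lebesgue_integral_def using rectangle_measure(1) by (subst integral_restrict_space) auto

lemma rect_integrable:
 fixes g :: "real \<times> real => 'b::{banach, second_countable_topology}"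
 assumes "g \<in> borel_measurable borel" "\<And>w. norm (g w) \<le> B"
 shows "integrable (lebesgue_on rect) g"
proof -
 interpret finite_measure "lebesgue_on rect" by (rule finite_measure_lebesgue_on[OF rectangle_measure(1)])
 show ?thesis by (rule integrable_const_bound[where B = B]) (use assms rect_borel in auto)
qed

section \<open>Regularized Schur complements of the symbol and of the matrices\<close>

context spline_pair
begin

lemma kap_herm: "herm P (kap \<theta>)" and muf_herm: "herm Q (muf \<theta>)"
proof -
 have "(\<Sum>s\<in>{- int wd..int wd}. of_real (shift_prod F G s) * cis (of_int s * \<theta>))
   = cnj (\<Sum>s\<in>{- int wd..int wd}. of_real (shift_prod G F s) * cis (of_int s * \<theta>))" for F G
  unfolding cnj_sum by (rule sum.reindex_bij_witness[of _ uminus uminus]) (auto simp: cis_cnj shift_prod_minus)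
 then show "herm P (kap \<theta>)" "herm Q (muf \<theta>)" unfolding herm_def kap_def muf_def by blast+
qed

text \<open>The symbol of the stiffness matrix, replaced by the identity on the exceptional set so
  that it is invertible at every point. The Schur complement \<open>Sf\<close> built from it is
  Hermitian and Borel everywhere.\<close>

definition Am :: "(real => real) => real \<times> real => mat_fun" where
 "Am b w c d = (if b (fst w) \<noteq> 0 \<and> kap_det (snd w) \<noteq> 0 then of_real (b (fst w)) * kap (snd w) c d else if c = d then 1 else 0)"

definition Sf :: "(real => real) => real \<times> real => mat_fun" where
 "Sf b w = schur_fun P (Am b w) (xif (snd w)) (\<lambda>i j. of_real (- \<rho>) * muf (snd w) i j)"

lemma herm_scale: "herm d T ==> herm d (\<lambda>i j. of_real r * T i j)"
 unfolding herm_def by (metis complex_cnj_complex_of_real complex_cnj_mult)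

lemma Am_herm: "herm P (Am b w)"
proof (cases "b (fst w) \<noteq> 0 \<and> kap_det (snd w) \<noteq> 0")
 case True
 then have "Am b w = (\<lambda>c d. of_real (b (fst w)) * kap (snd w) c d)" unfolding Am_def by (intro ext) simp
 then show ?thesis using herm_scale[OF kap_herm] by simp
next
 case False
 then have "Am b w = (\<lambda>c d. if c = d then 1 else 0)" unfolding Am_def by (intro ext) auto
 then show ?thesis by (simp add: herm_def)
qed

lemma Am_det: "Determinant.det (Matrix.mat P P (\<lambda>(c, d). Am b w c d)) \<noteq> 0"
proof (cases "b (fst w) \<noteq> 0 \<and> kap_det (snd w) \<noteq> 0")
 case True
 then have "Matrix.mat P P (\<lambda>(c, d). Am b w c d) = of_real (b (fst w)) \<cdot>\<^sub>m Matrix.mat P P (\<lambda>(c, d). kap (snd w) c d)"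
  unfolding Am_def by (intro eq_matI) auto
 then show ?thesis using True by (simp add: kap_det_def)
next
 case False
 then have "Matrix.mat P P (\<lambda>(c, d). Am b w c d) = 1\<^sub>m P" unfolding Am_def by (intro eq_matI) auto
 then show ?thesis by simp
qed

lemma Am_inv: "inv_pair P (Am b w) (finv P (Am b w))"
 by (rule inv_pair_finv_det[OF Am_det])

lemma mu_herm: "herm Q (\<lambda>i j. of_real (- \<rho>) * muf \<theta> i j)"
 by (rule herm_scale[OF muf_herm])

lemma Sf_herm: "herm Q (Sf b w)"
 unfolding Sf_def by (rule schur_trace_compare(1)[OF Am_herm mu_herm Am_inv, of \<i> 1 1]) auto

lemma kap_det_borel: "(\<lambda>w::real \<times> real. kap_det (snd w)) \<in> borel_measurable borel"
 unfolding kap_det_def by (rule det_measurable[OF coefficient_borel(1)])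

lemma b_fst_borel: "b \<in> borel_measurable borel ==> (\<lambda>w::real \<times> real. b (fst w) :: real) \<in> borel_measurable borel"
 by (rule measurable_compose[of fst borel borel b]) (intro borel_measurable_continuous_onI continuous_intros)

lemma Am_borel:
 assumes b: "b \<in> borel_measurable borel" shows "(\<lambda>w. Am b w c d) \<in> borel_measurable borel"
proof -
 note [measurable] = b_fst_borel[OF b] kap_det_borel coefficient_borel(1)
 show ?thesis unfolding Am_def by measurable
qed

lemma Sf_borel:
 assumes b: "b \<in> borel_measurable borel" shows "(\<lambda>w. Sf b w i j) \<in> borel_measurable borel"
proof -
 have [measurable]: "(\<lambda>w. finv P (Am b w) c d) \<in> borel_measurable borel" if "c < P" "d < P" for c d
  by (rule finv_measurable[OF Am_borel[OF b] Am_det that])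
 note [measurable] = coefficient_borel
 show ?thesis unfolding Sf_def schur_fun_def
  by (intro borel_measurable_diff borel_measurable_sum borel_measurable_times borel_measurable_const cnj_borel) auto
qed

lemma Sf_resolvent:
 assumes z: "0 < Im z" and ij: "i < Q" "j < Q"
 shows "b \<in> borel_measurable borel ==> (\<lambda>w. finv Q (shiftd (Sf b w) (\<lambda>_. z)) i j) \<in> borel_measurable borel"
  and "cmod (finv Q (shiftd (Sf b w) (\<lambda>_. z)) i j) \<le> 1 / Im z"
proof -
 have dis: "dissipative (Im z) Q (shiftd (Sf b w) (\<lambda>_. z))" for w by (rule dissipative_shiftd[OF Sf_herm]) simp
 show "cmod (finv Q (shiftd (Sf b w) (\<lambda>_. z)) i j) \<le> 1 / Im z"
  by (rule dissipative_entry[OF dis dissipative_inv[OF dis z] z ij])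
 show "(\<lambda>w. finv Q (shiftd (Sf b w) (\<lambda>_. z)) i j) \<in> borel_measurable borel" if b: "b \<in> borel_measurable borel"
  by (rule finv_measurable[OF _ dissipative_det[OF dis z] ij]) (simp only: shiftd_def, intro borel_measurable_diff Sf_borel[OF b] borel_measurable_const)
qed

text \<open>The coupling block is banded and its entries are bounded independently of the
  coefficient, so each of its O(n) rows contributes a bounded amount to the squared Frobenius
  norm.\<close>

lemma X_off_diagonal_bound:
 obtains C where "0 < C" "\<And>n. 1 \<le> n ==> (\<Sum>a<dP n. \<Sum>i<dQ n. (cmod (X b n a (dP n + i)))\<^sup>2) \<le> C * real n"
proof -
 \<comment> \<open>The entry bound for the coefficient 0; the coupling block is the same for every
   b.\<close>
 define Bx where "Bx = (0 + \<bar>\<tau>\<bar> + \<bar>\<rho>\<bar>) * ((Cb * Cb) * real wd)"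
 define m where "m = (P + Q) * (2 * wd + 1)"
 have row: "(\<Sum>i<dQ n. (cmod (X b n a (dP n + i)))\<^sup>2) \<le> real m * Bx\<^sup>2" if n: "1 \<le> n" and a: "a < dP n" for n a
 proof -
  have aN: "a < N n" and iN: "i < dQ n ==> dP n + i < N n" for i using a unfolding N_def by auto
  define S where "S = {i \<in> {..<dQ n}. \<bar>cell n a - cell n (dP n + i)\<bar> \<le> int wd}"
  have "card S \<le> card ({..<P + Q} \<times> {cell n a - int wd..cell n a + int wd})"
  proof (rule card_inj_on_le[of "\<lambda>i. (comp n (dP n + i), cell n (dP n + i))"])
   show "inj_on (\<lambda>i. (comp n (dP n + i), cell n (dP n + i))) S"
   proof (rule inj_onI)
    fix i j assume "i \<in> S" "j \<in> S" "(comp n (dP n + i), cell n (dP n + i)) = (comp n (dP n + j), cell n (dP n + j))"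
    then show "i = j" using inj_onD[OF N_bounds(3)[OF n], of "dP n + i" "dP n + j"] iN unfolding S_def by simp
   qed
   show "(\<lambda>i. (comp n (dP n + i), cell n (dP n + i))) ` S \<subseteq> {..<P + Q} \<times> {cell n a - int wd..cell n a + int wd}"
   proof (rule image_subsetI)
    fix i assume "i \<in> S"
    then show "(comp n (dP n + i), cell n (dP n + i)) \<in> {..<P + Q} \<times> {cell n a - int wd..cell n a + int wd}"
     using comp_less_iff(1)[OF n iN, of i] unfolding S_def by auto
   qed
  qed simp
  also have "\<dots> = m"
  proof -
   have "nat (2 * int wd + 1) = 2 * wd + 1" by simp
   then show ?thesis unfolding card_cartesian_product m_def by (simp del: mult_Suc_right)
  qed
  finally have cS: "card S \<le> m" .
  have "(\<Sum>i<dQ n. (cmod (X b n a (dP n + i)))\<^sup>2) = (\<Sum>i\<in>S. (cmod (X b n a (dP n + i)))\<^sup>2)"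
  proof (rule sum.mono_neutral_right)
   show "\<forall>i\<in>{..<dQ n} - S. (cmod (X b n a (dP n + i)))\<^sup>2 = 0"
   proof
    fix i assume i: "i \<in> {..<dQ n} - S"
    then have "\<bar>cell n a - cell n (dP n + i)\<bar> > int wd" unfolding S_def by auto
    then show "(cmod (X b n a (dP n + i)))\<^sup>2 = 0" using X_band[OF n aN iN] i by simp
   qed
  qed (auto simp: S_def)
  also have "\<dots> \<le> (\<Sum>i\<in>S. Bx\<^sup>2)"
  proof (rule sum_mono, rule power_mono)
   fix i assume "i \<in> S"
   then have "dP n + i < N n" using iN unfolding S_def by simp
   moreover have "X b n a (dP n + i) = X (\<lambda>_. 0) n a (dP n + i)" using a unfolding X_def by simp
   ultimately show "cmod (X b n a (dP n + i)) \<le> Bx"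
    unfolding Bx_def using X_bound[OF n _ _ aN, of "\<lambda>_. 0" 0] by simp
  qed simp
  also have "\<dots> \<le> real m * Bx\<^sup>2" using cS by (simp add: mult_right_mono)
  finally show ?thesis .
 qed
 have "(\<Sum>a<dP n. \<Sum>i<dQ n. (cmod (X b n a (dP n + i)))\<^sup>2) \<le> (real (P + k) * (real m * Bx\<^sup>2) + 1) * real n" if n: "1 \<le> n" for n
 proof -
  have "(\<Sum>a<dP n. \<Sum>i<dQ n. (cmod (X b n a (dP n + i)))\<^sup>2) \<le> (\<Sum>a<dP n. real m * Bx\<^sup>2)"
   by (rule sum_mono) (use row[OF n] in auto)
  also have "\<dots> = real (dP n) * (real m * Bx\<^sup>2)" by simp
  also have "\<dots> \<le> (real (P + k) * real n) * (real m * Bx\<^sup>2)"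
  proof (rule mult_right_mono)
   have "k * 1 \<le> k * n" using n by (intro mult_left_mono) auto
   then have "n * P + k - 1 \<le> n * P + k * n" by linarith
   then have "dP n \<le> (P + k) * n" unfolding dP_eq[OF n] by (simp add: algebra_simps)
   then show "real (dP n) \<le> real (P + k) * real n" by (metis of_nat_mono of_nat_mult)
  qed simp
  also have "\<dots> \<le> (real (P + k) * (real m * Bx\<^sup>2) + 1) * real n" by (simp add: algebra_simps)
  finally show ?thesis .
 qed
 moreover have "0 < real (P + k) * (real m * Bx\<^sup>2) + 1" by (simp add: add_nonneg_pos)
 ultimately show thesis using that by blast
qed



text \<open>The trace of the resolvent of a \<kappa> at \<i>\<delta>. Its imaginary part times
  \<delta> measures how much spectrum lies near 0 at scale \<delta>.\<close>

definition hres :: "(real => real) => real => real \<times> real => complex" where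
 "hres b \<delta> w = (\<Sum>c<P. finv P (shiftd (\<lambda>c d. of_real (b (fst w)) * kap (snd w) c d) (\<lambda>_. \<i> * of_real \<delta>)) c c)"

lemma hres_facts:
 assumes b: "b \<in> borel_measurable borel" and \<delta>: "0 < \<delta>"
 shows "hres b \<delta> \<in> borel_measurable borel" "cmod (hres b \<delta> w) \<le> real P * (1 / \<delta>)"
proof -
 have h: "herm P (\<lambda>c d. of_real (b (fst w)) * kap (snd w) c d)" for w by (rule herm_scale[OF kap_herm])
 have dis: "dissipative \<delta> P (shiftd (\<lambda>c d. of_real (b (fst w)) * kap (snd w) c d) (\<lambda>_. \<i> * of_real \<delta>))" for w
  by (rule dissipative_shiftd[OF h]) simp
 show "cmod (hres b \<delta> w) \<le> real P * (1 / \<delta>)"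
  unfolding hres_def using norm_sum_card_le[of "{..<P}" "\<lambda>c. finv P (shiftd (\<lambda>c d. of_real (b (fst w)) * kap (snd w) c d) (\<lambda>_. \<i> * of_real \<delta>)) c c" "1 / \<delta>"]
   dissipative_entry[OF dis dissipative_inv[OF dis \<delta>] \<delta>] by simp
 note [measurable] = b_fst_borel[OF b] coefficient_borel(1)
 have m: "(\<lambda>w. shiftd (\<lambda>c d. of_real (b (fst w)) * kap (snd w) c d) (\<lambda>_. \<i> * of_real \<delta>) i j) \<in> borel_measurable borel" for i j
  unfolding shiftd_def by measurable
 show "hres b \<delta> \<in> borel_measurable borel"
  unfolding hres_def[abs_def] by (intro borel_measurable_sum finv_measurable[OF m dissipative_det[OF dis \<delta>]]) auto
qed

text \<open>In modulus \<delta> times the trace is at most P, and it tends to 0 wherever a \<kappa>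
  is invertible, hence almost everywhere. Dominated convergence is applied along \<delta> = 1 / (m +
  1).\<close>

lemma hres_vanishing:
 assumes b: "b \<in> borel_measurable borel"
  and good: "AE w in lebesgue_on rect. b (fst w) \<noteq> 0 \<and> kap_det (snd w) \<noteq> 0"
 shows "(\<lambda>m. (1 / real (Suc m)) * Im ((LINT w|lebesgue_on rect. hres b (1 / real (Suc m)) w) / of_real (2 * pi))) \<longlonglongrightarrow> 0"
proof -
 have norm_scaled: "cmod (of_real (1 / real (Suc m)) * x) = 1 / real (Suc m) * cmod x" for m x
  unfolding norm_mult norm_of_real by simp
 have "(\<lambda>m. (LINT w|lebesgue_on rect. of_real (1 / real (Suc m)) * hres b (1 / real (Suc m)) w)) \<longlonglongrightarrow> (LINT w|lebesgue_on rect. (0::complex))"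
 proof (rule integral_dominated_convergence[where w = "\<lambda>_. real P"])
  show "integrable (lebesgue_on rect) (\<lambda>_. real P)" by (rule rect_integrable[where B = "real P"]) auto
  show "(\<lambda>w. of_real (1 / real (Suc m)) * hres b (1 / real (Suc m)) w) \<in> borel_measurable (lebesgue_on rect)" for m
   by (intro rect_borel borel_measurable_times borel_measurable_const hres_facts(1)[OF b]) simp
  show "AE w in lebesgue_on rect. cmod (of_real (1 / real (Suc m)) * hres b (1 / real (Suc m)) w) \<le> real P" for m
  proof (rule AE_I2)
   fix w
   have "1 / real (Suc m) * cmod (hres b (1 / real (Suc m)) w) \<le> 1 / real (Suc m) * (real P * (1 / (1 / real (Suc m))))"
    by (intro mult_left_mono hres_facts(2)[OF b]) auto
   also have "\<dots> = real P" by simp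
   finally show "cmod (of_real (1 / real (Suc m)) * hres b (1 / real (Suc m)) w) \<le> real P" by (simp only: norm_scaled)
  qed
  show "AE w in lebesgue_on rect. (\<lambda>m. of_real (1 / real (Suc m)) * hres b (1 / real (Suc m)) w) \<longlonglongrightarrow> 0"
   using good
  proof eventually_elim
   fix w assume g: "b (fst w) \<noteq> 0 \<and> kap_det (snd w) \<noteq> 0"
   have A: "Am b w = (\<lambda>c d. of_real (b (fst w)) * kap (snd w) c d)" using g unfolding Am_def by (intro ext) simp
   define B where "B = (\<Sum>c<P. cmod (finv P (Am b w) c c) + (\<Sum>k<P. cmod (finv P (Am b w) c k)))"
   have bd: "cmod (hres b \<delta> w) \<le> B" if "0 < \<delta>" for \<delta>
    unfolding hres_def B_def A[symmetric]
    by (rule order_trans[OF norm_sum], rule sum_mono, rule resolvent_bound_invertible[OF Am_herm Am_inv that]) simp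
   have "(\<lambda>m. B * (1 / real (Suc m))) \<longlonglongrightarrow> B * 0"
    by (intro tendsto_mult tendsto_const) (use LIMSEQ_inverse_real_of_nat in \<open>simp add: inverse_eq_divide\<close>)
   then have l: "(\<lambda>m. B * (1 / real (Suc m))) \<longlonglongrightarrow> 0" by simp
   show "(\<lambda>m. of_real (1 / real (Suc m)) * hres b (1 / real (Suc m)) w) \<longlonglongrightarrow> 0"
   proof (rule Lim_null_comparison[OF _ l], rule always_eventually, rule allI)
    fix m
    show "cmod (of_real (1 / real (Suc m)) * hres b (1 / real (Suc m)) w) \<le> B * (1 / real (Suc m))"
     unfolding norm_scaled mult.commute[of "1 / real (Suc m)"] by (rule mult_right_mono[OF bd]) auto
   qed
  qed
 qed simp
 then have "(\<lambda>m. of_real (1 / real (Suc m)) * (LINT w|lebesgue_on rect. hres b (1 / real (Suc m)) w)) \<longlonglongrightarrow> 0"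
  unfolding integral_mult_right_zero by simp
 from tendsto_Im[OF tendsto_divide[OF this tendsto_const, of "of_real (2 * pi)"]]
 have "(\<lambda>m. Im (of_real (1 / real (Suc m)) * (LINT w|lebesgue_on rect. hres b (1 / real (Suc m)) w) / of_real (2 * pi))) \<longlonglongrightarrow> 0" by simp
 moreover have "Im (of_real r * x / of_real (2 * pi)) = r * Im (x / of_real (2 * pi))" for r x
  unfolding times_divide_eq_right[symmetric] by simp
 ultimately show ?thesis by (simp only:)
qed

text \<open>The trace limit with \<tau> = 0: matrix and symbol become block diagonal, and the weight
  \<open>W\<close> keeps the stiffness block only.\<close>

lemma stiffness_trace_limit:
 assumes b: "b \<in> borel_measurable borel" "set_integrable lborel {0..1} b" and \<delta>: "0 < \<delta>"
 shows "(\<lambda>n. (\<Sum>i<dP n. finv (dP n) (shiftd (X b n) (\<lambda>_. \<i> * of_real \<delta>)) i i) / of_nat n)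
  \<longlonglongrightarrow> (LINT w|lebesgue_on rect. hres b \<delta> w) / of_real (2 * pi)"
proof -
 interpret s: spline_pair p k P q l Q 0 0 by unfold_locales (rule pk P0 ql Q0)+
 define W where "W c = (if c < P then 1 else 0 :: complex)" for c
 define Z where "Z = (\<lambda>_::nat. \<i> * of_real \<delta>)"
 have eta: "0 < \<delta>" "\<And>c. c < P + Q ==> \<delta> \<le> Im (Z c)" using \<delta> by (auto simp: Z_def)
 have "(\<Sum>i<N n. W (comp n i) * finv (N n) (shiftd (s.X b n) (\<lambda>i. Z (comp n i))) i i) = (\<Sum>i<dP n. finv (dP n) (shiftd (X b n) (\<lambda>_. \<i> * of_real \<delta>)) i i)" for n
 proof -
  have dis: "dissipative \<delta> (dP n + dQ n) (shiftd (s.X b n) Z)"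
   using s.X_herm[of n b] unfolding N_def by (intro dissipative_shiftd) (auto simp: Z_def)
  have "(\<Sum>i<N n. W (comp n i) * finv (N n) (shiftd (s.X b n) (\<lambda>i. Z (comp n i))) i i) = (\<Sum>i<dP n. finv (dP n + dQ n) (shiftd (s.X b n) Z) i i)"
   unfolding N_def sum_lessThan_add by (simp add: W_def comp_less_iff(2) Z_def)
  also have "\<dots> = (\<Sum>i<dP n. finv (dP n) (shiftd (s.X b n) Z) i i)"
   by (rule block_diag_trace[OF dissipative_inv[OF dis \<delta>]]) (auto simp: shiftd_def s.X_def)
  also have "finv (dP n) (shiftd (s.X b n) Z) = finv (dP n) (shiftd (X b n) (\<lambda>_. \<i> * of_real \<delta>))"
   by (rule finv_cong) (simp add: shiftd_def s.X_def X_def Z_def)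
  finally show ?thesis .
 qed
 moreover have "(\<Sum>c<P + Q. W c * finv (P + Q) (shiftd (s.block_sym (b (fst w)) (snd w)) Z) c c) = hres b \<delta> w" for w
 proof -
  have h: "herm (P + Q) (s.block_sym (b (fst w)) (snd w))"
   unfolding s.block_sym_def by (rule herm_block_fun[OF herm_scale[OF kap_herm] s.mu_herm])
  have dis: "dissipative \<delta> (P + Q) (shiftd (s.block_sym (b (fst w)) (snd w)) Z)"
   by (rule dissipative_shiftd[OF h]) (simp add: Z_def)
  have "(\<Sum>c<P + Q. W c * finv (P + Q) (shiftd (s.block_sym (b (fst w)) (snd w)) Z) c c) = (\<Sum>c<P. finv (P + Q) (shiftd (s.block_sym (b (fst w)) (snd w)) Z) c c)"
   unfolding sum_lessThan_add by (simp add: W_def)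
  also have "\<dots> = (\<Sum>c<P. finv P (shiftd (s.block_sym (b (fst w)) (snd w)) Z) c c)"
   by (rule block_diag_trace[OF dissipative_inv[OF dis \<delta>]]) (auto simp: shiftd_def s.block_sym_def block_fun_def)
  also have "finv P (shiftd (s.block_sym (b (fst w)) (snd w)) Z) = finv P (shiftd (\<lambda>c d. of_real (b (fst w)) * kap (snd w) c d) (\<lambda>_. \<i> * of_real \<delta>))"
   by (rule finv_cong) (simp add: shiftd_def s.block_sym_def block_fun_def Z_def)
  finally show ?thesis unfolding hres_def .
 qed
 ultimately show ?thesis
  using s.trace_limit_normalized(1)[where W = W and Z = Z, OF b eta] by (simp only: rect_set_integral)
qed

definition schur_seq :: "(real => real) => nat => mat_fun" where
 "schur_seq b n = schur_fun (dP n) (X b n) (\<lambda>i j. X b n i (dP n + j)) (\<lambda>i j. X b n (dP n + i) (dP n + j))"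

lemma schur_seq_compare:
 assumes inv: "inv_pair (dP n) (X b n) (finv (dP n) (X b n))" and z: "0 < Im z" and \<epsilon>: "0 < \<epsilon>" and \<delta>: "0 < \<delta>"
 shows "herm (dQ n) (schur_seq b n)"
  and "cmod ((\<Sum>i<dQ n. finv (dQ n) (shiftd (schur_seq b n) (\<lambda>_. z)) i i)
    - (\<Sum>i<dQ n. finv (N n) (shiftd (X b n) (\<lambda>i. if i < dP n then \<i> * of_real \<epsilon> else z)) (dP n + i) (dP n + i)))
   \<le> 4 * \<delta> * Im (\<Sum>i<dP n. finv (dP n) (shiftd (X b n) (\<lambda>_. \<i> * of_real \<delta>)) i i) / Im z
    + \<epsilon> / \<delta>\<^sup>2 * (\<Sum>a<dP n. \<Sum>i<dQ n. (cmod (X b n a (dP n + i)))\<^sup>2) / (Im z)\<^sup>2" (is "cmod (?s - ?g) \<le> ?b")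
proof -
 have h: "herm (dP n + dQ n) (X b n)" using X_herm[of n b] unfolding N_def .
 have hA: "herm (dP n) (X b n)" unfolding herm_def
 proof (intro allI impI)
  fix i j assume "i < dP n" "j < dP n"
  then show "X b n i j = cnj (X b n j i)" using h[unfolded herm_def, rule_format, of i j] by simp
 qed
 have hC: "herm (dQ n) (\<lambda>i j. X b n (dP n + i) (dP n + j))" unfolding herm_def
 proof (intro allI impI)
  fix i j assume "i < dQ n" "j < dQ n"
  then show "X b n (dP n + i) (dP n + j) = cnj (X b n (dP n + j) (dP n + i))"
   using h[unfolded herm_def, rule_format, of "dP n + i" "dP n + j"] by simp
 qed
 have "finv (N n) (shiftd (X b n) Z) = finv (dP n + dQ n) (shiftd (block_fun (dP n) (X b n) (\<lambda>i j. X b n i (dP n + j)) (\<lambda>i j. X b n (dP n + i) (dP n + j))) Z)" for Z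
  unfolding N_def
 proof (rule finv_cong)
  fix i j assume ij: "i < dP n + dQ n" "j < dP n + dQ n"
  then have "X b n i j = cnj (X b n j i)" using h unfolding herm_def by blast
  then show "shiftd (X b n) Z i j = shiftd (block_fun (dP n) (X b n) (\<lambda>i j. X b n i (dP n + j)) (\<lambda>i j. X b n (dP n + i) (dP n + j))) Z i j"
   unfolding shiftd_def block_fun_def by auto
 qed
 with schur_trace_compare[OF hA hC inv z \<epsilon> \<delta>, of "\<lambda>i j. X b n i (dP n + j)"]
 show "herm (dQ n) (schur_seq b n)" "cmod (?s - ?g) \<le> ?b"
  unfolding schur_seq_def by simp_all
qed

text \<open>The comparison of Schur complements is applied twice, to the matrices of index n and
  pointwise to the symbol, with common constants. The regularized traces converge as weighted traces
  of the whole resolvent, and the error terms converge as traces of the stiffness matrix at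
  \<i>\<delta>.\<close>

theorem schur_trace_limit:
 assumes \<tau>: "\<tau> = 1" and b: "b \<in> borel_measurable borel" "set_integrable lborel {0..1} b"
  and inv: "\<And>n. 1 \<le> n ==> inv_pair (dP n) (X b n) (finv (dP n) (X b n))"
  and good: "AE w in lebesgue_on rect. b (fst w) \<noteq> 0 \<and> kap_det (snd w) \<noteq> 0"
  and z: "0 < Im z"
 shows "(\<lambda>n. (\<Sum>i<dQ n. finv (dQ n) (shiftd (schur_seq b n) (\<lambda>_. z)) i i) / of_nat n)
  \<longlonglongrightarrow> (LINT w|lebesgue_on rect. (\<Sum>i<Q. finv Q (shiftd (Sf b w) (\<lambda>_. z)) i i)) / of_real (2 * pi)"
proof -
 obtain C0 where C0: "0 < C0" "\<And>n. 1 \<le> n ==> (\<Sum>a<dP n. \<Sum>i<dQ n. (cmod (X b n a (dP n + i)))\<^sup>2) \<le> C0 * real n"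
  using X_off_diagonal_bound by blast
 define C\<xi> where "C\<xi> = (\<Sum>a<P. \<Sum>i<Q. (\<Sum>s\<in>{- int wd..int wd}. \<bar>shift_prod (bv (P + i)) (bu a) s\<bar>)\<^sup>2)"
 have C\<xi>0: "0 \<le> C\<xi>" unfolding C\<xi>_def by (intro sum_nonneg) auto
 have C\<xi>: "(\<Sum>a<P. \<Sum>i<Q. (cmod (xif \<theta> a i))\<^sup>2) \<le> C\<xi>" for \<theta>
  unfolding C\<xi>_def
 proof (rule sum_mono, rule sum_mono, rule power_mono)
  fix a i
  show "cmod (xif \<theta> a i) \<le> (\<Sum>s\<in>{- int wd..int wd}. \<bar>shift_prod (bv (P + i)) (bu a) s\<bar>)"
   unfolding xif_def by (rule order_trans[OF norm_sum]) (simp add: norm_mult)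
 qed simp
 \<comment> \<open>\<open>C0\<close> times n bounds the squared Frobenius norm of the coupling block
   and \<open>C\<xi>\<close> that of its symbol; one constant then serves both estimates.\<close>
 define C where "C = (C0 + C\<xi>) / (Im z)\<^sup>2"
 have C: "0 < C" unfolding C_def using C0 C\<xi>0 z by (intro divide_pos_pos) auto
 define Z where "Z \<epsilon> c = (if c < P then \<i> * of_real \<epsilon> else z)" for \<epsilon> and c :: nat
 define T where "T \<epsilon> n = (\<Sum>i<dQ n. finv (N n) (shiftd (X b n) (\<lambda>i. if i < dP n then \<i> * of_real \<epsilon> else z)) (dP n + i) (dP n + i)) / of_nat n" for \<epsilon> n
 define \<phi> where "\<phi> w = (\<Sum>i<Q. finv Q (shiftd (Sf b w) (\<lambda>_. z)) i i)" for w
 define \<phi>e where "\<phi>e \<epsilon> w = (\<Sum>i<Q. finv (P + Q) (shiftd (block_sym (b (fst w)) (snd w)) (Z \<epsilon>)) (P + i) (P + i))" for \<epsilon> w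
 let ?M = "lebesgue_on rect"
 have Zeta: "0 < min \<epsilon> (Im z)" "\<And>c. c < P + Q ==> min \<epsilon> (Im z) \<le> Im (Z \<epsilon> c)" if "0 < \<epsilon>" for \<epsilon>
  using that z by (auto simp: Z_def)
 have \<phi>i: "integrable ?M \<phi>"
  unfolding \<phi>_def[abs_def]
  by (rule Bochner_Integration.integrable_sum, rule rect_integrable[where B = "1 / Im z"], rule Sf_resolvent(1)[OF z _ _ b(1)])
    (auto intro: Sf_resolvent(2)[OF z])
 have \<phi>ei: "integrable ?M (\<phi>e \<epsilon>)" if \<epsilon>: "0 < \<epsilon>" for \<epsilon>
  unfolding \<phi>e_def[abs_def]
 proof (rule Bochner_Integration.integrable_sum)
  fix i assume "i \<in> {..<Q}"
  then have i: "P + i < P + Q" by simp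
  show "integrable ?M (\<lambda>w. finv (P + Q) (shiftd (block_sym (b (fst w)) (snd w)) (Z \<epsilon>)) (P + i) (P + i))"
  proof (rule rect_integrable)
   show "(\<lambda>w::real \<times> real. finv (P + Q) (shiftd (block_sym (b (fst w)) (snd w)) (Z \<epsilon>)) (P + i) (P + i)) \<in> borel_measurable borel"
    using trace_limit_normalized(2)[where Z = "Z \<epsilon>" and \<eta> = "min \<epsilon> (Im z)", OF b] Zeta[OF \<epsilon>] i by blast
   show "cmod (finv (P + Q) (shiftd (block_sym (b (fst w)) (snd w)) (Z \<epsilon>)) (P + i) (P + i)) \<le> 1 / min \<epsilon> (Im z)" for w :: "real \<times> real"
    using trace_limit_normalized(3)[where Z = "Z \<epsilon>" and \<eta> = "min \<epsilon> (Im z)", OF b] Zeta[OF \<epsilon>] i by blast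
  qed
 qed
 have hi: "integrable ?M (hres b \<delta>)" if "0 < \<delta>" for \<delta>
  by (rule rect_integrable[OF hres_facts[OF b(1) that]])
 have Tlim: "T \<epsilon> \<longlonglongrightarrow> (LINT w|?M. \<phi>e \<epsilon> w) / of_real (2 * pi)" if \<epsilon>: "0 < \<epsilon>" for \<epsilon>
 proof -
  define W where "W c = (if c < P then 0 else 1 :: complex)" for c
  have "(\<Sum>i<N n. W (comp n i) * finv (N n) (shiftd (X b n) (\<lambda>i. Z \<epsilon> (comp n i))) i i) / of_nat n = T \<epsilon> n" for n
   unfolding T_def N_def sum_lessThan_add W_def Z_def comp_less_iff(2) by simp
  moreover have "(\<Sum>c<P + Q. W c * finv (P + Q) (shiftd (block_sym (b (fst w)) (snd w)) (Z \<epsilon>)) c c) = \<phi>e \<epsilon> w" for w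
   unfolding \<phi>e_def sum_lessThan_add W_def by simp
  ultimately show ?thesis using trace_limit_normalized(1)[where W = W and Z = "Z \<epsilon>", OF b Zeta[OF \<epsilon>]] by (simp only: rect_set_integral)
 qed
 show ?thesis unfolding \<phi>_def[symmetric]
 proof (rule two_parameter_limit[where T = T and J = "\<lambda>\<epsilon>. (LINT w|?M. \<phi>e \<epsilon> w) / of_real (2 * pi)" and c = "4 / Im z" and C = C
    and U = "\<lambda>\<delta> n. \<delta> * Im ((\<Sum>i<dP n. finv (dP n) (shiftd (X b n) (\<lambda>_. \<i> * of_real \<delta>)) i i) / of_nat n)"
    and V = "\<lambda>\<delta>. \<delta> * Im ((LINT w|?M. hres b \<delta> w) / of_real (2 * pi))", OF _ _ Tlim _ hres_vanishing[OF b(1) good] _ C])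
  show "0 < 4 / Im z" using z by simp
  show "(\<lambda>n. \<delta> * Im ((\<Sum>i<dP n. finv (dP n) (shiftd (X b n) (\<lambda>_. \<i> * of_real \<delta>)) i i) / of_nat n)) \<longlonglongrightarrow> \<delta> * Im ((LINT w|?M. hres b \<delta> w) / of_real (2 * pi))"
   if "0 < \<delta>" for \<delta>
   by (intro tendsto_mult tendsto_const tendsto_Im stiffness_trace_limit b that)
 next
  fix \<delta> \<epsilon> :: real and n :: nat assume \<delta>: "0 < \<delta>" and \<epsilon>: "0 < \<epsilon>" and n: "1 \<le> n"
  define t where "t = (\<Sum>i<dQ n. finv (dQ n) (shiftd (schur_seq b n) (\<lambda>_. z)) i i)"
  define T' where "T' = (\<Sum>i<dQ n. finv (N n) (shiftd (X b n) (\<lambda>i. if i < dP n then \<i> * of_real \<epsilon> else z)) (dP n + i) (dP n + i))"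
  define u' where "u' = (\<Sum>i<dP n. finv (dP n) (shiftd (X b n) (\<lambda>_. \<i> * of_real \<delta>)) i i)"
  define F where "F = (\<Sum>a<dP n. \<Sum>i<dQ n. (cmod (X b n a (dP n + i)))\<^sup>2)"
  have n0: "0 < real n" using n by simp
  have "cmod (t - T') \<le> 4 * \<delta> * Im u' / Im z + \<epsilon> / \<delta>\<^sup>2 * F / (Im z)\<^sup>2"
   unfolding t_def T'_def u'_def F_def by (rule schur_seq_compare(2)[OF inv[OF n] z \<epsilon> \<delta>])
  also have "\<epsilon> / \<delta>\<^sup>2 * F / (Im z)\<^sup>2 \<le> \<epsilon> / \<delta>\<^sup>2 * (C * real n)"
  proof -
   have "F \<le> (C0 + C\<xi>) * real n" using C0(2)[OF n] mult_nonneg_nonneg[OF C\<xi>0, of "real n"] unfolding F_def distrib_right by simp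
   then have "F / (Im z)\<^sup>2 \<le> C * real n" unfolding C_def by (simp add: divide_right_mono)
   then have "\<epsilon> / \<delta>\<^sup>2 * (F / (Im z)\<^sup>2) \<le> \<epsilon> / \<delta>\<^sup>2 * (C * real n)" using \<epsilon> by (intro mult_left_mono) auto
   then show ?thesis by simp
  qed
  finally have "cmod (t - T') \<le> 4 * \<delta> * Im u' / Im z + \<epsilon> / \<delta>\<^sup>2 * (C * real n)" by simp
  then have "cmod (t - T') / real n \<le> (4 * \<delta> * Im u' / Im z + \<epsilon> / \<delta>\<^sup>2 * (C * real n)) / real n"
   by (rule divide_right_mono) simp
  also have "\<dots> = 4 / Im z * (\<delta> * (Im u' / real n)) + \<epsilon> / \<delta>\<^sup>2 * C" using n0 by (simp add: add_divide_distrib)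
  also have "cmod (t - T') / real n = cmod (t / of_nat n - T' / of_nat n)"
   unfolding diff_divide_distrib[symmetric] norm_divide by simp
  also have "Im u' / real n = Im (u' / of_nat n)" by (simp add: Im_divide_of_nat)
  finally show "cmod (t / of_nat n - T \<epsilon> n) \<le> 4 / Im z * (\<delta> * Im (u' / of_nat n)) + \<epsilon> / \<delta>\<^sup>2 * C"
   unfolding T_def T'_def .
 next
  fix \<delta> \<epsilon> :: real assume \<delta>: "0 < \<delta>" and \<epsilon>: "0 < \<epsilon>"
  have pt: "AE w in ?M. cmod (\<phi> w - \<phi>e \<epsilon> w) \<le> 4 * \<delta> / Im z * Im (hres b \<delta> w) + \<epsilon> / \<delta>\<^sup>2 * C"
   using good
  proof eventually_elim
   fix w assume g: "b (fst w) \<noteq> 0 \<and> kap_det (snd w) \<noteq> 0"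
   have A: "Am b w = (\<lambda>c d. of_real (b (fst w)) * kap (snd w) c d)" using g unfolding Am_def by (intro ext) simp
   have bs: "block_sym (b (fst w)) (snd w) = block_fun P (Am b w) (xif (snd w)) (\<lambda>i j. of_real (- \<rho>) * muf (snd w) i j)"
    unfolding block_sym_def A by (simp add: \<tau>)
   have "cmod (\<phi> w - \<phi>e \<epsilon> w) \<le> 4 * \<delta> * Im (hres b \<delta> w) / Im z + \<epsilon> / \<delta>\<^sup>2 * (\<Sum>a<P. \<Sum>i<Q. (cmod (xif (snd w) a i))\<^sup>2) / (Im z)\<^sup>2"
    using schur_trace_compare(2)[where B = "xif (snd w)", OF Am_herm[of b w] mu_herm[of "snd w"] Am_inv[of b w] z \<epsilon> \<delta>]
    unfolding \<phi>_def \<phi>e_def Sf_def bs Z_def hres_def A .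
   also have "\<epsilon> / \<delta>\<^sup>2 * (\<Sum>a<P. \<Sum>i<Q. (cmod (xif (snd w) a i))\<^sup>2) / (Im z)\<^sup>2 \<le> \<epsilon> / \<delta>\<^sup>2 * C"
   proof -
    have "(\<Sum>a<P. \<Sum>i<Q. (cmod (xif (snd w) a i))\<^sup>2) \<le> C0 + C\<xi>" using C\<xi>[of "snd w"] C0 by linarith
    then have "(\<Sum>a<P. \<Sum>i<Q. (cmod (xif (snd w) a i))\<^sup>2) / (Im z)\<^sup>2 \<le> C" unfolding C_def by (rule divide_right_mono) simp
    then have "\<epsilon> / \<delta>\<^sup>2 * ((\<Sum>a<P. \<Sum>i<Q. (cmod (xif (snd w) a i))\<^sup>2) / (Im z)\<^sup>2) \<le> \<epsilon> / \<delta>\<^sup>2 * C" using \<epsilon> by (intro mult_left_mono) auto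
    then show ?thesis by simp
   qed
   finally show "cmod (\<phi> w - \<phi>e \<epsilon> w) \<le> 4 * \<delta> / Im z * Im (hres b \<delta> w) + \<epsilon> / \<delta>\<^sup>2 * C" by simp
  qed
  have hre: "integrable ?M (\<lambda>w. Im (hres b \<delta> w))" by (rule integrable_Im[OF hi[OF \<delta>]])
  have cst: "integrable ?M (\<lambda>_. \<epsilon> / \<delta>\<^sup>2 * C)" by (rule rect_integrable[where B = "\<bar>\<epsilon> / \<delta>\<^sup>2 * C\<bar>"]) auto
  have meas: "measure ?M (space ?M) = 2 * pi"
   using rectangle_measure by (subst measure_restrict_space) auto
  have "cmod ((LINT w|?M. \<phi> w) - (LINT w|?M. \<phi>e \<epsilon> w)) = cmod (LINT w|?M. \<phi> w - \<phi>e \<epsilon> w)"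
   using \<phi>i \<phi>ei[OF \<epsilon>] by (simp add: Bochner_Integration.integral_diff)
  also have "\<dots> \<le> (LINT w|?M. cmod (\<phi> w - \<phi>e \<epsilon> w))" by (rule integral_norm_bound)
  also have "\<dots> \<le> (LINT w|?M. 4 * \<delta> / Im z * Im (hres b \<delta> w) + \<epsilon> / \<delta>\<^sup>2 * C)"
   by (rule integral_mono_AE[OF _ _ pt]) (intro integrable_norm Bochner_Integration.integrable_diff \<phi>i \<phi>ei[OF \<epsilon>] Bochner_Integration.integrable_add integrable_mult_right hre cst)+
  also have "\<dots> = (LINT w|?M. 4 * \<delta> / Im z * Im (hres b \<delta> w)) + (LINT w|?M. \<epsilon> / \<delta>\<^sup>2 * C)"
   by (rule Bochner_Integration.integral_add[OF integrable_mult_right[OF hre] cst])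
  also have "\<dots> = 4 * \<delta> / Im z * Im (LINT w|?M. hres b \<delta> w) + \<epsilon> / \<delta>\<^sup>2 * C * (2 * pi)"
   unfolding integral_mult_right_zero integral_Im[OF hi[OF \<delta>]] lebesgue_integral_const meas by simp
  finally have le: "cmod ((LINT w|?M. \<phi> w) - (LINT w|?M. \<phi>e \<epsilon> w)) / (2 * pi) \<le> (4 * \<delta> / Im z * Im (LINT w|?M. hres b \<delta> w) + \<epsilon> / \<delta>\<^sup>2 * C * (2 * pi)) / (2 * pi)"
   by (rule divide_right_mono) simp
  have "cmod ((LINT w|?M. \<phi> w) / of_real (2 * pi) - (LINT w|?M. \<phi>e \<epsilon> w) / of_real (2 * pi)) = cmod ((LINT w|?M. \<phi> w) - (LINT w|?M. \<phi>e \<epsilon> w)) / (2 * pi)"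
   unfolding diff_divide_distrib[symmetric] norm_divide norm_of_real by simp
  also note le
  also have "(4 * \<delta> / Im z * Im (LINT w|?M. hres b \<delta> w) + \<epsilon> / \<delta>\<^sup>2 * C * (2 * pi)) / (2 * pi)
    = 4 / Im z * (\<delta> * Im ((LINT w|?M. hres b \<delta> w) / of_real (2 * pi))) + \<epsilon> / \<delta>\<^sup>2 * C"
  proof -
   have "Im (x / of_real (2 * pi)) = Im x / (2 * pi)" for x by (rule Im_divide_of_real)
   then show ?thesis by (simp only:) (simp add: add_divide_distrib)
  qed
  finally show "cmod ((LINT w|?M. \<phi> w) / of_real (2 * pi) - (LINT w|?M. \<phi>e \<epsilon> w) / of_real (2 * pi))
    \<le> 4 / Im z * (\<delta> * Im ((LINT w|?M. hres b \<delta> w) / of_real (2 * pi))) + \<epsilon> / \<delta>\<^sup>2 * C" .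
 qed
qed

end

section \<open>The distributions\<close>

lemma borel_representative:
 fixes a :: "real => real"
 assumes "a absolutely_integrable_on {0..1}"
 obtains b where "b \<in> borel_measurable borel" "set_integrable lborel {0..1} b" "AE x in lborel. x \<in> {0..1} \<longrightarrow> a x = b x"
proof -
 define f where "f x = indicat_real {0..1} x * a x" for x
 have f: "integrable lebesgue f" using assms unfolding set_integrable_def f_def by simp
 obtain b where b: "b \<in> borel_measurable lborel" "AE x in lborel. f x = b x"
  using completion_ex_borel_measurable_real[OF borel_measurable_integrable[OF f]] by auto
 have m: "b \<in> borel_measurable borel" using b(1) by simp
 have "AE x in lebesgue. f x = b x" by (rule AE_completion[OF b(2)])
 moreover have "b \<in> borel_measurable lebesgue" using b(1) by (rule measurable_completion)
 ultimately have "integrable lebesgue b \<longleftrightarrow> integrable lebesgue f"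
  using borel_measurable_integrable[OF f] by (intro integrable_cong_AE) (auto elim: eventually_mono)
 then have "integrable lebesgue b" using f by simp
 then have "integrable lborel b" using b(1) by (simp add: integrable_completion)
 then have "set_integrable lborel {0..1} b" unfolding set_integrable_def by (intro integrable_mult_indicator) auto
 moreover have "AE x in lborel. x \<in> {0..1} \<longrightarrow> a x = b x" using b(2) by eventually_elim (auto simp: f_def)
 ultimately show thesis using that m by blast
qed

lemma invertible_mat_det:
 fixes A :: "'a::field mat"
 assumes "invertible_mat A" "A \<in> carrier_mat n n" shows "Determinant.det A \<noteq> 0"
proof -
 obtain B where B: "A * B = 1\<^sub>m (dim_row A)" "B * A = 1\<^sub>m (dim_row B)"
  using assms(1) unfolding invertible_mat_def inverts_mat_def by blast
 have "dim_col B = n" using arg_cong[OF B(1), of dim_col] assms(2) by simp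
 moreover have "dim_row B = n" using arg_cong[OF B(2), of dim_col] assms(2) by simp
 ultimately have "B \<in> carrier_mat n n" by auto
 then show ?thesis using minv_eqI(2)[OF assms(2)] B(1) assms(2) by auto
qed

lemma tendsto_rescale:
 assumes "(\<lambda>n. t n / of_nat n) \<longlonglongrightarrow> (I :: complex)" "(\<lambda>n. real (d n) / real n) \<longlonglongrightarrow> real r" "0 < r"
 shows "(\<lambda>n. t n / of_nat (d n)) \<longlonglongrightarrow> I / of_nat r"
proof -
 have "(\<lambda>n. complex_of_real (real (d n) / real n)) \<longlonglongrightarrow> complex_of_real (real r)" by (rule tendsto_of_real[OF assms(2)])
 then have "(\<lambda>n. (t n / of_nat n) / complex_of_real (real (d n) / real n)) \<longlonglongrightarrow> I / complex_of_real (real r)"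
  by (intro tendsto_divide assms(1)) (use assms(3) in auto)
 moreover have "\<forall>\<^sub>F n in sequentially. (t n / of_nat n) / complex_of_real (real (d n) / real n) = t n / of_nat (d n)"
  using eventually_gt_at_top[of 0] by eventually_elim simp
 ultimately show ?thesis unfolding of_real_of_nat_eq by (rule Lim_transform_eventually)
qed

lemma rectangle_symbolI:
 assumes "\<And>x. x \<in> rect ==> f x \<in> carrier_mat s s"
  and "\<And>i j x. x \<in> rect ==> i < s ==> j < s ==> f x $$ (i, j) = F x i j"
  and "\<And>i j. i < s ==> j < s ==> (\<lambda>x. F x i j) \<in> borel_measurable borel"
 shows "symbol_on rect s s f"
 unfolding symbol_on_def
proof (intro conjI allI impI ballI)
 show "rect \<in> lmeasurable" "0 < measure lebesgue rect" using rectangle_measure by auto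
 show "f x \<in> carrier_mat s s" if "x \<in> rect" for x using assms(1) that .
 fix i j assume ij: "i < s" "j < s"
 show "(\<lambda>x. f x $$ (i, j)) \<in> borel_measurable (lebesgue_on rect)"
  using rect_borel[OF assms(3)[OF ij]] by (subst measurable_cong[where g = "\<lambda>x. F x i j"]) (use assms(2) ij in auto)
qed

text \<open>The index n = 0, where the scalings degenerate, is left out of the identification with
  X. The criterion for Hermitian sequences speaks of all n, so the Hermitian property at 0 is asked
  separately.\<close>

lemma rectangle_distributedI:
 assumes f: "\<And>x. x \<in> rect ==> f x \<in> carrier_mat s s"
  and F: "\<And>i j x. x \<in> rect ==> i < s ==> j < s ==> f x $$ (i, j) = F x i j"
  and Fm: "\<And>i j. i < s ==> j < s ==> (\<lambda>x. F x i j) \<in> borel_measurable borel"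
  and Fh: "\<And>x. herm s (F x)" and s: "0 < s"
  and A: "\<And>n. A n \<in> carrier_mat (d n) (d n)" and A0: "herm (d 0) (\<lambda>i j. A 0 $$ (i, j))"
  and X: "\<And>n i j. 1 \<le> n ==> i < d n ==> j < d n ==> A n $$ (i, j) = X n i j" and Xh: "\<And>n. 1 \<le> n ==> herm (d n) (X n)"
  and d: "filterlim d at_top sequentially" "(\<lambda>n. real (d n) / real n) \<longlonglongrightarrow> real s"
  and meas: "\<And>z. 0 < Im z ==> (\<lambda>x. \<Sum>i<s. finv s (shiftd (F x) (\<lambda>_. z)) i i) \<in> borel_measurable borel"
  and tr: "\<And>z. 0 < Im z ==> (\<lambda>n. (\<Sum>i<d n. finv (d n) (shiftd (X n) (\<lambda>_. z)) i i) / of_nat n)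
   \<longlonglongrightarrow> (LINT x|lebesgue_on rect. (\<Sum>i<s. finv s (shiftd (F x) (\<lambda>_. z)) i i)) / of_real (2 * pi)"
 shows "sv_eig_distributed A rect s f"
proof -
 have finvF: "finv s (shiftd (\<lambda>i j. f x $$ (i, j)) Z) = finv s (shiftd (F x) Z)" if "x \<in> rect" for x Z
  by (rule finv_cong) (simp add: shiftd_def F[OF that])
 have finvX: "finv (d n) (shiftd (\<lambda>i j. A n $$ (i, j)) Z) = finv (d n) (shiftd (X n) Z)" if "1 \<le> n" for n Z
  by (rule finv_cong) (simp add: shiftd_def X[OF that])
 show ?thesis
 proof (rule hermitian_distributedI[OF rectangle_symbolI[OF f F Fm] s _ A d(1)])
  show "herm s (\<lambda>i j. f x $$ (i, j))" if x: "x \<in> rect" for x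
   unfolding herm_def
  proof (intro allI impI)
   fix i j assume "i < s" "j < s"
   then show "f x $$ (i, j) = cnj (f x $$ (j, i))" using Fh[of x, unfolded herm_def, rule_format, of i j] F[OF x] by simp
  qed
  show "herm (d n) (\<lambda>i j. A n $$ (i, j))" for n
  proof (cases "1 \<le> n")
   case True
   show ?thesis unfolding herm_def
   proof (intro allI impI)
    fix i j assume "i < d n" "j < d n"
    then show "A n $$ (i, j) = cnj (A n $$ (j, i))" using Xh[OF True, unfolded herm_def, rule_format, of i j] X[OF True] by simp
   qed
  qed (use A0 in \<open>simp add: not_le\<close>)
  fix z :: complex assume z: "0 < Im z"
  show "(\<lambda>x. \<Sum>i<s. finv s (shiftd (\<lambda>i j. f x $$ (i, j)) (\<lambda>_. z)) i i) \<in> borel_measurable (lebesgue_on rect)"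
   using rect_borel[OF meas[OF z]]
   by (subst measurable_cong[where g = "\<lambda>x. \<Sum>i<s. finv s (shiftd (F x) (\<lambda>_. z)) i i"]) (auto simp: finvF)
  have "(LINT x|lebesgue_on rect. (\<Sum>i<s. finv s (shiftd (\<lambda>i j. f x $$ (i, j)) (\<lambda>_. z)) i i) / of_nat s)
    = (LINT x|lebesgue_on rect. (\<Sum>i<s. finv s (shiftd (F x) (\<lambda>_. z)) i i)) / of_nat s"
   unfolding integral_divide_zero[symmetric] by (rule Bochner_Integration.integral_cong) (auto simp: finvF)
  moreover have "(\<lambda>n. (\<Sum>i<d n. finv (d n) (shiftd (X n) (\<lambda>_. z)) i i) / of_nat (d n))
    \<longlonglongrightarrow> (LINT x|lebesgue_on rect. (\<Sum>i<s. finv s (shiftd (F x) (\<lambda>_. z)) i i)) / of_real (2 * pi) / of_nat s"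
   by (rule tendsto_rescale[OF tr[OF z] d(2) s])
  ultimately have lim: "(\<lambda>n. (\<Sum>i<d n. finv (d n) (shiftd (X n) (\<lambda>_. z)) i i) / of_nat (d n))
    \<longlonglongrightarrow> (LINT x:rect|lebesgue. (\<Sum>i<s. finv s (shiftd (\<lambda>i j. f x $$ (i, j)) (\<lambda>_. z)) i i) / of_nat s) / of_real (measure lebesgue rect)"
   unfolding rect_set_integral rectangle_measure(2) by (simp only: divide_divide_eq_left mult.commute)
  have "\<forall>\<^sub>F n in sequentially. (\<Sum>i<d n. finv (d n) (shiftd (X n) (\<lambda>_. z)) i i) / of_nat (d n)
    = (\<Sum>i<d n. finv (d n) (shiftd (\<lambda>i j. A n $$ (i, j)) (\<lambda>_. z)) i i) / of_nat (d n)"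
   using eventually_ge_at_top[of 1] by eventually_elim (simp add: finvX)
  with lim show "(\<lambda>n. (\<Sum>i<d n. finv (d n) (shiftd (\<lambda>i j. A n $$ (i, j)) (\<lambda>_. z)) i i) / of_nat (d n))
    \<longlonglongrightarrow> (LINT x:rect|lebesgue. (\<Sum>i<s. finv s (shiftd (\<lambda>i j. f x $$ (i, j)) (\<lambda>_. z)) i i) / of_nat s) / of_real (measure lebesgue rect)"
   by (rule Lim_transform_eventually)
 qed
qed

section \<open>The distribution of the block matrix\<close>

context spline_pair
begin


definition stokes_mat :: "(real => real) => nat => complex mat" where
 "stokes_mat a n = complex_mat (four_block_mat ((1 / real n) \<cdot>\<^sub>m A11 a p k n) (A12 p k q l n)
   ((A12 p k q l n)\<^sup>T) (real n \<cdot>\<^sub>m A22 \<rho> q l n))"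

definition stokes_symbol :: "(real => real) => real \<times> real => complex mat" where
 "stokes_symbol a w = four_block_mat (of_real (a (fst w)) \<cdot>\<^sub>m kappa_symbol p k (snd w)) (xi_symbol p k q l (snd w))
   (mat_adjoint (xi_symbol p k q l (snd w))) (of_real (- \<rho>) \<cdot>\<^sub>m mu_symbol q l (snd w))"

lemma stokes_mat_entries:
 assumes \<tau>: "\<tau> = 1" and n: "1 \<le> n" and b: "b \<in> borel_measurable borel" "AE x in lborel. x \<in> {0..1} \<longrightarrow> a x = b x"
  and ij: "i < N n" "j < N n"
 shows "stokes_mat a n $$ (i, j) = X b n i j"
proof -
 note c = matrix_carriers(1)[of a n] matrix_carriers(2,3)[of n] and e = matrix_entries[OF n b]
 have n0: "real n \<noteq> 0" using n by simp
 have dims: "dim_row (A11 a p k n) = dP n" "dim_col (A11 a p k n) = dP n" "dim_row (A12 p k q l n) = dP n" "dim_col (A12 p k q l n) = dQ n"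
  "dim_row (A22 \<rho> q l n) = dQ n" "dim_col (A22 \<rho> q l n) = dQ n" using c by auto
 have lt: "\<not> i' < dP n ==> i' < N n ==> i' - dP n < dQ n" for i' unfolding N_def by auto
 have "stokes_mat a n $$ (i, j) = of_real (four_block_mat ((1 / real n) \<cdot>\<^sub>m A11 a p k n) (A12 p k q l n)
   ((A12 p k q l n)\<^sup>T) (real n \<cdot>\<^sub>m A22 \<rho> q l n) $$ (i, j))"
  unfolding stokes_mat_def using ij by (intro index_map_mat(1)) (auto simp: dims N_def)
 also have "four_block_mat ((1 / real n) \<cdot>\<^sub>m A11 a p k n) (A12 p k q l n) ((A12 p k q l n)\<^sup>T) (real n \<cdot>\<^sub>m A22 \<rho> q l n) $$ (i, j)
   = (if i < dP n then if j < dP n then (1 / real n) * A11 a p k n $$ (i, j) else A12 p k q l n $$ (i, j - dP n)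
    else if j < dP n then A12 p k q l n $$ (j, i - dP n) else real n * A22 \<rho> q l n $$ (i - dP n, j - dP n))"
  using ij lt[of i] lt[of j] by (subst index_mat_four_block(1)) (auto simp: dims N_def)
 finally show ?thesis unfolding X_def using e ij lt[of i] lt[of j] n0 by (auto simp: \<tau>)
qed

lemma stokes_symbol_entries:
 assumes \<tau>: "\<tau> = 1" and ij: "i < P + Q" "j < P + Q"
 shows "stokes_symbol a w $$ (i, j) = block_sym (a (fst w)) (snd w) i j"
proof -
 note c = symbol_entries(4-6)[of "snd w"] and e = symbol_entries(1-3)[of _ _ "snd w"]
 have dims: "dim_row (kappa_symbol p k (snd w)) = P" "dim_col (kappa_symbol p k (snd w)) = P" "dim_row (mu_symbol q l (snd w)) = Q" "dim_col (mu_symbol q l (snd w)) = Q"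
  using c by auto
 have lt: "\<not> i' < P ==> i' < P + Q ==> i' - P < Q" for i' by auto
 show ?thesis
  unfolding stokes_symbol_def block_sym_def block_fun_def using ij lt[of i] lt[of j]
  by (subst index_mat_four_block(1)) (auto simp: dims \<tau> e mat_adjoint_entry[OF c(2)])
qed

lemma stokes_symbol_carrier: "stokes_symbol a w \<in> carrier_mat (P + Q) (P + Q)"
 unfolding stokes_symbol_def using symbol_entries(4-6)[of "snd w"] by (intro four_block_carrier_mat) auto

lemma stokes_mat_carrier: "stokes_mat a n \<in> carrier_mat (N n) (N n)"
 unfolding stokes_mat_def N_def using matrix_carriers(1)[of a n] matrix_carriers(2,3)[of n] by (intro map_carrier_mat[THEN iffD2] four_block_carrier_mat) auto

theorem stokes_distribution:
 assumes \<tau>: "\<tau> = 1" and a: "a absolutely_integrable_on {0..1}"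
 shows "sv_eig_distributed (stokes_mat a) rect (P + Q) (stokes_symbol a)"
proof -
 obtain b where b: "b \<in> borel_measurable borel" "set_integrable lborel {0..1} b" "AE x in lborel. x \<in> {0..1} \<longrightarrow> a x = b x"
  using borel_representative[OF a] .
 have bh: "herm (P + Q) (block_sym \<alpha> \<theta>)" for \<alpha> \<theta>
  unfolding block_sym_def by (rule herm_block_fun[OF herm_scale[OF kap_herm] mu_herm])
 have bm: "(\<lambda>w. block_sym (b (fst w)) (snd w) i j) \<in> borel_measurable borel" for i j
 proof -
  note [measurable] = b_fst_borel[OF b(1)] coefficient_borel
  have "(\<lambda>w. of_real (b (fst w)) * kap (snd w) i j) \<in> borel_measurable borel" by measurable
  moreover have "(\<lambda>w::real \<times> real. of_real \<tau> * xif (snd w) i (j - P)) \<in> borel_measurable borel"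
   "(\<lambda>w::real \<times> real. of_real (- \<rho>) * muf (snd w) (i - P) (j - P)) \<in> borel_measurable borel"
   "(\<lambda>w::real \<times> real. cnj (of_real \<tau> * xif (snd w) j (i - P))) \<in> borel_measurable borel"
   by (intro cnj_borel borel_measurable_times borel_measurable_const coefficient_borel)+
  ultimately show ?thesis unfolding block_sym_def block_fun_def
   by (cases "i < P"; cases "j < P"; simp only: if_True if_False)
 qed
 have "sv_eig_distributed (stokes_mat a) rect (P + Q) (stokes_symbol b)"
 proof (rule rectangle_distributedI[where F = "\<lambda>w. block_sym (b (fst w)) (snd w)" and d = N and X = "X b"])
  show "stokes_symbol b w \<in> carrier_mat (P + Q) (P + Q)" for w by (rule stokes_symbol_carrier)
  show "stokes_symbol b w $$ (i, j) = block_sym (b (fst w)) (snd w) i j" if "i < P + Q" "j < P + Q" for w i j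
   by (rule stokes_symbol_entries[OF \<tau> that])
  show "0 < P + Q" using P0 by simp
  show "stokes_mat a n \<in> carrier_mat (N n) (N n)" for n by (rule stokes_mat_carrier)
  show "stokes_mat a n $$ (i, j) = X b n i j" if "1 \<le> n" "i < N n" "j < N n" for n i j
   by (rule stokes_mat_entries[OF \<tau> that(1) b(1,3) that(2,3)])
  show "herm (N n) (X b n)" for n by (rule X_herm)
  show "filterlim N at_top sequentially" "(\<lambda>n. real (N n) / real n) \<longlonglongrightarrow> real (P + Q)" by (rule size_limits)+
  \<comment> \<open>At n = 0 both scalings, 1 / n and n, are 0, which removes the diagonal blocks;
    the off-diagonal blocks are transposes of each other.\<close>
  show "herm (N 0) (\<lambda>i j. stokes_mat a 0 $$ (i, j))"
   unfolding herm_def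
  proof (intro allI impI)
   fix i j assume ij: "i < N 0" "j < N 0"
   have dims: "dim_row (A11 a p k 0) = dP 0" "dim_col (A11 a p k 0) = dP 0" "dim_row (A12 p k q l 0) = dP 0" "dim_col (A12 p k q l 0) = dQ 0"
    "dim_row (A22 \<rho> q l 0) = dQ 0" "dim_col (A22 \<rho> q l 0) = dQ 0" using matrix_carriers(1)[of a 0] matrix_carriers(2,3)[of 0] by auto
   have e: "stokes_mat a 0 $$ (i, j) = of_real (if i < dP 0 then if j < dP 0 then 0 else A12 p k q l 0 $$ (i, j - dP 0)
    else if j < dP 0 then A12 p k q l 0 $$ (j, i - dP 0) else 0)" if "i < N 0" "j < N 0" for i j
    unfolding stokes_mat_def using that by (subst index_map_mat(1)) (auto simp: dims N_def index_mat_four_block(1))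
   show "stokes_mat a 0 $$ (i, j) = cnj (stokes_mat a 0 $$ (j, i))" unfolding e[OF ij] e[OF ij(2,1)] by simp
  qed
 next
  fix z :: complex assume z: "0 < Im z"
  have eta: "0 < Im z" "\<And>c. c < P + Q ==> Im z \<le> Im z" using z by auto
  note T = trace_limit_normalized[where Z = "\<lambda>_. z" and \<eta> = "Im z", OF b(1,2)]
  show "(\<lambda>w. \<Sum>i<P + Q. finv (P + Q) (shiftd (block_sym (b (fst w)) (snd w)) (\<lambda>_. z)) i i) \<in> borel_measurable borel"
   by (rule borel_measurable_sum, rule T(2)) (use z in auto)
  show "(\<lambda>n. (\<Sum>i<N n. finv (N n) (shiftd (X b n) (\<lambda>_. z)) i i) / of_nat n)
   \<longlonglongrightarrow> (LINT w|lebesgue_on rect. (\<Sum>i<P + Q. finv (P + Q) (shiftd (block_sym (b (fst w)) (snd w)) (\<lambda>_. z)) i i)) / of_real (2 * pi)"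
   using T(1)[of "\<lambda>_. 1"] z unfolding rect_set_integral by simp
 qed (use bh bm in auto)
 moreover have "AE w in lebesgue_on rect. stokes_symbol a w = stokes_symbol b w"
 proof -
  have "AE w in lebesgue_on rect. fst w \<in> {0..1} \<longrightarrow> a (fst w) = b (fst w)" by (rule AE_rectangle(1)[OF b(3)])
  moreover have "AE w in lebesgue_on rect. fst w \<in> {0..1}" by (rule AE_I2) auto
  ultimately show ?thesis by eventually_elim (simp add: stokes_symbol_def)
 qed
 ultimately show ?thesis by (rule sv_eig_distributed_cong_AE[OF _ stokes_symbol_carrier])
qed



section \<open>The distribution of the Schur complement\<close>

definition schur_symbol :: "(real => real) => real \<times> real => complex mat" where
 "schur_symbol a w = of_real (- \<rho>) \<cdot>\<^sub>m mu_symbol q l (snd w)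
   - (1 / of_real (a (fst w))) \<cdot>\<^sub>m (mat_adjoint (xi_symbol p k q l (snd w)) * minv (kappa_symbol p k (snd w)) * xi_symbol p k q l (snd w))"

lemma kappa_mat: "kappa_symbol p k \<theta> = Matrix.mat P P (\<lambda>(c, d). kap \<theta> c d)"
 using symbol_entries(1)[of _ _ \<theta>] symbol_entries(4)[of \<theta>] by (intro eq_matI) auto

text \<open>Off the exceptional set \<open>Am\<close> is a \<kappa>, and the scalar a leaves its
  inverse as the factor 1 / a.\<close>

lemma schur_symbol_entries:
 assumes g: "b (fst w) \<noteq> 0" "kap_det (snd w) \<noteq> 0" and ij: "i < Q" "j < Q"
 shows "schur_symbol b w $$ (i, j) = Sf b w i j"
proof -
 let ?b = "of_real (b (fst w))" let ?\<theta> = "snd w"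
 note c = symbol_entries(4-6)[of ?\<theta>]
 have d0: "Determinant.det (kappa_symbol p k ?\<theta>) \<noteq> 0" using g(2) unfolding kap_det_def kappa_mat .
 note m = minv_inverse(1)[OF c(1) d0]
 have mi: "minv (kappa_symbol p k ?\<theta>) $$ (a, d) = finv P (kap ?\<theta>) a d" for a d unfolding finv_def kappa_mat ..
 have kinv: "inv_pair P (kap ?\<theta>) (finv P (kap ?\<theta>))" by (rule inv_pair_finv_det) (use g(2) in \<open>simp add: kap_det_def\<close>)
 have A: "Am b w = (\<lambda>c d. ?b * kap ?\<theta> c d)" using g unfolding Am_def by (intro ext) simp
 have fA: "finv P (Am b w) a d = finv P (kap ?\<theta>) a d / ?b" if ad: "a < P" "d < P" for a d
  unfolding A
 proof (rule finv_eqI(2)[OF _ ad])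
  fix i j assume "i < P" "j < P"
  then have "(\<Sum>k<P. kap ?\<theta> i k * finv P (kap ?\<theta>) k j) = (if i = j then 1 else 0)" using kinv unfolding inv_pair_def by blast
  moreover have "(\<Sum>k<P. ?b * kap ?\<theta> i k * (finv P (kap ?\<theta>) k j / ?b)) = (\<Sum>k<P. kap ?\<theta> i k * finv P (kap ?\<theta>) k j)"
   using g(1) by (intro sum.cong refl) simp
  ultimately show "(\<Sum>k<P. ?b * kap ?\<theta> i k * (finv P (kap ?\<theta>) k j / ?b)) = (if i = j then 1 else 0)" by simp
 qed
 note ca = mat_adjoint_carrier[OF c(2)]
 have am: "mat_adjoint (xi_symbol p k q l ?\<theta>) * minv (kappa_symbol p k ?\<theta>) \<in> carrier_mat Q P" using ca m by simp
 have "(mat_adjoint (xi_symbol p k q l ?\<theta>) * minv (kappa_symbol p k ?\<theta>) * xi_symbol p k q l ?\<theta>) $$ (i, j)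
   = (\<Sum>d<P. (\<Sum>a<P. cnj (xif ?\<theta> a i) * finv P (kap ?\<theta>) a d) * xif ?\<theta> d j)"
  unfolding mult_mat_index[OF am c(2) ij]
  by (rule sum.cong[OF refl]) (use ij in \<open>simp add: mult_mat_index[OF ca m] mat_adjoint_entry[OF c(2)] symbol_entries mi\<close>)
 also have "\<dots> = ?b * (\<Sum>a<P. \<Sum>d<P. cnj (xif ?\<theta> a i) * finv P (Am b w) a d * xif ?\<theta> d j)"
  unfolding sum_distrib_right sum_distrib_left by (subst sum.swap) (use g(1) in \<open>simp add: fA\<close>)
 finally have prod: "(mat_adjoint (xi_symbol p k q l ?\<theta>) * minv (kappa_symbol p k ?\<theta>) * xi_symbol p k q l ?\<theta>) $$ (i, j)
   = ?b * (\<Sum>a<P. \<Sum>d<P. cnj (xif ?\<theta> a i) * finv P (Am b w) a d * xif ?\<theta> d j)" .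
 have "schur_symbol b w $$ (i, j) = of_real (- \<rho>) * mu_symbol q l ?\<theta> $$ (i, j)
   - 1 / ?b * ((mat_adjoint (xi_symbol p k q l ?\<theta>) * minv (kappa_symbol p k ?\<theta>) * xi_symbol p k q l ?\<theta>) $$ (i, j))"
  unfolding schur_symbol_def using ij by (simp add: carrier_matD[OF ca] carrier_matD[OF c(2)] carrier_matD[OF c(3)])
 then show ?thesis unfolding prod using ij g(1) by (simp add: symbol_entries Sf_def schur_fun_def)
qed

lemma schur_symbol_carrier: "schur_symbol a w \<in> carrier_mat Q Q"
 unfolding schur_symbol_def using symbol_entries(4-6)[of "snd w"] mat_adjoint_carrier[of "xi_symbol p k q l (snd w)" P Q]
 by (intro minus_carrier_mat smult_carrier_mat carrier_matI) auto

lemma schur_compl_carrier: "schur_compl a \<rho> p k q l n \<in> carrier_mat (dQ n) (dQ n)"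
 unfolding schur_compl_def using matrix_carriers(1)[of a n] matrix_carriers(2,3)[of n] by (intro minus_carrier_mat carrier_matI) auto

text \<open>The inverse of A11 / n is n times the inverse of A11, so n S_n is exactly the Schur
  complement of the rescaled block matrix.\<close>

lemma schur_mat_entries:
 assumes \<tau>: "\<tau> = 1" and n: "1 \<le> n" and b: "b \<in> borel_measurable borel" "AE x in lborel. x \<in> {0..1} \<longrightarrow> a x = b x"
  and det: "Determinant.det (A11 a p k n) \<noteq> 0"
 shows "inv_pair (dP n) (X b n) (finv (dP n) (X b n))"
  and "i < dQ n ==> j < dQ n ==> complex_mat (real n \<cdot>\<^sub>m schur_compl a \<rho> p k q l n) $$ (i, j) = schur_seq b n i j"
proof -
 note c = matrix_carriers(1)[of a n] matrix_carriers(2,3)[of n] and e = matrix_entries[OF n b] and m = minv_inverse[OF matrix_carriers(1)[of a n] det]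
 have n0: "real n \<noteq> 0" using n by simp
 let ?G = "\<lambda>i j. of_real (real n * minv (A11 a p k n) $$ (i, j))"
 have XA: "X b n i j = of_real (A11 a p k n $$ (i, j) / real n)" if "i < dP n" "j < dP n" for i j
  using that n0 by (simp add: X_def e(1))
 have XB: "X b n i (dP n + j) = of_real (A12 p k q l n $$ (i, j))" if "i < dP n" "j < dQ n" for i j
  using that unfolding X_def by (simp add: e(2) \<tau>)
 have XC: "X b n (dP n + i) (dP n + j) = of_real (real n * A22 \<rho> q l n $$ (i, j))" if "i < dQ n" "j < dQ n" for i j
  using that n0 by (simp add: X_def e(3))
 have prod: "(\<Sum>k<dP n. X b n i k * ?G k j) = (if i = j then 1 else 0)" if ij: "i < dP n" "j < dP n" for i j
 proof -
  have "(A11 a p k n * minv (A11 a p k n)) $$ (i, j) = (\<Sum>k'<dP n. A11 a p k n $$ (i, k') * minv (A11 a p k n) $$ (k', j))"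
   by (rule mult_mat_index[OF c(1) m(1) ij])
  then have "(\<Sum>k'<dP n. A11 a p k n $$ (i, k') * minv (A11 a p k n) $$ (k', j)) = (if i = j then 1 else 0)"
   unfolding m(2) using ij by simp
  moreover have "(\<Sum>k'<dP n. X b n i k' * ?G k' j) = of_real (\<Sum>k'<dP n. A11 a p k n $$ (i, k') * minv (A11 a p k n) $$ (k', j))"
   unfolding of_real_sum by (rule sum.cong[OF refl]) (use ij n0 in \<open>simp add: XA\<close>)
  ultimately show ?thesis by simp
 qed
 show "inv_pair (dP n) (X b n) (finv (dP n) (X b n))" by (rule finv_eqI(1)[OF prod])
 have fi: "finv (dP n) (X b n) x y = ?G x y" if "x < dP n" "y < dP n" for x y by (rule finv_eqI(2)[OF prod that])
 show "complex_mat (real n \<cdot>\<^sub>m schur_compl a \<rho> p k q l n) $$ (i, j) = schur_seq b n i j" if ij: "i < dQ n" "j < dQ n"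
 proof -
  have tc: "(A12 p k q l n)\<^sup>T \<in> carrier_mat (dQ n) (dP n)" using c(2) by simp
  have am: "(A12 p k q l n)\<^sup>T * minv (A11 a p k n) \<in> carrier_mat (dQ n) (dP n)" using tc m(1) by simp
  have "((A12 p k q l n)\<^sup>T * minv (A11 a p k n) * A12 p k q l n) $$ (i, j)
    = (\<Sum>y<dP n. (\<Sum>x<dP n. A12 p k q l n $$ (x, i) * minv (A11 a p k n) $$ (x, y)) * A12 p k q l n $$ (y, j))"
   unfolding mult_mat_index[OF am c(2) ij]
   by (rule sum.cong[OF refl]) (use ij c(2) in \<open>simp add: mult_mat_index[OF tc m(1)] carrier_matD\<close>)
  also have "\<dots> = (\<Sum>x<dP n. \<Sum>y<dP n. A12 p k q l n $$ (x, i) * minv (A11 a p k n) $$ (x, y) * A12 p k q l n $$ (y, j))"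
   unfolding sum_distrib_right by (rule sum.swap)
  finally have pr: "((A12 p k q l n)\<^sup>T * minv (A11 a p k n) * A12 p k q l n) $$ (i, j)
    = (\<Sum>x<dP n. \<Sum>y<dP n. A12 p k q l n $$ (x, i) * minv (A11 a p k n) $$ (x, y) * A12 p k q l n $$ (y, j))" .
  have "schur_compl a \<rho> p k q l n $$ (i, j) = A22 \<rho> q l n $$ (i, j) - ((A12 p k q l n)\<^sup>T * minv (A11 a p k n) * A12 p k q l n) $$ (i, j)"
   unfolding schur_compl_def using ij by (simp add: carrier_matD[OF tc] carrier_matD[OF c(2)] carrier_matD[OF c(3)])
  then have "complex_mat (real n \<cdot>\<^sub>m schur_compl a \<rho> p k q l n) $$ (i, j)
    = of_real (real n * A22 \<rho> q l n $$ (i, j)) - of_real (real n * (\<Sum>x<dP n. \<Sum>y<dP n. A12 p k q l n $$ (x, i) * minv (A11 a p k n) $$ (x, y) * A12 p k q l n $$ (y, j)))"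
   using ij schur_compl_carrier[of a n] unfolding pr by (simp add: carrier_matD right_diff_distrib)
  also have "of_real (real n * (\<Sum>x<dP n. \<Sum>y<dP n. A12 p k q l n $$ (x, i) * minv (A11 a p k n) $$ (x, y) * A12 p k q l n $$ (y, j)))
    = (\<Sum>x<dP n. \<Sum>y<dP n. cnj (X b n x (dP n + i)) * finv (dP n) (X b n) x y * X b n y (dP n + j))"
   unfolding sum_distrib_left of_real_sum by (intro sum.cong refl) (use ij in \<open>simp add: XB fi mult_ac\<close>)
  finally show ?thesis unfolding schur_seq_def schur_fun_def XC[OF ij] .
 qed
qed



theorem schur_distribution:
 assumes \<tau>: "\<tau> = 1" and a: "a absolutely_integrable_on {0..1}"
  and inv: "\<forall>n\<ge>1. invertible_mat (A11 a p k n)" and a0: "AE x in lebesgue_on {0..1}. a x \<noteq> 0"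
 shows "sv_eig_distributed (\<lambda>n. complex_mat (real n \<cdot>\<^sub>m schur_compl a \<rho> p k q l n)) rect Q (schur_symbol a)"
proof -
 obtain b where b: "b \<in> borel_measurable borel" "set_integrable lborel {0..1} b" "AE x in lborel. x \<in> {0..1} \<longrightarrow> a x = b x"
  using borel_representative[OF a] .
 have det: "Determinant.det (A11 a p k n) \<noteq> 0" if "1 \<le> n" for n
  using inv that by (intro invertible_mat_det[OF _ matrix_carriers(1)]) auto
 note E = schur_mat_entries[OF \<tau> _ b(1,3) det]
 have "finite {\<theta> \<in> {-pi..pi}. kap_det \<theta> = 0}" by (rule kap_det_finite[OF b(1,2) E(1)])
 then have k0: "AE \<theta> in lborel. \<theta> \<notin> {\<theta> \<in> {-pi..pi}. kap_det \<theta> = 0}" by (intro AE_not_in finite_imp_null_set_lborel)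
 have "AE x in lebesgue. x \<in> {0..1} \<longrightarrow> a x \<noteq> 0" using a0 by (simp add: AE_restrict_space_iff)
 then have "AE x in lborel. x \<in> {0..1} \<longrightarrow> a x \<noteq> 0" by (simp only: AE_completion_iff)
 then have ab: "AE x in lborel. x \<in> {0..1} \<longrightarrow> a x = b x \<and> b x \<noteq> 0" using b(3) by eventually_elim auto
 have in_rect: "AE w in lebesgue_on rect. w \<in> rect" by (rule AE_I2) simp
 have good: "AE w in lebesgue_on rect. a (fst w) = b (fst w) \<and> b (fst w) \<noteq> 0 \<and> kap_det (snd w) \<noteq> 0"
  using AE_rectangle(1)[OF ab] AE_rectangle(2)[OF k0] in_rect by eventually_elim auto
 then have good': "AE w in lebesgue_on rect. b (fst w) \<noteq> 0 \<and> kap_det (snd w) \<noteq> 0" by eventually_elim auto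
 \<comment> \<open>On the exceptional null set \<open>minv\<close> is unspecified or a vanishes, so
   the distribution is first proved for this everywhere defined version and then
   transferred.\<close>
 define g where "g w = Matrix.mat Q Q (\<lambda>(i, j). Sf b w i j)" for w
 have "sv_eig_distributed (\<lambda>n. complex_mat (real n \<cdot>\<^sub>m schur_compl a \<rho> p k q l n)) rect Q g"
 proof (rule rectangle_distributedI[where F = "Sf b" and d = dQ and X = "schur_seq b"])
  show "g w \<in> carrier_mat Q Q" for w unfolding g_def by simp
  show "g w $$ (i, j) = Sf b w i j" if "i < Q" "j < Q" for w i j unfolding g_def using that by simp
  show "(\<lambda>w. Sf b w i j) \<in> borel_measurable borel" for i j by (rule Sf_borel[OF b(1)])
  show "herm Q (Sf b w)" for w by (rule Sf_herm)
  show "0 < Q" by (rule Q0)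
  show "complex_mat (real n \<cdot>\<^sub>m schur_compl a \<rho> p k q l n) \<in> carrier_mat (dQ n) (dQ n)" for n
   using schur_compl_carrier[of a n] by simp
  show "herm (dQ 0) (\<lambda>i j. complex_mat (real 0 \<cdot>\<^sub>m schur_compl a \<rho> p k q l 0) $$ (i, j))"
   using schur_compl_carrier[of a 0] by (simp add: herm_def carrier_matD)
  show "complex_mat (real n \<cdot>\<^sub>m schur_compl a \<rho> p k q l n) $$ (i, j) = schur_seq b n i j" if "1 \<le> n" "i < dQ n" "j < dQ n" for n i j
   by (rule E(2)[OF that(1,1) that(2,3)])
  show "herm (dQ n) (schur_seq b n)" if "1 \<le> n" for n
   by (rule schur_seq_compare(1)[OF E(1)[OF that that], of \<i> 1 1]) auto
  show "filterlim dQ at_top sequentially" "(\<lambda>n. real (dQ n) / real n) \<longlonglongrightarrow> real Q" by (rule size_limits)+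
  fix z :: complex assume z: "0 < Im z"
  show "(\<lambda>w. \<Sum>i<Q. finv Q (shiftd (Sf b w) (\<lambda>_. z)) i i) \<in> borel_measurable borel"
   by (rule borel_measurable_sum, rule Sf_resolvent(1)[OF z _ _ b(1)]) auto
  show "(\<lambda>n. (\<Sum>i<dQ n. finv (dQ n) (shiftd (schur_seq b n) (\<lambda>_. z)) i i) / of_nat n)
   \<longlonglongrightarrow> (LINT w|lebesgue_on rect. (\<Sum>i<Q. finv Q (shiftd (Sf b w) (\<lambda>_. z)) i i)) / of_real (2 * pi)"
   by (rule schur_trace_limit[OF \<tau> b(1,2) E(1) good' z])
 qed
 moreover have "AE w in lebesgue_on rect. schur_symbol a w = g w"
  using good
 proof eventually_elim
  fix w assume w: "a (fst w) = b (fst w) \<and> b (fst w) \<noteq> 0 \<and> kap_det (snd w) \<noteq> 0"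
  then have "schur_symbol a w = schur_symbol b w" by (simp add: schur_symbol_def)
  also have "\<dots> = g w" unfolding g_def
   using w schur_symbol_carrier[of b w] by (intro eq_matI) (auto simp: schur_symbol_entries carrier_matD)
  finally show "schur_symbol a w = g w" .
 qed
 ultimately show ?thesis by (rule sv_eig_distributed_cong_AE[OF _ schur_symbol_carrier])
qed

end

theorem theorem6p4:
 fixes a :: "real \<Rightarrow> real" and \<rho> :: real and p q k l :: nat
 assumes "a absolutely_integrable_on {0..1}"
  and "1 \<le> p" and "1 \<le> q" and "k \<le> p - 1" and "l \<le> q - 1"
 shows "sv_eig_distributed
      (\<lambda>n. complex_mat (four_block_mat
       ((1 / real n) \<cdot>\<^sub>m A11 a p k n)  (A12 p k q l n)
       ((A12 p k q l n)\<^sup>T)             (real n \<cdot>\<^sub>m A22 \<rho> q l n)))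
      ({0..1} \<times> {-pi..pi}) ((p - k) + (q - l))
      (\<lambda>(x, \<theta>). four_block_mat
       (complex_of_real (a x) \<cdot>\<^sub>m kappa_symbol p k \<theta>)  (xi_symbol p k q l \<theta>)
       (mat_adjoint (xi_symbol p k q l \<theta>))             (complex_of_real (- \<rho>) \<cdot>\<^sub>m mu_symbol q l \<theta>))
     \<and>
     ((\<forall>n\<ge>1. invertible_mat (A11 a p k n)) \<and> (AE x in lebesgue_on {0..1}. a x \<noteq> 0) \<longrightarrow>
     sv_eig_distributed
      (\<lambda>n. complex_mat (real n \<cdot>\<^sub>m schur_compl a \<rho> p k q l n))
      ({0..1} \<times> {-pi..pi}) (q - l)
      (\<lambda>(x, \<theta>). complex_of_real (- \<rho>) \<cdot>\<^sub>m mu_symbol q l \<theta>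
        - (1 / complex_of_real (a x)) \<cdot>\<^sub>m
          (mat_adjoint (xi_symbol p k q l \<theta>) * minv (kappa_symbol p k \<theta>) * xi_symbol p k q l \<theta>)))"
proof -
 \<comment> \<open>The hypotheses on the degrees give k < p and l < q, so both block sizes are
   positive; the last argument sets the coupling factor \<tau> to 1.\<close>
 interpret spline_pair p k "p - k" q l "q - l" \<rho> 1 by unfold_locales (use assms in auto)
 show ?thesis
  using stokes_distribution[OF refl assms(1)] schur_distribution[OF refl assms(1)]
  unfolding stokes_mat_def[abs_def] stokes_symbol_def[abs_def] schur_symbol_def[abs_def] by (simp add: case_prod_beta')
qed

end
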